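(* In the setting described in the context (linear drift), the following converge in probability as $N\to\infty$. (i) $\displaystyle\sup_{t\le t_N}|e^{\mu t}X^N_{t,1}-x_{0,1}|\to0$ for any sequence $t_N\to\infty$ with $e^{(\lambda+\mu)t_N}=O(N^{1/2})$; (ii) $\displaystyle\sup_{t\ge t_N}N^{1/2}e^{-\lambda t}|X^N_{t,1}|\to0$ for any sequence $t_N$ with $e^{(\lambda+\mu)t_N}=\omega(N^{1/2})$ (i.e. $N^{-1/2}e^{(\lambda+\mu)t_N}\to\infty$); (iii) $\displaystyle\sup_{t_1,t_2\ge t_N}N^{1/2}\left|e^{-\lambda t_1}X^N_{t_1,2}-e^{-\lambda t_2}X^N_{t_2,2}\right|\to0$ for any sequence $t_N\to\infty$. Furthermore, if $\sigma_\infty\neq0$, then $$N^{1/2}e^{-\lambda t}X^N_{t,2}\Rightarrow Z_\infty$$ in distribution as $t,N\to\infty$.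
   Context: For each $N\in\mathbb N$, $(X_t^N)_{t\ge0}$ is a pure jump Markov process with $X_0^N=x_0$, taking values in $I^N\subset\mathbb R^2$, with Lévy kernel $K^N(x,dy)$ (jumps from $x$ to $x+y$ occur at rate $K^N(x,dy)$). $S\subset\mathbb R^2$ is open, $x_0\in S$, $S^N=I^N\cap S$, and $m^N(x,\theta)=\int_{\mathbb R^2}e^{\langle\theta,y\rangle}K^N(x,dy)$ for $x\in S^N$, $\theta\in(\mathbb R^2)^*$. There is a limit kernel $K(x,dy)$, $x\in S$, with Laplace transform $m(x,\theta)=\int e^{\langle\theta,y\rangle}K(x,dy)$, such that, with $'$ denoting differentiation in $\theta$: (a) for some $\eta_0>0$, $m(x,\theta)$ is uniformly bounded for $x\in S$, $|\theta|\le\eta_0$; (b) $\sup_{x\in S^N}\sup_{|\theta|\le\eta_0}|m^N(x,N\theta)/N-m(x,\theta)|\to0$ as $N\to\infty$; (c) with $b(x)=m'(x,0)$ and $b^N(x)=(m^N)'(x,0)$, $\sup_{x\in S^N}N^{1/2}|b^N(x)-b(x)|\to0$; (d) $a(x)=m''(x,0)$ is Lipschitz on $S$. Linear case: $b(x)=Bx$, $B=\begin{pmatrix}-\mu&0\\0&\lambda\end{pmatrix}$, $\lambda,\mu>0$; $x_0=(x_{0,1},0)$ with $x_{0,1}\ne0$; $x_t=e^{Bt}x_0=e^{-\mu t}x_0$. $S$ contains a neighbourhood of the path $(x_t)_{t\ge0}$. By stopping $X^N$ at the first time it leaves $S$, if necessary, it is assumed that $X_t^N$ remains in $\overline S$ for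 all $t\ge0$. Second subscripts $1,2$ denote coordinates. $\sigma_\infty^2=\int_0^\infty e^{-2\lambda s}a(x_s)_{2,2}\,ds$ and $Z_\infty\sim N(0,\sigma_\infty^2)$.
   Formalization: In (iii) and the limit law, e^{-λt} is replaced by e^{-λ(t∧T^N)}, T^N the exit time from S: (a) makes S bounded, so the literal claims fail for the stopped process when σ_∞≠0. S is taken to contain a uniform ε-neighbourhood of the path. *)

theory Defs
  imports "HOL-Probability.Probability"
begin

text \<open>
  Linear functionals on the state space are represented by vectors through the inner product,
  so derivatives in the dual variable are vectors and matrices.
\<close>

definition laplace :: "'e::euclidean_space measure \<Rightarrow> 'e \<Rightarrow> real" where
  "laplace \<kappa> \<theta> = (\<integral>y. exp (\<theta> \<bullet> y) \<partial>\<kappa>)"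

text \<open>The Bochner integral is 0 when it diverges, so finiteness is a separate predicate.\<close>

definition laplace_finite :: "'e::euclidean_space measure \<Rightarrow> 'e \<Rightarrow> bool" where
  "laplace_finite \<kappa> \<theta> \<longleftrightarrow> integrable \<kappa> (\<lambda>y. exp (\<theta> \<bullet> y))"

definition grad :: "('e::real_inner \<Rightarrow> real) \<Rightarrow> 'e \<Rightarrow> 'e" where
  "grad f \<theta> = (THE D. GDERIV f \<theta> :> D)"

definition hess :: "(real^'n \<Rightarrow> real) \<Rightarrow> real^'n \<Rightarrow> real^'n^'n" where
  "hess f \<theta> = matrix (frechet_derivative (grad f) (at \<theta>))"

definition drift :: "(real^'n) measure \<Rightarrow> real^'n" where
  "drift \<kappa> = grad (laplace \<kappa>) 0"

definition diffusivity :: "(real^'n) measure \<Rightarrow> real^'n^'n" where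
  "diffusivity \<kappa> = hess (laplace \<kappa>) 0"

text \<open>
  \<^term>\<open>\<kappa> x\<close> is the jump measure at \<^term>\<open>x\<close>: jumps from \<open>x\<close> to \<open>x + y\<close> occur at rate \<open>\<kappa> x (dy)\<close>.
  An atom at 0 is not excluded; it only produces invisible jumps.
\<close>

definition levy_kernel_on :: "'e::euclidean_space set \<Rightarrow> ('e \<Rightarrow> 'e measure) \<Rightarrow> bool" where
  "levy_kernel_on D \<kappa> \<longleftrightarrow>
     (\<forall>x\<in>D. finite_measure (\<kappa> x) \<and> sets (\<kappa> x) = sets borel) \<and>
     (\<forall>A\<in>sets borel. (\<lambda>x. measure (\<kappa> x) A) \<in> borel_measurable (restrict_space borel D))"

definition jump_history ::
  "'a measure \<Rightarrow> (nat \<Rightarrow> 'a \<Rightarrow> ereal) \<Rightarrow> (nat \<Rightarrow> 'a \<Rightarrow> 'e::euclidean_space) \<Rightarrow> nat \<Rightarrow> 'a set set" where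
  "jump_history M J Y n = sigma_sets (space M)
     ({J k -` B \<inter> space M |k B. k \<le> n \<and> B \<in> sets borel} \<union>
      {Y k -` B \<inter> space M |k B. k \<le> n \<and> B \<in> sets borel})"

text \<open>
  \<open>J n\<close> is the time of the \<open>n\<close>-th jump (\<open>\<infinity>\<close> if there is none) and \<open>Y n\<close> the state after it.
  The last clause says that, given the history up to a finite \<open>J n\<close> and with
  \<open>q = \<kappa> (Y n) UNIV\<close>, the holding time is exponential with parameter \<open>q\<close> and the displacement
  is independent of it with law \<open>\<kappa> (Y n) / q\<close>. If \<open>q = 0\<close>, the right-hand side is 0
  (as \<open>x / 0 = 0\<close>), so that \<open>Y n\<close> is absorbing.
\<close>

definition pure_jump_markov ::
  "'a measure \<Rightarrow> 'e::euclidean_space set \<Rightarrow> ('e \<Rightarrow> 'e measure) \<Rightarrow> 'e \<Rightarrow> (real \<Rightarrow> 'a \<Rightarrow> 'e) \<Rightarrow> bool" where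
  "pure_jump_markov M D \<kappa> x0 X \<longleftrightarrow>
     prob_space M \<and> levy_kernel_on D \<kappa> \<and>
     (\<exists>(J :: nat \<Rightarrow> 'a \<Rightarrow> ereal) (Y :: nat \<Rightarrow> 'a \<Rightarrow> 'e).
        (\<forall>n. J n \<in> borel_measurable M \<and> Y n \<in> borel_measurable M) \<and>
        (\<forall>w\<in>space M.
           J 0 w = 0 \<and> Y 0 w = x0 \<and>
           (\<forall>n. J n w \<le> J (Suc n) w) \<and>
           (\<forall>n. J n w < \<infinity> \<longrightarrow> J n w < J (Suc n) w \<and> Y n w \<in> D) \<and>
           (\<lambda>n. J n w) \<longlonglongrightarrow> \<infinity> \<and>
           (\<forall>n t. J n w \<le> ereal t \<and> ereal t < J (Suc n) w \<longrightarrow> X t w = Y n w)) \<and>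
        (\<forall>n. \<forall>F\<in>jump_history M J Y n. \<forall>A\<in>sets borel. \<forall>s\<ge>0.
           measure M {w \<in> F. J n w < \<infinity> \<and> J (Suc n) w \<le> J n w + ereal s \<and> Y (Suc n) w - Y n w \<in> A}
           = (LINT w : {w \<in> F. J n w < \<infinity>} | M.
                (1 - exp (- measure (\<kappa> (Y n w)) UNIV * s)) *
                (measure (\<kappa> (Y n w)) A / measure (\<kappa> (Y n w)) UNIV))))"

definition exit_time :: "'e set \<Rightarrow> (real \<Rightarrow> 'a \<Rightarrow> 'e) \<Rightarrow> 'a \<Rightarrow> ereal" where
  "exit_time S X w = Inf {ereal t |t. 0 \<le> t \<and> X t w \<notin> S}"

text \<open>
  A process stopped on leaving a bounded set is eventually frozen or confined, so the rescaling
  \<open>e^(-lam t) X t\<close> of the stopped process tends to 0 for each fixed \<open>N\<close>. Where the limiting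
  behaviour of this rescaled quantity is asserted, the time in the exponential must be stopped as
  well; it is then given by \<open>stopped_clock\<close>, which is just \<open>t\<close> as long as \<open>S\<close> has not been left.
\<close>

definition stopped_clock :: "'e set \<Rightarrow> (real \<Rightarrow> 'a \<Rightarrow> 'e) \<Rightarrow> real \<Rightarrow> 'a \<Rightarrow> real" where
  "stopped_clock S X t w = real_of_ereal (min (ereal t) (exit_time S X w))"

definition stopped :: "'e set \<Rightarrow> (real \<Rightarrow> 'a \<Rightarrow> 'e) \<Rightarrow> real \<Rightarrow> 'a \<Rightarrow> 'e" where
  "stopped S X t w = X (stopped_clock S X t w) w"

text \<open>
  The \<open>N\<close>-th variable lives on its own space. Measurability is part of the definition because
  \<^const>\<open>measure\<close> is 0 on non-measurable sets; the variables used here are suprema over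
  uncountable sets.
\<close>

definition tendsto_zero_in_prob :: "(nat \<Rightarrow> 'a measure) \<Rightarrow> (nat \<Rightarrow> 'a \<Rightarrow> ereal) \<Rightarrow> bool" where
  "tendsto_zero_in_prob M Z \<longleftrightarrow>
     (\<forall>\<^sub>F N in sequentially. Z N \<in> borel_measurable (M N)) \<and>
     (\<forall>\<epsilon>>0. (\<lambda>N. measure (M N) {w \<in> space (M N). Z N w > ereal \<epsilon>}) \<longlonglongrightarrow> 0)"

definition saddle_matrix :: "real \<Rightarrow> real \<Rightarrow> real^2^2" where
  "saddle_matrix lam \<mu> = vector [vector [- \<mu>, 0], vector [0, lam]]"

text \<open>The solution \<open>exp (B t) x0\<close> of the linear equation when the second coordinate of \<open>x0\<close> is 0.\<close>

definition stable_path :: "real \<Rightarrow> real^2 \<Rightarrow> real \<Rightarrow> real^2" where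
  "stable_path \<mu> x0 t = exp (- \<mu> * t) *\<^sub>R x0"

definition sigma_inf_sq :: "real \<Rightarrow> real \<Rightarrow> real^2 \<Rightarrow> (real^2 \<Rightarrow> (real^2) measure) \<Rightarrow> real" where
  "sigma_inf_sq lam \<mu> x0 K =
     (LINT s : {0..} | lborel. exp (- 2 * lam * s) * diffusivity (K (stable_path \<mu> x0 s)) $ 2 $ 2)"

end

theory Submission
  imports Defs "HOL-Real_Asymp.Real_Asymp"
begin

text \<open>
  Everything rests on one inequality. Let \<open>V t x\<close> be a nonnegative function whose
  time derivative plus its expected change by jumps, \<open>V' + \<integral> (V t (x + y) - V t x)
  \<kappa> x (dy)\<close>, is nonpositive while \<open>x\<close> is in \<open>S\<close>. Then the
  value of \<open>V\<close> along the process has expectation at most \<open>V 0 x0\<close> at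
  every stopping time up to the exit from \<open>S\<close>. This is
  \<open>optional_stopping\<close>; it is proved directly from the law of the jump times and
  displacements, one jump at a time: between jumps the loss of \<open>V\<close> is an ordinary
  integral (\<open>flow_bound\<close>), and the contributions of the successive jumps telescope.
  Stopping at a deterministic time bounds expectations (\<open>expectation_le\<close>); stopping
  when \<open>V\<close> is first found large on a finite set of times gives
  \<open>maximal_inequality\<close>. To treat increments after a time \<open>r\<close> as well,
  \<open>V\<close> has a third argument, the state recorded at time \<open>r\<close>.

  Exponential moments bound the second moment of the jumps of the \<open>N\<close>-th process by a
  multiple of \<open>1 / N\<close> and the third by a multiple of \<open>1 / N\<^sup>2\<close>,
  while the drift is that of the linear saddle up to an error \<open>\<beta> = e / sqrt N\<close>,
  with \<open>e\<close> as small as desired. Write \<open>d = x $ 1 - exp (- \<mu> * t) * x0 $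
  1\<close> for the deviation from the deterministic path. Since the first coordinate is
  contracted, \<open>exp (- lam * t) * (d\<^sup>2 + const)\<close> is superharmonic for a small
  constant, which bounds \<open>exp (- lam * t) * d\<^sup>2\<close> for all times at once
  (\<open>stable_coordinate_bound\<close>). For the second coordinate, \<open>exp (- lam * t) * x
  $ 2\<close> is a martingale up to the drift error, and a perturbation of its square is
  superharmonic (\<open>unstable_coordinate_bound\<close>): its oscillation after time
  \<open>r\<close> is of order \<open>N powr (-1/2)\<close> times \<open>e + exp (- lam * r /
  2)\<close>. Together they show that the process leaves \<open>S\<close> before time
  \<open>s\<close> only with a probability of order \<open>exp (2 * lam * s) / N\<close>
  (\<open>exit_bound\<close>). The three convergences in probability follow by inserting the time
  scales.

  For the limit law let \<open>A t = \<integral>\<^sub>0\<^sup>t exp (- 2 * lam * s) * a (x_s)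
  ds\<close>, the variance accumulated along the deterministic path. The function \<open>exp
  (u\<^sup>2 * A t / 2) * cos (u * sqrt N * exp (- lam * t) * x $ 2 + \<phi>)\<close> is a
  martingale up to small errors. Those caused by the distance of the state from the path are
  controlled by the squared distance, so adding a multiple of it, and a linear function of time
  for the remaining errors, makes the sum superharmonic (\<open>W_superharmonic\<close>). The
  choices \<open>0\<close>, \<open>pi\<close> and \<open>\<plusminus> pi / 2\<close> of
  \<open>\<phi>\<close> then give both inequalities for the real and the imaginary part of the
  characteristic function at a fixed time \<open>R\<close>
  (\<open>characteristic_bound_fixed\<close>). By the oscillation bound, little changes after time
  \<open>R\<close>, so the characteristic function converges to that of the normal law as first
  \<open>N\<close> and then \<open>R\<close> grow, and Levy's continuity theorem concludes
  (\<open>asymptotic_normality\<close>).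
\<close>

section \<open>Functionals determined by their values on a pi-system\<close>

text \<open>
  A functional version of the uniqueness of measures. Both sides of the law of a jump are iterated
  integrals rather than integrals for given measures on a product space; linearity and monotone
  continuity make each of them a measure on the sigma-algebra, so that agreement on a pi-system
  suffices.
\<close>

lemma nn_functional_eqI:
  fixes T1 T2 :: "('a \<Rightarrow> ennreal) \<Rightarrow> ennreal"
  assumes gen: "sets P = sigma_sets (space P) G" "Int_stable G" "G \<subseteq> Pow (space P)"
    and eq: "\<And>A. A \<in> G \<Longrightarrow> T1 (indicator A) = T2 (indicator A)"
    and cover: "\<And>i::nat. E i \<in> G" "incseq E" "(\<Union>i. E i) = space P"
    and fin1: "T1 (\<lambda>x. 1) < \<infinity>"
    and cong: "\<And>T f g. T \<in> {T1, T2} \<Longrightarrow> (\<And>x. x \<in> space P \<Longrightarrow> f x = g x) \<Longrightarrow> T f = T g"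
    and lin: "\<And>T f g c. T \<in> {T1, T2} \<Longrightarrow> f \<in> borel_measurable P \<Longrightarrow> g \<in> borel_measurable P \<Longrightarrow>
      T (\<lambda>x. c * f x + g x) = c * T f + T g"
    and sup: "\<And>T f. T \<in> {T1, T2} \<Longrightarrow> (\<And>i::nat. f i \<in> borel_measurable P) \<Longrightarrow> incseq f \<Longrightarrow> T (\<lambda>x. SUP i. f i x) = (SUP i. T (f i))"
    and f: "f \<in> borel_measurable P"
  shows "T1 f = T2 f"
proof -
  have E_sets [measurable]: "E i \<in> sets P" for i using cover(1) gen(1) by auto
  have one: "T (\<lambda>x. 1) = (SUP i. T (indicator (E i)))" if T: "T \<in> {T1, T2}" for T
  proof -
    have "T (\<lambda>x. 1) = T (\<lambda>x. SUP i. indicator (E i) x)"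
    proof (rule cong[OF T])
      fix x assume "x \<in> space P"
      then obtain i where i: "x \<in> E i" using cover(3) by auto
      have "(1::ennreal) \<le> (SUP i. indicator (E i) x)"
        by (rule SUP_upper2[of i]) (use i in auto)
      moreover have "(SUP i. indicator (E i) x) \<le> (1::ennreal)"
        by (rule SUP_least) (auto split: split_indicator)
      ultimately show "(1::ennreal) = (SUP i. indicator (E i) x)" by (rule antisym)
    qed
    also have "\<dots> = (SUP i. T (indicator (E i)))"
      by (rule sup[OF T, of "\<lambda>i. indicator (E i)"])
        (use cover(2) in \<open>auto simp: incseq_def le_fun_def split: split_indicator\<close>)
    finally show ?thesis .
  qed
  have fin: "T1 (\<lambda>x. 1) < \<infinity>" "T1 (\<lambda>x. 1) = T2 (\<lambda>x. 1)"
    using one[of T1] one[of T2] eq[OF cover(1)] fin1 by simp_all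
  have zero: "T (\<lambda>x. 0) = 0" if T: "T \<in> {T1, T2}" for T
  proof -
    have "T (\<lambda>x. 1) < \<infinity>" using T fin by auto
    moreover have "T (\<lambda>x. 1) = T (\<lambda>x. 1) + T (\<lambda>x. 0)"
      using lin[OF T, of "\<lambda>x. 1" "\<lambda>x. 0" 1] by simp
    ultimately show ?thesis
      by (metis add.right_neutral ennreal_add_left_cancel infinity_ennreal_def less_irrefl)
  qed
  have cmult: "T (\<lambda>x. c * f x) = c * T f" if T: "T \<in> {T1, T2}" and f: "f \<in> borel_measurable P" for T f c
    using lin[OF T f, of "\<lambda>x. 0" c] zero[OF T] by simp
  have add: "T (\<lambda>x. f x + g x) = T f + T g"
    if T: "T \<in> {T1, T2}" and f: "f \<in> borel_measurable P" "g \<in> borel_measurable P" for T f g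
    using lin[OF T f, of 1] by simp
  have sum: "T (\<lambda>x. \<Sum>i. f i x) = (\<Sum>i. T (f i))"
    if T: "T \<in> {T1, T2}" and f: "\<And>i::nat. f i \<in> borel_measurable P" for T f
  proof -
    have fin_sum: "T (\<lambda>x. \<Sum>i<n. f i x) = (\<Sum>i<n. T (f i))" for n
      using f by (induction n) (simp_all add: zero[OF T] add[OF T])
    have "T (\<lambda>x. \<Sum>i. f i x) = T (\<lambda>x. SUP n. \<Sum>i<n. f i x)"
      by (simp add: suminf_eq_SUP)
    also have "\<dots> = (SUP n. T (\<lambda>x. \<Sum>i<n. f i x))"
      using f by (intro sup[OF T]) (auto simp: incseq_def le_fun_def intro!: sum_mono2)
    finally show ?thesis by (simp add: fin_sum suminf_eq_SUP)
  qed
  have set_eq: "T1 (indicator A) = T2 (indicator A)" if "A \<in> sets P" for A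
    using gen(2,3) that unfolding gen(1)
  proof (induction rule: sigma_sets_induct_disjoint)
    case (basic A)
    then show ?case by (rule eq)
  next
    case empty
    have "T (indicator {}) = 0" if "T \<in> {T1, T2}" for T
      using cmult[OF that, of "indicator {}" 0] by (simp add: indicator_def[abs_def])
    from this[of T1] this[of T2] show ?case by (simp only: insertI1 insertI2 simp_thms)
  next
    case (compl A)
    then have A[measurable]: "A \<in> sets P" using gen by simp
    have *: "T (indicator A) + T (indicator (space P - A)) = T (\<lambda>x. 1)" if "T \<in> {T1, T2}" for T
    proof -
      have "T (indicator A) + T (indicator (space P - A)) = T (\<lambda>x. indicator A x + indicator (space P - A) x)"
        by (rule add[OF that, symmetric]) simp_all
      also have "\<dots> = T (\<lambda>x. 1)"
        by (rule cong[OF that]) (simp split: split_indicator)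
      finally show ?thesis .
    qed
    have "T1 (indicator A) \<noteq> \<infinity>"
    proof
      assume "T1 (indicator A) = \<infinity>"
      with *[of T1] have "T1 (\<lambda>x. 1) = \<infinity>" by simp
      with fin(1) show False by simp
    qed
    moreover have "T1 (indicator A) + T1 (indicator (space P - A)) = T1 (indicator A) + T2 (indicator (space P - A))"
    proof -
      have "T1 (indicator A) + T1 (indicator (space P - A)) = T2 (indicator A) + T2 (indicator (space P - A))"
        unfolding *[of T1, simplified] *[of T2, simplified] by (rule fin(2))
      with compl(2) show ?thesis by simp
    qed
    ultimately show ?case
      by (simp add: ennreal_add_left_cancel)
  next
    case (union A)
    then have A[measurable]: "\<And>i. A i \<in> sets P" using gen by auto
    have *: "T (indicator (\<Union>i. A i)) = (\<Sum>i. T (indicator (A i)))" if "T \<in> {T1, T2}" for T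
    proof -
      have "T (indicator (\<Union>i. A i)) = T (\<lambda>x. \<Sum>i. indicator (A i) x)"
        by (rule cong[OF that]) (simp add: suminf_indicator[OF union(1)])
      also have "\<dots> = (\<Sum>i. T (indicator (A i)))"
        by (rule sum[OF that]) simp
      finally show ?thesis .
    qed
    show ?case using *[of T1] *[of T2] union by simp
  qed
  show ?thesis
    using f
  proof (induction rule: borel_measurable_induct)
    case (cong f g)
    have "T f = T g" if "T \<in> {T1, T2}" for T
      by (rule assms(9)[OF that]) (rule cong(3))
    from this[of T1] this[of T2] cong(4) show ?case by simp
  next
    case (set A)
    then show ?case by (rule set_eq)
  next
    case (mult u c)
    then show ?case using cmult[of T1 u c] cmult[of T2 u c] by simp
  next
    case (add u v)
    then show ?case using lin[of T1 v u 1] lin[of T2 v u 1] by simp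
  next
    case (seq U)
    have "(SUP i. U i) = (\<lambda>x. SUP i. U i x)"
      by (rule ext) (simp only: SUP_apply)
    moreover have "T1 (U i) = T2 (U i)" for i using seq by blast
    ultimately show ?case
      using sup[of T1 U] sup[of T2 U] seq by simp
  qed
qed

text \<open>
  The clauses of \<^const>\<open>pure_jump_markov\<close> with the jump times and embedded states
  fixed, so that they can be named.
\<close>

locale jump_process = prob_space M for M :: "'a measure" +
  fixes D :: "'e::euclidean_space set" and \<kappa> :: "'e \<Rightarrow> 'e measure" and x0 :: 'e
    and X :: "real \<Rightarrow> 'a \<Rightarrow> 'e" and J :: "nat \<Rightarrow> 'a \<Rightarrow> ereal" and Y :: "nat \<Rightarrow> 'a \<Rightarrow> 'e"
  assumes kernel: "levy_kernel_on D \<kappa>"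
    and J_meas [measurable]: "\<And>n. J n \<in> borel_measurable M"
    and Y_meas [measurable]: "\<And>n. Y n \<in> borel_measurable M"
    and J_0: "\<And>w. w \<in> space M \<Longrightarrow> J 0 w = 0"
    and Y_0: "\<And>w. w \<in> space M \<Longrightarrow> Y 0 w = x0"
    and J_mono: "\<And>n w. w \<in> space M \<Longrightarrow> J n w \<le> J (Suc n) w"
    and J_strict: "\<And>n w. w \<in> space M \<Longrightarrow> J n w < \<infinity> \<Longrightarrow> J n w < J (Suc n) w"
    and Y_in: "\<And>n w. w \<in> space M \<Longrightarrow> J n w < \<infinity> \<Longrightarrow> Y n w \<in> D"
    and J_lim: "\<And>w. w \<in> space M \<Longrightarrow> (\<lambda>n. J n w) \<longlonglongrightarrow> \<infinity>"
    and X_eq: "\<And>n t w. w \<in> space M \<Longrightarrow> J n w \<le> ereal t \<Longrightarrow> ereal t < J (Suc n) w \<Longrightarrow> X t w = Y n w"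
    and law: "\<And>n F A s. F \<in> jump_history M J Y n \<Longrightarrow> A \<in> sets borel \<Longrightarrow> s \<ge> 0 \<Longrightarrow>
      measure M {w \<in> F. J n w < \<infinity> \<and> J (Suc n) w \<le> J n w + ereal s \<and> Y (Suc n) w - Y n w \<in> A}
      = (LINT w : {w \<in> F. J n w < \<infinity>} | M.
                (1 - exp (- measure (\<kappa> (Y n w)) UNIV * s)) *
                (measure (\<kappa> (Y n w)) A / measure (\<kappa> (Y n w)) UNIV))"

lemma pure_jump_markovD:
  assumes "pure_jump_markov M D \<kappa> x0 X"
  obtains J Y where "jump_process M D \<kappa> x0 X J Y"
  using assms unfolding pure_jump_markov_def
  apply (elim conjE exE)
  subgoal for J Y
    by (rule that[of J Y], intro jump_process.intro jump_process_axioms.intro; blast)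
  done

context jump_process
begin

definition H :: "nat \<Rightarrow> 'a measure" where
  "H n = sigma (space M) (jump_history M J Y n)"

lemma jump_history_Pow: "jump_history M J Y n \<subseteq> Pow (space M)"
  unfolding jump_history_def by (rule sigma_sets_into_sp[THEN subsetI[OF PowI], rotated]) auto

lemma space_H [simp]: "space (H n) = space M"
  by (simp add: H_def space_measure_of[OF jump_history_Pow])

lemma sets_H: "sets (H n) = jump_history M J Y n"
proof -
  have "sets (H n) = sigma_sets (space M) (jump_history M J Y n)"
    by (simp add: H_def sets_measure_of[OF jump_history_Pow])
  then show ?thesis
    unfolding jump_history_def by (subst (asm) sigma_sets_sigma_sets_eq) auto
qed

lemma sets_H_sub: "sets (H n) \<subseteq> sets M"
  unfolding sets_H jump_history_def
  by (rule sets.sigma_sets_subset) (auto intro: measurable_sets)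

lemma measurable_H_M: "f \<in> measurable (H n) N \<Longrightarrow> f \<in> measurable M N"
  using sets_H_sub by (auto simp: measurable_def)

lemma J_H: "k \<le> n \<Longrightarrow> J k \<in> borel_measurable (H n)"
  unfolding measurable_def sets_H jump_history_def
  by (auto intro!: sigma_sets.Basic)

lemma Y_H: "k \<le> n \<Longrightarrow> Y k \<in> borel_measurable (H n)"
  unfolding measurable_def sets_H jump_history_def
  by (auto intro!: sigma_sets.Basic)

lemma J_H_n [measurable]: "J n \<in> borel_measurable (H n)" and Y_H_n [measurable]: "Y n \<in> borel_measurable (H n)"
  by (auto intro: J_H Y_H)

lemma H_mono: "sets (H n) \<subseteq> sets (H (Suc n))"
  unfolding sets_H jump_history_def
  by (rule sigma_sets_mono') (blast intro: le_SucI)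

lemma measurable_H_Suc: "f \<in> measurable (H n) N \<Longrightarrow> f \<in> measurable (H (Suc n)) N"
  using H_mono by (auto simp: measurable_def)

lemma J_nonneg: "w \<in> space M \<Longrightarrow> 0 \<le> J n w"
  by (induction n) (auto simp: J_0 intro: order_trans[OF _ J_mono])

definition jt :: "nat \<Rightarrow> 'a \<Rightarrow> real" where "jt n w = real_of_ereal (J n w)"

lemma jt_H [measurable]: "jt n \<in> borel_measurable (H n)"
  unfolding jt_def by measurable

lemma jt_meas [measurable]: "jt n \<in> borel_measurable M"
  unfolding jt_def by measurable

lemma jt_nonneg: "w \<in> space M \<Longrightarrow> 0 \<le> jt n w"
  using J_nonneg[of w n] by (simp add: jt_def real_of_ereal_pos)

lemma J_eq_jt: "w \<in> space M \<Longrightarrow> J n w < \<infinity> \<Longrightarrow> J n w = ereal (jt n w)"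
  using J_nonneg[of w n] by (cases "J n w") (auto simp: jt_def)

text \<open>
  The jump kernel at the state after the \<open>n\<close>-th jump; it is set to 0 if there is no
  such jump, because \<open>Y n\<close> may then lie outside the domain on which the kernel is
  known to be measurable.
\<close>

definition kmass :: "nat \<Rightarrow> 'e set \<Rightarrow> 'a \<Rightarrow> real" where
  "kmass n A w = (if J n w < \<infinity> then measure (\<kappa> (Y n w)) A else 0)"

abbreviation rate :: "nat \<Rightarrow> 'a \<Rightarrow> real" where
  "rate n w \<equiv> kmass n UNIV w"

lemma kmass_H [measurable]:
  assumes A: "A \<in> sets borel"
  shows "kmass n A \<in> borel_measurable (H n)"
proof -
  let ?\<Omega> = "{w \<in> space M. J n w < \<infinity>}"
  have Om: "?\<Omega> \<in> sets (H n)"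
  proof -
    have "{w \<in> space (H n). J n w < \<infinity>} \<in> sets (H n)" by measurable
    then show ?thesis by simp
  qed
  have "Y n \<in> measurable (restrict_space (H n) ?\<Omega>) (restrict_space borel D)"
    by (rule measurable_restrict_space2) (auto simp: space_restrict_space Y_in intro: measurable_restrict_space1)
  then have "(\<lambda>w. measure (\<kappa> (Y n w)) A) \<in> borel_measurable (restrict_space (H n) ?\<Omega>)"
    using kernel A unfolding levy_kernel_on_def by (auto intro: measurable_compose)
  then have "(\<lambda>w. if w \<in> ?\<Omega> then measure (\<kappa> (Y n w)) A else 0) \<in> borel_measurable (H n)"
    by (subst (asm) measurable_restrict_space_iff) (use Om in \<open>auto simp: Int_absorb2\<close>)
  then show ?thesis
    by (rule measurable_cong[THEN iffD1, rotated]) (auto simp: kmass_def)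
qed

lemma kmass_nonneg [simp]: "0 \<le> kmass n A w" by (simp add: kmass_def)

definition jump_law :: "nat \<Rightarrow> 'a \<Rightarrow> 'e measure" where
  "jump_law n w = (if J n w < \<infinity> then scale_measure (ennreal (1 / rate n w)) (\<kappa> (Y n w)) else null_measure borel)"

lemma kernel_at:
  assumes "w \<in> space M" "J n w < \<infinity>"
  shows "finite_measure (\<kappa> (Y n w))" "sets (\<kappa> (Y n w)) = sets borel" "space (\<kappa> (Y n w)) = UNIV"
proof -
  show "finite_measure (\<kappa> (Y n w))" and *: "sets (\<kappa> (Y n w)) = sets borel"
    using kernel Y_in[OF assms] unfolding levy_kernel_on_def by blast+
  show "space (\<kappa> (Y n w)) = UNIV"
    using sets_eq_imp_space_eq[OF *] by simp
qed

lemma sets_jump_law: "w \<in> space M \<Longrightarrow> sets (jump_law n w) = sets borel"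
  by (simp add: jump_law_def kernel_at)

lemma emeasure_jump_law:
  assumes w: "w \<in> space M"
  shows "emeasure (jump_law n w) A = ennreal (kmass n A w / rate n w)"
proof (cases "J n w < \<infinity>")
  case True
  interpret k: finite_measure "\<kappa> (Y n w)" using kernel_at[OF w True] by simp
  show ?thesis using True
    by (simp add: jump_law_def kmass_def k.emeasure_eq_measure ennreal_mult'[symmetric])
qed (simp add: jump_law_def kmass_def)

lemma jump_law_measurable [measurable]: "jump_law n \<in> measurable (H n) (subprob_algebra borel)"
proof (rule measurable_subprob_algebra)
  fix w assume w: "w \<in> space (H n)"
  show "sets (jump_law n w) = sets borel" using w by (simp add: sets_jump_law)
  show "subprob_space (jump_law n w)"
  proof
    show "emeasure (jump_law n w) (space (jump_law n w)) \<le> 1"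
      using w sets_jump_law[of w n, THEN sets_eq_imp_space_eq] by (simp add: emeasure_jump_law)
    show "space (jump_law n w) \<noteq> {}"
      using w sets_jump_law[of w n, THEN sets_eq_imp_space_eq] by simp
  qed
next
  fix A :: "'e set" assume [measurable]: "A \<in> sets borel"
  show "(\<lambda>a. emeasure (jump_law n a) A) \<in> borel_measurable (H n)"
    by (subst measurable_cong[OF emeasure_jump_law]) (simp, measurable)
qed

lemma nn_integral_jump_law:
  assumes w: "w \<in> space M" "J n w < \<infinity>" and f: "f \<in> borel_measurable borel"
  shows "ennreal (rate n w) * (\<integral>\<^sup>+y. f y \<partial>jump_law n w) = (\<integral>\<^sup>+y. f y \<partial>\<kappa> (Y n w))"
proof -
  interpret k: finite_measure "\<kappa> (Y n w)" using kernel_at[OF w] by simp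
  have [measurable_cong]: "sets (\<kappa> (Y n w)) = sets borel" using kernel_at[OF w] by simp
  have [measurable]: "f \<in> borel_measurable (\<kappa> (Y n w))" using f by measurable
  have r: "rate n w = measure (\<kappa> (Y n w)) (space (\<kappa> (Y n w)))" using w by (simp add: kmass_def kernel_at)
  have "(\<integral>\<^sup>+y. f y \<partial>jump_law n w) = ennreal (1 / rate n w) * (\<integral>\<^sup>+y. f y \<partial>\<kappa> (Y n w))"
    using w by (simp add: jump_law_def nn_integral_scale_measure)
  moreover have "(\<integral>\<^sup>+y. f y \<partial>\<kappa> (Y n w)) = 0" if "rate n w = 0"
  proof -
    have "emeasure (\<kappa> (Y n w)) (space (\<kappa> (Y n w))) = 0"
      using that unfolding r by (simp add: k.emeasure_eq_measure)
    then have "AE x in \<kappa> (Y n w). f x = 0"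
      using AE_iff_null_sets[of "space (\<kappa> (Y n w))" "\<kappa> (Y n w)"]
      by (auto intro!: AE_I'[of "space (\<kappa> (Y n w))"])
    then show ?thesis by (subst nn_integral_0_iff_AE) auto
  qed
  ultimately show ?thesis
    by (cases "rate n w = 0") (auto simp: mult.assoc[symmetric] ennreal_mult'[symmetric])
qed

end

section \<open>The joint law of one holding time and one displacement\<close>

context jump_process
begin

abbreviation holding :: "nat \<Rightarrow> 'a \<Rightarrow> real" where
  "holding n w \<equiv> jt (Suc n) w - jt n w"

abbreviation displacement :: "nat \<Rightarrow> 'a \<Rightarrow> 'e" where
  "displacement n w \<equiv> Y (Suc n) w - Y n w"

text \<open>
  The two sides of the defining property of the process, for a function \<open>f\<close> of the
  history, the holding time and the displacement: what happens at the next jump, and what the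
  exponential clock and the normalised kernel predict. If the rate is 0, the exponential density
  vanishes, so \<open>step_predicted\<close> counts nothing, in agreement with the absence of a
  next jump.
\<close>

definition step_actual :: "nat \<Rightarrow> ('a \<times> real \<times> 'e \<Rightarrow> ennreal) \<Rightarrow> ennreal" where
  "step_actual n f = (\<integral>\<^sup>+w. (if J n w < \<infinity> \<and> J (Suc n) w < \<infinity> then f (w, holding n w, displacement n w) else 0) \<partial>M)"

definition step_predicted :: "nat \<Rightarrow> ('a \<times> real \<times> 'e \<Rightarrow> ennreal) \<Rightarrow> ennreal" where
  "step_predicted n f = (\<integral>\<^sup>+w. (\<integral>\<^sup>+s. ennreal (exponential_density (rate n w) s) *
     (\<integral>\<^sup>+y. f (w, s, y) \<partial>jump_law n w) \<partial>lborel) \<partial>M)"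

text \<open>
  The history sigma-algebra is coarser than that of \<open>M\<close>, so that joint measurability
  over the history passes to \<open>M\<close>.
\<close>

lemma id_H: "(\<lambda>w. w) \<in> measurable M (H n)"
  using sets_H_sub by (auto simp: measurable_def Int_absorb2 sets.sets_into_space dest: sets.sets_into_space)

lemma step_actual_measurable:
  assumes f: "f \<in> borel_measurable (H n \<Otimes>\<^sub>M (borel \<Otimes>\<^sub>M borel))"
  shows "(\<lambda>w. if J n w < \<infinity> \<and> J (Suc n) w < \<infinity> then f (w, holding n w, displacement n w) else 0) \<in> borel_measurable M"
proof -
  have [measurable]: "(\<lambda>w. f (w, holding n w, displacement n w)) \<in> borel_measurable M"
    by (rule measurable_compose[OF _ f]) (intro measurable_Pair id_H; measurable)
  show ?thesis by measurable
qed

lemma jump_law_integral_measurable: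
  assumes f: "f \<in> borel_measurable (H n \<Otimes>\<^sub>M (borel \<Otimes>\<^sub>M borel))"
  shows "(\<lambda>z. \<integral>\<^sup>+y. f (fst z, snd z, y) \<partial>jump_law n (fst z)) \<in> borel_measurable (H n \<Otimes>\<^sub>M borel)"
proof (rule nn_integral_measurable_subprob_algebra2[where N=borel])
  show "(\<lambda>(z, y). f (fst z, snd z, y)) \<in> borel_measurable ((H n \<Otimes>\<^sub>M borel) \<Otimes>\<^sub>M borel)"
    unfolding split_beta' by (rule measurable_compose[OF _ f]) measurable
  show "(\<lambda>z. jump_law n (fst z)) \<in> measurable (H n \<Otimes>\<^sub>M borel) (subprob_algebra borel)"
    by measurable
qed

lemma step_predicted_measurable1:
  assumes f: "f \<in> borel_measurable (H n \<Otimes>\<^sub>M (borel \<Otimes>\<^sub>M borel))" and w: "w \<in> space M"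
  shows "(\<lambda>y. f (w, s, y)) \<in> borel_measurable (jump_law n w)"
proof -
  have "(\<lambda>y. f (w, s, y)) \<in> borel_measurable borel"
    by (rule measurable_compose[OF _ f]) (intro measurable_Pair measurable_const measurable_ident; simp add: w)
  then show ?thesis using sets_jump_law[OF w, of n] by (simp cong: measurable_cong_sets)
qed

lemma step_predicted_measurable2:
  assumes f: "f \<in> borel_measurable (H n \<Otimes>\<^sub>M (borel \<Otimes>\<^sub>M borel))" and w: "w \<in> space M"
  shows "(\<lambda>s. \<integral>\<^sup>+y. f (w, s, y) \<partial>jump_law n w) \<in> borel_measurable borel"
proof -
  have "(\<lambda>s. (w, s)) \<in> measurable borel (H n \<Otimes>\<^sub>M borel)" 
    by (intro measurable_Pair measurable_const measurable_ident; simp add: w)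
  from measurable_compose[OF this jump_law_integral_measurable[OF f]] show ?thesis by simp
qed

lemma step_predicted_measurable3:
  assumes f: "f \<in> borel_measurable (H n \<Otimes>\<^sub>M (borel \<Otimes>\<^sub>M borel))"
  shows "(\<lambda>w. \<integral>\<^sup>+s. ennreal (exponential_density (rate n w) s) *
     (\<integral>\<^sup>+y. f (w, s, y) \<partial>jump_law n w) \<partial>lborel) \<in> borel_measurable (H n)"
proof (rule lborel.borel_measurable_nn_integral)
  have [measurable]: "(\<lambda>z. \<integral>\<^sup>+y. f (fst z, snd z, y) \<partial>jump_law n (fst z)) \<in> borel_measurable (H n \<Otimes>\<^sub>M lborel)"
    using jump_law_integral_measurable[OF f] by simp
  show "(\<lambda>(w, s). ennreal (exponential_density (rate n w) s) * (\<integral>\<^sup>+y. f (w, s, y) \<partial>jump_law n w)) \<in> borel_measurable (H n \<Otimes>\<^sub>M lborel)"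
    unfolding split_beta' exponential_density_def by measurable
qed

text \<open>
  On rectangles the claim is the defining property of the process; the factor \<open>1 - exp (- q
  * s)\<close> is the distribution function of the exponential density.
\<close>

lemma step_actual_rectangle:
  assumes F: "F \<in> sets (H n)" and A: "A \<in> sets borel"
  shows "step_actual n (indicator (F \<times> ({..s} \<times> A))) = step_predicted n (indicator (F \<times> ({..s} \<times> A)))"
proof (cases "s \<ge> 0")
  case False
  have "step_actual n (indicator (F \<times> ({..s} \<times> A))) = (\<integral>\<^sup>+w. 0 \<partial>M)"
    unfolding step_actual_def
  proof (intro nn_integral_cong)
    fix w assume w: "w \<in> space M"
    have "holding n w > 0" if "J n w < \<infinity>" "J (Suc n) w < \<infinity>"
      using J_strict[OF w that(1)] J_eq_jt[OF w that(1)] J_eq_jt[OF w that(2)] by simp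
    then show "(if J n w < \<infinity> \<and> J (Suc n) w < \<infinity> then indicator (F \<times> {..s} \<times> A) (w, holding n w, displacement n w) else 0) = (0::ennreal)"
      using False by (cases "J n w < \<infinity> \<and> J (Suc n) w < \<infinity>") (auto simp: indicator_def)
  qed
  moreover have zero: "ennreal (exponential_density (rate n w) t) * (\<integral>\<^sup>+y. indicator (F \<times> {..s} \<times> A) (w, t, y) \<partial>jump_law n w) = 0" for w t
    using False by (cases "t \<le> s") (auto simp: exponential_density_def)
  then have "step_predicted n (indicator (F \<times> ({..s} \<times> A))) = 0"
    unfolding step_predicted_def zero by simp
  ultimately show ?thesis by simp
next
  case True
  let ?E = "{w \<in> F. J n w < \<infinity> \<and> J (Suc n) w \<le> J n w + ereal s \<and> Y (Suc n) w - Y n w \<in> A}"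
  let ?g = "\<lambda>w. (1 - exp (- rate n w * s)) * (kmass n A w / rate n w)"
  have FM [measurable]: "F \<in> sets M" using F sets_H_sub by auto
  have Fsub: "F \<subseteq> space M" using sets.sets_into_space[OF FM] .
  have [measurable]: "kmass n A \<in> borel_measurable M" "kmass n UNIV \<in> borel_measurable M"
    by (rule measurable_H_M[OF kmass_H[OF A]], rule measurable_H_M[OF kmass_H]) simp
  have g0: "0 \<le> ?g w" for w using True by (intro mult_nonneg_nonneg) auto
  have "step_actual n (indicator (F \<times> ({..s} \<times> A))) = (\<integral>\<^sup>+w. indicator ?E w \<partial>M)"
    unfolding step_actual_def
  proof (intro nn_integral_cong)
    fix w assume w: "w \<in> space M"
    have "J (Suc n) w \<le> J n w + ereal s \<longleftrightarrow> J (Suc n) w < \<infinity> \<and> holding n w \<le> s" if "J n w < \<infinity>"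
    proof (cases "J (Suc n) w < \<infinity>")
      case True
      then show ?thesis using J_eq_jt[OF w that] J_eq_jt[OF w True] by auto
    next
      case False
      then show ?thesis using J_eq_jt[OF w that] by auto
    qed
    then show "(if J n w < \<infinity> \<and> J (Suc n) w < \<infinity> then indicator (F \<times> {..s} \<times> A) (w, holding n w, displacement n w) else 0)
      = (indicator ?E w :: ennreal)"
      by (auto split: split_indicator)
  qed
  also have "\<dots> = emeasure M ?E"
  proof (rule nn_integral_indicator)
    have "?E = F \<inter> {w \<in> space M. J n w < \<infinity> \<and> J (Suc n) w \<le> J n w + ereal s \<and> Y (Suc n) w - Y n w \<in> A}"
      using Fsub by auto
    also have "\<dots> \<in> sets M" using A by measurable
    finally show "?E \<in> sets M" .
  qed
  also have "\<dots> = ennreal (measure M ?E)" by (rule emeasure_eq_measure)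
  also have "measure M ?E = (LINT w : {w \<in> F. J n w < \<infinity>} | M.
                (1 - exp (- measure (\<kappa> (Y n w)) UNIV * s)) *
                (measure (\<kappa> (Y n w)) A / measure (\<kappa> (Y n w)) UNIV))"
    using law[of F n A s] F A True by (simp add: sets_H)
  also have "\<dots> = (LINT w | M. indicator F w * ?g w)"
    unfolding set_lebesgue_integral_def
    by (intro Bochner_Integration.integral_cong) (auto simp: kmass_def split: split_indicator)
  also have "ennreal \<dots> = (\<integral>\<^sup>+w. ennreal (indicator F w * ?g w) \<partial>M)"
  proof (rule nn_integral_eq_integral[symmetric])
    show "AE x in M. 0 \<le> indicator F x * ?g x" using g0 by (auto intro!: AE_I2 mult_nonneg_nonneg simp: indicator_def)
    have le: "\<bar>indicator F x * ?g x\<bar> \<le> 1" if "x \<in> space M" for x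
    proof -
      have "kmass n A x \<le> rate n x"
        using kernel_at[OF that] A by (auto simp: kmass_def intro!: finite_measure.finite_measure_mono)
      then have "kmass n A x / rate n x \<le> 1" by (auto simp: divide_le_eq_1 less_le)
      then have "?g x \<le> 1 * 1" using True by (intro mult_mono) auto
      then show ?thesis using g0[of x] by (auto simp: indicator_def abs_if)
    qed
    show "integrable M (\<lambda>w. indicator F w * ?g w)"
      by (rule integrable_const_bound[where B=1]) (use le in \<open>auto intro!: AE_I2\<close>, measurable)
  qed
  also have "\<dots> = step_predicted n (indicator (F \<times> ({..s} \<times> A)))"
    unfolding step_predicted_def
  proof (rule nn_integral_cong)
    fix w assume w: "w \<in> space M"
    have "(\<integral>\<^sup>+t. ennreal (exponential_density (rate n w) t) * (\<integral>\<^sup>+y. indicator (F \<times> {..s} \<times> A) (w, t, y) \<partial>jump_law n w) \<partial>lborel)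
      = (\<integral>\<^sup>+t. indicator F w * ennreal (kmass n A w / rate n w) * (ennreal (exponential_density (rate n w) t) * indicator {..s} t) \<partial>lborel)"
    proof (intro nn_integral_cong)
      fix t
      have "(\<integral>\<^sup>+y. indicator (F \<times> {..s} \<times> A) (w, t, y) \<partial>jump_law n w) = (\<integral>\<^sup>+y. indicator F w * indicator {..s} t * indicator A y \<partial>jump_law n w)"
        by (intro nn_integral_cong) (auto split: split_indicator)
      also have "\<dots> = indicator F w * indicator {..s} t * emeasure (jump_law n w) A"
        using A sets_jump_law[OF w] by (subst nn_integral_cmult_indicator) auto
      finally show "ennreal (exponential_density (rate n w) t) * (\<integral>\<^sup>+y. indicator (F \<times> {..s} \<times> A) (w, t, y) \<partial>jump_law n w)
        = indicator F w * ennreal (kmass n A w / rate n w) * (ennreal (exponential_density (rate n w) t) * indicator {..s} t)"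
        by (simp add: emeasure_jump_law[OF w] ac_simps)
    qed
    also have "\<dots> = indicator F w * ennreal (kmass n A w / rate n w) * (\<integral>\<^sup>+t. ennreal (exponential_density (rate n w) t) * indicator {..s} t \<partial>lborel)"
      by (rule nn_integral_cmult) measurable
    also have "\<dots> = ennreal (indicator F w * ?g w)"
    proof (cases "rate n w = 0")
      case False
      then have r: "0 < rate n w" using kmass_nonneg[of n UNIV w] by linarith
      have "(\<integral>\<^sup>+t. ennreal (exponential_density (rate n w) t) * indicator {..s} t \<partial>lborel) = ennreal (1 - exp (- rate n w * s))"
        using nn_integral_erlang_density[OF r, of 0 s] True by (simp add: erlang_CDF_def)
      then show ?thesis
        using True r by (auto simp: ennreal_mult[symmetric] mult.commute split: split_indicator)
    qed simp
    finally show "ennreal (indicator F w * ?g w) = (\<integral>\<^sup>+t. ennreal (exponential_density (rate n w) t) * (\<integral>\<^sup>+y. indicator (F \<times> {..s} \<times> A) (w, t, y) \<partial>jump_law n w) \<partial>lborel)"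
      by simp
  qed
  finally show ?thesis .
qed

lemma sets_step_space:
  "sets (H n \<Otimes>\<^sub>M (borel \<Otimes>\<^sub>M (borel :: 'e measure))) =
     sigma_sets (space M \<times> UNIV) {F \<times> ({..s::real} \<times> A) |F s A. F \<in> sets (H n) \<and> A \<in> sets borel}"
proof -
  let ?B = "{b \<times> A |b A. b \<in> range (\<lambda>s::real. {..s}) \<and> A \<in> sets (borel :: 'e measure)}"
  have cov: "(UNIV :: real set) = (\<Union>i::nat. {..real i})"
    by (auto intro: real_arch_simple)
  have "sets ((borel :: real measure) \<Otimes>\<^sub>M (borel :: 'e measure)) = sets (sigma UNIV (range (\<lambda>s::real. {..s})) \<Otimes>\<^sub>M sigma UNIV (sets (borel :: 'e measure)))"
    by (rule sets_pair_measure_cong) (simp_all add: borel_eq_atMost sets.sigma_sets_eq[of borel, simplified])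
  also have "sigma UNIV (range (\<lambda>s::real. {..s})) \<Otimes>\<^sub>M sigma UNIV (sets (borel :: 'e measure)) = sigma (UNIV \<times> UNIV) ?B"
  proof (rule sigma_prod)
    show "\<exists>E\<subseteq>range (\<lambda>s::real. {..s}). countable E \<and> UNIV = \<Union>E"
      by (rule exI[of _ "range (\<lambda>i::nat. {..real i})"]) (use cov in auto)
    show "\<exists>E\<subseteq>sets (borel :: 'e measure). countable E \<and> UNIV = \<Union>E"
      by (rule exI[of _ "{UNIV}"]) auto
  qed auto
  finally have inner: "sets ((borel :: real measure) \<Otimes>\<^sub>M (borel :: 'e measure)) = sets (sigma UNIV ?B)" by simp
  have Hsub: "sets (H n) \<subseteq> Pow (space M)" using sets.space_closed[of "H n"] by simp
  have "sets (H n \<Otimes>\<^sub>M (borel \<Otimes>\<^sub>M (borel :: 'e measure))) = sets (sigma (space M) (sets (H n)) \<Otimes>\<^sub>M sigma UNIV ?B)"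
    using sets.sigma_sets_eq[of "H n"]
    by (intro sets_pair_measure_cong inner) (simp add: sets_measure_of[OF Hsub])
  also have "sigma (space M) (sets (H n)) \<Otimes>\<^sub>M sigma UNIV ?B = sigma (space M \<times> UNIV) {a \<times> b |a b. a \<in> sets (H n) \<and> b \<in> ?B}"
  proof (rule sigma_prod)
    show "\<exists>E\<subseteq>sets (H n). countable E \<and> space M = \<Union>E"
      by (rule exI[of _ "{space M}"]) (use sets.top[of "H n"] in auto)
    let ?C = "\<lambda>i::nat. {..real i} \<times> (UNIV :: 'e set)"
    have "?C i \<in> ?B" for i
      by (intro CollectI exI[of _ "{..real i}"] exI[of _ UNIV]) auto
    then have "range ?C \<subseteq> ?B" by (rule image_subsetI)
    moreover have "UNIV = \<Union>(range ?C)" by (auto intro: real_arch_simple)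
    ultimately show "\<exists>E\<subseteq>?B. countable E \<and> UNIV = \<Union>E"
      by (intro exI[of _ "range ?C"] conjI) simp_all
  qed (use Hsub in auto)
  also have "sets \<dots> = sigma_sets (space M \<times> UNIV) {a \<times> b |a b. a \<in> sets (H n) \<and> b \<in> ?B}"
    using Hsub by (intro sets_measure_of) auto
  also have "{a \<times> b |a b. a \<in> sets (H n) \<and> b \<in> ?B} = {F \<times> ({..s::real} \<times> A) |F s A. F \<in> sets (H n) \<and> A \<in> sets borel}"
    by blast
  finally show ?thesis .
qed

text \<open>
  The rectangles form a pi-system generating the product sigma-algebra, and the whole space is an
  increasing union of countably many of them.
\<close>

theorem step_disintegration:
  assumes f: "f \<in> borel_measurable (H n \<Otimes>\<^sub>M (borel \<Otimes>\<^sub>M borel))"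
  shows "step_actual n f = step_predicted n f"
proof (rule nn_functional_eqI[where E="\<lambda>i. space M \<times> ({..real i} \<times> UNIV)", OF _ _ _ _ _ _ _ _ _ _ _ f])
  let ?G = "{F \<times> ({..s::real} \<times> A) |F s A. F \<in> sets (H n) \<and> A \<in> sets (borel::'e measure)}"
  show "sets (H n \<Otimes>\<^sub>M (borel \<Otimes>\<^sub>M (borel :: 'e measure))) = sigma_sets (space (H n \<Otimes>\<^sub>M (borel \<Otimes>\<^sub>M (borel :: 'e measure)))) ?G"
    unfolding sets_step_space by (simp add: space_pair_measure)
  show "Int_stable ?G"
  proof (rule Int_stableI)
    fix a b assume "a \<in> ?G" "b \<in> ?G"
    then obtain F s A F' s' A' where *: "a = F \<times> ({..s} \<times> A)" "b = F' \<times> ({..s'} \<times> A')"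
      "F \<in> sets (H n)" "A \<in> sets borel" "F' \<in> sets (H n)" "A' \<in> sets borel" by auto
    have "a \<inter> b = (F \<inter> F') \<times> ({..min s s'} \<times> (A \<inter> A'))" using * by auto
    then show "a \<inter> b \<in> ?G" using * by blast
  qed
  show "?G \<subseteq> Pow (space (H n \<Otimes>\<^sub>M (borel \<Otimes>\<^sub>M (borel :: 'e measure))))"
    using sets.space_closed[of "H n"] by (auto simp: space_pair_measure)
  show "step_actual n (indicator A) = step_predicted n (indicator A)" if "A \<in> ?G" for A
    using that step_actual_rectangle by auto
  show "space M \<times> ({..real i} \<times> UNIV) \<in> ?G" for i
    by (intro CollectI exI[of _ "space M"] exI[of _ "real i"] exI[of _ UNIV]) (use sets.top[of "H n"] in simp)
  show "incseq (\<lambda>i. space M \<times> ({..real i} \<times> (UNIV :: 'e set)))"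
    by (auto simp: incseq_def)
  show "(\<Union>i. space M \<times> ({..real i} \<times> (UNIV :: 'e set))) = space (H n \<Otimes>\<^sub>M (borel \<Otimes>\<^sub>M borel))"
    by (auto simp: space_pair_measure intro: real_arch_simple)
next
  have "step_actual n (\<lambda>x. 1) \<le> (\<integral>\<^sup>+w. 1 \<partial>M)"
    unfolding step_actual_def by (rule nn_integral_mono) auto
  then show "step_actual n (\<lambda>x. 1) < \<infinity>"
    by (simp add: emeasure_space_1 order.strict_trans1)
next
  fix T and f g :: "'a \<times> real \<times> 'e \<Rightarrow> ennreal"
  assume T: "T \<in> {step_actual n, step_predicted n}" and eq: "\<And>x. x \<in> space (H n \<Otimes>\<^sub>M (borel \<Otimes>\<^sub>M (borel :: 'e measure))) \<Longrightarrow> f x = g x"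
  have "f (w, s, y) = g (w, s, y)" if "w \<in> space M" for w s y
    using that by (intro eq) (auto simp: space_pair_measure)
  then show "T f = T g"
    using T by (auto simp: step_actual_def step_predicted_def intro!: nn_integral_cong arg_cong2[where f="(*)"])
next
  let ?P = "H n \<Otimes>\<^sub>M (borel \<Otimes>\<^sub>M (borel :: 'e measure))"
  fix T and f g :: "'a \<times> real \<times> 'e \<Rightarrow> ennreal" and c
  assume T: "T \<in> {step_actual n, step_predicted n}" and f: "f \<in> borel_measurable ?P" and g: "g \<in> borel_measurable ?P"
  note m = step_actual_measurable step_predicted_measurable1 step_predicted_measurable2
    measurable_H_M[OF step_predicted_measurable3]
  have "step_actual n (\<lambda>x. c * f x + g x) = c * step_actual n f + step_actual n g"
    unfolding step_actual_def using m(1)[OF f] m(1)[OF g]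
    by (subst nn_integral_cmult[symmetric], simp, subst nn_integral_add[symmetric])
      (auto intro!: nn_integral_cong)
  moreover have "step_predicted n (\<lambda>x. c * f x + g x) = c * step_predicted n f + step_predicted n g"
  proof -
    let ?e = "\<lambda>w s. ennreal (exponential_density (rate n w) s)"
    let ?I = "\<lambda>h w s. \<integral>\<^sup>+y. h (w, s, y) \<partial>jump_law n w"
    have "step_predicted n (\<lambda>x. c * f x + g x) = (\<integral>\<^sup>+w. c * (\<integral>\<^sup>+s. ?e w s * ?I f w s \<partial>lborel) + (\<integral>\<^sup>+s. ?e w s * ?I g w s \<partial>lborel) \<partial>M)"
      unfolding step_predicted_def
    proof (rule nn_integral_cong)
      fix w assume w: "w \<in> space M"
      note [measurable] = m(2)[OF f w] m(2)[OF g w] m(3)[OF f w] m(3)[OF g w]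
      have "(\<integral>\<^sup>+s. ?e w s * (\<integral>\<^sup>+y. c * f (w, s, y) + g (w, s, y) \<partial>jump_law n w) \<partial>lborel)
        = (\<integral>\<^sup>+s. c * (?e w s * ?I f w s) + ?e w s * ?I g w s \<partial>lborel)"
        by (rule nn_integral_cong) (simp add: nn_integral_add nn_integral_cmult algebra_simps)
      also have "\<dots> = c * (\<integral>\<^sup>+s. ?e w s * ?I f w s \<partial>lborel) + (\<integral>\<^sup>+s. ?e w s * ?I g w s \<partial>lborel)"
        by (simp add: nn_integral_add nn_integral_cmult)
      finally show "(\<integral>\<^sup>+s. ?e w s * (\<integral>\<^sup>+y. c * f (w, s, y) + g (w, s, y) \<partial>jump_law n w) \<partial>lborel) = \<dots>" .
    qed
    also have "\<dots> = c * step_predicted n f + step_predicted n g"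
      unfolding step_predicted_def using m(4)[OF f] m(4)[OF g] by (simp add: nn_integral_add nn_integral_cmult)
    finally show ?thesis .
  qed
  ultimately show "T (\<lambda>x. c * f x + g x) = c * T f + T g"
    using T by auto
next
  let ?P = "H n \<Otimes>\<^sub>M (borel \<Otimes>\<^sub>M (borel :: 'e measure))"
  fix T and f :: "nat \<Rightarrow> 'a \<times> real \<times> 'e \<Rightarrow> ennreal"
  assume T: "T \<in> {step_actual n, step_predicted n}" and f: "\<And>i. f i \<in> borel_measurable ?P" and inc: "incseq f"
  note m = step_actual_measurable step_predicted_measurable1 step_predicted_measurable2
    measurable_H_M[OF step_predicted_measurable3]
  have incx: "f i x \<le> f j x" if "i \<le> j" for i j x using inc that by (simp add: incseq_def le_fun_def del: split_paired_All)
  have "step_actual n (\<lambda>x. SUP i. f i x) = (SUP i. step_actual n (f i))"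
  proof -
    have "step_actual n (\<lambda>x. SUP i. f i x) = (\<integral>\<^sup>+w. (SUP i. if J n w < \<infinity> \<and> J (Suc n) w < \<infinity> then f i (w, holding n w, displacement n w) else 0) \<partial>M)"
      unfolding step_actual_def by (rule nn_integral_cong) auto
    also have "\<dots> = (SUP i. step_actual n (f i))"
      unfolding step_actual_def
      by (rule nn_integral_monotone_convergence_SUP) (use m(1)[OF f] in \<open>auto simp: incseq_def le_fun_def incx\<close>)
    finally show ?thesis .
  qed
  moreover have "step_predicted n (\<lambda>x. SUP i. f i x) = (SUP i. step_predicted n (f i))"
  proof -
    let ?e = "\<lambda>w s. ennreal (exponential_density (rate n w) s)"
    let ?I = "\<lambda>h w s. \<integral>\<^sup>+y. h (w, s, y) \<partial>jump_law n w"
    have "step_predicted n (\<lambda>x. SUP i. f i x) = (\<integral>\<^sup>+w. (SUP i. (\<integral>\<^sup>+s. ?e w s * ?I (f i) w s \<partial>lborel)) \<partial>M)"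
      unfolding step_predicted_def
    proof (rule nn_integral_cong)
      fix w assume w: "w \<in> space M"
      note [measurable] = m(2)[OF f w] m(3)[OF f w]
      have "(\<integral>\<^sup>+s. ?e w s * (\<integral>\<^sup>+y. (SUP i. f i (w, s, y)) \<partial>jump_law n w) \<partial>lborel)
        = (\<integral>\<^sup>+s. (SUP i. ?e w s * ?I (f i) w s) \<partial>lborel)"
        by (rule nn_integral_cong, subst nn_integral_monotone_convergence_SUP)
          (auto simp: incseq_def le_fun_def incx SUP_mult_left_ennreal)
      also have "\<dots> = (SUP i. (\<integral>\<^sup>+s. ?e w s * ?I (f i) w s \<partial>lborel))"
        by (rule nn_integral_monotone_convergence_SUP)
          (auto simp: incseq_def le_fun_def intro!: mult_left_mono nn_integral_mono incx)
      finally show "(\<integral>\<^sup>+s. ?e w s * (\<integral>\<^sup>+y. (SUP i. f i (w, s, y)) \<partial>jump_law n w) \<partial>lborel) = \<dots>" .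
    qed
    also have "\<dots> = (SUP i. step_predicted n (f i))"
      unfolding step_predicted_def
      by (rule nn_integral_monotone_convergence_SUP)
        (auto simp: incseq_def le_fun_def intro!: mult_left_mono nn_integral_mono incx m(4) f)
    finally show ?thesis .
  qed
  ultimately show "T (\<lambda>x. SUP i. f i x) = (SUP i. T (f i))"
    using T by auto
qed

end

section \<open>One step as a double integral over time and jump\<close>

context jump_process
begin

lemma kmass_M [measurable]: "A \<in> sets borel \<Longrightarrow> kmass n A \<in> borel_measurable M"
  by (rule measurable_H_M[OF kmass_H])

text \<open>
  The density of the exponential law contains the rate, which cancels the normalisation of the
  jump law. In this form the case of rate 0 needs no separate treatment.
\<close>

definition step_kernel :: "nat \<Rightarrow> ('a \<times> real \<times> 'e \<Rightarrow> ennreal) \<Rightarrow> 'a \<Rightarrow> ennreal" where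
  "step_kernel n f w = (if J n w < \<infinity> then
     (\<integral>\<^sup>+s. indicator {0..} s * ennreal (exp (- rate n w * s)) * (\<integral>\<^sup>+y. f (w, s, y) \<partial>\<kappa> (Y n w)) \<partial>lborel) else 0)"

lemma step_kernel_eq:
  assumes f: "f \<in> borel_measurable (H n \<Otimes>\<^sub>M (borel \<Otimes>\<^sub>M borel))" and w: "w \<in> space M"
  shows "(\<integral>\<^sup>+s. ennreal (exponential_density (rate n w) s) * (\<integral>\<^sup>+y. f (w, s, y) \<partial>jump_law n w) \<partial>lborel) = step_kernel n f w"
proof (cases "J n w < \<infinity>")
  case True
  have m: "(\<lambda>y. f (w, s, y)) \<in> borel_measurable borel" for s
    by (rule measurable_compose[OF _ f]) (intro measurable_Pair measurable_const measurable_ident; simp add: w)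
  have "ennreal (exponential_density (rate n w) s) * (\<integral>\<^sup>+y. f (w, s, y) \<partial>jump_law n w)
    = indicator {0..} s * ennreal (exp (- rate n w * s)) * (\<integral>\<^sup>+y. f (w, s, y) \<partial>\<kappa> (Y n w))" for s
  proof -
    have "ennreal (exponential_density (rate n w) s) = indicator {0..} s * ennreal (exp (- rate n w * s)) * ennreal (rate n w)"
      by (auto simp: exponential_density_def ennreal_mult[symmetric] mult.commute split: split_indicator)
    then show ?thesis
      using nn_integral_jump_law[OF w True m[of s]] by (simp add: mult.assoc)
  qed
  with True show ?thesis by (simp add: step_kernel_def)
next
  case False
  then show ?thesis by (simp add: jump_law_def step_kernel_def)
qed

lemma step_kernel_measurable:
  assumes f: "f \<in> borel_measurable (H n \<Otimes>\<^sub>M (borel \<Otimes>\<^sub>M borel))"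
  shows "step_kernel n f \<in> borel_measurable M"
  by (rule measurable_cong[THEN iffD1, OF step_kernel_eq[OF f] measurable_H_M[OF step_predicted_measurable3[OF f]]])

lemma step_formula:
  assumes f: "f \<in> borel_measurable (H n \<Otimes>\<^sub>M (borel \<Otimes>\<^sub>M borel))"
  shows "(\<integral>\<^sup>+w. (if J n w < \<infinity> \<and> J (Suc n) w < \<infinity> then f (w, holding n w, displacement n w) else 0) \<partial>M)
    = (\<integral>\<^sup>+w. step_kernel n f w \<partial>M)"
proof -
  have "step_predicted n f = (\<integral>\<^sup>+w. step_kernel n f w \<partial>M)"
    unfolding step_predicted_def by (rule nn_integral_cong) (rule step_kernel_eq[OF f])
  with step_disintegration[OF f] show ?thesis by (simp add: step_actual_def)
qed

lemma exp_tail_integral: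
  fixes q c :: real
  assumes "0 < q" "0 \<le> c"
  shows "(\<integral>\<^sup>+s. indicator {0..} s * ennreal (exp (- q * s)) * (indicator {c<..} s * ennreal q) \<partial>lborel) = ennreal (exp (- q * c))"
proof -
  have "(\<integral>\<^sup>+s. indicator {0..} s * ennreal (exp (- q * s)) * (indicator {c<..} s * ennreal q) \<partial>lborel)
    = (\<integral>\<^sup>+s. ennreal (q * exp (- q * s)) * indicator {c..} s \<partial>lborel)"
  proof (rule nn_integral_cong_AE)
    have "AE s in lborel. s \<noteq> c" by (rule AE_lborel_singleton)
    then show "AE s in lborel. indicator {0..} s * ennreal (exp (- q * s)) * (indicator {c<..} s * ennreal q) = ennreal (q * exp (- q * s)) * indicator {c..} s"
      by eventually_elim (use assms in \<open>auto simp: ennreal_mult mult.commute split: split_indicator\<close>)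
  qed
  also have "\<dots> = ennreal (0 - (- exp (- q * c)))"
  proof (rule nn_integral_FTC_atLeast)
    show "DERIV (\<lambda>s. - exp (- q * s)) s :> q * exp (- q * s)" for s
      by (auto intro!: derivative_eq_intros)
    have "filterlim (\<lambda>s. - q * s) at_bot at_top"
      by (rule filterlim_tendsto_neg_mult_at_bot[OF tendsto_const]) (use assms(1) in \<open>auto simp: filterlim_ident\<close>)
    from tendsto_minus[OF filterlim_compose[OF exp_at_bot this]]
    show "((\<lambda>s. - exp (- q * s)) \<longlongrightarrow> 0) at_top" by simp
  qed (use assms in auto)
  finally show ?thesis by simp
qed

text \<open>
  The exponential tail of the holding time, for a deadline \<open>h\<close> that may depend on the
  history. The defining property speaks only of jumps that do occur, so the event of no further
  jump has to be identified first.
\<close>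

lemma no_jump_before:
  assumes g: "g \<in> borel_measurable (H n)" and h: "h \<in> borel_measurable (H n)"
    and supp: "\<And>w. w \<in> space M \<Longrightarrow> g w \<noteq> 0 \<Longrightarrow> J n w < \<infinity> \<and> jt n w \<le> h w"
  shows "(\<integral>\<^sup>+w. (if ereal (h w) < J (Suc n) w then g w else 0) \<partial>M)
    = (\<integral>\<^sup>+w. g w * ennreal (exp (- rate n w * (h w - jt n w))) \<partial>M)"
proof -
  note [measurable] = g h measurable_H_M[OF g] measurable_H_M[OF h]
  have count: "(\<integral>\<^sup>+w. (if J n w < \<infinity> \<and> J (Suc n) w < \<infinity> then g w * (if h w - jt n w < holding n w then 1 else 0) else 0) \<partial>M)
    = (\<integral>\<^sup>+w. (if rate n w > 0 then g w * ennreal (exp (- rate n w * (h w - jt n w))) else 0) \<partial>M)"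
    if g [measurable]: "g \<in> borel_measurable (H n)" and h [measurable]: "h \<in> borel_measurable (H n)"
    and supp: "\<And>w. w \<in> space M \<Longrightarrow> g w \<noteq> 0 \<Longrightarrow> J n w < \<infinity> \<and> jt n w \<le> h w" for g and h :: "'a \<Rightarrow> real"
  proof -
    let ?f = "\<lambda>x. g (fst x) * (if h (fst x) - jt n (fst x) < fst (snd x) then 1 else 0)"
    have "?f \<in> borel_measurable (H n \<Otimes>\<^sub>M (borel \<Otimes>\<^sub>M (borel :: 'e measure)))" by measurable
    from step_formula[OF this]
    have "(\<integral>\<^sup>+w. (if J n w < \<infinity> \<and> J (Suc n) w < \<infinity> then g w * (if h w - jt n w < holding n w then 1 else 0) else 0) \<partial>M)
      = (\<integral>\<^sup>+w. (if J n w < \<infinity> then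
         (\<integral>\<^sup>+s. indicator {0..} s * ennreal (exp (- rate n w * s)) * (\<integral>\<^sup>+y. g w * (if h w - jt n w < s then 1 else 0) \<partial>\<kappa> (Y n w)) \<partial>lborel) else 0) \<partial>M)"
      by (simp only: fst_conv snd_conv step_kernel_def)
    also have "\<dots> = (\<integral>\<^sup>+w. (if rate n w > 0 then g w * ennreal (exp (- rate n w * (h w - jt n w))) else 0) \<partial>M)"
    proof (rule nn_integral_cong)
      fix w assume w: "w \<in> space M"
      show "(if J n w < \<infinity> then
         (\<integral>\<^sup>+s. indicator {0..} s * ennreal (exp (- rate n w * s)) * (\<integral>\<^sup>+y. g w * (if h w - jt n w < s then 1 else 0) \<partial>\<kappa> (Y n w)) \<partial>lborel) else 0)
        = (if rate n w > 0 then g w * ennreal (exp (- rate n w * (h w - jt n w))) else 0)"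
      proof (cases "J n w < \<infinity> \<and> g w \<noteq> 0")
        case True
        then have le: "0 \<le> h w - jt n w" using supp[OF w] by simp
        interpret k: finite_measure "\<kappa> (Y n w)" using kernel_at[OF w] True by simp
        have mass: "emeasure (\<kappa> (Y n w)) (space (\<kappa> (Y n w))) = ennreal (rate n w)"
          using True kernel_at[OF w, of n] by (simp add: kmass_def k.emeasure_eq_measure)
        have "(\<integral>\<^sup>+s. indicator {0..} s * ennreal (exp (- rate n w * s)) * (\<integral>\<^sup>+y. g w * (if h w - jt n w < s then 1 else 0) \<partial>\<kappa> (Y n w)) \<partial>lborel)
          = (\<integral>\<^sup>+s. g w * (indicator {0..} s * ennreal (exp (- rate n w * s)) * (indicator {h w - jt n w<..} s * ennreal (rate n w))) \<partial>lborel)"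
          by (rule nn_integral_cong) (auto simp: mass ac_simps split: split_indicator)
        also have "\<dots> = g w * (\<integral>\<^sup>+s. (indicator {0..} s * ennreal (exp (- rate n w * s)) * (indicator {h w - jt n w<..} s * ennreal (rate n w))) \<partial>lborel)"
          by (rule nn_integral_cmult) measurable
        also have "\<dots> = (if rate n w > 0 then g w * ennreal (exp (- rate n w * (h w - jt n w))) else 0)"
        proof (cases "rate n w > 0")
          case True
          then show ?thesis using exp_tail_integral[OF True le] by simp
        next
          case False
          then have "rate n w = 0" using kmass_nonneg[of n UNIV w] by linarith
          then show ?thesis by simp
        qed
        finally show ?thesis using True by simp
      qed (auto simp: kmass_def)
    qed
    finally show ?thesis .
  qed
  \<comment> \<open>Almost surely a further jump occurs exactly if the rate is positive: letting the deadline be the present time counts all further jumps, and their total mass is that of the event of positive rate.\<close>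
  have never: "AE w in M. J n w < \<infinity> \<longrightarrow> (J (Suc n) w = \<infinity> \<longleftrightarrow> rate n w = 0)"
  proof -
    let ?g0 = "\<lambda>w. if J n w < \<infinity> \<and> rate n w = 0 then 1 else (0::ennreal)"
    let ?g1 = "\<lambda>w. if J n w < \<infinity> \<and> rate n w > 0 then 1 else (0::ennreal)"
    have hold: "holding n w > 0" if "w \<in> space M" "J n w < \<infinity>" "J (Suc n) w < \<infinity>" for w
      using J_strict[OF that(1,2)] J_eq_jt[OF that(1,2)] J_eq_jt[OF that(1,3)] by simp
    have "(\<integral>\<^sup>+w. (if J n w < \<infinity> \<and> J (Suc n) w < \<infinity> \<and> rate n w = 0 then 1 else 0) \<partial>M)
      = (\<integral>\<^sup>+w. (if J n w < \<infinity> \<and> J (Suc n) w < \<infinity> then ?g0 w * (if jt n w - jt n w < holding n w then 1 else 0) else 0) \<partial>M)"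
      by (rule nn_integral_cong) (use hold in auto)
    also have "\<dots> = (\<integral>\<^sup>+w. (if rate n w > 0 then ?g0 w * ennreal (exp (- rate n w * (jt n w - jt n w))) else 0) \<partial>M)"
      by (rule count) (auto split: if_splits)
    also have "\<dots> = 0" by (intro nn_integral_zero') (auto intro!: AE_I2)
    finally have ae0: "AE w in M. \<not> (J n w < \<infinity> \<and> J (Suc n) w < \<infinity> \<and> rate n w = 0)"
      by (subst (asm) nn_integral_0_iff_AE) (auto split: if_splits)
    have "(\<integral>\<^sup>+w. (if J n w < \<infinity> \<and> J (Suc n) w < \<infinity> \<and> rate n w > 0 then 1 else 0) \<partial>M)
      = (\<integral>\<^sup>+w. (if J n w < \<infinity> \<and> J (Suc n) w < \<infinity> then ?g1 w * (if jt n w - jt n w < holding n w then 1 else 0) else 0) \<partial>M)"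
      by (rule nn_integral_cong) (use hold in auto)
    also have "\<dots> = (\<integral>\<^sup>+w. (if rate n w > 0 then ?g1 w * ennreal (exp (- rate n w * (jt n w - jt n w))) else 0) \<partial>M)"
      by (rule count) (auto split: if_splits)
    also have "\<dots> = (\<integral>\<^sup>+w. ?g1 w \<partial>M)" by (rule nn_integral_cong) auto
    finally have eq: "(\<integral>\<^sup>+w. (if J n w < \<infinity> \<and> J (Suc n) w < \<infinity> \<and> rate n w > 0 then 1 else 0) \<partial>M) = (\<integral>\<^sup>+w. ?g1 w \<partial>M)" .
    have "(\<integral>\<^sup>+w. ?g1 w \<partial>M) \<le> (\<integral>\<^sup>+w. 1 \<partial>M)" by (rule nn_integral_mono) auto
    then have "(\<integral>\<^sup>+w. ?g1 w \<partial>M) < \<infinity>"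
      by (rule order.strict_trans1) (simp add: emeasure_space_1)
    then have fin: "(\<integral>\<^sup>+w. ?g1 w \<partial>M) \<noteq> \<infinity>" by simp
    have "(\<integral>\<^sup>+w. ?g1 w \<partial>M) = (\<integral>\<^sup>+w. (if J n w < \<infinity> \<and> J (Suc n) w < \<infinity> \<and> rate n w > 0 then 1 else 0) + (if J n w < \<infinity> \<and> J (Suc n) w = \<infinity> \<and> rate n w > 0 then 1 else 0) \<partial>M)"
      by (rule nn_integral_cong) auto
    also have "\<dots> = (\<integral>\<^sup>+w. ?g1 w \<partial>M) + (\<integral>\<^sup>+w. (if J n w < \<infinity> \<and> J (Suc n) w = \<infinity> \<and> rate n w > 0 then 1 else 0) \<partial>M)"
      by (subst nn_integral_add, measurable, measurable, simp only: eq)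
    finally have "(\<integral>\<^sup>+w. (if J n w < \<infinity> \<and> J (Suc n) w = \<infinity> \<and> rate n w > 0 then 1 else 0) \<partial>M) = 0"
      using fin ennreal_add_left_cancel[of "\<integral>\<^sup>+w. ?g1 w \<partial>M" 0] by fastforce
    then have ae1: "AE w in M. \<not> (J n w < \<infinity> \<and> J (Suc n) w = \<infinity> \<and> rate n w > 0)"
      by (subst (asm) nn_integral_0_iff_AE) (auto split: if_splits)
    from ae0 ae1 show ?thesis
    proof eventually_elim
      case (elim w)
      then show ?case using kmass_nonneg[of n UNIV w] by (auto simp: less_le)
    qed
  qed
  have "(\<integral>\<^sup>+w. (if ereal (h w) < J (Suc n) w then g w else 0) \<partial>M)
    = (\<integral>\<^sup>+w. (if J n w < \<infinity> \<and> J (Suc n) w < \<infinity> then g w * (if h w - jt n w < holding n w then 1 else 0) else 0)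
        + (if rate n w = 0 then g w else 0) \<partial>M)"
  proof (rule nn_integral_cong_AE, use never AE_space in eventually_elim)
    case (elim w)
    show ?case
    proof (cases "g w = 0")
      case False
      with supp[OF elim(2)] have fin: "J n w < \<infinity>" by simp
      show ?thesis
      proof (cases "J (Suc n) w < \<infinity>")
        case True
        have "ereal (h w) < J (Suc n) w \<longleftrightarrow> h w - jt n w < holding n w"
          unfolding J_eq_jt[OF elim(2) True] by simp
        moreover have "rate n w \<noteq> 0" using elim(1) fin True by simp
        ultimately show ?thesis using fin True by simp
      next
        case False
        then have "J (Suc n) w = \<infinity>" by simp
        moreover have "rate n w = 0" using elim(1) fin \<open>J (Suc n) w = \<infinity>\<close> by simp
        ultimately show ?thesis using fin by simp
      qed
    qed simp
  qed
  also have "\<dots> = (\<integral>\<^sup>+w. (if rate n w > 0 then g w * ennreal (exp (- rate n w * (h w - jt n w))) else 0) \<partial>M)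
      + (\<integral>\<^sup>+w. (if rate n w = 0 then g w else 0) \<partial>M)"
    by (subst count[OF g h supp, symmetric], assumption, assumption, rule nn_integral_add) measurable
  also have "\<dots> = (\<integral>\<^sup>+w. (if rate n w > 0 then g w * ennreal (exp (- rate n w * (h w - jt n w))) else 0)
      + (if rate n w = 0 then g w else 0) \<partial>M)"
    by (subst nn_integral_add) auto
  also have "\<dots> = (\<integral>\<^sup>+w. g w * ennreal (exp (- rate n w * (h w - jt n w))) \<partial>M)"
    by (rule nn_integral_cong) (use kmass_nonneg[of n UNIV] in \<open>auto simp: less_le\<close>)
  finally show ?thesis .
qed

end

section \<open>Superharmonic functions and optional stopping\<close>

text \<open>
  The deterministic core. While the state is constant, \<open>exp (- q * s) * v (a + s)\<close>
  decreases at least at the speed \<open>exp (- q * s) * I (a + s)\<close>, where \<open>q\<close>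
  is the jump rate and \<open>I\<close> the expected value after a jump. Integrating this balances
  the value at time \<open>a\<close> against the value at the next jump or at the deadline
  \<open>h\<close>, whichever comes first.
\<close>

lemma flow_bound:
  fixes v v' :: "real \<Rightarrow> real"
  assumes q: "0 \<le> q" and le: "a \<le> h"
    and v': "v' \<in> borel_measurable borel"
    and nonneg: "\<And>t. a \<le> t \<Longrightarrow> t \<le> h \<Longrightarrow> 0 \<le> v t"
    and deriv: "\<And>t. a < h \<Longrightarrow> a \<le> t \<Longrightarrow> t \<le> h \<Longrightarrow> (v has_real_derivative v' t) (at t)"
    and I: "\<And>t. a < h \<Longrightarrow> a \<le> t \<Longrightarrow> t \<le> h \<Longrightarrow> 0 \<le> q * v t - v' t \<and> I t \<le> ennreal (q * v t - v' t)"
  shows "(\<integral>\<^sup>+s. indicator {0..} s * ennreal (exp (- q * s)) * (if a + s \<le> h then I (a + s) else 0) \<partial>lborel)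
     + ennreal (v h) * ennreal (exp (- q * (h - a))) \<le> ennreal (v a)"
proof (cases "a < h")
  case False
  with le have ah: "a = h" by simp
  have "(\<integral>\<^sup>+s. indicator {0..} s * ennreal (exp (- q * s)) * (if a + s \<le> h then I (a + s) else 0) \<partial>lborel)
    = (\<integral>\<^sup>+(s::real). 0 \<partial>lborel)"
  proof (rule nn_integral_cong_AE)
    have "AE s in lborel. s \<noteq> (0::real)" by (rule AE_lborel_singleton)
    then show "AE s in lborel. indicator {0..} s * ennreal (exp (- q * s)) * (if a + s \<le> h then I (a + s) else 0) = 0"
      by eventually_elim (auto simp: ah split: split_indicator)
  qed
  then show ?thesis by (simp add: ah)
next
  case True
  have v'm [measurable]: "v' \<in> borel_measurable borel" by (rule v')
  let ?f = "\<lambda>s. if s \<in> {a..h} then exp (- q * (s - a)) * (q * v s - v' s) else 0"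
  let ?F = "\<lambda>s. - exp (- q * (s - a)) * v s"
  have vm: "(\<lambda>s. if s \<in> {a..h} then v s else 0) \<in> borel_measurable borel"
  proof -
    have "continuous_on {a..h} v"
      using deriv[OF True] by (intro continuous_at_imp_continuous_on) (simp add: DERIV_isCont[OF deriv[OF True]])
    then have "(\<lambda>s. indicator {a..h} s *\<^sub>R v s) \<in> borel_measurable borel"
      by (intro borel_measurable_continuous_on_indicator) auto
    then show ?thesis by (rule measurable_cong[THEN iffD1, rotated]) (auto simp: indicator_def)
  qed
  have fm: "?f \<in> borel_measurable borel"
  proof -
    have "(\<lambda>s. if s \<in> {a..h} then exp (- q * (s - a)) * (q * (if s \<in> {a..h} then v s else 0) - v' s) else 0) \<in> borel_measurable borel"
      using vm by measurable
    then show ?thesis by (rule measurable_cong[THEN iffD1, rotated]) auto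
  qed
  have FTC: "(\<integral>\<^sup>+s. ennreal (?f s) * indicator {a..h} s \<partial>lborel) = ennreal (?F h - ?F a)"
  proof (rule nn_integral_FTC_Icc[OF fm])
    fix s assume s: "s \<in> {a..h}"
    show "(?F has_real_derivative ?f s) (at s)"
      using s by (auto intro!: derivative_eq_intros deriv[OF True] simp: algebra_simps)
    show "0 \<le> ?f s" using I[OF True, of s] s by auto
  qed (rule le)
  have "(\<integral>\<^sup>+s. indicator {0..} s * ennreal (exp (- q * s)) * (if a + s \<le> h then I (a + s) else 0) \<partial>lborel)
    \<le> (\<integral>\<^sup>+s. ennreal (?f (a + s)) * indicator {a..h} (a + s) \<partial>lborel)"
  proof (rule nn_integral_mono)
    fix s :: real
    show "indicator {0..} s * ennreal (exp (- q * s)) * (if a + s \<le> h then I (a + s) else 0) \<le> ennreal (?f (a + s)) * indicator {a..h} (a + s)"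
    proof (cases "0 \<le> s \<and> a + s \<le> h")
      case in_range: True
      have "ennreal (exp (- q * s)) * I (a + s) \<le> ennreal (exp (- q * s)) * ennreal (q * v (a + s) - v' (a + s))"
        using I[OF True, of "a + s"] in_range by (intro mult_left_mono) auto
      also have "\<dots> = ennreal (exp (- q * s) * (q * v (a + s) - v' (a + s)))"
        using I[OF True, of "a + s"] in_range by (intro ennreal_mult[symmetric]) auto
      finally show ?thesis using in_range by (simp split: split_indicator)
    qed auto
  qed
  also have "\<dots> = (\<integral>\<^sup>+s. ennreal (?f s) * indicator {a..h} s \<partial>lborel)"
  proof -
    have "(\<lambda>s. ennreal (?f s) * indicator {a..h} s) \<in> borel_measurable borel"
      using fm by measurable
    from nn_integral_real_affine[OF this, of 1 a] show ?thesis by (simp only: mult_1_left abs_one ennreal_1 one_neq_zero not_False_eq_True simp_thms)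
  qed
  also have "\<dots> = ennreal (v a - exp (- q * (h - a)) * v h)"
    unfolding FTC by simp
  finally have "(\<integral>\<^sup>+s. indicator {0..} s * ennreal (exp (- q * s)) * (if a + s \<le> h then I (a + s) else 0) \<partial>lborel)
     + ennreal (v h) * ennreal (exp (- q * (h - a))) \<le> ennreal (v a - exp (- q * (h - a)) * v h) + ennreal (exp (- q * (h - a)) * v h)"
    using nonneg[of h] le by (intro add_mono) (auto simp: ennreal_mult[symmetric] mult.commute)
  also have "\<dots> = ennreal (v a)"
  proof -
    have "?F a \<le> ?F h"
      by (rule DERIV_nonneg_imp_nondecreasing[OF le])
        (use deriv[OF True] I[OF True] in \<open>auto intro!: exI derivative_eq_intros simp: algebra_simps\<close>)
    then show ?thesis
      using nonneg[of h] le by (subst ennreal_plus[symmetric]) auto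
  qed
  finally show ?thesis .
qed

text \<open>
  Here \<open>a n\<close> will be the mass that is still moving after \<open>n\<close> jumps and
  \<open>b n\<close> the mass that stops before the next one.
\<close>

lemma suminf_le_telescope:
  fixes a b :: "nat \<Rightarrow> ennreal"
  assumes "\<And>n. a (Suc n) + b n \<le> a n"
  shows "(\<Sum>n. b n) \<le> a 0"
proof -
  have partial: "a n + (\<Sum>k<n. b k) \<le> a 0" for n
  proof (induction n)
    case (Suc n)
    have "a (Suc n) + (\<Sum>k<Suc n. b k) = (a (Suc n) + b n) + (\<Sum>k<n. b k)"
      by (simp add: ac_simps)
    also have "\<dots> \<le> a n + (\<Sum>k<n. b k)" by (rule add_right_mono[OF assms])
    also note Suc.IH
    finally show ?case .
  qed simp
  have "(\<Sum>k<n. b k) \<le> a 0" for n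
  proof -
    have "(\<Sum>k<n. b k) \<le> a n + (\<Sum>k<n. b k)" by simp
    also note partial
    finally show ?thesis .
  qed
  then show ?thesis unfolding suminf_eq_SUP by (intro SUP_least)
qed

context jump_process
begin

text \<open>
  The state at time \<open>r\<close> as known after \<open>n\<close> jumps: up to time
  \<open>r\<close> it follows the process, then it is frozen.
\<close>

primrec state_record :: "real \<Rightarrow> nat \<Rightarrow> 'a \<Rightarrow> 'e" where
  "state_record r 0 w = Y 0 w"
| "state_record r (Suc n) w = (if J (Suc n) w \<le> ereal r then Y (Suc n) w else state_record r n w)"

lemma state_record_H [measurable]: "state_record r n \<in> borel_measurable (H n)"
proof (induction n)
  case 0
  then show ?case by (simp add: Y_H_n)
next
  case (Suc n)
  note [measurable] = measurable_H_Suc[OF Suc]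
  show ?case by simp
qed

lemma state_record_M [measurable]: "state_record r n \<in> borel_measurable M"
  by (rule measurable_H_M[OF state_record_H])

lemma state_record_eq: "J n w \<le> ereal r \<Longrightarrow> state_record r n w = Y n w"
  by (cases n) auto

text \<open>
  \<open>V t x z\<close> depends on the time, the present state \<open>x\<close> and the state
  \<open>z\<close> recorded at time \<open>r\<close>. Before time \<open>r\<close> the record is
  the present state, so the inequality is required only for \<open>z = x\<close> there and a jump
  changes both arguments. \<open>V'\<close> is the time derivative; it is passed explicitly so
  that its measurability in \<open>t\<close> can be required. The inequality says that \<open>V' +
  \<integral> (V t (x + y) - V t x) \<kappa> x (dy) \<le> 0\<close>.
\<close>

definition superharmonic :: "'e set \<Rightarrow> real \<Rightarrow> real \<Rightarrow> (real \<Rightarrow> 'e \<Rightarrow> 'e \<Rightarrow> real) \<Rightarrow> (real \<Rightarrow> 'e \<Rightarrow> 'e \<Rightarrow> real) \<Rightarrow> bool" where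
  "superharmonic S r R V V' \<longleftrightarrow>
     (\<forall>t\<in>{0..R}. \<forall>x z. 0 \<le> V t x z) \<and>
     (\<lambda>(t, x, z). V t x z) \<in> borel_measurable (borel \<Otimes>\<^sub>M (borel \<Otimes>\<^sub>M borel)) \<and>
     (\<forall>x z. (\<lambda>t. V' t x z) \<in> borel_measurable borel) \<and>
     (\<forall>x\<in>D \<inter> S. \<forall>z. \<forall>t\<in>{0..R}. (t \<le> r \<longrightarrow> z = x) \<longrightarrow>
        ((\<lambda>t. V t x z) has_real_derivative V' t x z) (at t) \<and>
        integrable (\<kappa> x) (\<lambda>y. V t (x + y) (if t \<le> r then x + y else z)) \<and>
        (\<integral>y. V t (x + y) (if t \<le> r then x + y else z) \<partial>\<kappa> x) \<le> measure (\<kappa> x) UNIV * V t x z - V' t x z)"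

text \<open>
  One step of the induction: on an event \<open>G\<close> of the history after \<open>n\<close>
  jumps, the value at the next jump or at the deadline \<open>h\<close>, whichever comes first,
  has at most the expectation of the present value. The law of the step turns both terms into
  integrals along the flow with frozen state, where \<open>flow_bound\<close> applies.
\<close>

lemma superharmonic_step:
  assumes V: "superharmonic S r R V V'"
    and G: "G \<in> sets (H n)" and h: "h \<in> borel_measurable (H n)"
    and Gh: "\<And>w. w \<in> G \<Longrightarrow> J n w < \<infinity> \<and> jt n w \<le> h w \<and> h w \<le> R \<and> (jt n w < h w \<longrightarrow> Y n w \<in> S)"
  shows "(\<integral>\<^sup>+w. (if w \<in> G \<and> J (Suc n) w \<le> ereal (h w) then ennreal (V (jt (Suc n) w) (Y (Suc n) w) (state_record r (Suc n) w)) else 0) \<partial>M)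
     + (\<integral>\<^sup>+w. (if w \<in> G \<and> ereal (h w) < J (Suc n) w then ennreal (V (h w) (Y n w) (state_record r n w)) else 0) \<partial>M)
     \<le> (\<integral>\<^sup>+w. (if w \<in> G then ennreal (V (jt n w) (Y n w) (state_record r n w)) else 0) \<partial>M)"
proof -
  have V0: "0 \<le> V t x z" if "0 \<le> t" "t \<le> R" for t x z using V that unfolding superharmonic_def by auto
  have V'm [measurable]: "(\<lambda>t. V' t x z) \<in> borel_measurable borel" for x z using V unfolding superharmonic_def by blast
  have Vm: "(\<lambda>x. V (a x) (b x) (c x)) \<in> borel_measurable N"
    if "a \<in> borel_measurable N" "b \<in> borel_measurable N" "c \<in> borel_measurable N" for N a b c
  proof -
    have "(\<lambda>(t, x, z). V t x z) \<in> borel_measurable (borel \<Otimes>\<^sub>M (borel \<Otimes>\<^sub>M borel))"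
      using V unfolding superharmonic_def by blast
    from measurable_compose[OF _ this, of "\<lambda>x. (a x, b x, c x)" N] that show ?thesis by simp
  qed
  have Vgen: "((\<lambda>t. V t x z) has_real_derivative V' t x z) (at t)"
      "integrable (\<kappa> x) (\<lambda>y. V t (x + y) (if t \<le> r then x + y else z))"
      "(\<integral>y. V t (x + y) (if t \<le> r then x + y else z) \<partial>\<kappa> x) \<le> measure (\<kappa> x) UNIV * V t x z - V' t x z"
    if "x \<in> D" "x \<in> S" "0 \<le> t" "t \<le> R" "t \<le> r \<longrightarrow> z = x" for x z t
    using V that unfolding superharmonic_def by auto
  have Gsub: "G \<subseteq> space M" using sets.sets_into_space[OF G] by simp
  note [measurable] = h G measurable_H_M[OF h]
  have GM [measurable]: "G \<in> sets M" using G sets_H_sub[of n] by blast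
  let ?Z = "state_record r n"
  let ?f = "\<lambda>x. if fst x \<in> G \<and> jt n (fst x) + fst (snd x) \<le> h (fst x)
     then ennreal (V (jt n (fst x) + fst (snd x)) (Y n (fst x) + snd (snd x))
       (if jt n (fst x) + fst (snd x) \<le> r then Y n (fst x) + snd (snd x) else ?Z (fst x))) else 0"
  let ?I = "\<lambda>w t. \<integral>\<^sup>+y. ennreal (V t (Y n w + y) (if t \<le> r then Y n w + y else ?Z w)) \<partial>\<kappa> (Y n w)"
  have fm: "?f \<in> borel_measurable (H n \<Otimes>\<^sub>M (borel \<Otimes>\<^sub>M borel))"
    by (intro measurable_If measurable_compose[OF _ measurable_ennreal] Vm) measurable
  have m2: "(\<lambda>w. if w \<in> G then ennreal (V (h w) (Y n w) (?Z w)) else 0) \<in> borel_measurable (H n)"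
    by (intro measurable_If measurable_compose[OF _ measurable_ennreal] Vm) measurable
  have jump: "(\<integral>\<^sup>+w. (if w \<in> G \<and> J (Suc n) w \<le> ereal (h w) then ennreal (V (jt (Suc n) w) (Y (Suc n) w) (state_record r (Suc n) w)) else 0) \<partial>M)
    = (\<integral>\<^sup>+w. (if J n w < \<infinity> \<and> J (Suc n) w < \<infinity> then ?f (w, holding n w, displacement n w) else 0) \<partial>M)"
  proof (rule nn_integral_cong)
    fix w assume w: "w \<in> space M"
    show "(if w \<in> G \<and> J (Suc n) w \<le> ereal (h w) then ennreal (V (jt (Suc n) w) (Y (Suc n) w) (state_record r (Suc n) w)) else 0)
      = (if J n w < \<infinity> \<and> J (Suc n) w < \<infinity> then ?f (w, holding n w, displacement n w) else 0)"
    proof (cases "w \<in> G \<and> J (Suc n) w < \<infinity>")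
      case True
      then have "J n w < \<infinity>" using Gh by blast
      then show ?thesis using True J_eq_jt[OF w, of "Suc n"] by simp
    next
      case False
      then show ?thesis by auto
    qed
  qed
  also have "\<dots> = (\<integral>\<^sup>+w. step_kernel n ?f w \<partial>M)"
    by (rule step_formula[OF fm])
  finally have jump': "(\<integral>\<^sup>+w. (if w \<in> G \<and> J (Suc n) w \<le> ereal (h w) then ennreal (V (jt (Suc n) w) (Y (Suc n) w) (state_record r (Suc n) w)) else 0) \<partial>M)
     = (\<integral>\<^sup>+w. step_kernel n ?f w \<partial>M)" .
  have kernel_G: "step_kernel n ?f w = (\<integral>\<^sup>+s. indicator {0..} s * ennreal (exp (- rate n w * s)) * (if jt n w + s \<le> h w then ?I w (jt n w + s) else 0) \<partial>lborel)"
    if "w \<in> G" for w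
  proof -
    have "J n w < \<infinity>" using Gh that by blast
    then have "step_kernel n ?f w = (\<integral>\<^sup>+s. indicator {0..} s * ennreal (exp (- rate n w * s)) * (\<integral>\<^sup>+y. ?f (w, s, y) \<partial>\<kappa> (Y n w)) \<partial>lborel)"
      by (simp only: step_kernel_def if_True)
    also have "\<dots> = (\<integral>\<^sup>+s. indicator {0..} s * ennreal (exp (- rate n w * s)) * (if jt n w + s \<le> h w then ?I w (jt n w + s) else 0) \<partial>lborel)"
    proof (rule nn_integral_cong)
      fix s
      have "(\<integral>\<^sup>+y. ?f (w, s, y) \<partial>\<kappa> (Y n w)) = (if jt n w + s \<le> h w then ?I w (jt n w + s) else 0)"
        using that by (cases "jt n w + s \<le> h w") (simp_all only: fst_conv snd_conv simp_thms if_True if_False nn_integral_const mult_zero_left)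
      then show "indicator {0..} s * ennreal (exp (- rate n w * s)) * (\<integral>\<^sup>+y. ?f (w, s, y) \<partial>\<kappa> (Y n w))
        = indicator {0..} s * ennreal (exp (- rate n w * s)) * (if jt n w + s \<le> h w then ?I w (jt n w + s) else 0)"
        by (simp only:)
    qed
    finally show ?thesis .
  qed
  have kernel_not_G: "step_kernel n ?f w = 0" if "w \<notin> G" for w
    unfolding step_kernel_def fst_conv snd_conv using that by simp
  have stay: "(\<integral>\<^sup>+w. (if w \<in> G \<and> ereal (h w) < J (Suc n) w then ennreal (V (h w) (Y n w) (?Z w)) else 0) \<partial>M)
    = (\<integral>\<^sup>+w. (if w \<in> G then ennreal (V (h w) (Y n w) (?Z w)) else 0) * ennreal (exp (- rate n w * (h w - jt n w))) \<partial>M)"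
  proof -
    have "(\<integral>\<^sup>+w. (if ereal (h w) < J (Suc n) w then (if w \<in> G then ennreal (V (h w) (Y n w) (?Z w)) else 0) else 0) \<partial>M)
      = (\<integral>\<^sup>+w. (if w \<in> G then ennreal (V (h w) (Y n w) (?Z w)) else 0) * ennreal (exp (- rate n w * (h w - jt n w))) \<partial>M)"
      by (rule no_jump_before[OF m2 h]) (use Gh in \<open>auto split: if_splits\<close>)
    moreover have "(\<lambda>w. if ereal (h w) < J (Suc n) w then (if w \<in> G then ennreal (V (h w) (Y n w) (?Z w)) else 0) else 0)
      = (\<lambda>w. if w \<in> G \<and> ereal (h w) < J (Suc n) w then ennreal (V (h w) (Y n w) (?Z w)) else 0)" by auto
    ultimately show ?thesis by simp
  qed
  show ?thesis
    unfolding jump' stay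
  proof (subst nn_integral_add[symmetric, OF step_kernel_measurable[OF fm]])
    show "(\<lambda>w. (if w \<in> G then ennreal (V (h w) (Y n w) (?Z w)) else 0) * ennreal (exp (- rate n w * (h w - jt n w)))) \<in> borel_measurable M"
      using measurable_H_M[OF m2] by measurable
    show "(\<integral>\<^sup>+w. step_kernel n ?f w
        + (if w \<in> G then ennreal (V (h w) (Y n w) (?Z w)) else 0) * ennreal (exp (- rate n w * (h w - jt n w))) \<partial>M)
      \<le> (\<integral>\<^sup>+w. (if w \<in> G then ennreal (V (jt n w) (Y n w) (?Z w)) else 0) \<partial>M)"
    proof (rule nn_integral_mono)
      fix w assume w: "w \<in> space M"
      show "step_kernel n ?f w
        + (if w \<in> G then ennreal (V (h w) (Y n w) (?Z w)) else 0) * ennreal (exp (- rate n w * (h w - jt n w)))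
        \<le> (if w \<in> G then ennreal (V (jt n w) (Y n w) (?Z w)) else 0)"
      proof (cases "w \<in> G")
        case True
        then have fin: "J n w < \<infinity>" and le: "jt n w \<le> h w" and hR: "h w \<le> R" and S: "jt n w < h w \<Longrightarrow> Y n w \<in> S"
          using Gh by blast+
        have j0: "0 \<le> jt n w" using jt_nonneg[OF w] .
        have Zeq: "t \<le> r \<longrightarrow> ?Z w = Y n w" if "jt n w \<le> t" for t
          using that J_eq_jt[OF w fin] by (auto intro!: state_record_eq)
        have "(\<integral>\<^sup>+s. indicator {0..} s * ennreal (exp (- rate n w * s)) * (if jt n w + s \<le> h w then ?I w (jt n w + s) else 0) \<partial>lborel)
          + ennreal (V (h w) (Y n w) (?Z w)) * ennreal (exp (- rate n w * (h w - jt n w))) \<le> ennreal (V (jt n w) (Y n w) (?Z w))"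
        proof (rule flow_bound[where v'="\<lambda>t. V' t (Y n w) (?Z w)" and v="\<lambda>t. V t (Y n w) (?Z w)"])
          fix t assume t: "jt n w < h w" "jt n w \<le> t" "t \<le> h w"
          note gen = Vgen[OF Y_in[OF w fin] S[OF t(1)] order_trans[OF j0 t(2)] order_trans[OF t(3) hR] Zeq[OF t(2)]]
          show "((\<lambda>t. V t (Y n w) (?Z w)) has_real_derivative V' t (Y n w) (?Z w)) (at t)" by (rule gen)
          have pos: "0 \<le> V t x z" for x z using V0 j0 t hR by auto
          have "?I w t = ennreal (\<integral>y. V t (Y n w + y) (if t \<le> r then Y n w + y else ?Z w) \<partial>\<kappa> (Y n w))"
            by (rule nn_integral_eq_integral[OF gen(2)]) (simp add: pos)
          also have "\<dots> \<le> ennreal (rate n w * V t (Y n w) (?Z w) - V' t (Y n w) (?Z w))"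
            using gen(3) fin by (intro ennreal_leI) (simp add: kmass_def)
          finally have "?I w t \<le> ennreal (rate n w * V t (Y n w) (?Z w) - V' t (Y n w) (?Z w))" .
          moreover have "0 \<le> (\<integral>y. V t (Y n w + y) (if t \<le> r then Y n w + y else ?Z w) \<partial>\<kappa> (Y n w))"
            by (rule Bochner_Integration.integral_nonneg) (simp add: pos)
          ultimately show "0 \<le> rate n w * V t (Y n w) (?Z w) - V' t (Y n w) (?Z w) \<and> ?I w t \<le> ennreal (rate n w * V t (Y n w) (?Z w) - V' t (Y n w) (?Z w))"
            using gen(3) fin by (simp add: kmass_def)
        qed (use le V0 j0 hR in auto)
        then show ?thesis unfolding kernel_G[OF True] using True by (simp only: if_True simp_thms)
      next
        case False
        then show ?thesis unfolding kernel_not_G[OF False] by simp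
      qed
    qed
  qed
qed

text \<open>
  A stopping time bounded by \<open>R\<close>, given by one deadline for each jump interval: after
  the \<open>n\<close>-th jump the process will be stopped at time \<open>h n\<close> unless a
  jump comes first. Deadlines may depend on the history, and on a state outside \<open>S\<close>
  the process stops at once.
\<close>

definition stopping_rule :: "'e set \<Rightarrow> real \<Rightarrow> (nat \<Rightarrow> 'a \<Rightarrow> real) \<Rightarrow> bool" where
  "stopping_rule S R h \<longleftrightarrow> (\<forall>n. h n \<in> borel_measurable (H n)) \<and>
     (\<forall>n. \<forall>w\<in>space M. J n w \<le> ereal R \<longrightarrow> jt n w \<le> h n w \<and> h n w \<le> R \<and> (Y n w \<notin> S \<longrightarrow> h n w = jt n w))"

text \<open>
  No deadline has passed before the \<open>n\<close>-th jump.
\<close>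

definition alive :: "(nat \<Rightarrow> 'a \<Rightarrow> real) \<Rightarrow> nat \<Rightarrow> 'a \<Rightarrow> bool" where
  "alive h n w \<longleftrightarrow> (\<forall>j<n. J (Suc j) w \<le> ereal (h j w))"

text \<open>
  The number of jumps before the process is stopped.
\<close>

definition stage :: "(nat \<Rightarrow> 'a \<Rightarrow> real) \<Rightarrow> 'a \<Rightarrow> nat" where
  "stage h w = (LEAST k. ereal (h k w) < J (Suc k) w)"

lemma alive_Suc: "alive h (Suc n) w \<longleftrightarrow> alive h n w \<and> J (Suc n) w \<le> ereal (h n w)"
  unfolding alive_def less_Suc_eq by blast

lemma stopping_ruleD:
  assumes "stopping_rule S R h"
  shows "h n \<in> borel_measurable (H n)"
    and "w \<in> space M \<Longrightarrow> J n w \<le> ereal R \<Longrightarrow> jt n w \<le> h n w"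
    and "w \<in> space M \<Longrightarrow> J n w \<le> ereal R \<Longrightarrow> h n w \<le> R"
    and "w \<in> space M \<Longrightarrow> J n w \<le> ereal R \<Longrightarrow> Y n w \<notin> S \<Longrightarrow> h n w = jt n w"
  using assms unfolding stopping_rule_def by blast+

lemma alive_le:
  assumes h: "stopping_rule S R h" and R: "0 \<le> R" and w: "w \<in> space M" and a: "alive h n w"
  shows "J n w \<le> ereal R"
  using a
proof (induction n)
  case 0
  then show ?case using J_0[OF w] R by simp
next
  case (Suc n)
  then have "J n w \<le> ereal R" "J (Suc n) w \<le> ereal (h n w)" by (auto simp: alive_def)
  moreover from this have "ereal (h n w) \<le> ereal R" using stopping_ruleD(3)[OF h w, of n] by simp
  ultimately show ?case by (blast intro: order_trans)
qed

lemma stage_exists: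
  assumes h: "stopping_rule S R h" and R: "0 \<le> R" and w: "w \<in> space M"
  shows "\<exists>k. ereal (h k w) < J (Suc k) w"
proof (rule ccontr)
  assume "\<nexists>k. ereal (h k w) < J (Suc k) w"
  then have "alive h n w" for n by (auto simp: alive_def not_less)
  then have "J n w \<le> ereal R" for n using alive_le[OF h R w] by blast
  then have "(\<infinity>::ereal) \<le> ereal R"
    by (intro LIMSEQ_le_const2[OF J_lim[OF w]] exI[of _ 0] allI impI)
  then show False by simp
qed

lemma stage_iff:
  assumes h: "stopping_rule S R h" and R: "0 \<le> R" and w: "w \<in> space M"
  shows "stage h w = k \<longleftrightarrow> alive h k w \<and> ereal (h k w) < J (Suc k) w"
proof
  assume k: "stage h w = k"
  have "ereal (h k w) < J (Suc k) w"
    using LeastI_ex[OF stage_exists[OF h R w]] k unfolding stage_def by simp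
  moreover have "J (Suc j) w \<le> ereal (h j w)" if "j < k" for j
    using not_less_Least[of j "\<lambda>k. ereal (h k w) < J (Suc k) w"] that k unfolding stage_def by simp
  ultimately show "alive h k w \<and> ereal (h k w) < J (Suc k) w" by (simp add: alive_def)
next
  assume *: "alive h k w \<and> ereal (h k w) < J (Suc k) w"
  have "k \<le> y" if "ereal (h y w) < J (Suc y) w" for y
  proof (rule ccontr)
    assume "\<not> k \<le> y"
    then have "J (Suc y) w \<le> ereal (h y w)" using * by (simp add: alive_def)
    with that show False by simp
  qed
  with * show "stage h w = k"
    unfolding stage_def by (intro Least_equality) simp_all
qed

lemma alive_H:
  assumes h: "stopping_rule S R h"
  shows "{w \<in> space M. alive h n w} \<in> sets (H n)"
proof -
  have "{w \<in> space (H n). \<forall>j\<in>{..<n}. J (Suc j) w \<le> ereal (h j w)} \<in> sets (H n)"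
  proof (rule sets.sets_Collect_finite_All)
    fix j assume j: "j \<in> {..<n}"
    have H_le: "k \<le> m \<Longrightarrow> sets (H k) \<subseteq> sets (H m)" for k m
      by (induction m) (use H_mono in \<open>auto simp: le_Suc_eq\<close>)
    have [measurable]: "J (Suc j) \<in> borel_measurable (H n)" using j by (intro J_H) auto
    have [measurable]: "h j \<in> borel_measurable (H n)"
      using stopping_ruleD(1)[OF h, of j] H_le[of j n] j by (auto simp: measurable_def)
    show "{w \<in> space (H n). J (Suc j) w \<le> ereal (h j w)} \<in> sets (H n)" by measurable
  qed simp
  moreover have "{w \<in> space (H n). \<forall>j\<in>{..<n}. J (Suc j) w \<le> ereal (h j w)} = {w \<in> space M. alive h n w}"
    by (auto simp: alive_def)
  ultimately show ?thesis by (simp only:)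
qed

text \<open>
  The steps telescope: the mass still alive after \<open>n\<close> jumps splits into the mass
  stopped in the current interval and that alive after the next jump. Since \<open>V\<close> is
  nonnegative, what is still alive can be dropped from each partial sum.
\<close>

theorem optional_stopping:
  assumes V: "superharmonic S r R V V'" and h: "stopping_rule S R h" and R: "0 \<le> R"
  shows "(\<integral>\<^sup>+w. ennreal (V (h (stage h w) w) (Y (stage h w) w) (state_record r (stage h w) w)) \<partial>M) \<le> ennreal (V 0 x0 x0)"
proof -
  let ?W = "\<lambda>n t w. ennreal (V t (Y n w) (state_record r n w))"
  define G where "G n = {w \<in> space M. alive h n w}" for n
  let ?a = "\<lambda>n. \<integral>\<^sup>+w. (if w \<in> G n then ?W n (jt n w) w else 0) \<partial>M"
  let ?B = "\<lambda>n w. if w \<in> G n \<and> ereal (h n w) < J (Suc n) w then ?W n (h n w) w else 0"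
  have GH: "G n \<in> sets (H n)" for n
    using alive_H[OF h, of n] by (simp only: G_def)
  have Gh: "J n w < \<infinity> \<and> jt n w \<le> h n w \<and> h n w \<le> R \<and> (jt n w < h n w \<longrightarrow> Y n w \<in> S)"
    if "w \<in> G n" for n w
  proof -
    have w: "w \<in> space M" and al: "alive h n w" using that by (simp_all add: G_def)
    have le: "J n w \<le> ereal R" by (rule alive_le[OF h R w al])
    have "J n w < \<infinity>" by (rule order.strict_trans1[OF le]) simp
    moreover have "Y n w \<in> S" if "jt n w < h n w"
      using stopping_ruleD(4)[OF h w le] that by (cases "Y n w \<in> S") simp_all
    ultimately show ?thesis
      by (intro conjI impI stopping_ruleD(2)[OF h w le] stopping_ruleD(3)[OF h w le])
  qed
  have G_Suc: "(w \<in> G n \<and> J (Suc n) w \<le> ereal (h n w)) = (w \<in> G (Suc n))" for n w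
    unfolding G_def mem_Collect_eq alive_Suc by blast
  have step: "?a (Suc n) + (\<integral>\<^sup>+w. ?B n w \<partial>M) \<le> ?a n" for n
    using superharmonic_step[where h="h n" and G="G n" and n=n and r=r and S=S and R=R, OF V GH stopping_ruleD(1)[OF h]]
    unfolding G_Suc using Gh by blast
  have Vm: "(\<lambda>x. V (a x) (b x) (c x)) \<in> borel_measurable N"
    if "a \<in> borel_measurable N" "b \<in> borel_measurable N" "c \<in> borel_measurable N" for N :: "'a measure" and a b c
  proof -
    have "(\<lambda>(t, x, z). V t x z) \<in> borel_measurable (borel \<Otimes>\<^sub>M (borel \<Otimes>\<^sub>M borel))"
      using V unfolding superharmonic_def by blast
    from measurable_compose[OF _ this, of "\<lambda>x. (a x, b x, c x)" N] that show ?thesis by simp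
  qed
  have [measurable]: "h n \<in> borel_measurable M" for n by (rule measurable_H_M[OF stopping_ruleD(1)[OF h]])
  have [measurable]: "G n \<in> sets M" for n
    using subsetD[OF sets_H_sub alive_H[OF h, of n]] by (simp only: G_def)
  have Bm: "?B n \<in> borel_measurable M" for n
  proof -
    have 1: "(\<lambda>w. V (h n w) (Y n w) (state_record r n w)) \<in> borel_measurable M"
      by (intro Vm Y_meas state_record_M \<open>h n \<in> borel_measurable M\<close>)
    have 2: "{w \<in> space M. w \<in> G n \<and> ereal (h n w) < J (Suc n) w} \<in> sets M"
      by measurable
    show ?thesis
      by (rule measurable_If[OF measurable_compose[OF 1 measurable_ennreal] measurable_const 2]) simp
  qed
  have e1: "(\<integral>\<^sup>+w. ?W (stage h w) (h (stage h w) w) w \<partial>M) = (\<integral>\<^sup>+w. (\<Sum>k. ?B k w) \<partial>M)"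
  proof (rule nn_integral_cong)
    fix w assume w: "w \<in> space M"
    have "(\<Sum>k. ?B k w) = (\<Sum>k\<in>{stage h w}. ?B k w)"
    proof (rule suminf_finite)
      fix k assume "k \<notin> {stage h w}"
      then have "\<not> (w \<in> G k \<and> ereal (h k w) < J (Suc k) w)"
        using stage_iff[OF h R w, of k] by (auto simp: G_def)
      then show "?B k w = 0" by (simp only: if_False)
    qed simp
    also have "\<dots> = ?W (stage h w) (h (stage h w) w) w"
      using stage_iff[OF h R w, of "stage h w"] w by (simp add: G_def)
    finally show "?W (stage h w) (h (stage h w) w) w = (\<Sum>k. ?B k w)" by simp
  qed
  have e2: "(\<integral>\<^sup>+w. (\<Sum>k. ?B k w) \<partial>M) = (\<Sum>k. \<integral>\<^sup>+w. ?B k w \<partial>M)"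
    by (rule nn_integral_suminf) (rule Bm)
  have e3: "(\<Sum>k. \<integral>\<^sup>+w. ?B k w \<partial>M) \<le> ?a 0"
    by (rule suminf_le_telescope[where a="?a" and b="\<lambda>n. \<integral>\<^sup>+w. ?B n w \<partial>M"]) (rule step)
  have e4: "?a 0 = (\<integral>\<^sup>+w. ennreal (V 0 x0 x0) \<partial>M)"
    by (rule nn_integral_cong) (simp add: G_def alive_def J_0 Y_0 jt_def)
  have e5: "(\<integral>\<^sup>+w. ennreal (V 0 x0 x0) \<partial>M) = ennreal (V 0 x0 x0)"
    by (simp add: emeasure_space_1)
  show ?thesis
    by (rule order_trans[OF eq_refl[OF trans[OF e1 e2]] order_trans[OF e3 eq_refl[OF trans[OF e4 e5]]]])
qed

end

section \<open>The process stopped at the exit time\<close>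

context jump_process
begin

lemma J_le:
  assumes w: "w \<in> space M" and le: "k \<le> m"
  shows "J k w \<le> J m w"
  using le
proof (induction rule: dec_induct)
  case base
  show ?case by (rule order_refl)
next
  case (step n)
  show ?case by (rule order_trans[OF step.IH J_mono[OF w]])
qed

lemma interval_exists:
  assumes w: "w \<in> space M" and t: "0 \<le> t"
  obtains n where "J n w \<le> ereal t" "ereal t < J (Suc n) w"
proof -
  have "\<exists>n. ereal t < J n w"
  proof -
    have "eventually (\<lambda>n. ereal t < J n w) sequentially"
      using J_lim[OF w] by (rule order_tendstoD(1)) simp
    then show ?thesis by (auto simp: eventually_sequentially)
  qed
  then have *: "ereal t < J (LEAST n. ereal t < J n w) w" by (rule LeastI_ex)
  show thesis
  proof (cases "LEAST n. ereal t < J n w")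
    case 0
    with * J_0[OF w] t show thesis by simp
  next
    case (Suc n)
    then have "\<not> ereal t < J n w" using not_less_Least[of n "\<lambda>n. ereal t < J n w"] by simp
    with * Suc show thesis by (intro that[of n]) auto
  qed
qed

lemma interval_unique:
  assumes w: "w \<in> space M" and "J j w \<le> ereal t" "ereal t < J (Suc k) w"
  shows "j \<le> k"
proof (rule ccontr)
  assume "\<not> j \<le> k"
  then have "J (Suc k) w \<le> J j w" using J_le[OF w, of "Suc k" j] by simp
  then have "J (Suc k) w \<le> ereal t" using assms(2) by (rule order_trans)
  then show False using assms(3) by simp
qed

text \<open>
  The stopping rule for the minimum of \<open>t\<close> and the exit time of \<open>S\<close>.
\<close>

definition time_rule :: "'e set \<Rightarrow> real \<Rightarrow> nat \<Rightarrow> 'a \<Rightarrow> real" where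
  "time_rule S t n w = (if Y n w \<in> S then t else jt n w)"

lemma jt_le: "w \<in> space M \<Longrightarrow> J n w \<le> ereal t \<Longrightarrow> jt n w \<le> t"
  using J_eq_jt[of w n] by fastforce

lemma J_eq_jt': "w \<in> space M \<Longrightarrow> J n w \<le> ereal t \<Longrightarrow> J n w = ereal (jt n w)"
  by (rule J_eq_jt) (auto dest: order.strict_trans1[of _ "ereal t" \<infinity>])

lemma time_rule:
  assumes S: "S \<in> sets borel"
  shows "stopping_rule S t (time_rule S t)"
proof -
  have "time_rule S t n \<in> borel_measurable (H n)" for n
    unfolding time_rule_def using S by measurable
  then show ?thesis
    unfolding stopping_rule_def using jt_le by (auto simp: time_rule_def)
qed

lemma stage_facts:
  assumes S: "S \<in> sets borel" and t: "0 \<le> t" and w: "w \<in> space M"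
  defines "k \<equiv> stage (time_rule S t) w"
  shows "\<And>j. j < k \<Longrightarrow> Y j w \<in> S" "J k w \<le> ereal t" "ereal (time_rule S t k w) < J (Suc k) w"
    "jt k w \<le> time_rule S t k w" "time_rule S t k w \<le> t"
proof -
  note tr = time_rule[OF S, of t]
  have al: "alive (time_rule S t) k w" and lt: "ereal (time_rule S t k w) < J (Suc k) w"
    using stage_iff[OF tr t w, of k] by (simp_all add: k_def)
  show "ereal (time_rule S t k w) < J (Suc k) w" by (rule lt)
  show Jk: "J k w \<le> ereal t" by (rule alive_le[OF tr t w al])
  show "jt k w \<le> time_rule S t k w" "time_rule S t k w \<le> t"
    using jt_le[OF w Jk] by (auto simp: time_rule_def)
  show "Y j w \<in> S" if "j < k" for j
  proof (rule ccontr)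
    assume "Y j w \<notin> S"
    then have "J (Suc j) w \<le> ereal (jt j w)" using al that by (auto simp: alive_def time_rule_def)
    moreover have "J j w \<le> ereal t" using J_le[OF w, of j k] that Jk by (auto intro: order_trans)
    ultimately show False
      using J_strict[OF w, of j] J_eq_jt'[OF w, of j t] by auto
  qed
qed

lemma X_at:
  assumes "w \<in> space M" "J n w \<le> ereal t" "ereal t < J (Suc n) w"
  shows "X t w = Y n w"
  by (rule X_eq[OF assms])

text \<open>
  The exit time is an infimum over a continuum of times, but paths are constant between jumps, so
  the process can leave \<open>S\<close> only at a jump time.
\<close>

lemma exit_time_stage:
  assumes S: "S \<in> sets borel" and t: "0 \<le> t" and w: "w \<in> space M"
  defines "k \<equiv> stage (time_rule S t) w"
  shows "min (ereal t) (exit_time S X w) = ereal (time_rule S t k w)"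
proof -
  note sf = stage_facts[OF S t w, folded k_def]
  have inside: "X t' w \<in> S" if t': "0 \<le> t'" "ereal t' < J k w \<or> ereal t' < J (Suc k) w \<and> Y k w \<in> S" for t'
  proof -
    obtain j where j: "J j w \<le> ereal t'" "ereal t' < J (Suc j) w" using interval_exists[OF w t'(1)] .
    have "ereal t' < J (Suc k) w" using t'(2) J_mono[OF w, of k] by (auto intro: less_le_trans)
    then have "j \<le> k" using interval_unique[OF w j(1)] by simp
    moreover have "j < k" if "ereal t' < J k w"
    proof (rule ccontr)
      assume "\<not> j < k"
      then have "J k w \<le> ereal t'" using J_le[OF w, of k j] j(1) by (auto intro: order_trans)
      with that show False by simp
    qed
    ultimately have "Y j w \<in> S" using t'(2) sf(1)[of j] by (cases "j = k") auto
    then show ?thesis using X_at[OF w j] by simp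
  qed
  show ?thesis
  proof (cases "Y k w \<in> S")
    case True
    have "J (Suc k) w \<le> exit_time S X w"
      unfolding exit_time_def
    proof (rule Inf_greatest, clarify)
      fix t' assume "0 \<le> t'" "X t' w \<notin> S"
      then show "J (Suc k) w \<le> ereal t'" using inside[of t'] True by (meson not_less)
    qed
    moreover have "ereal t < J (Suc k) w" using sf(3) True by (simp add: time_rule_def)
    ultimately have "ereal t \<le> exit_time S X w" by (meson less_imp_le less_le_trans)
    then show ?thesis using True by (simp add: time_rule_def min_def)
  next
    case False
    have Jk: "J k w = ereal (jt k w)" by (rule J_eq_jt'[OF w sf(2)])
    have "J k w \<le> exit_time S X w"
      unfolding exit_time_def
    proof (rule Inf_greatest, clarify)
      fix t' assume "0 \<le> t'" "X t' w \<notin> S"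
      then show "J k w \<le> ereal t'" using inside[of t'] by (meson not_less)
    qed
    moreover have "exit_time S X w \<le> ereal (jt k w)"
      unfolding exit_time_def
    proof (rule Inf_lower, clarify)
      have "X (jt k w) w = Y k w"
        by (rule X_at[OF w]) (use J_strict[OF w, of k] Jk in auto)
      then show "\<exists>t. ereal (jt k w) = ereal t \<and> 0 \<le> t \<and> X t w \<notin> S"
        using False jt_nonneg[OF w] by auto
    qed
    ultimately have "exit_time S X w = ereal (jt k w)" using Jk by (auto intro: antisym)
    then show ?thesis using False sf(4,5) by (simp add: time_rule_def min_def)
  qed
qed

lemma stopped_clock_stage:
  assumes S: "S \<in> sets borel" and t: "0 \<le> t" and w: "w \<in> space M"
  shows "stopped_clock S X t w = time_rule S t (stage (time_rule S t) w) w"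
  unfolding stopped_clock_def exit_time_stage[OF assms] by simp

lemma stopped_stage:
  assumes S: "S \<in> sets borel" and t: "0 \<le> t" and w: "w \<in> space M"
  shows "stopped S X t w = Y (stage (time_rule S t) w) w"
  unfolding stopped_def stopped_clock_stage[OF assms]
proof (rule X_at[OF w])
  note sf = stage_facts[OF assms]
  show "J (stage (time_rule S t) w) w \<le> ereal (time_rule S t (stage (time_rule S t) w) w)"
    using sf(4) J_eq_jt'[OF w sf(2)] by simp
  show "ereal (time_rule S t (stage (time_rule S t) w) w) < J (Suc (stage (time_rule S t) w)) w"
    by (rule sf(3))
qed

lemma stage_measurable:
  assumes h: "\<And>n. h n \<in> borel_measurable M"
  shows "stage h \<in> measurable M (count_space UNIV)"
proof -
  note [measurable] = h
  have "(\<lambda>w. LEAST k. ereal (h k w) < J (Suc k) w) \<in> measurable M (count_space UNIV)" by measurable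
  then show ?thesis by (simp add: stage_def[abs_def])
qed

lemma at_stage_measurable:
  fixes h :: "nat \<Rightarrow> 'a \<Rightarrow> real" and f :: "nat \<Rightarrow> 'a \<Rightarrow> 'b"
  assumes h: "\<And>n. h n \<in> borel_measurable M" and f: "\<And>n. f n \<in> measurable M N"
  shows "(\<lambda>w. f (stage h w) w) \<in> measurable M N"
proof (rule measurable_compose_countable)
  show "f i \<in> measurable M N" for i by (rule f)
  show "stage h \<in> measurable M (count_space UNIV)" using h by (rule stage_measurable)
qed

lemma time_rule_measurable: "S \<in> sets borel \<Longrightarrow> time_rule S t n \<in> borel_measurable M"
  by (rule measurable_H_M[OF stopping_ruleD(1)[OF time_rule]])

lemma stopped_clock_measurable:
  assumes S: "S \<in> sets borel" and t: "0 \<le> t"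
  shows "stopped_clock S X t \<in> borel_measurable M"
proof -
  have "(\<lambda>w. time_rule S t (stage (time_rule S t) w) w) \<in> borel_measurable M"
    by (rule at_stage_measurable[where h="time_rule S t" and f="time_rule S t"]) (rule time_rule_measurable[OF S])+
  then show ?thesis
    by (rule measurable_cong[THEN iffD2, rotated]) (rule stopped_clock_stage[OF S t])
qed

lemma stopped_measurable:
  assumes S: "S \<in> sets borel" and t: "0 \<le> t"
  shows "stopped S X t \<in> borel_measurable M"
proof -
  have "(\<lambda>w. Y (stage (time_rule S t) w) w) \<in> borel_measurable M"
    by (rule at_stage_measurable[where h="time_rule S t" and f=Y]) (rule time_rule_measurable[OF S] Y_meas)+
  then show ?thesis
    by (rule measurable_cong[THEN iffD2, rotated]) (rule stopped_stage[OF S t])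
qed

lemma stage_constant:
  assumes S: "S \<in> sets borel" and t: "0 \<le> t" and w: "w \<in> space M"
    and s: "t \<le> s" and lt: "Y (stage (time_rule S t) w) w \<in> S \<Longrightarrow> ereal s < J (Suc (stage (time_rule S t) w)) w"
  shows "stage (time_rule S s) w = stage (time_rule S t) w"
proof -
  let ?k = "stage (time_rule S t) w"
  note sf = stage_facts[OF S t w]
  have "alive (time_rule S s) ?k w"
    unfolding alive_def
  proof (intro allI impI)
    fix j assume j: "j < ?k"
    have "J (Suc j) w \<le> J ?k w" using J_le[OF w, of "Suc j" ?k] j by simp
    also have "\<dots> \<le> ereal t" by (rule sf(2))
    also have "\<dots> \<le> ereal s" using s by simp
    finally show "J (Suc j) w \<le> ereal (time_rule S s j w)" using sf(1)[OF j] by (simp add: time_rule_def)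
  qed
  moreover have "ereal (time_rule S s ?k w) < J (Suc ?k) w"
    using lt sf(3) by (cases "Y ?k w \<in> S") (simp_all add: time_rule_def)
  ultimately show ?thesis
    using stage_iff[OF time_rule[OF S, of s] _ w, of ?k] t s by simp
qed

text \<open>
  Suprema over intervals of times will be reduced to countable sets. This needs right-continuity
  of functions of the time, the stopped clock and the stopped state; locally the state is constant
  and the clock either stands still or runs with \<open>t\<close>.
\<close>

lemma stopped_right_constant:
  assumes S: "S \<in> sets borel" and t: "0 \<le> t" and w: "w \<in> space M"
  shows "\<exists>\<delta>>0. (\<forall>s. t \<le> s \<and> s < t + \<delta> \<longrightarrow> stopped S X s w = stopped S X t w) \<and>
     ((\<forall>s. t \<le> s \<and> s < t + \<delta> \<longrightarrow> stopped_clock S X s w = stopped_clock S X t w) \<or>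
      (\<forall>s. t \<le> s \<and> s < t + \<delta> \<longrightarrow> stopped_clock S X s w = s))"
proof -
  let ?k = "stage (time_rule S t) w"
  note sf = stage_facts[OF S t w]
  have eq: "stopped S X s w = Y ?k w \<and> stopped_clock S X s w = time_rule S s ?k w"
    if "t \<le> s" "Y ?k w \<in> S \<Longrightarrow> ereal s < J (Suc ?k) w" for s
    using stage_constant[OF S t w that] stopped_stage[OF S _ w, of s] stopped_clock_stage[OF S _ w, of s] t that(1) by simp
  show ?thesis
  proof (cases "Y ?k w \<in> S")
    case True
    then have lt: "ereal t < J (Suc ?k) w" using sf(3) by (simp add: time_rule_def)
    have "\<exists>\<delta>>0. \<forall>s. s < t + \<delta> \<longrightarrow> ereal s < J (Suc ?k) w"
    proof (cases "J (Suc ?k) w")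
      case (real r)
      then show ?thesis using lt by (intro exI[of _ "r - t"] conjI allI impI) simp_all
    next
      case PInf
      then show ?thesis by (intro exI[of _ 1] conjI allI impI) simp_all
    next
      case MInf
      then show ?thesis using lt by simp
    qed
    then obtain \<delta> where \<delta>: "\<delta> > 0" "\<And>s. s < t + \<delta> \<Longrightarrow> ereal s < J (Suc ?k) w" by blast
    have "stopped S X s w = stopped S X t w \<and> stopped_clock S X s w = s" if "t \<le> s" "s < t + \<delta>" for s
      using eq[OF that(1) \<delta>(2)[OF that(2)]] stopped_stage[OF S t w] True by (simp add: time_rule_def)
    with \<delta>(1) show ?thesis by blast
  next
    case False
    have *: "stopped S X s w = stopped S X t w \<and> stopped_clock S X s w = stopped_clock S X t w" if "t \<le> s" for s
      using eq[OF that] False stopped_stage[OF S t w] stopped_clock_stage[OF S t w] by (simp add: time_rule_def)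
    show ?thesis
      by (rule exI[of _ "1::real"], intro conjI disjI1 allI impI)
        (simp, rule conjunct1[OF *], elim conjE, assumption, rule conjunct2[OF *], elim conjE, assumption)
  qed
qed

lemma state_record_later:
  assumes w: "w \<in> space M" and m: "J m w \<le> ereal r" "ereal r < J (Suc m) w" and le: "m \<le> n"
  shows "state_record r n w = Y m w"
  using le
proof (induction rule: dec_induct)
  case base
  show ?case by (rule state_record_eq[OF m(1)])
next
  case (step n)
  have "J (Suc m) w \<le> J (Suc n) w" by (rule J_le[OF w]) (use step.hyps in simp)
  from less_le_trans[OF m(2) this] have "\<not> J (Suc n) w \<le> ereal r" by simp
  then show ?case using step.IH by simp
qed

text \<open>
  The record kept along the jumps is the stopped state at time \<open>r\<close>, even if the
  process was stopped before that time.
\<close>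

lemma record_stage:
  assumes S: "S \<in> sets borel" and r: "0 \<le> r" and g: "0 \<le> g" and w: "w \<in> space M"
  shows "state_record r (stage (time_rule S g) w) w = stopped S X (min r g) w"
proof (cases "g \<le> r")
  case True
  have "J (stage (time_rule S g) w) w \<le> ereal r"
    by (rule order_trans[OF stage_facts(2)[OF S g w]]) (simp add: True)
  from state_record_eq[OF this] show ?thesis using stopped_stage[OF S g w] True by (simp add: min_def)
next
  case False
  let ?k = "stage (time_rule S g) w" and ?m = "stage (time_rule S r) w"
  note sf = stage_facts[OF S r w]
  have st: "stopped S X (min r g) w = Y ?m w" using stopped_stage[OF S r w] False by (simp add: min_def)
  have le: "?m \<le> ?k"
  proof (rule ccontr)
    assume "\<not> ?m \<le> ?k"
    then have lt: "?k < ?m" by simp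
    have "Y ?k w \<in> S" by (rule sf(1)[OF lt])
    then have "ereal g < J (Suc ?k) w" using stage_facts(3)[OF S g w] by (simp add: time_rule_def)
    moreover have "J (Suc ?k) w \<le> J ?m w" using J_le[OF w, of "Suc ?k" ?m] lt by simp
    ultimately have "ereal g < J ?m w" by (rule less_le_trans)
    from less_le_trans[OF this sf(2)] have "ereal g < ereal r" .
    with False show False by simp
  qed
  show ?thesis
  proof (cases "Y ?m w \<in> S")
    case True
    then have "ereal r < J (Suc ?m) w" using sf(3) by (simp add: time_rule_def)
    from state_record_later[OF w sf(2) this le] st show ?thesis by simp
  next
    case nS: False
    have "?k = ?m" using stage_constant[OF S r w, of g] False nS by simp
    then show ?thesis using st state_record_eq[OF sf(2)] by simp
  qed
qed

lemma superharmonic_measurable: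
  assumes V: "superharmonic S r R V V'"
    and "a \<in> borel_measurable N" "b \<in> borel_measurable N" "c \<in> borel_measurable N"
  shows "(\<lambda>x. V (a x) (b x) (c x)) \<in> borel_measurable N"
proof -
  have "(\<lambda>(t, x, z). V t x z) \<in> borel_measurable (borel \<Otimes>\<^sub>M (borel \<Otimes>\<^sub>M borel))"
    using V unfolding superharmonic_def by blast
  from measurable_compose[OF _ this, of "\<lambda>x. (a x, b x, c x)" N] assms(2-4) show ?thesis by simp
qed

lemma superharmonic_nonneg:
  assumes V: "superharmonic S r R V V'" and "0 \<le> t" "t \<le> R"
  shows "0 \<le> V t x z"
  using assms unfolding superharmonic_def by auto

text \<open>
  Optional stopping for the rule \<open>time_rule\<close>.
\<close>

theorem expectation_le:
  assumes V: "superharmonic S r t V V'" and S: "S \<in> sets borel" and r: "0 \<le> r" and t: "0 \<le> t"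
  shows "integrable M (\<lambda>w. V (stopped_clock S X t w) (stopped S X t w) (stopped S X (min r t) w))"
    and "(\<integral>w. V (stopped_clock S X t w) (stopped S X t w) (stopped S X (min r t) w) \<partial>M) \<le> V 0 x0 x0"
proof -
  let ?f = "\<lambda>w. V (stopped_clock S X t w) (stopped S X t w) (stopped S X (min r t) w)"
  have fm: "?f \<in> borel_measurable M"
    using r t by (intro superharmonic_measurable[OF V stopped_clock_measurable stopped_measurable stopped_measurable] S) simp_all
  have clock: "0 \<le> stopped_clock S X t w \<and> stopped_clock S X t w \<le> t" if "w \<in> space M" for w
    using order_trans[OF jt_nonneg[OF that] stage_facts(4)[OF S t that]] stage_facts(5)[OF S t that] stopped_clock_stage[OF S t that] by simp
  have nn: "0 \<le> ?f w" if "w \<in> space M" for w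
    using clock[OF that] superharmonic_nonneg[OF V] by simp
  have "(\<integral>\<^sup>+w. ennreal (?f w) \<partial>M) = (\<integral>\<^sup>+w. ennreal (V (time_rule S t (stage (time_rule S t) w) w) (Y (stage (time_rule S t) w) w) (state_record r (stage (time_rule S t) w) w)) \<partial>M)"
    by (rule nn_integral_cong) (simp add: stopped_clock_stage[OF S t] stopped_stage[OF S t] record_stage[OF S r t])
  also have "\<dots> \<le> ennreal (V 0 x0 x0)"
    by (rule optional_stopping[OF V time_rule[OF S] t])
  finally have le: "(\<integral>\<^sup>+w. ennreal (?f w) \<partial>M) \<le> ennreal (V 0 x0 x0)" .
  show int: "integrable M ?f"
  proof (rule integrableI_nonneg[OF fm])
    show "AE w in M. 0 \<le> ?f w" using nn by (rule AE_I2)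
    show "(\<integral>\<^sup>+w. ennreal (?f w) \<partial>M) < \<infinity>" using le by (rule order.strict_trans1) simp
  qed
  have "ennreal (\<integral>w. ?f w \<partial>M) = (\<integral>\<^sup>+w. ennreal (?f w) \<partial>M)"
    by (rule nn_integral_eq_integral[OF int, symmetric]) (rule AE_I2[OF nn])
  then have "ennreal (\<integral>w. ?f w \<partial>M) \<le> ennreal (V 0 x0 x0)" using le by (simp only:)
  then show "(\<integral>w. ?f w \<partial>M) \<le> V 0 x0 x0"
    unfolding ennreal_le_iff[OF superharmonic_nonneg[OF V order_refl t]] .
qed

text \<open>
  Stop at the first time in the finite set \<open>G\<close> at which \<open>V\<close> is at least
  \<open>c\<close>, at the exit from \<open>S\<close>, or at \<open>R\<close>. Within a jump
  interval the state is known in advance, so the deadline depends on the history only; the time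
  \<open>R\<close> is included to make the minimum well defined.
\<close>

definition hitting_rule :: "'e set \<Rightarrow> real \<Rightarrow> real \<Rightarrow> (real \<Rightarrow> 'e \<Rightarrow> 'e \<Rightarrow> real) \<Rightarrow> real \<Rightarrow> real set \<Rightarrow> nat \<Rightarrow> 'a \<Rightarrow> real" where
  "hitting_rule S r R V c G n w = (if Y n w \<in> S
     then Min (insert R {g \<in> G. jt n w \<le> g \<and> c \<le> V g (Y n w) (state_record r n w)}) else jt n w)"

lemma hitting_rule:
  assumes V: "superharmonic S r R V V'" and S: "S \<in> sets borel" and G: "finite G" "G \<subseteq> {0..R}"
  shows "stopping_rule S R (hitting_rule S r R V c G)"
proof -
  let ?A = "\<lambda>n w. {g \<in> G. jt n w \<le> g \<and> c \<le> V g (Y n w) (state_record r n w)}"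
  have "hitting_rule S r R V c G n \<in> borel_measurable (H n)" for n
  proof -
    have [measurable]: "(\<lambda>w. V g (Y n w) (state_record r n w)) \<in> borel_measurable (H n)" for g
      by (rule superharmonic_measurable[OF V borel_measurable_const Y_H_n state_record_H])
    have "(\<lambda>w. Min (insert R (?A n w))) \<in> borel_measurable (H n)"
    proof (rule borel_measurable_iff_le[THEN iffD2], rule allI)
      fix a
      let ?U = "\<Union>g\<in>{g \<in> G. g \<le> a}. {w \<in> space (H n). jt n w \<le> g \<and> c \<le> V g (Y n w) (state_record r n w)}"
      have "{w \<in> space (H n). Min (insert R (?A n w)) \<le> a} = (if R \<le> a then space (H n) else ?U)"
      proof -
        have "Min (insert R (?A n w)) \<le> a \<longleftrightarrow> R \<le> a \<or> (\<exists>g\<in>?A n w. g \<le> a)" for w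
          using G(1) by (subst Min_le_iff) auto
        then show ?thesis by auto
      qed
      also have "\<dots> \<in> sets (H n)"
      proof -
        have "?U \<in> sets (H n)"
        proof (rule sets.finite_UN)
          show "{w \<in> space (H n). jt n w \<le> g \<and> c \<le> V g (Y n w) (state_record r n w)} \<in> sets (H n)" for g
            by measurable
        qed (use G(1) in simp)
        then show ?thesis using sets.top[of "H n"] by (cases "R \<le> a") simp_all
      qed
      finally show "{w \<in> space (H n). Min (insert R (?A n w)) \<le> a} \<in> sets (H n)" .
    qed
    then show ?thesis unfolding hitting_rule_def using S by measurable
  qed
  moreover have "jt n w \<le> hitting_rule S r R V c G n w \<and> hitting_rule S r R V c G n w \<le> R \<and> (Y n w \<notin> S \<longrightarrow> hitting_rule S r R V c G n w = jt n w)"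
    if "w \<in> space M" "J n w \<le> ereal R" for n w
    using G(1) jt_le[OF that] by (auto simp: hitting_rule_def intro: Min.boundedI)
  ultimately show ?thesis unfolding stopping_rule_def by blast
qed

text \<open>
  If the value is at least \<open>c\<close> at some time in \<open>G\<close>, it is at least
  \<open>c\<close> where \<open>hitting_rule\<close> stops; then Markov's inequality applies.
\<close>

theorem maximal_inequality_finite:
  assumes V: "superharmonic S r R V V'" and S: "S \<in> sets borel" and r: "0 \<le> r" and R: "0 \<le> R"
    and G: "finite G" "G \<subseteq> {0..R}" and c: "0 < c"
  shows "measure M {w \<in> space M. \<exists>g\<in>G. c \<le> V (stopped_clock S X g w) (stopped S X g w) (stopped S X (min r g) w)} \<le> V 0 x0 x0 / c"
proof -
  let ?h = "hitting_rule S r R V c G"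
  let ?k = "\<lambda>w. stage ?h w"
  let ?u = "\<lambda>w. V (?h (?k w) w) (Y (?k w) w) (state_record r (?k w) w)"
  let ?E = "{w \<in> space M. \<exists>g\<in>G. c \<le> V (stopped_clock S X g w) (stopped S X g w) (stopped S X (min r g) w)}"
  note hr = hitting_rule[OF V S G, of c]
  have hit: "c \<le> ?u w" if w: "w \<in> space M" and g: "g \<in> G" and cg: "c \<le> V (stopped_clock S X g w) (stopped S X g w) (stopped S X (min r g) w)" for w g
  proof -
    have g0: "0 \<le> g" and gR: "g \<le> R" using g G(2) by auto
    let ?m = "stage (time_rule S g) w"
    let ?A = "\<lambda>n. {g \<in> G. jt n w \<le> g \<and> c \<le> V g (Y n w) (state_record r n w)}"
    note sf = stage_facts[OF S g0 w]
    have cm: "c \<le> V (time_rule S g ?m w) (Y ?m w) (state_record r ?m w)"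
      using cg stopped_clock_stage[OF S g0 w] stopped_stage[OF S g0 w] record_stage[OF S r g0 w] by simp
    have al: "alive ?h (?k w) w" and lt: "ereal (?h (?k w) w) < J (Suc (?k w)) w"
      using stage_iff[OF hr R w, of "?k w"] by simp_all
    have Min_in_A: "c \<le> V (?h n w) (Y n w) (state_record r n w)" if "Y n w \<in> S" "?h n w \<noteq> R" for n
    proof -
      have "?h n w = Min (insert R (?A n))" using that by (simp add: hitting_rule_def)
      moreover have "Min (insert R (?A n)) \<in> insert R (?A n)" using G(1) by (intro Min_in) auto
      ultimately show ?thesis using that by auto
    qed
    \<comment> \<open>Compare the interval in which the hitting rule stops with the one in which the process is at the stopped time of g: the rule may have stopped earlier, in the same interval, or, impossibly, later.\<close>
    consider "?k w < ?m" | "?k w = ?m" | "?m < ?k w" by linarith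
    then show "c \<le> ?u w"
    proof cases
      case 1
      have YS: "Y (?k w) w \<in> S" by (rule sf(1)[OF 1])
      have "J (Suc (?k w)) w \<le> J ?m w" using J_le[OF w, of "Suc (?k w)" ?m] 1 by simp
      also note sf(2)
      finally have "ereal (?h (?k w) w) < ereal g" using lt by (rule less_le_trans[rotated])
      then have "?h (?k w) w \<noteq> R" using gR by simp
      then show ?thesis by (rule Min_in_A[OF YS])
    next
      case 2
      show ?thesis
      proof (cases "Y ?m w \<in> S")
        case False
        then show ?thesis using cm 2 by (simp add: time_rule_def hitting_rule_def)
      next
        case True
        have gA: "g \<in> ?A ?m" using g cm True jt_le[OF w sf(2)] by (simp add: time_rule_def)
        show ?thesis
        proof (cases "?h ?m w = R")
          case hR: True
          have "?h ?m w \<le> g" using gA G(1) True by (simp add: hitting_rule_def)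
          then have "g = R" using hR gR by simp
          then show ?thesis using gA hR 2 by simp
        next
          case False
          then show ?thesis using Min_in_A[OF True] 2 by simp
        qed
      qed
    next
      case 3
      then have le: "J (Suc ?m) w \<le> ereal (?h ?m w)" using al by (simp add: alive_def)
      show ?thesis
      proof (cases "Y ?m w \<in> S")
        case False
        then show ?thesis using le sf(3) by (simp add: time_rule_def hitting_rule_def)
      next
        case True
        have gA: "g \<in> ?A ?m" using g cm True jt_le[OF w sf(2)] by (simp add: time_rule_def)
        have "?h ?m w \<le> g" using gA G(1) True by (simp add: hitting_rule_def)
        then have "J (Suc ?m) w \<le> ereal g" by (intro order_trans[OF le]) simp
        then show ?thesis using sf(3) True by (simp add: time_rule_def)
      qed
    qed
  qed
  have hm: "?h n \<in> borel_measurable M" for n by (rule measurable_H_M[OF stopping_ruleD(1)[OF hr]])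
  have um: "?u \<in> borel_measurable M"
    by (rule at_stage_measurable[OF hm, where f="\<lambda>n w. V (?h n w) (Y n w) (state_record r n w)"])
      (rule superharmonic_measurable[OF V hm Y_meas state_record_M])
  have "ennreal c * emeasure M ?E \<le> ennreal c * emeasure M {w \<in> space M. c \<le> ?u w}"
    using um hit by (intro mult_left_mono emeasure_mono) auto
  also have "\<dots> = (\<integral>\<^sup>+w. ennreal c * indicator {w \<in> space M. c \<le> ?u w} w \<partial>M)"
    using um by (subst nn_integral_cmult_indicator) auto
  also have "\<dots> \<le> (\<integral>\<^sup>+w. ennreal (?u w) \<partial>M)"
    by (rule nn_integral_mono) (auto split: split_indicator intro: ennreal_leI)
  also have "\<dots> \<le> ennreal (V 0 x0 x0)"
    by (rule optional_stopping[OF V hr R])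
  finally have "ennreal (c * measure M ?E) \<le> ennreal (V 0 x0 x0)"
    using c by (simp add: emeasure_eq_measure ennreal_mult)
  then have "c * measure M ?E \<le> V 0 x0 x0"
    unfolding ennreal_le_iff[OF superharmonic_nonneg[OF V order_refl R]] .
  then show ?thesis using c by (simp add: field_simps)
qed

text \<open>
  The bound does not depend on the finite set, so it passes to increasing unions.
\<close>

theorem maximal_inequality:
  assumes V: "\<And>R. 0 \<le> R \<Longrightarrow> superharmonic S r R V V'" and S: "S \<in> sets borel" and r: "0 \<le> r"
    and C: "countable C" "C \<subseteq> {0..}" and c: "0 < c"
  shows "measure M {w \<in> space M. \<exists>g\<in>C. c \<le> V (stopped_clock S X g w) (stopped S X g w) (stopped S X (min r g) w)} \<le> V 0 x0 x0 / c"
proof (cases "C = {}")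
  case True
  have "0 \<le> V 0 x0 x0" by (rule superharmonic_nonneg[OF V[of 0]]) auto
  then show ?thesis using True c by simp
next
  case False
  define q where "q = from_nat_into C"
  have q: "range q = C" using False C(1) by (simp add: q_def range_from_nat_into)
  have qC: "q k \<in> C" for k using q by blast
  have q0: "0 \<le> q k" for k using subsetD[OF C(2) qC] by simp
  define P where "P g w \<longleftrightarrow> c \<le> V (stopped_clock S X g w) (stopped S X g w) (stopped S X (min r g) w)" for g w
  define E where "E n = (\<Union>k\<in>{..n}. {w \<in> space M. P (q k) w})" for n :: nat
  have Pm: "{w \<in> space M. P (q k) w} \<in> sets M" for k
  proof -
    have [measurable]: "(\<lambda>w. V (stopped_clock S X (q k) w) (stopped S X (q k) w) (stopped S X (min r (q k)) w)) \<in> borel_measurable M"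
      using r q0 by (intro superharmonic_measurable[OF V[of 0] stopped_clock_measurable stopped_measurable stopped_measurable] S) simp_all
    show ?thesis unfolding P_def by measurable
  qed
  have Em: "E n \<in> sets M" for n
    unfolding E_def by (rule sets.finite_UN) (rule finite_atMost, rule Pm)
  have inc: "incseq E"
  proof (rule incseq_SucI)
    show "E n \<subseteq> E (Suc n)" for n unfolding E_def by (rule UN_mono) auto
  qed
  have le: "measure M (E n) \<le> V 0 x0 x0 / c" for n
  proof -
    define R where "R = Max (q ` {..n})"
    have sub: "q ` {..n} \<subseteq> {0..R}"
      unfolding R_def by (rule image_subsetI) (simp add: q0)
    have R0: "0 \<le> R" using order_trans[OF q0[of 0] Max_ge[of "q ` {..n}" "q 0"]] by (simp add: R_def)
    have "E n = {w \<in> space M. \<exists>g\<in>q ` {..n}. P g w}" unfolding E_def by blast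
    then show ?thesis
      using maximal_inequality_finite[OF V[OF R0] S r R0 _ sub c] unfolding P_def by simp
  qed
  have lim: "(\<lambda>n. measure M (E n)) \<longlonglongrightarrow> measure M (\<Union>n. E n)"
    by (rule finite_Lim_measure_incseq) (use Em inc in blast)+
  have "measure M (\<Union>n. E n) \<le> V 0 x0 x0 / c"
    by (rule LIMSEQ_le_const2[OF lim]) (use le in blast)
  moreover have "(\<Union>n. E n) = {w \<in> space M. \<exists>g\<in>C. P g w}"
    unfolding E_def q[symmetric] by blast
  ultimately show ?thesis unfolding P_def by simp
qed

end

section \<open>Second-moment bounds near a saddle point\<close>

lemma square_AM_GM:
  fixes g e a :: real
  assumes "0 < a" "\<bar>e\<bar> \<le> \<beta>"
  shows "2 * g * e \<le> a * g\<^sup>2 + \<beta>\<^sup>2 / a"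
proof -
  have "e\<^sup>2 \<le> \<beta>\<^sup>2" using power_mono[OF assms(2), of 2] by simp
  then have "e\<^sup>2 / a \<le> \<beta>\<^sup>2 / a" using assms(1) by (simp add: divide_right_mono)
  moreover have "0 \<le> (a * g - e)\<^sup>2 / a" using assms(1) by simp
  then have "2 * g * e \<le> a * g\<^sup>2 + e\<^sup>2 / a"
    using assms(1) by (simp add: power2_eq_square field_simps)
  ultimately show ?thesis by linarith
qed

text \<open>
  Used for a function defined by cases that is 0 up to the point \<open>r\<close> and has a double
  zero there.
\<close>

lemma DERIV_zero_squeeze:
  fixes f G :: "real \<Rightarrow> real"
  assumes G: "DERIV G r :> 0" "G r = 0" and f: "f r = 0" "\<And>s. \<bar>f s\<bar> \<le> \<bar>G s\<bar>"
  shows "DERIV f r :> 0"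
  unfolding DERIV_def
proof (rule Lim_null_comparison)
  show "eventually (\<lambda>h. norm ((f (r + h) - f r) / h) \<le> \<bar>(G (r + h) - G r) / h\<bar>) (at 0)"
    using f G(2) by (intro always_eventually allI) (simp add: abs_divide divide_right_mono)
  show "((\<lambda>h. \<bar>(G (r + h) - G r) / h\<bar>) \<longlongrightarrow> 0) (at 0)"
    using tendsto_rabs[OF G(1)[unfolded DERIV_def]] by simp
qed

lemma norm_sq_2: "(norm (x :: real^2))\<^sup>2 = (x $ 1)\<^sup>2 + (x $ 2)\<^sup>2"
  unfolding power2_norm_eq_inner inner_vec_def sum_2 by (simp add: power2_eq_square)

lemma quadratic_moment:
  fixes \<kappa> :: "(real^2) measure"
  assumes "finite_measure \<kappa>" and sp: "space \<kappa> = UNIV" and i: "integrable \<kappa> (\<lambda>y. y $ i)" "integrable \<kappa> (\<lambda>y. (y $ i)\<^sup>2)"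
  shows "integrable \<kappa> (\<lambda>y. (p + a * (y $ i))\<^sup>2)"
    and "(\<integral>y. (p + a * (y $ i))\<^sup>2 \<partial>\<kappa>) = measure \<kappa> UNIV * p\<^sup>2 + 2 * p * a * (\<integral>y. y $ i \<partial>\<kappa>) + a\<^sup>2 * (\<integral>y. (y $ i)\<^sup>2 \<partial>\<kappa>)"
proof -
  interpret finite_measure \<kappa> by fact
  have eq: "(p + a * (y $ i))\<^sup>2 = p\<^sup>2 + (2 * p * a) * (y $ i) + a\<^sup>2 * (y $ i)\<^sup>2" for y :: "real^2"
    by (simp add: power2_eq_square algebra_simps)
  have c: "integrable \<kappa> (\<lambda>y. p\<^sup>2)" by (rule integrable_const)
  show "integrable \<kappa> (\<lambda>y. (p + a * (y $ i))\<^sup>2)" unfolding eq using i c by simp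
  show "(\<integral>y. (p + a * (y $ i))\<^sup>2 \<partial>\<kappa>) = measure \<kappa> UNIV * p\<^sup>2 + 2 * p * a * (\<integral>y. y $ i \<partial>\<kappa>) + a\<^sup>2 * (\<integral>y. (y $ i)\<^sup>2 \<partial>\<kappa>)"
    unfolding eq using i c by (simp add: sp)
qed

text \<open>
  \<open>v\<close> bounds the second moments of the jumps and \<open>\<beta>\<close> the deviation
  of the drift from the linear field \<open>(- \<mu> * x $ 1, lam * x $ 2)\<close>. For the
  \<open>N\<close>-th process \<open>v\<close> will be of order \<open>1 / N\<close> and
  \<open>\<beta>\<close> small compared with \<open>1 / sqrt N\<close>.
\<close>

locale saddle_process = jump_process M D \<kappa> x0 X J Y
  for M :: "'a measure" and D :: "(real^2) set" and \<kappa> x0 X J Y +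
  fixes S :: "(real^2) set" and lam \<mu> v \<beta> :: real
  assumes S_open: "open S" and lam: "0 < lam" and \<mu>: "0 < \<mu>" and x02: "x0 $ 2 = 0"
    and v: "0 \<le> v" and \<beta>: "0 \<le> \<beta>"
    and mean_int: "\<And>x i. x \<in> D \<inter> S \<Longrightarrow> integrable (\<kappa> x) (\<lambda>y. y $ i)"
    and var_int: "\<And>x i. x \<in> D \<inter> S \<Longrightarrow> integrable (\<kappa> x) (\<lambda>y. (y $ i)\<^sup>2)"
    and var_le: "\<And>x i. x \<in> D \<inter> S \<Longrightarrow> (\<integral>y. (y $ i)\<^sup>2 \<partial>\<kappa> x) \<le> v"
    and drift1: "\<And>x. x \<in> D \<inter> S \<Longrightarrow> \<bar>(\<integral>y. y $ 1 \<partial>\<kappa> x) + \<mu> * x $ 1\<bar> \<le> \<beta>"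
    and drift2: "\<And>x. x \<in> D \<inter> S \<Longrightarrow> \<bar>(\<integral>y. y $ 2 \<partial>\<kappa> x) - lam * x $ 2\<bar> \<le> \<beta>"
begin

lemma S_borel: "S \<in> sets borel" using S_open by (rule borel_open)

abbreviation clock :: "real \<Rightarrow> 'a \<Rightarrow> real" where "clock \<equiv> stopped_clock S X"
abbreviation state :: "real \<Rightarrow> 'a \<Rightarrow> real^2" where "state \<equiv> stopped S X"

lemma kernel_fin:
  assumes "x \<in> D"
  shows "finite_measure (\<kappa> x)" and "space (\<kappa> x) = UNIV" and "sets (\<kappa> x) = sets borel"
proof -
  note x = assms
  show "finite_measure (\<kappa> x)" and *: "sets (\<kappa> x) = sets borel"
    using kernel x unfolding levy_kernel_on_def by blast+
  show "space (\<kappa> x) = UNIV" using sets_eq_imp_space_eq[OF *] by simp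
qed

definition C1 :: real where "C1 = v + \<beta>\<^sup>2 / \<mu>"

text \<open>
  Let \<open>d\<close> be the deviation of the first coordinate from the path. The drift pulls
  \<open>d\<close> towards 0, so \<open>d\<^sup>2\<close> grows on average at most at the rate
  \<open>- 2 * \<mu> * d\<^sup>2 + 2 * \<bar>d\<bar> * \<beta> + v \<le> C1\<close>. Discounting
  by \<open>exp (- lam * t)\<close> and adding \<open>C1 / lam\<close> absorbs this constant
  growth for all times at once.
\<close>

definition V1 :: "real \<Rightarrow> real^2 \<Rightarrow> real^2 \<Rightarrow> real" where
  "V1 t x z = exp (- lam * t) * ((x $ 1 - exp (- \<mu> * t) * x0 $ 1)\<^sup>2 + C1 / lam)"

definition V1' :: "real \<Rightarrow> real^2 \<Rightarrow> real^2 \<Rightarrow> real" where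
  "V1' t x z = - lam * V1 t x z + exp (- lam * t) * (2 * (x $ 1 - exp (- \<mu> * t) * x0 $ 1) * (\<mu> * exp (- \<mu> * t) * x0 $ 1))"

lemma C1_nonneg: "0 \<le> C1" using v \<beta> \<mu> by (simp add: C1_def)

lemma vec_nth_borel [measurable]: "(\<lambda>x::real^2. x $ i) \<in> borel_measurable borel"
  by (intro borel_measurable_continuous_onI continuous_intros)

lemma V1_superharmonic: "superharmonic S r R V1 V1'"
  unfolding superharmonic_def
proof (intro conjI ballI allI impI)
  show "0 \<le> V1 t x z" for t x z
    unfolding V1_def using C1_nonneg lam by (intro mult_nonneg_nonneg add_nonneg_nonneg) auto
  show "(\<lambda>(t, x, z). V1 t x z) \<in> borel_measurable (borel \<Otimes>\<^sub>M (borel \<Otimes>\<^sub>M borel))"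
    unfolding V1_def split_beta' by measurable
  show "(\<lambda>t. V1' t x z) \<in> borel_measurable borel" for x z
    unfolding V1'_def V1_def by measurable
next
  fix x z t assume x: "x \<in> D \<inter> S"
  show "((\<lambda>t. V1 t x z) has_real_derivative V1' t x z) (at t)"
    unfolding V1_def V1'_def by (auto intro!: derivative_eq_intros simp: algebra_simps)
  let ?E = "exp (- lam * t)" and ?xt = "exp (- \<mu> * t) * x0 $ 1" and ?q = "measure (\<kappa> x) UNIV"
  let ?g = "x $ 1 - ?xt" and ?m = "\<integral>y. y $ 1 \<partial>\<kappa> x" and ?m2 = "\<integral>y. (y $ 1)\<^sup>2 \<partial>\<kappa> x"
  interpret k: finite_measure "\<kappa> x" using kernel_fin x by blast
  have sp: "space (\<kappa> x) = UNIV" using kernel_fin x by blast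
  note qm = quadratic_moment[OF k.finite_measure_axioms sp mean_int[OF x] var_int[OF x], where p="?g" and a=1 and i=1]
  have eq: "V1 t (x + y) z' = ?E * ((?g + 1 * (y $ 1))\<^sup>2 + C1 / lam)" for y z'
    by (simp add: V1_def algebra_simps)
  have ci: "integrable (\<kappa> x) (\<lambda>y. C1 / lam)" by (rule k.integrable_const)
  show "integrable (\<kappa> x) (\<lambda>y. V1 t (x + y) (if t \<le> r then x + y else z))"
    unfolding eq using qm(1) ci by simp
  have "(\<integral>y. V1 t (x + y) (if t \<le> r then x + y else z) \<partial>\<kappa> x) = ?E * ((?q * ?g\<^sup>2 + 2 * ?g * ?m + ?m2) + ?q * (C1 / lam))"
    unfolding eq using qm ci by (simp add: sp)
  also have "\<dots> \<le> ?q * V1 t x z - V1' t x z"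
  proof -
    define e where "e = ?m + \<mu> * x $ 1"
    have e: "\<bar>e\<bar> \<le> \<beta>" using drift1[OF x] by (simp add: e_def)
    have "2 * ?g * e \<le> \<mu> * ?g\<^sup>2 + \<beta>\<^sup>2 / \<mu>" by (rule square_AM_GM[OF \<mu> e])
    moreover have "2 * ?g * ?m + 2 * ?g * (\<mu> * ?xt) = 2 * ?g * e - 2 * \<mu> * ?g\<^sup>2"
      by (simp add: e_def power2_eq_square algebra_simps)
    moreover have "0 \<le> \<mu> * ?g\<^sup>2" "0 \<le> lam * ?g\<^sup>2" using \<mu> lam by auto
    ultimately have "2 * ?g * ?m + ?m2 + 2 * ?g * (\<mu> * ?xt) \<le> lam * ?g\<^sup>2 + C1"
      using var_le[OF x, of 1] unfolding C1_def by linarith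
    then have "?E * (2 * ?g * ?m + ?m2 + 2 * ?g * (\<mu> * ?xt)) \<le> ?E * (lam * ?g\<^sup>2 + C1)"
      by (rule mult_left_mono) simp
    moreover have "?q * V1 t x z - V1' t x z - ?E * ((?q * ?g\<^sup>2 + 2 * ?g * ?m + ?m2) + ?q * (C1 / lam))
      = ?E * (lam * ?g\<^sup>2 + C1) - ?E * (2 * ?g * ?m + ?m2 + 2 * ?g * (\<mu> * ?xt))"
      using lam by (simp add: V1_def V1'_def algebra_simps)
    ultimately show ?thesis by linarith
  qed
  finally show "(\<integral>y. V1 t (x + y) (if t \<le> r then x + y else z) \<partial>\<kappa> x) \<le> ?q * V1 t x z - V1' t x z" .
qed

definition C2 :: "real \<Rightarrow> real" where "C2 r = 4 * \<beta>\<^sup>2 / lam\<^sup>2 + 2 * v * exp (- lam * r) / lam"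

lemma C2_nonneg: "0 \<le> C2 r" using v lam by (simp add: C2_def)

text \<open>
  Let \<open>p\<close> be the increment of \<open>exp (- lam * t) * x $ 2\<close> since time
  \<open>r\<close>. Up to the drift error it is a martingale, with a variance that grows at the
  rate \<open>exp (- 2 * lam * t) * v\<close>. The decreasing factor \<open>1 + exp (- lam *
  t)\<close> in front of \<open>p\<^sup>2\<close> yields a term \<open>- lam * exp (- lam * t) *
  p\<^sup>2\<close>, which absorbs the cross term of \<open>p\<close> with the drift error; what
  is left decays at least like \<open>exp (- lam * t)\<close> and is compensated by the summand
  \<open>exp (- lam * t) * C2 r\<close>.
\<close>

definition V2 :: "real \<Rightarrow> real \<Rightarrow> real^2 \<Rightarrow> real^2 \<Rightarrow> real" where
  "V2 r t x z = (if t \<le> r then 0 else (1 + exp (- lam * t)) * (exp (- lam * t) * x $ 2 - exp (- lam * r) * z $ 2)\<^sup>2) + exp (- lam * t) * C2 r"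

definition V2' :: "real \<Rightarrow> real \<Rightarrow> real^2 \<Rightarrow> real^2 \<Rightarrow> real" where
  "V2' r t x z = (if t \<le> r then 0 else
     - lam * exp (- lam * t) * (exp (- lam * t) * x $ 2 - exp (- lam * r) * z $ 2)\<^sup>2
     + (1 + exp (- lam * t)) * (2 * (exp (- lam * t) * x $ 2 - exp (- lam * r) * z $ 2) * (- lam * exp (- lam * t) * x $ 2)))
     - lam * exp (- lam * t) * C2 r"

text \<open>
  At \<open>t = r\<close> the two branches fit together because the record equals the state there,
  so that the square has a double zero.
\<close>

lemma V2_derivative:
  assumes z: "t \<le> r \<longrightarrow> z = x"
  shows "((\<lambda>t. V2 r t x z) has_real_derivative V2' r t x z) (at t)"
proof -
  let ?G = "\<lambda>t. (1 + exp (- lam * t)) * (exp (- lam * t) * x $ 2 - exp (- lam * r) * z $ 2)\<^sup>2"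
  let ?G' = "\<lambda>t. - lam * exp (- lam * t) * (exp (- lam * t) * x $ 2 - exp (- lam * r) * z $ 2)\<^sup>2
     + (1 + exp (- lam * t)) * (2 * (exp (- lam * t) * x $ 2 - exp (- lam * r) * z $ 2) * (- lam * exp (- lam * t) * x $ 2))"
  have G: "(?G has_real_derivative ?G' t) (at t)" for t
    by (auto intro!: derivative_eq_intros simp: algebra_simps)
  have main: "((\<lambda>t. if t \<le> r then 0 else ?G t) has_real_derivative (if t \<le> r then 0 else ?G' t)) (at t)"
  proof -
    consider "t < r" | "t = r" | "r < t" by linarith
    then show ?thesis
    proof cases
      case 1
      have "((\<lambda>t. 0) has_real_derivative 0) (at t)" by simp
      then have "((\<lambda>t. if t \<le> r then 0 else ?G t) has_real_derivative 0) (at t)"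
        by (rule has_field_derivative_transform_within_open[OF _ open_lessThan[of r]]) (use 1 in auto)
      then show ?thesis using 1 by simp
    next
      case 2
      have Gr: "?G r = 0" "?G' r = 0" using z 2 by auto
      have "DERIV (\<lambda>t. if t \<le> r then 0 else ?G t) r :> 0"
        by (rule DERIV_zero_squeeze[of ?G]) (use G[of r] Gr in auto)
      then show ?thesis using 2 by simp
    next
      case 3
      have "((\<lambda>t. if t \<le> r then 0 else ?G t) has_real_derivative ?G' t) (at t)"
        by (rule has_field_derivative_transform_within_open[OF G open_greaterThan[of r]]) (use 3 in auto)
      then show ?thesis using 3 by simp
    qed
  qed
  have rest: "((\<lambda>t. exp (- lam * t) * C2 r) has_real_derivative (- lam * exp (- lam * t) * C2 r)) (at t)"
    by (auto intro!: derivative_eq_intros)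
  show ?thesis
    unfolding V2_def V2'_def by (rule DERIV_cong[OF DERIV_add[OF main rest]]) simp
qed

lemma V2_superharmonic: "superharmonic S r R (V2 r) (V2' r)"
  unfolding superharmonic_def
proof (intro conjI ballI allI impI)
  show "0 \<le> V2 r t x z" for t x z
    unfolding V2_def using C2_nonneg by (intro add_nonneg_nonneg) (auto intro!: mult_nonneg_nonneg add_nonneg_nonneg)
  show "(\<lambda>(t, x, z). V2 r t x z) \<in> borel_measurable (borel \<Otimes>\<^sub>M (borel \<Otimes>\<^sub>M borel))"
    unfolding V2_def split_beta' by measurable
  show "(\<lambda>t. V2' r t x z) \<in> borel_measurable borel" for x z
    unfolding V2'_def by measurable
next
  fix x z t assume x: "x \<in> D \<inter> S" and z: "t \<le> r \<longrightarrow> z = x" and t: "t \<in> {0..R}"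
  show "((\<lambda>t. V2 r t x z) has_real_derivative V2' r t x z) (at t)" by (rule V2_derivative[OF z])
  let ?E = "exp (- lam * t)" and ?q = "measure (\<kappa> x) UNIV"
  let ?p = "?E * x $ 2 - exp (- lam * r) * z $ 2" and ?m = "\<integral>y. y $ 2 \<partial>\<kappa> x" and ?m2 = "\<integral>y. (y $ 2)\<^sup>2 \<partial>\<kappa> x"
  interpret k: finite_measure "\<kappa> x" using kernel_fin x by blast
  have sp: "space (\<kappa> x) = UNIV" using kernel_fin x by blast
  have int: "integrable (\<kappa> x) (\<lambda>y. V2 r t (x + y) (if t \<le> r then x + y else z)) \<and>
     (\<integral>y. V2 r t (x + y) (if t \<le> r then x + y else z) \<partial>\<kappa> x) \<le> ?q * V2 r t x z - V2' r t x z"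
  proof (cases "t \<le> r")
    case True
    have "0 \<le> lam * ?E * C2 r" using lam C2_nonneg by simp
    then show ?thesis using True by (simp add: V2_def V2'_def sp k.integrable_const)
  next
    case False
    note qm = quadratic_moment[OF k.finite_measure_axioms sp mean_int[OF x] var_int[OF x], where p="?p" and a="?E" and i=2]
    have eq: "V2 r t (x + y) (if t \<le> r then x + y else z) = (1 + ?E) * (?p + ?E * (y $ 2))\<^sup>2 + ?E * C2 r" for y
      using False by (simp add: V2_def algebra_simps)
    have ci: "integrable (\<kappa> x) (\<lambda>y. ?E * C2 r)" by (rule k.integrable_const)
    have i: "integrable (\<kappa> x) (\<lambda>y. V2 r t (x + y) (if t \<le> r then x + y else z))"
      unfolding eq using qm(1) ci by simp
    have "(\<integral>y. V2 r t (x + y) (if t \<le> r then x + y else z) \<partial>\<kappa> x) = (1 + ?E) * (?q * ?p\<^sup>2 + 2 * ?p * ?E * ?m + ?E\<^sup>2 * ?m2) + ?q * (?E * C2 r)"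
      unfolding eq using qm ci by (simp add: sp)
    also have "\<dots> \<le> ?q * V2 r t x z - V2' r t x z"
    proof -
      define e where "e = ?m - lam * x $ 2"
      have e: "\<bar>2 * e\<bar> \<le> 2 * \<beta>" using drift2[OF x] by (simp add: e_def)
      have E1: "0 < ?E" "?E \<le> 1" "?E \<le> exp (- lam * r)" using t lam False by (auto simp: mult_nonneg_nonneg)
      have m20: "0 \<le> ?m2" by (rule Bochner_Integration.integral_nonneg) simp
      have "2 * ?p * ((1 + ?E) * e) \<le> lam * ?p\<^sup>2 + (2 * \<beta>)\<^sup>2 / lam"
      proof (rule square_AM_GM[OF lam])
        have "\<bar>(1 + ?E) * e\<bar> \<le> 2 * \<bar>e\<bar>" using E1 by (simp add: abs_mult mult_right_mono)
        then show "\<bar>(1 + ?E) * e\<bar> \<le> 2 * \<beta>" using e by simp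
      qed
      moreover have "(1 + ?E) * (?E * ?m2) \<le> 2 * (exp (- lam * r) * v)"
        using E1 m20 var_le[OF x, of 2] by (intro mult_mono) auto
      moreover have "lam * C2 r = (2 * \<beta>)\<^sup>2 / lam + 2 * (exp (- lam * r) * v)"
        using lam by (simp add: C2_def field_simps power2_eq_square)
      ultimately have "2 * ?p * ((1 + ?E) * e) + (1 + ?E) * (?E * ?m2) \<le> lam * ?p\<^sup>2 + lam * C2 r" by linarith
      then have "?E * (2 * ?p * ((1 + ?E) * e) + (1 + ?E) * (?E * ?m2)) \<le> ?E * (lam * ?p\<^sup>2 + lam * C2 r)"
        by (rule mult_left_mono) simp
      moreover have "?q * V2 r t x z - V2' r t x z - ((1 + ?E) * (?q * ?p\<^sup>2 + 2 * ?p * ?E * ?m + ?E\<^sup>2 * ?m2) + ?q * (?E * C2 r))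
        = ?E * (lam * ?p\<^sup>2 + lam * C2 r) - ?E * (2 * ?p * ((1 + ?E) * e) + (1 + ?E) * (?E * ?m2))"
        using False by (simp add: V2_def V2'_def e_def power2_eq_square algebra_simps)
      ultimately show ?thesis by linarith
    qed
    finally show ?thesis using i by blast
  qed
  then show "integrable (\<kappa> x) (\<lambda>y. V2 r t (x + y) (if t \<le> r then x + y else z))"
    "(\<integral>y. V2 r t (x + y) (if t \<le> r then x + y else z) \<partial>\<kappa> x) \<le> ?q * V2 r t x z - V2' r t x z" by blast+
qed

lemma state_measurable: "0 \<le> t \<Longrightarrow> state t \<in> borel_measurable M"
  by (rule stopped_measurable[OF S_borel])

lemma clock_measurable: "0 \<le> t \<Longrightarrow> clock t \<in> borel_measurable M"
  by (rule stopped_clock_measurable[OF S_borel])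

text \<open>
  Stopped clocks for different times differ only by truncation.
\<close>

lemma clock_min:
  assumes w: "w \<in> space M" and r: "0 \<le> r" "r \<le> t"
  shows "clock r w = min r (clock t w)"
proof -
  have t: "0 \<le> t" using r by simp
  have e: "min (ereal s) (exit_time S X w) = ereal (clock s w)" if "0 \<le> s" for s
    using exit_time_stage[OF S_borel that w] stopped_clock_stage[OF S_borel that w] by simp
  have "ereal (clock r w) = min (ereal r) (min (ereal t) (exit_time S X w))"
    using r(2) by (simp add: e[OF r(1), symmetric] min.assoc[symmetric] min_absorb1)
  also have "\<dots> = ereal (min r (clock t w))" by (simp add: e[OF t])
  finally show ?thesis by (simp only: ereal.inject)
qed

lemma clock_bounds:
  assumes w: "w \<in> space M" and t: "0 \<le> t"
  shows "0 \<le> clock t w" "clock t w \<le> t"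
  using stopped_clock_stage[OF S_borel t w] stage_facts(4,5)[OF S_borel t w] jt_nonneg[OF w, of "stage (time_rule S t) w"] by linarith+

lemma state_cong: "clock s w = clock t w \<Longrightarrow> state s w = state t w"
  by (simp add: stopped_def)

lemma exited:
  assumes w: "w \<in> space M" and t: "0 \<le> t" and lt: "clock t w < t"
  shows "state t w \<notin> S"
proof
  assume "state t w \<in> S"
  then have "clock t w = t"
    using stopped_clock_stage[OF S_borel t w] stopped_stage[OF S_borel t w] by (simp add: time_rule_def)
  with lt show False by simp
qed

lemma event_measurable:
  assumes "countable C" "\<And>g. g \<in> C \<Longrightarrow> {w \<in> space M. P g w} \<in> sets M"
  shows "{w \<in> space M. \<exists>g\<in>C. P g w} \<in> sets M"
proof -
  have "{w \<in> space M. \<exists>g\<in>C. P g w} = (\<Union>g\<in>C. {w \<in> space M. P g w})" by auto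
  also have "\<dots> \<in> sets M" using assms by (intro sets.countable_UN') auto
  finally show ?thesis .
qed

lemma superharmonic_event:
  assumes V: "superharmonic S r 0 V V'" and r: "0 \<le> r" and C: "countable C" "C \<subseteq> {0..}"
  shows "{w \<in> space M. \<exists>g\<in>C. c \<le> V (clock g w) (state g w) (state (min r g) w)} \<in> sets M"
proof (rule event_measurable[OF C(1)])
  fix g assume "g \<in> C"
  then have g: "0 \<le> g" using C(2) by auto
  have "(\<lambda>w. V (clock g w) (state g w) (state (min r g) w)) \<in> borel_measurable M"
    using r g by (intro superharmonic_measurable[OF V clock_measurable state_measurable state_measurable]) simp_all
  then show "{w \<in> space M. c \<le> V (clock g w) (state g w) (state (min r g) w)} \<in> sets M" by measurable
qed

text \<open>
  \<open>V1\<close> dominates the quantity and starts from \<open>C1 / lam\<close>, because the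
  initial deviation is 0.
\<close>

theorem stable_coordinate_bound:
  assumes C: "countable C" "C \<subseteq> {0..}" and c: "0 < c"
  shows "measure M {w \<in> space M. \<exists>g\<in>C. c \<le> exp (- lam * clock g w) * (state g w $ 1 - exp (- \<mu> * clock g w) * x0 $ 1)\<^sup>2} \<le> C1 / (lam * c)"
proof -
  let ?E = "{w \<in> space M. \<exists>g\<in>C. c \<le> V1 (clock g w) (state g w) (state (min 0 g) w)}"
  have "measure M {w \<in> space M. \<exists>g\<in>C. c \<le> exp (- lam * clock g w) * (state g w $ 1 - exp (- \<mu> * clock g w) * x0 $ 1)\<^sup>2} \<le> measure M ?E"
  proof (rule finite_measure_mono)
    show "?E \<in> sets M" by (rule superharmonic_event[OF V1_superharmonic order_refl C])
    have "exp (- lam * t) * (x $ 1 - exp (- \<mu> * t) * x0 $ 1)\<^sup>2 \<le> V1 t x z" for t x z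
      unfolding V1_def using C1_nonneg lam by (intro mult_left_mono) auto
    then show "{w \<in> space M. \<exists>g\<in>C. c \<le> exp (- lam * clock g w) * (state g w $ 1 - exp (- \<mu> * clock g w) * x0 $ 1)\<^sup>2} \<subseteq> ?E"
      by (blast intro: order_trans)
  qed
  also have "\<dots> \<le> V1 0 x0 x0 / c"
    by (rule maximal_inequality[OF V1_superharmonic S_borel order_refl C c])
  also have "\<dots> = C1 / (lam * c)" by (simp add: V1_def)
  finally show ?thesis .
qed

text \<open>
  \<open>V2 r\<close> dominates the squared increment after time \<open>r\<close> and starts from
  \<open>C2 r\<close>. If the process was stopped before \<open>r\<close>, the increment is 0.
\<close>

theorem unstable_coordinate_bound:
  assumes r: "0 \<le> r" and C: "countable C" "C \<subseteq> {r..}" and c: "0 < c"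
  shows "measure M {w \<in> space M. \<exists>g\<in>C. c \<le> (exp (- lam * clock g w) * state g w $ 2 - exp (- lam * clock r w) * state r w $ 2)\<^sup>2} \<le> C2 r / c"
proof -
  let ?P = "\<lambda>g w. c \<le> (exp (- lam * clock g w) * state g w $ 2 - exp (- lam * clock r w) * state r w $ 2)\<^sup>2"
  let ?E = "{w \<in> space M. \<exists>g\<in>C. c \<le> V2 r (clock g w) (state g w) (state (min r g) w)}"
  have C0: "C \<subseteq> {0..}" using C(2) r by auto
  have sub: "c \<le> V2 r (clock g w) (state g w) (state (min r g) w)" if w: "w \<in> space M" and g: "g \<in> C" and P: "?P g w" for g w
  proof -
    have rg: "r \<le> g" using g C(2) by auto
    have cr: "clock r w = min r (clock g w)" by (rule clock_min[OF w r rg])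
    show ?thesis
    proof (cases "clock g w \<le> r")
      case True
      then have "clock r w = clock g w" using cr by simp
      then show ?thesis using P state_cong[of r w g] c by simp
    next
      case False
      then have "clock r w = r" using cr by simp
      let ?p = "exp (- lam * clock g w) * state g w $ 2 - exp (- lam * r) * state r w $ 2"
      have "c \<le> ?p\<^sup>2" using P \<open>clock r w = r\<close> by simp
      also have "\<dots> \<le> (1 + exp (- lam * clock g w)) * ?p\<^sup>2"
        using mult_right_mono[of 1 "1 + exp (- lam * clock g w)" "?p\<^sup>2"] by simp
      also have "\<dots> \<le> V2 r (clock g w) (state g w) (state (min r g) w)"
        using False rg C2_nonneg by (simp add: V2_def min_absorb1)
      finally show ?thesis .
    qed
  qed
  have "measure M {w \<in> space M. \<exists>g\<in>C. ?P g w} \<le> measure M ?E"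
    by (rule finite_measure_mono[OF _ superharmonic_event[OF V2_superharmonic r C(1) C0]]) (use sub in blast)
  also have "\<dots> \<le> V2 r 0 x0 x0 / c"
    by (rule maximal_inequality[OF V2_superharmonic S_borel r C(1) C0 c])
  also have "\<dots> = C2 r / c" using r by (simp add: V2_def)
  finally show ?thesis .
qed

text \<open>
  When the process leaves \<open>S\<close>, its distance from the path is at least
  \<open>\<epsilon>\<close>, so the square of one of the two coordinates of the deviation is at
  least \<open>\<epsilon>\<^sup>2 / 2\<close>. The two bounds above with the single time
  \<open>R\<close> apply to the state in which the process is stopped.
\<close>

theorem exit_bound:
  assumes tube: "0 < \<epsilon>" "\<And>t. 0 \<le> t \<Longrightarrow> ball (stable_path \<mu> x0 t) \<epsilon> \<subseteq> S" and R: "0 \<le> R"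
  shows "measure M {w \<in> space M. clock R w < R} \<le> 2 * C1 * exp (lam * R) / (lam * \<epsilon>\<^sup>2) + 2 * C2 0 * exp (2 * lam * R) / \<epsilon>\<^sup>2"
proof -
  define c1 where "c1 = exp (- lam * R) * \<epsilon>\<^sup>2 / 2"
  define c2 where "c2 = exp (- 2 * lam * R) * \<epsilon>\<^sup>2 / 2"
  have c: "0 < c1" "0 < c2" using tube(1) by (simp_all add: c1_def c2_def)
  let ?E1 = "{w \<in> space M. \<exists>g\<in>{R}. c1 \<le> exp (- lam * clock g w) * (state g w $ 1 - exp (- \<mu> * clock g w) * x0 $ 1)\<^sup>2}"
  let ?E2 = "{w \<in> space M. \<exists>g\<in>{R}. c2 \<le> (exp (- lam * clock g w) * state g w $ 2 - exp (- lam * clock 0 w) * state 0 w $ 2)\<^sup>2}"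
  have [measurable]: "clock R \<in> borel_measurable M" "clock 0 \<in> borel_measurable M"
    using R by (auto intro: clock_measurable)
  have [measurable]: "(\<lambda>w. state R w $ i) \<in> borel_measurable M" "(\<lambda>w. state 0 w $ i) \<in> borel_measurable M" for i
    using R by (auto intro!: measurable_compose[OF state_measurable vec_nth_borel])
  have E: "?E1 \<in> sets M" "?E2 \<in> sets M" by simp_all
  have sub: "{w \<in> space M. clock R w < R} \<subseteq> ?E1 \<union> ?E2"
  proof
    fix w assume "w \<in> {w \<in> space M. clock R w < R}"
    then have w: "w \<in> space M" and lt: "clock R w < R" by auto
    let ?t = "clock R w" and ?x = "state R w"
    note cb = clock_bounds[OF w R]
    have "?x \<notin> ball (stable_path \<mu> x0 ?t) \<epsilon>" using exited[OF w R lt] tube(2)[OF cb(1)] by blast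
    then have "\<epsilon> \<le> norm (stable_path \<mu> x0 ?t - ?x)" by (simp add: dist_norm not_less)
    then have "\<epsilon>\<^sup>2 \<le> (norm (stable_path \<mu> x0 ?t - ?x))\<^sup>2" using tube(1) by (intro power_mono) auto
    also have "\<dots> = (?x $ 1 - exp (- \<mu> * ?t) * x0 $ 1)\<^sup>2 + (?x $ 2)\<^sup>2"
      by (simp add: norm_sq_2 stable_path_def x02 power2_commute)
    finally have "\<epsilon>\<^sup>2 / 2 \<le> (?x $ 1 - exp (- \<mu> * ?t) * x0 $ 1)\<^sup>2 \<or> \<epsilon>\<^sup>2 / 2 \<le> (?x $ 2)\<^sup>2" by linarith
    then show "w \<in> ?E1 \<union> ?E2"
    proof
      assume a: "\<epsilon>\<^sup>2 / 2 \<le> (?x $ 1 - exp (- \<mu> * ?t) * x0 $ 1)\<^sup>2"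
      have "exp (- lam * R) * (\<epsilon>\<^sup>2 / 2) \<le> exp (- lam * ?t) * (?x $ 1 - exp (- \<mu> * ?t) * x0 $ 1)\<^sup>2"
        using a cb lam by (intro mult_mono) auto
      then show ?thesis using w by (simp add: c1_def)
    next
      assume a: "\<epsilon>\<^sup>2 / 2 \<le> (?x $ 2)\<^sup>2"
      have st0: "state 0 w = x0"
      proof -
        have "clock 0 w = 0" using clock_bounds[OF w order_refl] by simp
        moreover have "X 0 w = Y 0 w"
          using J_0[OF w] J_strict[OF w, of 0] by (intro X_eq[OF w]) (simp_all add: zero_ereal_def[symmetric])
        ultimately show ?thesis by (simp add: stopped_def Y_0[OF w])
      qed
      have "exp (- 2 * lam * R) * (\<epsilon>\<^sup>2 / 2) \<le> (exp (- lam * ?t))\<^sup>2 * (?x $ 2)\<^sup>2"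
        using a cb lam by (intro mult_mono) (auto simp: exp_double[symmetric] power2_eq_square exp_add[symmetric])
      then show ?thesis using w by (simp add: c2_def st0 x02 power_mult_distrib)
    qed
  qed
  have "measure M {w \<in> space M. clock R w < R} \<le> measure M ?E1 + measure M ?E2"
    using order_trans[OF finite_measure_mono[OF sub] measure_Un_le[OF E]] E by simp
  also have "\<dots> \<le> C1 / (lam * c1) + C2 0 / c2"
    using R c by (intro add_mono stable_coordinate_bound unstable_coordinate_bound) auto
  also have "\<dots> = 2 * C1 * exp (lam * R) / (lam * \<epsilon>\<^sup>2) + 2 * C2 0 * exp (2 * lam * R) / \<epsilon>\<^sup>2"
    by (simp add: c1_def c2_def exp_minus field_simps)
  finally show ?thesis .
qed

end

section \<open>Derivatives of Laplace transforms\<close>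

lemma power_le_fact_exp:
  fixes x :: real
  assumes "0 \<le> x"
  shows "x ^ k \<le> fact k * exp x"
proof -
  have "x ^ k / fact k \<le> (\<Sum>n<Suc k. x ^ n / fact n)"
    using assms by (intro member_le_sum) auto
  also have "\<dots> \<le> exp x"
  proof -
    have "(\<Sum>n<Suc k. x ^ n /\<^sub>R fact n) \<le> (\<Sum>n. x ^ n /\<^sub>R fact n)"
      using assms by (intro sum_le_suminf summable_exp_generic) auto
    then show ?thesis by (simp add: exp_def divide_inverse_commute)
  qed
  finally show ?thesis by (simp add: field_simps)
qed

lemma exp_Taylor2:
  fixes x :: real
  shows "\<bar>exp x - 1 - x\<bar> \<le> x\<^sup>2 * exp \<bar>x\<bar>"
proof -
  obtain t where t: "\<bar>t\<bar> \<le> \<bar>x\<bar>" "exp x = (\<Sum>m<2. x ^ m / fact m) + exp t / fact 2 * x ^ 2"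
    using Maclaurin_exp_le[of x 2] by blast
  have eq: "exp x - 1 - x = exp t / 2 * x\<^sup>2" using t(2) by (simp add: numeral_2_eq_2)
  define E where "E = exp \<bar>x\<bar>"
  have E: "exp t \<le> E" "0 \<le> E" "0 \<le> exp t" using t(1) by (auto simp: E_def)
  then have "exp t / 2 \<le> E" by linarith
  then have "exp t / 2 * x\<^sup>2 \<le> E * x\<^sup>2" by (rule mult_right_mono) simp
  moreover have "0 \<le> exp t / 2 * x\<^sup>2" by simp
  ultimately show ?thesis unfolding eq E_def by (simp add: mult.commute)
qed

text \<open>
  Odd terms cancel, which makes the second difference of the Laplace transform accurate to fourth
  order.
\<close>

lemma exp_symmetric_Taylor4:
  fixes x :: real
  shows "\<bar>exp x + exp (- x) - 2 - x\<^sup>2\<bar> \<le> x ^ 4 * exp \<bar>x\<bar>"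
proof -
  obtain t where t: "\<bar>t\<bar> \<le> \<bar>x\<bar>" "exp x = (\<Sum>m<4. x ^ m / fact m) + exp t / fact 4 * x ^ 4"
    using Maclaurin_exp_le[of x 4] by blast
  obtain u where u: "\<bar>u\<bar> \<le> \<bar>- x\<bar>" "exp (- x) = (\<Sum>m<4. (- x) ^ m / fact m) + exp u / fact 4 * (- x) ^ 4"
    using Maclaurin_exp_le[of "- x" 4] by blast
  have eq: "exp x + exp (- x) - 2 - x\<^sup>2 = (exp t + exp u) / 24 * x ^ 4"
    using t(2) u(2) by (simp add: eval_nat_numeral field_simps)
  define E where "E = exp \<bar>x\<bar>"
  have E: "exp t \<le> E" "exp u \<le> E" "0 \<le> E" using t(1) u(1) by (auto simp: E_def)
  have "exp t + exp u \<le> E + E" by (rule add_mono[OF E(1,2)])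
  moreover have "E + E \<le> E * 24" using E(3) by simp
  ultimately have "(exp t + exp u) / 24 \<le> E" by (simp add: divide_le_eq)
  then have "(exp t + exp u) / 24 * x ^ 4 \<le> E * x ^ 4" by (rule mult_right_mono) simp
  moreover have "0 \<le> (exp t + exp u) / 24 * x ^ 4" by (intro mult_nonneg_nonneg) (auto intro: add_nonneg_nonneg)
  ultimately show ?thesis unfolding eq E_def by (simp add: mult.commute)
qed

lemma norm_integral_le:
  fixes f :: "'a \<Rightarrow> 'b::{banach, second_countable_topology}"
  assumes "integrable M f" "integrable M g" "\<And>x. norm (f x) \<le> g x"
  shows "norm (\<integral>x. f x \<partial>M) \<le> (\<integral>x. g x \<partial>M)"
proof -
  have "norm (\<integral>x. f x \<partial>M) \<le> (\<integral>x. norm (f x) \<partial>M)" by (rule integral_norm_bound)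
  also have "\<dots> \<le> (\<integral>x. g x \<partial>M)"
    by (rule Bochner_Integration.integral_mono[OF integrable_norm[OF assms(1)] assms(2)]) (rule assms(3))
  finally show ?thesis .
qed

locale exponential_moments = finite_measure \<kappa> for \<kappa> :: "'e::euclidean_space measure" +
  fixes \<rho> :: real
  assumes sets_\<kappa> [measurable_cong]: "sets \<kappa> = sets borel"
    and \<rho>: "0 < \<rho>"
    and finite_laplace: "\<And>\<theta>. norm \<theta> \<le> \<rho> \<Longrightarrow> laplace_finite \<kappa> \<theta>"
begin

lemma integrable_exp: "norm \<theta> \<le> \<rho> \<Longrightarrow> integrable \<kappa> (\<lambda>y. exp (\<theta> \<bullet> y))"
  using finite_laplace by (simp add: laplace_finite_def)

text \<open>
  Finiteness of the transform on the coordinate directions gives finiteness of \<open>\<integral>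
  exp (c * norm y)\<close> only for smaller \<open>c\<close>, as \<open>norm y\<close> is bounded
  by the sum of the absolute values of the coordinates.
\<close>

definition radius :: real where "radius = \<rho> / DIM('e)"

lemma radius_pos: "0 < radius" using \<rho> by (simp add: radius_def)

lemma exp_norm_le:
  fixes y :: 'e
  shows "exp (radius * norm y) \<le> (\<Sum>b\<in>Basis. exp ((\<rho> *\<^sub>R b) \<bullet> y) + exp ((- \<rho> *\<^sub>R b) \<bullet> y))"
proof -
  have "\<exists>b\<in>Basis. norm y \<le> DIM('e) * \<bar>y \<bullet> b\<bar>"
  proof (rule ccontr)
    assume "\<not> ?thesis"
    then have *: "\<bar>y \<bullet> b\<bar> < norm y / DIM('e)" if "b \<in> Basis" for b :: 'e
      using that by (simp add: field_simps not_le)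
    have "norm y \<le> (\<Sum>b\<in>Basis. \<bar>y \<bullet> b\<bar>)" by (rule norm_le_l1)
    also have "\<dots> < (\<Sum>b\<in>(Basis :: 'e set). norm y / DIM('e))"
      by (rule sum_strict_mono) (use * in auto)
    also have "\<dots> = norm y" by simp
    finally show False by simp
  qed
  then obtain b :: 'e where b: "b \<in> Basis" "norm y \<le> DIM('e) * \<bar>y \<bullet> b\<bar>" by blast
  have "radius * norm y \<le> \<rho> * \<bar>y \<bullet> b\<bar>"
    using mult_left_mono[OF b(2), of radius] radius_pos by (simp add: radius_def)
  then have "exp (radius * norm y) \<le> exp (\<rho> * \<bar>y \<bullet> b\<bar>)" by simp
  also have "\<dots> \<le> exp ((\<rho> *\<^sub>R b) \<bullet> y) + exp ((- \<rho> *\<^sub>R b) \<bullet> y)"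
    by (cases "0 \<le> y \<bullet> b") (auto simp: inner_commute)
  also have "\<dots> \<le> (\<Sum>b\<in>Basis. exp ((\<rho> *\<^sub>R b) \<bullet> y) + exp ((- \<rho> *\<^sub>R b) \<bullet> y))"
    using b(1) by (intro member_le_sum[of b Basis "\<lambda>b. exp ((\<rho> *\<^sub>R b) \<bullet> y) + exp ((- \<rho> *\<^sub>R b) \<bullet> y)"]) (auto intro: add_nonneg_nonneg)
  finally show ?thesis .
qed

lemma integrable_exp_norm: "integrable \<kappa> (\<lambda>y. exp (radius * norm y))"
proof (rule Bochner_Integration.integrable_bound)
  show "integrable \<kappa> (\<lambda>y. \<Sum>b\<in>Basis. exp ((\<rho> *\<^sub>R b) \<bullet> y) + exp ((- \<rho> *\<^sub>R b) \<bullet> y))"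
    using \<rho> by (intro Bochner_Integration.integrable_sum Bochner_Integration.integrable_add integrable_exp) auto
  show "AE y in \<kappa>. norm (exp (radius * norm y)) \<le> norm (\<Sum>b\<in>Basis. exp ((\<rho> *\<^sub>R b) \<bullet> y) + exp ((- \<rho> *\<^sub>R b) \<bullet> y))"
    using exp_norm_le by (intro AE_I2) (auto intro: order_trans[OF _ abs_ge_self])
qed measurable

lemma integrable_power_exp:
  assumes "c < radius"
  shows "integrable \<kappa> (\<lambda>y. norm y ^ k * exp (c * norm y))"
proof (rule Bochner_Integration.integrable_bound)
  let ?d = "radius - c"
  show "integrable \<kappa> (\<lambda>y. fact k / ?d ^ k * exp (radius * norm y))"
    by (intro integrable_mult_right integrable_exp_norm)
  show "AE y in \<kappa>. norm (norm y ^ k * exp (c * norm y)) \<le> norm (fact k / ?d ^ k * exp (radius * norm y))"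
  proof (rule AE_I2)
    fix y :: 'e
    have d: "0 < ?d" using assms by simp
    have "(?d * norm y) ^ k / ?d ^ k \<le> fact k * exp (?d * norm y) / ?d ^ k"
      using d by (intro divide_right_mono power_le_fact_exp) simp_all
    moreover have "(?d * norm y) ^ k / ?d ^ k = norm y ^ k"
      using d by (simp add: power_mult_distrib)
    ultimately have "norm y ^ k \<le> fact k / ?d ^ k * exp (?d * norm y)" by simp
    then have "norm y ^ k * exp (c * norm y) \<le> fact k / ?d ^ k * exp (?d * norm y) * exp (c * norm y)"
      by (rule mult_right_mono) simp
    also have "\<dots> = fact k / ?d ^ k * exp (radius * norm y)"
      by (simp add: exp_add[symmetric] algebra_simps)
    finally show "norm (norm y ^ k * exp (c * norm y)) \<le> norm (fact k / ?d ^ k * exp (radius * norm y))"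
      using assms by simp
  qed
qed measurable

lemma integrable_weighted:
  fixes g :: "'e \<Rightarrow> 'f::{banach, second_countable_topology}"
  assumes [measurable]: "g \<in> borel_measurable borel" and g: "\<And>y. norm (g y) \<le> A * norm y ^ k" and \<theta>: "norm \<theta> < radius"
  shows "integrable \<kappa> (\<lambda>y. exp (\<theta> \<bullet> y) *\<^sub>R g y)"
proof (rule Bochner_Integration.integrable_bound[OF integrable_mult_right[of A, OF integrable_power_exp[OF \<theta>, of k]]])
  show "AE y in \<kappa>. norm (exp (\<theta> \<bullet> y) *\<^sub>R g y) \<le> norm (A * (norm y ^ k * exp (norm \<theta> * norm y)))"
  proof (rule AE_I2)
    fix y :: 'e
    have "\<theta> \<bullet> y \<le> norm \<theta> * norm y" using Cauchy_Schwarz_ineq2[of \<theta> y] by simp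
    then have "exp (\<theta> \<bullet> y) * norm (g y) \<le> exp (norm \<theta> * norm y) * (A * norm y ^ k)"
      using g[of y] by (intro mult_mono) simp_all
    also have "\<dots> = A * (norm y ^ k * exp (norm \<theta> * norm y))" by (simp add: ac_simps)
    also have "\<dots> \<le> norm (A * (norm y ^ k * exp (norm \<theta> * norm y)))" by simp
    finally show "norm (exp (\<theta> \<bullet> y) *\<^sub>R g y) \<le> norm (A * (norm y ^ k * exp (norm \<theta> * norm y)))" by simp
  qed
qed measurable

lemma integrable_weight:
  fixes g :: "'e \<Rightarrow> 'f::{banach, second_countable_topology}"
  assumes "g \<in> borel_measurable borel" "\<And>y. norm (g y) \<le> A * norm y ^ k"
  shows "integrable \<kappa> g"
  using integrable_weighted[OF assms, of 0] radius_pos by simp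

text \<open>
  Differentiation under the integral sign, by dominated remainder: \<open>exp (\<theta> \<bullet>
  y)\<close> differs from its first-order expansion by a term of order \<open>norm h ^ 2\<close>
  times an integrable function. The weight \<open>g\<close> is needed because the gradient is
  differentiated again.
\<close>

lemma has_derivative_weighted:
  fixes g :: "'e \<Rightarrow> 'f::{banach, second_countable_topology}"
  assumes [measurable]: "g \<in> borel_measurable borel" and g: "\<And>y. norm (g y) \<le> norm y ^ k" and \<theta>: "norm \<theta> < radius"
  shows "((\<lambda>\<theta>. \<integral>y. exp (\<theta> \<bullet> y) *\<^sub>R g y \<partial>\<kappa>) has_derivative (\<lambda>h. \<integral>y. exp (\<theta> \<bullet> y) *\<^sub>R ((h \<bullet> y) *\<^sub>R g y) \<partial>\<kappa>)) (at \<theta>)"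
proof -
  define \<delta> where "\<delta> = (radius - norm \<theta>) / 2"
  have \<delta>: "0 < \<delta>" and \<theta>\<delta>: "norm \<theta> + \<delta> < radius" using \<theta> by (auto simp: \<delta>_def field_simps)
  let ?D = "\<lambda>h. \<integral>y. exp (\<theta> \<bullet> y) *\<^sub>R ((h \<bullet> y) *\<^sub>R g y) \<partial>\<kappa>"
  let ?F = "\<lambda>\<theta>. \<integral>y. exp (\<theta> \<bullet> y) *\<^sub>R g y \<partial>\<kappa>"
  have hg: "norm ((h \<bullet> y) *\<^sub>R g y) \<le> norm h * norm y ^ Suc k" for h y
    using mult_mono[OF Cauchy_Schwarz_ineq2[of h y] g[of y]] by (simp add: ac_simps)
  have intD: "integrable \<kappa> (\<lambda>y. exp (\<theta> \<bullet> y) *\<^sub>R ((h \<bullet> y) *\<^sub>R g y))" for h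
    by (rule integrable_weighted[where k="Suc k", OF _ hg \<theta>]) measurable
  define C where "C = (\<integral>y. norm y ^ (k + 2) * exp ((norm \<theta> + \<delta>) * norm y) \<partial>\<kappa>)"
  have bl: "bounded_linear ?D"
  proof -
    have "linear ?D"
    proof (rule linearI)
      fix a b :: 'e and c :: real
      have "?D a + ?D b = (\<integral>y. exp (\<theta> \<bullet> y) *\<^sub>R ((a \<bullet> y) *\<^sub>R g y) + exp (\<theta> \<bullet> y) *\<^sub>R ((b \<bullet> y) *\<^sub>R g y) \<partial>\<kappa>)"
        by (rule Bochner_Integration.integral_add[OF intD intD, symmetric])
      also have "\<dots> = ?D (a + b)"
        by (rule Bochner_Integration.integral_cong[OF refl]) (simp only: inner_add_left scaleR_add_left scaleR_add_right)
      finally show "?D (a + b) = ?D a + ?D b" ..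
      have "?D (c *\<^sub>R a) = (\<integral>y. c *\<^sub>R (exp (\<theta> \<bullet> y) *\<^sub>R ((a \<bullet> y) *\<^sub>R g y)) \<partial>\<kappa>)"
        by (rule Bochner_Integration.integral_cong[OF refl]) (simp add: mult.left_commute)
      also have "\<dots> = c *\<^sub>R ?D a" by (rule integral_scaleR_right)
      finally show "?D (c *\<^sub>R a) = c *\<^sub>R ?D a" .
    qed
    then show ?thesis by (simp add: linear_conv_bounded_linear)
  qed
  show ?thesis
  proof (rule has_derivativeI_sandwich[OF \<delta> bl])
    fix \<theta>' assume ne: "\<theta>' \<noteq> \<theta>" and d: "dist \<theta>' \<theta> < \<delta>"
    define h where "h = \<theta>' - \<theta>"
    have h: "norm h \<le> \<delta>" "0 < norm h" and \<theta>': "\<theta>' = \<theta> + h" using d ne by (auto simp: h_def dist_norm)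
    have n\<theta>': "norm \<theta>' < radius" using \<theta>\<delta> h norm_triangle_ineq[of \<theta> h] unfolding \<theta>' by linarith
    have g1: "norm (g y) \<le> 1 * norm y ^ k" for y using g[of y] by simp
    note i1 = integrable_weighted[OF assms(1) g1 n\<theta>'] and i2 = integrable_weighted[OF assms(1) g1 \<theta>]
    have "(?F \<theta>' - ?F \<theta>) - ?D h = (\<integral>y. exp (\<theta>' \<bullet> y) *\<^sub>R g y - exp (\<theta> \<bullet> y) *\<^sub>R g y - exp (\<theta> \<bullet> y) *\<^sub>R ((h \<bullet> y) *\<^sub>R g y) \<partial>\<kappa>)"
      using i1 i2 intD[of h] by (simp only: Bochner_Integration.integral_diff Bochner_Integration.integrable_diff)
    also have "norm \<dots> \<le> (\<integral>y. (norm h)\<^sup>2 * (norm y ^ (k + 2) * exp ((norm \<theta> + \<delta>) * norm y)) \<partial>\<kappa>)"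
    proof (rule norm_integral_le)
      show "integrable \<kappa> (\<lambda>y. exp (\<theta>' \<bullet> y) *\<^sub>R g y - exp (\<theta> \<bullet> y) *\<^sub>R g y - exp (\<theta> \<bullet> y) *\<^sub>R ((h \<bullet> y) *\<^sub>R g y))"
        by (intro Bochner_Integration.integrable_diff i1 i2 intD)
      show "integrable \<kappa> (\<lambda>y. (norm h)\<^sup>2 * (norm y ^ (k + 2) * exp ((norm \<theta> + \<delta>) * norm y)))"
        by (intro integrable_mult_right integrable_power_exp \<theta>\<delta>)
      fix y :: 'e
      have hy: "\<bar>h \<bullet> y\<bar> \<le> norm h * norm y" by (rule Cauchy_Schwarz_ineq2)
      have \<theta>y: "\<theta> \<bullet> y \<le> norm \<theta> * norm y" using Cauchy_Schwarz_ineq2[of \<theta> y] by simp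
      have "norm (exp (\<theta>' \<bullet> y) *\<^sub>R g y - exp (\<theta> \<bullet> y) *\<^sub>R g y - exp (\<theta> \<bullet> y) *\<^sub>R ((h \<bullet> y) *\<^sub>R g y))
        = norm ((exp (\<theta> \<bullet> y) * (exp (h \<bullet> y) - 1 - h \<bullet> y)) *\<^sub>R g y)"
        by (simp add: \<theta>' inner_add_left exp_add algebra_simps)
      also have "\<dots> = exp (\<theta> \<bullet> y) * \<bar>exp (h \<bullet> y) - 1 - h \<bullet> y\<bar> * norm (g y)"
        by (simp add: abs_mult)
      also have "\<dots> \<le> exp (norm \<theta> * norm y) * ((norm h * norm y)\<^sup>2 * exp (\<delta> * norm y)) * norm y ^ k"
      proof (intro mult_mono g)
        have "\<bar>exp (h \<bullet> y) - 1 - h \<bullet> y\<bar> \<le> (h \<bullet> y)\<^sup>2 * exp \<bar>h \<bullet> y\<bar>" by (rule exp_Taylor2)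
        also have "\<dots> \<le> (norm h * norm y)\<^sup>2 * exp (\<delta> * norm y)"
        proof (rule mult_mono)
          show "(h \<bullet> y)\<^sup>2 \<le> (norm h * norm y)\<^sup>2" using power_mono[OF hy, of 2] by simp
          have "norm h * norm y \<le> \<delta> * norm y" using h by (intro mult_right_mono) auto
          then show "exp \<bar>h \<bullet> y\<bar> \<le> exp (\<delta> * norm y)" using hy by simp
        qed auto
        finally show "\<bar>exp (h \<bullet> y) - 1 - h \<bullet> y\<bar> \<le> (norm h * norm y)\<^sup>2 * exp (\<delta> * norm y)" .
      qed (use \<theta>y in auto)
      also have "\<dots> = (norm h)\<^sup>2 * (norm y ^ (k + 2) * exp ((norm \<theta> + \<delta>) * norm y))"
        by (simp add: power_mult_distrib power_add distrib_right exp_add power2_eq_square)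
      finally show "norm (exp (\<theta>' \<bullet> y) *\<^sub>R g y - exp (\<theta> \<bullet> y) *\<^sub>R g y - exp (\<theta> \<bullet> y) *\<^sub>R ((h \<bullet> y) *\<^sub>R g y))
        \<le> (norm h)\<^sup>2 * (norm y ^ (k + 2) * exp ((norm \<theta> + \<delta>) * norm y))" .
    qed
    also have "\<dots> = (norm h)\<^sup>2 * C" unfolding C_def by (rule integral_mult_right_zero)
    finally have "norm ((?F \<theta>' - ?F \<theta>) - ?D (\<theta>' - \<theta>)) \<le> (norm h)\<^sup>2 * C" by (simp add: h_def)
    then have "norm ((?F \<theta>' - ?F \<theta>) - ?D (\<theta>' - \<theta>)) / norm h \<le> norm h * C"
      using h(2) by (simp add: divide_le_eq power2_eq_square ac_simps)
    then show "norm ((?F \<theta>' - ?F \<theta>) - ?D (\<theta>' - \<theta>)) / norm (\<theta>' - \<theta>) \<le> norm (\<theta>' - \<theta>) * C"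
      by (simp add: h_def)
  next
    have "((\<lambda>y. norm (y - \<theta>) * C) \<longlongrightarrow> norm (\<theta> - \<theta>) * C) (at \<theta>)"
      by (intro tendsto_intros)
    then show "((\<lambda>y. norm (y - \<theta>) * C) \<longlongrightarrow> 0) (at \<theta>)" by simp
  qed
qed

lemma grad_laplace:
  assumes "norm \<theta> < radius"
  shows "grad (laplace \<kappa>) \<theta> = (\<integral>y. exp (\<theta> \<bullet> y) *\<^sub>R y \<partial>\<kappa>)"
proof -
  have int: "integrable \<kappa> (\<lambda>y. exp (\<theta> \<bullet> y) *\<^sub>R y)"
    by (rule integrable_weighted[where k=1 and A=1, OF _ _ assms]) auto
  have "(laplace \<kappa> has_derivative (\<lambda>h. \<integral>y. exp (\<theta> \<bullet> y) *\<^sub>R ((h \<bullet> y) *\<^sub>R (1::real)) \<partial>\<kappa>)) (at \<theta>)"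
    using has_derivative_weighted[where g="\<lambda>y. 1::real" and k=0, OF _ _ assms] by (simp add: laplace_def[abs_def])
  moreover have "(\<integral>y. exp (\<theta> \<bullet> y) *\<^sub>R ((h \<bullet> y) *\<^sub>R (1::real)) \<partial>\<kappa>) = h \<bullet> (\<integral>y. exp (\<theta> \<bullet> y) *\<^sub>R y \<partial>\<kappa>)" for h
    using integral_inner_right[of h \<kappa>, OF int] by simp
  ultimately have G: "GDERIV (laplace \<kappa>) \<theta> :> (\<integral>y. exp (\<theta> \<bullet> y) *\<^sub>R y \<partial>\<kappa>)"
    by (simp add: gderiv_def)
  show ?thesis
    unfolding grad_def
  proof (rule the_equality)
    show "GDERIV (laplace \<kappa>) \<theta> :> (\<integral>y. exp (\<theta> \<bullet> y) *\<^sub>R y \<partial>\<kappa>)" by (rule G)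
  next
    fix D assume "GDERIV (laplace \<kappa>) \<theta> :> D"
    then have "(\<lambda>h. h \<bullet> D) = (\<lambda>h. h \<bullet> (\<integral>y. exp (\<theta> \<bullet> y) *\<^sub>R y \<partial>\<kappa>))"
      using G unfolding gderiv_def by (rule has_derivative_unique)
    then show "D = (\<integral>y. exp (\<theta> \<bullet> y) *\<^sub>R y \<partial>\<kappa>)"
      by (simp add: fun_eq_iff vector_eq_ldot)
  qed
qed

text \<open>
  Powers are dominated by half of the available exponent; \<open>exp \<bar>z\<bar> \<le> exp z +
  exp (- z)\<close> leads back to the transform.
\<close>

lemma coordinate_power_moment:
  assumes b: "b \<in> Basis"
  shows "integrable \<kappa> (\<lambda>y. \<bar>y \<bullet> b\<bar> ^ k * exp (\<rho> / 2 * \<bar>y \<bullet> b\<bar>))"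
    and "(\<integral>y. \<bar>y \<bullet> b\<bar> ^ k * exp (\<rho> / 2 * \<bar>y \<bullet> b\<bar>) \<partial>\<kappa>) \<le> fact k * (2 / \<rho>) ^ k * (laplace \<kappa> (\<rho> *\<^sub>R b) + laplace \<kappa> (- \<rho> *\<^sub>R b))"
proof -
  let ?g = "\<lambda>y. fact k * (2 / \<rho>) ^ k * (exp ((\<rho> *\<^sub>R b) \<bullet> y) + exp ((- \<rho> *\<^sub>R b) \<bullet> y))"
  have le: "\<bar>y \<bullet> b\<bar> ^ k * exp (\<rho> / 2 * \<bar>y \<bullet> b\<bar>) \<le> ?g y" for y
  proof -
    let ?z = "\<bar>y \<bullet> b\<bar>"
    have "(\<rho> / 2 * ?z) ^ k \<le> fact k * exp (\<rho> / 2 * ?z)"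
      using \<rho> by (intro power_le_fact_exp) auto
    then have "?z ^ k \<le> fact k * (2 / \<rho>) ^ k * exp (\<rho> / 2 * ?z)"
      using \<rho> by (simp add: power_mult_distrib power_divide field_simps)
    then have "?z ^ k * exp (\<rho> / 2 * ?z) \<le> fact k * (2 / \<rho>) ^ k * exp (\<rho> / 2 * ?z) * exp (\<rho> / 2 * ?z)"
      by (rule mult_right_mono) simp
    also have "\<dots> = fact k * (2 / \<rho>) ^ k * exp (\<rho> * ?z)"
      by (simp add: mult.assoc exp_add[symmetric])
    also have "\<dots> \<le> ?g y"
    proof (rule mult_left_mono)
      show "exp (\<rho> * ?z) \<le> exp ((\<rho> *\<^sub>R b) \<bullet> y) + exp ((- \<rho> *\<^sub>R b) \<bullet> y)"
        by (cases "0 \<le> y \<bullet> b") (auto simp: inner_commute)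
    qed (use \<rho> in auto)
    finally show ?thesis .
  qed
  have i: "integrable \<kappa> (\<lambda>y. exp ((\<rho> *\<^sub>R b) \<bullet> y))" "integrable \<kappa> (\<lambda>y. exp ((- \<rho> *\<^sub>R b) \<bullet> y))"
    by (rule integrable_exp, use b \<rho> in simp)+
  have ig: "integrable \<kappa> ?g"
    by (intro integrable_mult_right Bochner_Integration.integrable_add i)
  show int: "integrable \<kappa> (\<lambda>y. \<bar>y \<bullet> b\<bar> ^ k * exp (\<rho> / 2 * \<bar>y \<bullet> b\<bar>))"
  proof (rule Bochner_Integration.integrable_bound[OF ig])
    show "AE y in \<kappa>. norm (\<bar>y \<bullet> b\<bar> ^ k * exp (\<rho> / 2 * \<bar>y \<bullet> b\<bar>)) \<le> norm (?g y)"
    proof (rule AE_I2)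
      fix y
      have "norm (\<bar>y \<bullet> b\<bar> ^ k * exp (\<rho> / 2 * \<bar>y \<bullet> b\<bar>)) = \<bar>y \<bullet> b\<bar> ^ k * exp (\<rho> / 2 * \<bar>y \<bullet> b\<bar>)" by simp
      also have "\<dots> \<le> ?g y" by (rule le)
      also have "\<dots> \<le> norm (?g y)" by simp
      finally show "norm (\<bar>y \<bullet> b\<bar> ^ k * exp (\<rho> / 2 * \<bar>y \<bullet> b\<bar>)) \<le> norm (?g y)" .
    qed
  qed measurable
  have "(\<integral>y. \<bar>y \<bullet> b\<bar> ^ k * exp (\<rho> / 2 * \<bar>y \<bullet> b\<bar>) \<partial>\<kappa>) \<le> (\<integral>y. ?g y \<partial>\<kappa>)"
    by (rule integral_mono[OF int ig le])
  also have "\<dots> = fact k * (2 / \<rho>) ^ k * (laplace \<kappa> (\<rho> *\<^sub>R b) + laplace \<kappa> (- \<rho> *\<^sub>R b))"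
    unfolding integral_mult_right_zero laplace_def Bochner_Integration.integral_add[OF i] ..
  finally show "(\<integral>y. \<bar>y \<bullet> b\<bar> ^ k * exp (\<rho> / 2 * \<bar>y \<bullet> b\<bar>) \<partial>\<kappa>) \<le> fact k * (2 / \<rho>) ^ k * (laplace \<kappa> (\<rho> *\<^sub>R b) + laplace \<kappa> (- \<rho> *\<^sub>R b))" .
qed

lemma coordinate_moment:
  assumes b: "b \<in> Basis"
  shows "integrable \<kappa> (\<lambda>y. \<bar>y \<bullet> b\<bar> ^ k)"
    and "(\<integral>y. \<bar>y \<bullet> b\<bar> ^ k \<partial>\<kappa>) \<le> fact k * (2 / \<rho>) ^ k * (laplace \<kappa> (\<rho> *\<^sub>R b) + laplace \<kappa> (- \<rho> *\<^sub>R b))"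
proof -
  note cm = coordinate_power_moment[OF b, of k]
  have le: "\<bar>y \<bullet> b\<bar> ^ k \<le> \<bar>y \<bullet> b\<bar> ^ k * exp (\<rho> / 2 * \<bar>y \<bullet> b\<bar>)" for y
  proof -
    have "\<bar>y \<bullet> b\<bar> ^ k * 1 \<le> \<bar>y \<bullet> b\<bar> ^ k * exp (\<rho> / 2 * \<bar>y \<bullet> b\<bar>)"
      by (rule mult_left_mono) (use \<rho> in auto)
    then show ?thesis by simp
  qed
  show int: "integrable \<kappa> (\<lambda>y. \<bar>y \<bullet> b\<bar> ^ k)"
    by (rule Bochner_Integration.integrable_bound[OF cm(1)]) (use le in auto)
  show "(\<integral>y. \<bar>y \<bullet> b\<bar> ^ k \<partial>\<kappa>) \<le> fact k * (2 / \<rho>) ^ k * (laplace \<kappa> (\<rho> *\<^sub>R b) + laplace \<kappa> (- \<rho> *\<^sub>R b))"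
    using integral_mono[OF int cm(1) le] cm(2) by linarith
qed

text \<open>
  Laplace transforms converge uniformly but their second derivatives are not assumed to converge.
  The second difference recovers the second moment with an error that is controlled by values of
  the transform alone.
\<close>

lemma second_difference:
  assumes b: "b \<in> Basis" and h: "0 \<le> h" "h \<le> \<rho> / 2"
  shows "\<bar>laplace \<kappa> (h *\<^sub>R b) + laplace \<kappa> (- h *\<^sub>R b) - 2 * laplace \<kappa> 0 - h\<^sup>2 * (\<integral>y. (y \<bullet> b)\<^sup>2 \<partial>\<kappa>)\<bar>
    \<le> h ^ 4 * (24 * (2 / \<rho>) ^ 4 * (laplace \<kappa> (\<rho> *\<^sub>R b) + laplace \<kappa> (- \<rho> *\<^sub>R b)))"
proof -
  have nh: "norm (h *\<^sub>R b) \<le> \<rho>" "norm (- h *\<^sub>R b) \<le> \<rho>" using b h \<rho> by auto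
  have i: "integrable \<kappa> (\<lambda>y. exp ((h *\<^sub>R b) \<bullet> y))" "integrable \<kappa> (\<lambda>y. exp ((- h *\<^sub>R b) \<bullet> y))"
    "integrable \<kappa> (\<lambda>y. (y \<bullet> b)\<^sup>2)"
    using integrable_exp[OF nh(1)] integrable_exp[OF nh(2)] coordinate_moment(1)[OF b, of 2] by simp_all
  let ?f = "\<lambda>y. exp ((h *\<^sub>R b) \<bullet> y) + exp ((- h *\<^sub>R b) \<bullet> y) - 2 - h\<^sup>2 * (y \<bullet> b)\<^sup>2"
  have c2: "integrable \<kappa> (\<lambda>y. 2 :: real)" by (rule integrable_const)
  have eq: "laplace \<kappa> (h *\<^sub>R b) + laplace \<kappa> (- h *\<^sub>R b) - 2 * laplace \<kappa> 0 - h\<^sup>2 * (\<integral>y. (y \<bullet> b)\<^sup>2 \<partial>\<kappa>) = (\<integral>y. ?f y \<partial>\<kappa>)"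
    using i c2 by (simp add: laplace_def)
  have "norm (\<integral>y. ?f y \<partial>\<kappa>) \<le> (\<integral>y. h ^ 4 * (\<bar>y \<bullet> b\<bar> ^ 4 * exp (\<rho> / 2 * \<bar>y \<bullet> b\<bar>)) \<partial>\<kappa>)"
  proof (rule norm_integral_le)
    show "integrable \<kappa> ?f" using i c2 by simp
    show "integrable \<kappa> (\<lambda>y. h ^ 4 * (\<bar>y \<bullet> b\<bar> ^ 4 * exp (\<rho> / 2 * \<bar>y \<bullet> b\<bar>)))"
      by (intro integrable_mult_right coordinate_power_moment b)
    fix y :: 'e
    have "norm (?f y) = \<bar>exp (h * (y \<bullet> b)) + exp (- (h * (y \<bullet> b))) - 2 - (h * (y \<bullet> b))\<^sup>2\<bar>"
      by (simp add: inner_commute power_mult_distrib)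
    also have "\<dots> \<le> (h * (y \<bullet> b)) ^ 4 * exp \<bar>h * (y \<bullet> b)\<bar>" by (rule exp_symmetric_Taylor4)
    also have "\<dots> \<le> (h * (y \<bullet> b)) ^ 4 * exp (\<rho> / 2 * \<bar>y \<bullet> b\<bar>)"
    proof (rule mult_left_mono)
      have "\<bar>h * (y \<bullet> b)\<bar> \<le> \<rho> / 2 * \<bar>y \<bullet> b\<bar>" 
        using mult_right_mono[OF h(2), of "\<bar>y \<bullet> b\<bar>"] h(1) by (simp add: abs_mult)
      then show "exp \<bar>h * (y \<bullet> b)\<bar> \<le> exp (\<rho> / 2 * \<bar>y \<bullet> b\<bar>)" by simp
    qed simp
    also have "\<dots> = h ^ 4 * (\<bar>y \<bullet> b\<bar> ^ 4 * exp (\<rho> / 2 * \<bar>y \<bullet> b\<bar>))"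
      by (simp add: power_mult_distrib power_even_abs)
    finally show "norm (?f y) \<le> h ^ 4 * (\<bar>y \<bullet> b\<bar> ^ 4 * exp (\<rho> / 2 * \<bar>y \<bullet> b\<bar>))" .
  qed
  also have "\<dots> = h ^ 4 * (\<integral>y. \<bar>y \<bullet> b\<bar> ^ 4 * exp (\<rho> / 2 * \<bar>y \<bullet> b\<bar>) \<partial>\<kappa>)"
    by (rule integral_mult_right_zero)
  also have "\<dots> \<le> h ^ 4 * (24 * (2 / \<rho>) ^ 4 * (laplace \<kappa> (\<rho> *\<^sub>R b) + laplace \<kappa> (- \<rho> *\<^sub>R b)))"
    using coordinate_power_moment(2)[OF b, of 4] by (intro mult_left_mono) (auto simp: fact_numeral)
  finally show ?thesis unfolding eq by simp
qed

end

lemma drift_eq: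
  assumes "exponential_moments \<kappa> \<rho>"
  shows "drift \<kappa> = (\<integral>y. y \<partial>\<kappa>)"
proof -
  interpret exponential_moments \<kappa> \<rho> by (rule assms)
  show ?thesis using grad_laplace[of 0] radius_pos by (simp add: drift_def)
qed

lemma drift_component:
  fixes \<kappa> :: "(real^'n) measure"
  assumes "exponential_moments \<kappa> \<rho>"
  shows "integrable \<kappa> (\<lambda>y. y $ i)" and "drift \<kappa> $ i = (\<integral>y. y $ i \<partial>\<kappa>)"
proof -
  interpret exponential_moments \<kappa> \<rho> by (rule assms)
  have "integrable \<kappa> (\<lambda>y. y)" by (rule integrable_weight[where k=1 and A=1]) auto
  from integrable_inner_left[of "axis i 1", OF this] integral_inner_left[of "axis i 1", OF this]
  show "integrable \<kappa> (\<lambda>y. y $ i)" "drift \<kappa> $ i = (\<integral>y. y $ i \<partial>\<kappa>)"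
    by (simp_all add: drift_eq[OF assms] inner_axis)
qed

lemma diffusivity_component:
  fixes \<kappa> :: "(real^'n) measure"
  assumes "exponential_moments \<kappa> \<rho>"
  shows "diffusivity \<kappa> $ i $ j = (\<integral>y. y $ i * y $ j \<partial>\<kappa>)"
proof -
  interpret exponential_moments \<kappa> \<rho> by (rule assms)
  let ?D = "\<lambda>h. \<integral>y. (h \<bullet> y) *\<^sub>R y \<partial>\<kappa>"
  have "((\<lambda>\<theta>. \<integral>y. exp (\<theta> \<bullet> y) *\<^sub>R y \<partial>\<kappa>) has_derivative ?D) (at 0)"
    using has_derivative_weighted[where g="\<lambda>y. y" and k=1 and \<theta>=0] radius_pos by simp
  then have "(grad (laplace \<kappa>) has_derivative ?D) (at 0)"
  proof (rule has_derivative_transform_within_open)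
    show "open (ball 0 radius :: (real^'n) set)" by (rule open_ball)
    show "0 \<in> (ball 0 radius :: (real^'n) set)" using radius_pos by simp
    show "(\<integral>y. exp (\<theta> \<bullet> y) *\<^sub>R y \<partial>\<kappa>) = grad (laplace \<kappa>) \<theta>" if "\<theta> \<in> ball 0 radius" for \<theta>
      using that by (intro grad_laplace[symmetric]) simp
  qed
  then have "frechet_derivative (grad (laplace \<kappa>)) (at 0) = ?D"
    by (rule frechet_derivative_at[symmetric])
  then have eq: "diffusivity \<kappa> $ i $ j = ?D (axis j 1) $ i"
    by (simp add: diffusivity_def hess_def matrix_def)
  have int: "integrable \<kappa> (\<lambda>y. (axis j 1 \<bullet> y) *\<^sub>R y)"
  proof (rule integrable_weight[where k=2 and A=1])
    fix y :: "real^'n"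
    have "norm ((axis j 1 \<bullet> y) *\<^sub>R y) = \<bar>y $ j\<bar> * norm y" by (simp add: inner_axis')
    also have "\<dots> \<le> norm y ^ 2"
      using mult_right_mono[OF component_le_norm_cart[of y j], of "norm y"] by (simp add: power2_eq_square)
    finally show "norm ((axis j 1 \<bullet> y) *\<^sub>R y) \<le> 1 * norm y ^ 2" by simp
  qed measurable
  have "?D (axis j 1) $ i = ?D (axis j 1) \<bullet> axis i 1" by (simp add: inner_axis)
  also have "\<dots> = (\<integral>y. ((axis j 1 \<bullet> y) *\<^sub>R y) \<bullet> axis i 1 \<partial>\<kappa>)"
    by (rule integral_inner_left[symmetric]) (rule int)
  also have "\<dots> = (\<integral>y. y $ i * y $ j \<partial>\<kappa>)"
    by (rule Bochner_Integration.integral_cong[OF refl]) (simp add: inner_axis inner_axis' mult.commute)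
  finally show ?thesis using eq by (rule trans[rotated])
qed

section \<open>The characteristic function of the rescaled unstable coordinate\<close>

text \<open>
  The expansion of the cosine around an arbitrary phase \<open>\<xi>\<close>; the bound is uniform
  in \<open>\<xi>\<close>.
\<close>

lemma cos_Taylor3:
  fixes \<xi> z :: real
  shows "\<bar>cos (\<xi> + z) - (cos \<xi> - z * sin \<xi> - z\<^sup>2 / 2 * cos \<xi>)\<bar> \<le> \<bar>z\<bar> ^ 3"
proof -
  have "cmod (iexp z - (\<Sum>k\<le>2. (\<i> * z) ^ k / fact k)) \<le> \<bar>z\<bar> ^ Suc 2 / fact (Suc 2)"
    by (rule iexp_approx1)
  moreover have "(\<Sum>k\<le>2. (\<i> * z) ^ k / fact k) = 1 + \<i> * z - z\<^sup>2 / 2"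
  proof -
    have "{..2::nat} = {0, 1, 2}" by auto
    then show ?thesis by (simp add: power_mult_distrib)
  qed
  ultimately have le: "cmod (iexp z - (1 + \<i> * z - z\<^sup>2 / 2)) \<le> \<bar>z\<bar> ^ 3 / 6"
    by (simp add: eval_nat_numeral)
  have "cos (\<xi> + z) - (cos \<xi> - z * sin \<xi> - z\<^sup>2 / 2 * cos \<xi>) = Re (iexp \<xi> * (iexp z - (1 + \<i> * z - z\<^sup>2 / 2)))"
    by (simp add: Re_exp Im_exp cos_add algebra_simps power2_eq_square)
  also have "\<bar>\<dots>\<bar> \<le> cmod (iexp \<xi> * (iexp z - (1 + \<i> * z - z\<^sup>2 / 2)))" by (rule abs_Re_le_cmod)
  also have "\<dots> = cmod (iexp z - (1 + \<i> * z - z\<^sup>2 / 2))" by (simp add: norm_mult)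
  also have "\<dots> \<le> \<bar>z\<bar> ^ 3" using le zero_le_power[of "\<bar>z\<bar>" 3] by linarith
  finally show ?thesis .
qed

text \<open>
  \<open>a\<close> is the limiting variance rate of the second coordinate and \<open>A\<close> its
  discounted integral along the deterministic path. The parameters \<open>\<alpha>\<close> and
  \<open>\<tau>\<close> bound the error of the variance and the third absolute moment.
  Measurability of \<open>a\<close> is required only along the path; \<open>max 0 t\<close> keeps
  the path in \<open>S\<close> for negative times.
\<close>

locale saddle_clt = saddle_process M D \<kappa> x0 X J Y S lam \<mu> v \<beta>
  for M :: "'a measure" and D :: "(real^2) set" and \<kappa> x0 X J Y S lam \<mu> v \<beta> +
  fixes a :: "real^2 \<Rightarrow> real" and L n \<alpha> \<tau> :: real and A :: "real \<Rightarrow> real"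
  assumes n: "0 < n" and L: "0 \<le> L"
    and lipschitz: "\<And>x x'. x \<in> S \<Longrightarrow> x' \<in> S \<Longrightarrow> \<bar>a x - a x'\<bar> \<le> L * norm (x - x')"
    and path_in: "\<And>t. 0 \<le> t \<Longrightarrow> stable_path \<mu> x0 t \<in> S"
    and a_nonneg: "\<And>x. x \<in> S \<Longrightarrow> 0 \<le> a x"
    and a_limit: "\<And>x. x \<in> D \<inter> S \<Longrightarrow> \<bar>a x - n * (\<integral>y. (y $ 2)\<^sup>2 \<partial>\<kappa> x)\<bar> \<le> \<alpha>"
    and third_int: "\<And>x. x \<in> D \<inter> S \<Longrightarrow> integrable (\<kappa> x) (\<lambda>y. \<bar>y $ 2\<bar> ^ 3)"
    and third_le: "\<And>x. x \<in> D \<inter> S \<Longrightarrow> (\<integral>y. \<bar>y $ 2\<bar> ^ 3 \<partial>\<kappa> x) \<le> \<tau>"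
    and \<alpha>: "0 \<le> \<alpha>" and \<tau>: "0 \<le> \<tau>"
    and A_0: "A 0 = 0"
    and A_deriv: "\<And>t. 0 \<le> t \<Longrightarrow> (A has_real_derivative exp (- 2 * lam * t) * a (stable_path \<mu> x0 t)) (at t)"
    and A_meas: "A \<in> borel_measurable borel" "(\<lambda>t. a (stable_path \<mu> x0 (max 0 t))) \<in> borel_measurable borel"
begin

lemma A_mono:
  assumes "0 \<le> s" "s \<le> t"
  shows "A s \<le> A t"
proof (rule DERIV_nonneg_imp_nondecreasing[OF assms(2)])
  fix r assume "s \<le> r" "r \<le> t"
  then have r: "0 \<le> r" using assms(1) by simp
  have "0 \<le> exp (- 2 * lam * r) * a (stable_path \<mu> x0 r)"
    by (intro mult_nonneg_nonneg a_nonneg path_in r) simp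
  with A_deriv[OF r] show "\<exists>y. DERIV A r :> y \<and> 0 \<le> y" by blast
qed

text \<open>
  The factor that compensates the decay of the characteristic function.
\<close>

definition F :: "real \<Rightarrow> real \<Rightarrow> real" where "F u t = exp (u\<^sup>2 / 2 * A t)"

text \<open>
  The squared distance from the deterministic path.
\<close>

definition Q :: "real \<Rightarrow> real^2 \<Rightarrow> real" where
  "Q t x = (x $ 1 - exp (- \<mu> * t) * x0 $ 1)\<^sup>2 + (x $ 2)\<^sup>2"

definition B0 :: "real \<Rightarrow> real \<Rightarrow> real \<Rightarrow> real" where
  "B0 u \<delta> R = F u R * (u\<^sup>2 / 2) * L / \<delta> * exp ((2 * lam + 1) * R)"

definition err :: "real \<Rightarrow> real \<Rightarrow> real \<Rightarrow> real" where
  "err u \<delta> R = F u R * (\<bar>u * sqrt n\<bar> * \<beta> + \<bar>u * sqrt n\<bar> ^ 3 * \<tau> + u\<^sup>2 / 2 * (\<alpha> + L * \<delta>)) + B0 u \<delta> R * (R + 1) * (2 * \<beta>\<^sup>2 + 2 * v)"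

text \<open>
  The second summand is the approximate martingale. Its drift contains the difference of
  \<open>a\<close> at the state and on the path, which is at most \<open>L * (\<delta> + Q t x /
  \<delta>)\<close>. The coefficient of \<open>Q\<close> in the third summand decreases in time:
  the exponential compensates the growth of \<open>Q\<close> at the rate \<open>2 * lam +
  1\<close>, and the factor \<open>R + 1 - t\<close> gains another \<open>B0 * exp (- (2 * lam +
  1) * t) * Q\<close>, which by the choice of \<open>B0\<close> absorbs the term with \<open>Q /
  \<delta>\<close>. The last summand absorbs the remaining constant errors, and the constant
  \<open>F u R\<close> makes the sum nonnegative.
\<close>

definition W :: "real \<Rightarrow> real \<Rightarrow> real \<Rightarrow> real \<Rightarrow> real \<Rightarrow> real^2 \<Rightarrow> real^2 \<Rightarrow> real" where
  "W u \<phi> \<delta> R t x z = F u R + F u t * cos (u * sqrt n * exp (- lam * t) * x $ 2 + \<phi>)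
     + B0 u \<delta> R * exp (- (2 * lam + 1) * t) * (R + 1 - t) * Q t x + err u \<delta> R * (R - t)"

definition W' :: "real \<Rightarrow> real \<Rightarrow> real \<Rightarrow> real \<Rightarrow> real \<Rightarrow> real^2 \<Rightarrow> real^2 \<Rightarrow> real" where
  "W' u \<phi> \<delta> R t x z = F u t * (u\<^sup>2 / 2 * (exp (- 2 * lam * t) * a (stable_path \<mu> x0 (max 0 t)))) * cos (u * sqrt n * exp (- lam * t) * x $ 2 + \<phi>)
     + F u t * sin (u * sqrt n * exp (- lam * t) * x $ 2 + \<phi>) * (lam * (u * sqrt n) * exp (- lam * t) * x $ 2)
     + (- (2 * lam + 1) * (B0 u \<delta> R * exp (- (2 * lam + 1) * t) * (R + 1 - t)) - B0 u \<delta> R * exp (- (2 * lam + 1) * t)) * Q t x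
     + B0 u \<delta> R * exp (- (2 * lam + 1) * t) * (R + 1 - t) * (2 * (x $ 1 - exp (- \<mu> * t) * x0 $ 1) * (\<mu> * (exp (- \<mu> * t) * x0 $ 1)))
     - err u \<delta> R"

lemma F_pos: "0 < F u t" by (simp add: F_def)

lemma F_mono: "0 \<le> s \<Longrightarrow> s \<le> t \<Longrightarrow> F u s \<le> F u t"
  unfolding F_def using A_mono[of s t] by (simp add: mult_left_mono)

lemma F_0: "F u 0 = 1" by (simp add: F_def A_0)

lemma F_ge_1: "0 \<le> t \<Longrightarrow> 1 \<le> F u t" using F_mono[of 0 t u] by (simp add: F_0)

lemma Q_nonneg: "0 \<le> Q t x" by (simp add: Q_def)

lemma B0_nonneg: "0 < \<delta> \<Longrightarrow> 0 \<le> B0 u \<delta> R"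
  unfolding B0_def using L F_pos[of u R] by (intro mult_nonneg_nonneg divide_nonneg_nonneg) auto

lemma err_nonneg: "0 < \<delta> \<Longrightarrow> 0 \<le> R \<Longrightarrow> 0 \<le> err u \<delta> R"
  unfolding err_def using L F_pos[of u R] B0_nonneg[of \<delta> u R] \<alpha> \<tau> \<beta> v
  by (intro add_nonneg_nonneg mult_nonneg_nonneg) auto

lemma norm_path_sq: "(norm (x - stable_path \<mu> x0 t))\<^sup>2 = Q t x"
  by (simp add: norm_sq_2 stable_path_def x02 Q_def)

lemma W_lower:
  assumes "0 < \<delta>" "0 \<le> t" "t \<le> R"
  shows "F u R + F u t * cos (u * sqrt n * exp (- lam * t) * x $ 2 + \<phi>) \<le> W u \<phi> \<delta> R t x z"
proof -
  have "0 \<le> B0 u \<delta> R * exp (- (2 * lam + 1) * t) * (R + 1 - t) * Q t x"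
    using assms B0_nonneg[of \<delta> u R] Q_nonneg[of t x] by (intro mult_nonneg_nonneg) auto
  moreover have "0 \<le> err u \<delta> R * (R - t)"
    using assms err_nonneg[of \<delta> R u] by (intro mult_nonneg_nonneg) auto
  ultimately show ?thesis unfolding W_def by linarith
qed

lemma W_nonneg:
  assumes "0 < \<delta>" "0 \<le> t" "t \<le> R"
  shows "0 \<le> W u \<phi> \<delta> R t x z"
proof -
  let ?c = "cos (u * sqrt n * exp (- lam * t) * x $ 2 + \<phi>)"
  have "F u t * (- 1) \<le> F u t * ?c" using F_pos[of u t] by (intro mult_left_mono) auto
  moreover have "F u t \<le> F u R" by (rule F_mono[OF assms(2,3)])
  ultimately show ?thesis using W_lower[OF assms, of u x \<phi> z] by linarith
qed

lemma F_derivative: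
  assumes "0 \<le> t"
  shows "((\<lambda>t. F u t) has_real_derivative F u t * (u\<^sup>2 / 2 * (exp (- 2 * lam * t) * a (stable_path \<mu> x0 t)))) (at t)"
  unfolding F_def by (rule DERIV_cong[OF DERIV_fun_exp[OF DERIV_cmult[OF A_deriv[OF assms]]]]) simp

lemma W_derivative:
  assumes t: "0 \<le> t"
  shows "((\<lambda>t. W u \<phi> \<delta> R t x z) has_real_derivative W' u \<phi> \<delta> R t x z) (at t)"
proof -
  have Q': "((\<lambda>t. Q t x) has_real_derivative 2 * (x $ 1 - exp (- \<mu> * t) * x0 $ 1) * (\<mu> * (exp (- \<mu> * t) * x0 $ 1))) (at t)"
    unfolding Q_def by (auto intro!: derivative_eq_intros)
  have cos': "((\<lambda>t. cos (u * sqrt n * exp (- lam * t) * x $ 2 + \<phi>)) has_real_derivative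
      sin (u * sqrt n * exp (- lam * t) * x $ 2 + \<phi>) * (lam * (u * sqrt n) * exp (- lam * t) * x $ 2)) (at t)"
    by (auto intro!: derivative_eq_intros simp: algebra_simps)
  have b': "((\<lambda>t. B0 u \<delta> R * exp (- (2 * lam + 1) * t) * (R + 1 - t)) has_real_derivative
      - (2 * lam + 1) * (B0 u \<delta> R * exp (- (2 * lam + 1) * t) * (R + 1 - t)) - B0 u \<delta> R * exp (- (2 * lam + 1) * t)) (at t)"
    by (auto intro!: derivative_eq_intros simp: algebra_simps)
  have err': "((\<lambda>t. err u \<delta> R * (R - t)) has_real_derivative - err u \<delta> R) (at t)"
    by (auto intro!: derivative_eq_intros)
  have "max 0 t = t" using t by simp
  then show ?thesis
    unfolding W_def W'_def
    by (intro DERIV_cong[OF DERIV_add[OF DERIV_add[OF DERIV_add[OF DERIV_const DERIV_mult[OF F_derivative[OF t] cos']] DERIV_mult[OF b' Q']] err']])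
      (simp add: algebra_simps)
qed

text \<open>
  Second-order expansion of the phase under a jump; only the third moment enters the error.
\<close>

lemma cos_jump_integral:
  assumes x: "x \<in> D \<inter> S"
  shows "integrable (\<kappa> x) (\<lambda>y. cos (\<xi> + \<eta> * y $ 2))"
    and "(\<integral>y. cos (\<xi> + \<eta> * y $ 2) \<partial>\<kappa> x) \<le> measure (\<kappa> x) UNIV * cos \<xi> - sin \<xi> * \<eta> * (\<integral>y. y $ 2 \<partial>\<kappa> x)
      - cos \<xi> * (\<eta>\<^sup>2 / 2) * (\<integral>y. (y $ 2)\<^sup>2 \<partial>\<kappa> x) + \<bar>\<eta>\<bar> ^ 3 * \<tau>"
proof -
  interpret k: finite_measure "\<kappa> x" using kernel_fin x by blast
  have sp: "space (\<kappa> x) = UNIV" and [measurable_cong]: "sets (\<kappa> x) = sets borel" using kernel_fin x by blast+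
  note m1 = mean_int[OF x, of 2] and m2 = var_int[OF x, of 2] and m3 = third_int[OF x]
  show i: "integrable (\<kappa> x) (\<lambda>y. cos (\<xi> + \<eta> * y $ 2))"
    by (rule k.integrable_const_bound[where B=1]) auto
  let ?g = "\<lambda>y::real^2. cos \<xi> + (- sin \<xi> * \<eta>) * y $ 2 + (- cos \<xi> * (\<eta>\<^sup>2 / 2)) * (y $ 2)\<^sup>2 + \<bar>\<eta>\<bar> ^ 3 * \<bar>y $ 2\<bar> ^ 3"
  have c: "integrable (\<kappa> x) (\<lambda>y. cos \<xi>)" by (rule k.integrable_const)
  have ig: "integrable (\<kappa> x) ?g" using c m1 m2 m3 by simp
  have "(\<integral>y. cos (\<xi> + \<eta> * y $ 2) \<partial>\<kappa> x) \<le> (\<integral>y. ?g y \<partial>\<kappa> x)"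
  proof (rule Bochner_Integration.integral_mono[OF i ig])
    fix y :: "real^2"
    have "cos (\<xi> + \<eta> * y $ 2) - (cos \<xi> - \<eta> * y $ 2 * sin \<xi> - (\<eta> * y $ 2)\<^sup>2 / 2 * cos \<xi>) \<le> \<bar>\<eta> * y $ 2\<bar> ^ 3"
      using cos_Taylor3[of \<xi> "\<eta> * y $ 2"] by linarith
    then show "cos (\<xi> + \<eta> * y $ 2) \<le> ?g y"
      by (simp add: abs_mult power_mult_distrib algebra_simps)
  qed
  also have "\<dots> = measure (\<kappa> x) UNIV * cos \<xi> + (- sin \<xi> * \<eta>) * (\<integral>y. y $ 2 \<partial>\<kappa> x)
      + (- cos \<xi> * (\<eta>\<^sup>2 / 2)) * (\<integral>y. (y $ 2)\<^sup>2 \<partial>\<kappa> x) + \<bar>\<eta>\<bar> ^ 3 * (\<integral>y. \<bar>y $ 2\<bar> ^ 3 \<partial>\<kappa> x)"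
    using c m1 m2 m3 by (simp add: sp)
  also have "\<dots> \<le> measure (\<kappa> x) UNIV * cos \<xi> + (- sin \<xi> * \<eta>) * (\<integral>y. y $ 2 \<partial>\<kappa> x)
      + (- cos \<xi> * (\<eta>\<^sup>2 / 2)) * (\<integral>y. (y $ 2)\<^sup>2 \<partial>\<kappa> x) + \<bar>\<eta>\<bar> ^ 3 * \<tau>"
    using third_le[OF x] by (intro add_left_mono mult_left_mono) auto
  finally show "(\<integral>y. cos (\<xi> + \<eta> * y $ 2) \<partial>\<kappa> x) \<le> measure (\<kappa> x) UNIV * cos \<xi> - sin \<xi> * \<eta> * (\<integral>y. y $ 2 \<partial>\<kappa> x)
      - cos \<xi> * (\<eta>\<^sup>2 / 2) * (\<integral>y. (y $ 2)\<^sup>2 \<partial>\<kappa> x) + \<bar>\<eta>\<bar> ^ 3 * \<tau>" by simp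
qed

text \<open>
  The squared distance grows at most at the rate \<open>2 * lam + 1\<close> plus a constant:
  \<open>2 * lam\<close> stems from the unstable direction and 1 from separating the drift error
  by the inequality of arithmetic and geometric means.
\<close>

lemma Q_jump_integral:
  assumes x: "x \<in> D \<inter> S"
  shows "integrable (\<kappa> x) (\<lambda>y. Q t (x + y))"
    and "(\<integral>y. Q t (x + y) \<partial>\<kappa> x) + 2 * (x $ 1 - exp (- \<mu> * t) * x0 $ 1) * (\<mu> * (exp (- \<mu> * t) * x0 $ 1))
      \<le> measure (\<kappa> x) UNIV * Q t x + (2 * lam + 1) * Q t x + 2 * \<beta>\<^sup>2 + 2 * v"
proof -
  interpret k: finite_measure "\<kappa> x" using kernel_fin x by blast
  have sp: "space (\<kappa> x) = UNIV" using kernel_fin x by blast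
  let ?xt = "exp (- \<mu> * t) * x0 $ 1"
  let ?g = "x $ 1 - ?xt" and ?h = "x $ 2"
  let ?m1 = "\<integral>y. y $ 1 \<partial>\<kappa> x" and ?m2 = "\<integral>y. y $ 2 \<partial>\<kappa> x"
  note q1 = quadratic_moment[OF k.finite_measure_axioms sp mean_int[OF x] var_int[OF x], where p="?g" and a=1 and i=1]
  note q2 = quadratic_moment[OF k.finite_measure_axioms sp mean_int[OF x] var_int[OF x], where p="?h" and a=1 and i=2]
  have eq: "Q t (x + y) = (?g + 1 * (y $ 1))\<^sup>2 + (?h + 1 * (y $ 2))\<^sup>2" for y
    by (simp add: Q_def algebra_simps)
  show "integrable (\<kappa> x) (\<lambda>y. Q t (x + y))" unfolding eq using q1(1) q2(1) by simp
  have int: "(\<integral>y. Q t (x + y) \<partial>\<kappa> x) = (measure (\<kappa> x) UNIV * ?g\<^sup>2 + 2 * ?g * 1 * ?m1 + 1\<^sup>2 * (\<integral>y. (y $ 1)\<^sup>2 \<partial>\<kappa> x))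
      + (measure (\<kappa> x) UNIV * ?h\<^sup>2 + 2 * ?h * 1 * ?m2 + 1\<^sup>2 * (\<integral>y. (y $ 2)\<^sup>2 \<partial>\<kappa> x))"
    unfolding eq by (subst Bochner_Integration.integral_add[OF q1(1) q2(1)]) (simp only: q1(2) q2(2))
  define g h xt m1 m2 where "g = ?g" and "h = ?h" and "xt = ?xt" and "m1 = ?m1" and "m2 = ?m2"
  define q v1 v2 where "q = measure (\<kappa> x) UNIV" and "v1 = (\<integral>y. (y $ 1)\<^sup>2 \<partial>\<kappa> x)" and "v2 = (\<integral>y. (y $ 2)\<^sup>2 \<partial>\<kappa> x)"
  define e1 e2 where "e1 = m1 + \<mu> * (g + xt)" and "e2 = m2 - lam * h"
  have Qx: "Q t x = g\<^sup>2 + h\<^sup>2" by (simp add: Q_def g_def h_def xt_def)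
  have v12: "v1 \<le> v" "v2 \<le> v" using var_le[OF x] by (simp_all add: v1_def v2_def)
  have "\<bar>e1\<bar> \<le> \<beta>" "\<bar>e2\<bar> \<le> \<beta>"
    using drift1[OF x] drift2[OF x] by (simp_all add: e1_def e2_def m1_def m2_def g_def h_def xt_def)
  then have "2 * g * e1 \<le> 1 * g\<^sup>2 + \<beta>\<^sup>2 / 1" "2 * h * e2 \<le> 1 * h\<^sup>2 + \<beta>\<^sup>2 / 1"
    by (intro square_AM_GM; simp)+
  moreover have "2 * g * m1 + 2 * g * (\<mu> * xt) = 2 * g * e1 - 2 * (\<mu> * g\<^sup>2)"
    by (simp add: e1_def power2_eq_square algebra_simps)
  moreover have "2 * h * m2 = 2 * h * e2 + 2 * (lam * h\<^sup>2)"
    by (simp add: e2_def power2_eq_square algebra_simps)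
  moreover have "0 \<le> \<mu> * g\<^sup>2" "0 \<le> lam * g\<^sup>2" using \<mu> lam by auto
  ultimately have "2 * g * m1 + v1 + 2 * h * m2 + v2 + 2 * g * (\<mu> * xt) \<le> (g\<^sup>2 + h\<^sup>2) + 2 * (lam * g\<^sup>2) + 2 * (lam * h\<^sup>2) + 2 * \<beta>\<^sup>2 + 2 * v"
    using v12 by linarith
  also have "\<dots> = (2 * lam + 1) * (g\<^sup>2 + h\<^sup>2) + 2 * \<beta>\<^sup>2 + 2 * v" by (simp add: algebra_simps)
  finally have "(q * g\<^sup>2 + 2 * g * 1 * m1 + 1\<^sup>2 * v1) + (q * h\<^sup>2 + 2 * h * 1 * m2 + 1\<^sup>2 * v2) + 2 * g * (\<mu> * xt)
      \<le> q * (g\<^sup>2 + h\<^sup>2) + (2 * lam + 1) * (g\<^sup>2 + h\<^sup>2) + 2 * \<beta>\<^sup>2 + 2 * v"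
    by (simp add: distrib_left)
  then show "(\<integral>y. Q t (x + y) \<partial>\<kappa> x) + 2 * ?g * (\<mu> * ?xt)
      \<le> measure (\<kappa> x) UNIV * Q t x + (2 * lam + 1) * Q t x + 2 * \<beta>\<^sup>2 + 2 * v"
    unfolding int Qx g_def h_def xt_def m1_def m2_def q_def v1_def v2_def .
qed

text \<open>
  The drift of the second coordinate cancels against the derivative of \<open>exp (- lam *
  t)\<close>, and the jump variance against the derivative of \<open>F\<close>; what remains are
  the errors of drift, third order, variance limit and position.
\<close>

lemma phase_drift_bound:
  fixes u :: real
  assumes x: "x \<in> D \<inter> S" and t: "0 \<le> t" and \<delta>: "0 < \<delta>"
  defines "\<eta> \<equiv> u * sqrt n * exp (- lam * t)"
  shows "- sin \<xi> * \<eta> * (\<integral>y. y $ 2 \<partial>\<kappa> x) - cos \<xi> * (\<eta>\<^sup>2 / 2) * (\<integral>y. (y $ 2)\<^sup>2 \<partial>\<kappa> x) + \<bar>\<eta>\<bar> ^ 3 * \<tau>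
     + u\<^sup>2 / 2 * (exp (- 2 * lam * t) * a (stable_path \<mu> x0 t)) * cos \<xi> + sin \<xi> * (lam * (u * sqrt n) * exp (- lam * t) * x $ 2)
     \<le> \<bar>u * sqrt n\<bar> * \<beta> + \<bar>u * sqrt n\<bar> ^ 3 * \<tau> + u\<^sup>2 / 2 * (\<alpha> + L * \<delta>) + u\<^sup>2 / 2 * L / \<delta> * Q t x"
proof -
  let ?U = "u * sqrt n" and ?E = "exp (- lam * t)" and ?m = "\<integral>y. y $ 2 \<partial>\<kappa> x" and ?m2 = "\<integral>y. (y $ 2)\<^sup>2 \<partial>\<kappa> x"
  let ?at = "a (stable_path \<mu> x0 t)"
  have E: "0 < ?E" "?E \<le> 1" using t lam by auto
  have \<eta>U: "\<bar>\<eta>\<bar> \<le> \<bar>?U\<bar>"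
    using mult_left_mono[OF E(2), of "\<bar>?U\<bar>"] E by (simp add: \<eta>_def abs_mult)
  have "- sin \<xi> * \<eta> * (?m - lam * x $ 2) \<le> \<bar>?U\<bar> * \<beta>"
  proof -
    have "- sin \<xi> * \<eta> * (?m - lam * x $ 2) \<le> \<bar>sin \<xi>\<bar> * \<bar>\<eta>\<bar> * \<bar>?m - lam * x $ 2\<bar>"
      using abs_ge_self[of "- sin \<xi> * \<eta> * (?m - lam * x $ 2)"] by (simp only: abs_mult abs_minus_cancel)
    also have "\<dots> \<le> 1 * \<bar>?U\<bar> * \<beta>" using drift2[OF x] \<eta>U by (intro mult_mono) auto
    finally show ?thesis by simp
  qed
  moreover have "- sin \<xi> * \<eta> * ?m + sin \<xi> * (lam * ?U * ?E * x $ 2) = - sin \<xi> * \<eta> * (?m - lam * x $ 2)"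
    by (simp add: \<eta>_def algebra_simps)
  moreover have "\<bar>\<eta>\<bar> ^ 3 * \<tau> \<le> \<bar>?U\<bar> ^ 3 * \<tau>"
    using \<eta>U \<tau> by (intro mult_right_mono power_mono) auto
  moreover have "- cos \<xi> * (\<eta>\<^sup>2 / 2) * ?m2 + u\<^sup>2 / 2 * (exp (- 2 * lam * t) * ?at) * cos \<xi>
     \<le> u\<^sup>2 / 2 * (\<alpha> + L * \<delta>) + u\<^sup>2 / 2 * L / \<delta> * Q t x"
  proof -
    have E2: "exp (- 2 * lam * t) = ?E\<^sup>2" by (simp add: power2_eq_square exp_add[symmetric])
    have "- cos \<xi> * (\<eta>\<^sup>2 / 2) * ?m2 + u\<^sup>2 / 2 * (exp (- 2 * lam * t) * ?at) * cos \<xi>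
      = u\<^sup>2 / 2 * (cos \<xi> * ?E\<^sup>2 * (?at - n * ?m2))"
      unfolding E2 \<eta>_def using n by (simp add: power_mult_distrib algebra_simps)
    also have "\<dots> \<le> u\<^sup>2 / 2 * (\<alpha> + L * (\<delta> + Q t x / \<delta>))"
    proof (rule mult_left_mono)
      have "norm (stable_path \<mu> x0 t - x) \<le> \<delta> + Q t x / \<delta>"
      proof -
        let ?d = "norm (x - stable_path \<mu> x0 t)"
        have "2 * 1 * ?d \<le> \<delta> * 1\<^sup>2 + ?d\<^sup>2 / \<delta>" by (rule square_AM_GM[OF \<delta>]) simp
        then have "2 * ?d \<le> \<delta> + ?d\<^sup>2 / \<delta>" by simp
        moreover have "?d \<le> 2 * ?d" by simp
        ultimately have "?d \<le> \<delta> + ?d\<^sup>2 / \<delta>" by (rule order_trans[rotated])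
        then show ?thesis by (simp add: norm_path_sq norm_minus_commute)
      qed
      then have "L * norm (stable_path \<mu> x0 t - x) \<le> L * (\<delta> + Q t x / \<delta>)" by (rule mult_left_mono[OF _ L])
      then have b: "\<bar>?at - n * ?m2\<bar> \<le> \<alpha> + L * (\<delta> + Q t x / \<delta>)"
        using lipschitz[OF path_in[OF t], of x] a_limit[OF x] x by auto
      have "cos \<xi> * ?E\<^sup>2 * (?at - n * ?m2) \<le> \<bar>cos \<xi>\<bar> * ?E\<^sup>2 * \<bar>?at - n * ?m2\<bar>"
        using abs_ge_self[of "cos \<xi> * ?E\<^sup>2 * (?at - n * ?m2)"] by (simp add: abs_mult)
      also have "\<dots> \<le> 1 * 1 * (\<alpha> + L * (\<delta> + Q t x / \<delta>))"
        using b E by (intro mult_mono) (auto simp: power_le_one)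
      finally show "cos \<xi> * ?E\<^sup>2 * (?at - n * ?m2) \<le> \<alpha> + L * (\<delta> + Q t x / \<delta>)" by simp
    qed simp
    also have "\<dots> = u\<^sup>2 / 2 * (\<alpha> + L * \<delta>) + u\<^sup>2 / 2 * L / \<delta> * Q t x" by (simp add: field_simps)
    finally show ?thesis .
  qed
  ultimately show ?thesis by linarith
qed

lemma W_generator:
  assumes x: "x \<in> D \<inter> S" and t: "0 \<le> t" "t \<le> R" and \<delta>: "0 < \<delta>"
  shows "integrable (\<kappa> x) (\<lambda>y. W u \<phi> \<delta> R t (x + y) z')"
    and "(\<integral>y. W u \<phi> \<delta> R t (x + y) z' \<partial>\<kappa> x) \<le> measure (\<kappa> x) UNIV * W u \<phi> \<delta> R t x z - W' u \<phi> \<delta> R t x z"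
proof -
  interpret k: finite_measure "\<kappa> x" using kernel_fin x by blast
  have sp: "space (\<kappa> x) = UNIV" using kernel_fin x by blast
  define \<eta> where "\<eta> = u * sqrt n * exp (- lam * t)"
  define \<xi> where "\<xi> = \<eta> * x $ 2 + \<phi>"
  define b where "b = B0 u \<delta> R * exp (- (2 * lam + 1) * t)"
  define f where "f = F u t"
  define q where "q = measure (\<kappa> x) UNIV"
  define G where "G = 2 * (x $ 1 - exp (- \<mu> * t) * x0 $ 1) * (\<mu> * (exp (- \<mu> * t) * x0 $ 1))"
  define IQ where "IQ = (\<integral>y. Q t (x + y) \<partial>\<kappa> x)"
  define Ic where "Ic = (\<integral>y. cos (\<xi> + \<eta> * y $ 2) \<partial>\<kappa> x)"
  define P where "P = u\<^sup>2 / 2 * (exp (- 2 * lam * t) * a (stable_path \<mu> x0 t)) * cos \<xi> + sin \<xi> * (lam * (u * sqrt n) * exp (- lam * t) * x $ 2)"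
  define c where "c = F u R + err u \<delta> R * (R - t)"
  have eq: "W u \<phi> \<delta> R t (x + y) z' = c + f * cos (\<xi> + \<eta> * y $ 2) + b * (R + 1 - t) * Q t (x + y)" for y
    by (simp add: W_def c_def f_def b_def \<xi>_def \<eta>_def algebra_simps)
  note ic = cos_jump_integral[OF x, of \<xi> \<eta>] and iq = Q_jump_integral[OF x, of t]
  have cc: "integrable (\<kappa> x) (\<lambda>y. c)" by (rule k.integrable_const)
  show "integrable (\<kappa> x) (\<lambda>y. W u \<phi> \<delta> R t (x + y) z')"
    unfolding eq using ic(1) iq(1) cc by simp
  have int: "(\<integral>y. W u \<phi> \<delta> R t (x + y) z' \<partial>\<kappa> x) = q * c + f * Ic + b * (R + 1 - t) * IQ"
    unfolding eq Ic_def IQ_def q_def using ic(1) iq(1) cc by (simp add: sp)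
  have f: "0 < f" "f \<le> F u R" unfolding f_def using F_pos F_mono[OF t] by auto
  have b0: "0 \<le> b" unfolding b_def using B0_nonneg[OF \<delta>] by simp
  have bB: "b \<le> B0 u \<delta> R"
  proof -
    have "- (2 * lam + 1) * t \<le> 0" by (rule mult_nonpos_nonneg) (use lam t in auto)
    then have "exp (- (2 * lam + 1) * t) \<le> 1" by (simp only: exp_le_one_iff)
    from mult_left_mono[OF this B0_nonneg[OF \<delta>, of u R]] show ?thesis unfolding b_def by simp
  qed
  define K where "K = \<bar>u * sqrt n\<bar> * \<beta> + \<bar>u * sqrt n\<bar> ^ 3 * \<tau> + u\<^sup>2 / 2 * (\<alpha> + L * \<delta>)"
  have K0: "0 \<le> K" unfolding K_def using \<beta> \<tau> \<alpha> L \<delta> by (intro add_nonneg_nonneg mult_nonneg_nonneg) auto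
  have KQ: "0 \<le> u\<^sup>2 / 2 * L / \<delta> * Q t x" using L \<delta> Q_nonneg[of t x] by simp
  have "Ic - q * cos \<xi> + P \<le> K + u\<^sup>2 / 2 * L / \<delta> * Q t x"
    using ic(2) phase_drift_bound[OF x t(1) \<delta>, of \<xi> u] unfolding Ic_def q_def P_def K_def \<eta>_def by linarith
  then have "f * (Ic - q * cos \<xi> + P) \<le> f * (K + u\<^sup>2 / 2 * L / \<delta> * Q t x)" using f by (intro mult_left_mono) auto
  also have "\<dots> \<le> F u R * (K + u\<^sup>2 / 2 * L / \<delta> * Q t x)" using f K0 KQ by (intro mult_right_mono) auto
  also have "\<dots> = F u R * K + F u R * (u\<^sup>2 / 2 * L / \<delta> * Q t x)" by (simp add: distrib_left)
  also have "F u R * (u\<^sup>2 / 2 * L / \<delta> * Q t x) \<le> b * Q t x"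
  proof -
    have "F u R * (u\<^sup>2 / 2) * L / \<delta> * 1 \<le> F u R * (u\<^sup>2 / 2) * L / \<delta> * exp ((2 * lam + 1) * (R - t))"
      using t lam L \<delta> F_pos[of u R] by (intro mult_left_mono) auto
    also have "\<dots> = b" unfolding b_def B0_def by (simp add: exp_add[symmetric] algebra_simps)
    finally have "F u R * (u\<^sup>2 / 2) * L / \<delta> * 1 * Q t x \<le> b * Q t x" using Q_nonneg by (intro mult_right_mono) auto
    then show ?thesis by (simp add: algebra_simps)
  qed
  finally have 1: "f * (Ic - q * cos \<xi> + P) \<le> F u R * K + b * Q t x" by simp
  have "b * (R + 1 - t) * (IQ + G - q * Q t x) \<le> b * (R + 1 - t) * ((2 * lam + 1) * Q t x + (2 * \<beta>\<^sup>2 + 2 * v))"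
    using iq(2) b0 t unfolding IQ_def G_def q_def by (intro mult_left_mono mult_nonneg_nonneg) auto
  moreover have "b * (R + 1 - t) * (2 * \<beta>\<^sup>2 + 2 * v) \<le> B0 u \<delta> R * (R + 1) * (2 * \<beta>\<^sup>2 + 2 * v)"
    using bB b0 t v B0_nonneg[OF \<delta>, of u R] by (intro mult_right_mono mult_mono) auto
  ultimately have 2: "b * (R + 1 - t) * (IQ + G - q * Q t x) \<le> (2 * lam + 1) * (b * (R + 1 - t)) * Q t x + B0 u \<delta> R * (R + 1) * (2 * \<beta>\<^sup>2 + 2 * v)"
    by (simp add: algebra_simps)
  have err: "err u \<delta> R = F u R * K + B0 u \<delta> R * (R + 1) * (2 * \<beta>\<^sup>2 + 2 * v)" by (simp add: err_def K_def)
  have W: "W u \<phi> \<delta> R t x z = c + f * cos \<xi> + b * (R + 1 - t) * Q t x"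
    by (simp add: W_def c_def f_def b_def \<xi>_def \<eta>_def algebra_simps)
  have W': "W' u \<phi> \<delta> R t x z = f * P + (- (2 * lam + 1) * (b * (R + 1 - t)) - b) * Q t x + b * (R + 1 - t) * G - err u \<delta> R"
    using t by (simp add: W'_def f_def P_def b_def G_def \<xi>_def \<eta>_def algebra_simps)
  show "(\<integral>y. W u \<phi> \<delta> R t (x + y) z' \<partial>\<kappa> x) \<le> measure (\<kappa> x) UNIV * W u \<phi> \<delta> R t x z - W' u \<phi> \<delta> R t x z"
    unfolding int W W' q_def[symmetric] using 1 2 err by (simp add: algebra_simps)
qed

lemma W_superharmonic:
  assumes \<delta>: "0 < \<delta>"
  shows "superharmonic S r R (W u \<phi> \<delta> R) (W' u \<phi> \<delta> R)"
  unfolding superharmonic_def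
proof (intro conjI ballI allI impI)
  show "0 \<le> W u \<phi> \<delta> R t x z" if "t \<in> {0..R}" for t x z
    by (rule W_nonneg[OF \<delta>]) (use that in simp_all)
  note [measurable] = A_meas
  show "(\<lambda>(t, x, z). W u \<phi> \<delta> R t x z) \<in> borel_measurable (borel \<Otimes>\<^sub>M (borel \<Otimes>\<^sub>M borel))"
    unfolding W_def F_def Q_def split_beta' by measurable
  show "(\<lambda>t. W' u \<phi> \<delta> R t x z) \<in> borel_measurable borel" for x z
    unfolding W'_def F_def Q_def by measurable
next
  fix x z t assume x: "x \<in> D \<inter> S" and t: "t \<in> {0..R}"
  then have t0: "0 \<le> t" "t \<le> R" by auto
  show "((\<lambda>t. W u \<phi> \<delta> R t x z) has_real_derivative W' u \<phi> \<delta> R t x z) (at t)" by (rule W_derivative[OF t0(1)])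
  have z_irrelevant: "(\<lambda>y. W u \<phi> \<delta> R t (x + y) (if t \<le> r then x + y else z)) = (\<lambda>y. W u \<phi> \<delta> R t (x + y) z)" by (simp add: W_def)
  show "integrable (\<kappa> x) (\<lambda>y. W u \<phi> \<delta> R t (x + y) (if t \<le> r then x + y else z))"
    unfolding z_irrelevant by (rule W_generator(1)[OF x t0 \<delta>])
  show "(\<integral>y. W u \<phi> \<delta> R t (x + y) (if t \<le> r then x + y else z) \<partial>\<kappa> x) \<le> measure (\<kappa> x) UNIV * W u \<phi> \<delta> R t x z - W' u \<phi> \<delta> R t x z"
    unfolding z_irrelevant by (rule W_generator(2)[OF x t0 \<delta>])
qed

definition phase :: "real \<Rightarrow> real \<Rightarrow> 'a \<Rightarrow> real" where
  "phase u t w = u * sqrt n * exp (- lam * clock t w) * state t w $ 2"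

lemma phase_measurable: "0 \<le> t \<Longrightarrow> phase u t \<in> borel_measurable M"
  unfolding phase_def
  by (intro borel_measurable_times borel_measurable_const measurable_compose[OF clock_measurable]
      measurable_compose[OF state_measurable vec_nth_borel]) simp_all

lemma F_clock_measurable: "0 \<le> t \<Longrightarrow> (\<lambda>w. F u (clock t w)) \<in> borel_measurable M"
  unfolding F_def using A_meas(1) by (intro measurable_compose[OF clock_measurable]) simp_all

lemma weighted_cos_le:
  assumes \<delta>: "0 < \<delta>" and R: "0 \<le> R"
  shows "(\<integral>w. F u (clock R w) * cos (phase u R w + \<phi>) \<partial>M) \<le> cos \<phi> + err u \<delta> R * R"
proof -
  note e = expectation_le[OF W_superharmonic[OF \<delta>, where r=0 and R=R and u=u and \<phi>=\<phi>] S_borel order_refl R]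
  have b: "F u R + F u (clock R w) * cos (phase u R w + \<phi>) \<le> W u \<phi> \<delta> R (clock R w) (state R w) (state (min 0 R) w)"
    if "w \<in> space M" for w
    unfolding phase_def by (rule W_lower[OF \<delta> clock_bounds[OF that R]])
  have Fb: "\<bar>F u (clock R w)\<bar> \<le> F u R" if "w \<in> space M" for w
    using F_mono[OF clock_bounds[OF that R]] F_pos[of u "clock R w"] by simp
  have i: "integrable M (\<lambda>w. F u (clock R w) * cos (phase u R w + \<phi>))"
  proof (rule integrable_const_bound[where B="F u R"])
    show "AE w in M. norm (F u (clock R w) * cos (phase u R w + \<phi>)) \<le> F u R"
    proof (rule AE_I2)
      fix w assume "w \<in> space M"
      have "\<bar>F u (clock R w)\<bar> * \<bar>cos (phase u R w + \<phi>)\<bar> \<le> F u R * 1"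
        using Fb[OF \<open>w \<in> space M\<close>] F_pos[of u R] by (intro mult_mono) auto
      then show "norm (F u (clock R w) * cos (phase u R w + \<phi>)) \<le> F u R" by (simp add: abs_mult)
    qed
    show "(\<lambda>w. F u (clock R w) * cos (phase u R w + \<phi>)) \<in> borel_measurable M"
      using F_clock_measurable[OF R] phase_measurable[OF R] by measurable
  qed
  have "F u R + (\<integral>w. F u (clock R w) * cos (phase u R w + \<phi>) \<partial>M) = (\<integral>w. F u R + F u (clock R w) * cos (phase u R w + \<phi>) \<partial>M)"
    using i by (simp add: prob_space)
  also have "\<dots> \<le> (\<integral>w. W u \<phi> \<delta> R (clock R w) (state R w) (state (min 0 R) w) \<partial>M)"
    by (rule integral_mono_AE[OF _ e(1)]) (use i b in auto)
  also note e(2)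
  also have "W u \<phi> \<delta> R 0 x0 x0 = F u R + cos \<phi> + err u \<delta> R * R"
    by (simp add: W_def Q_def x02 F_0)
  finally show ?thesis by simp
qed

lemma integrable_iexp_phase: "0 \<le> t \<Longrightarrow> integrable M (\<lambda>w. iexp (phase u t w))"
  by (rule integrable_const_bound[where B=1]) (use phase_measurable in auto)

text \<open>
  The phases \<open>0\<close>, \<open>pi\<close> and \<open>\<plusminus> pi / 2\<close> show that
  \<open>F\<close> at the stopped clock times \<open>iexp\<close> of the phase has expectation
  close to 1. Replacing the stopped clock by \<open>R\<close> costs the probability of an earlier
  exit.
\<close>

theorem characteristic_bound_fixed:
  assumes \<delta>: "0 < \<delta>" and R: "0 \<le> R"
  shows "cmod ((\<integral>w. iexp (phase u R w) \<partial>M) - exp (- (u\<^sup>2 / 2 * A R))) \<le> 2 * (err u \<delta> R * R) + 2 * F u R * measure M {w \<in> space M. clock R w < R}"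
proof -
  let ?f = "\<lambda>w. F u (clock R w)" and ?p = "phase u R"
  have [measurable]: "?f \<in> borel_measurable M" "?p \<in> borel_measurable M" "clock R \<in> borel_measurable M"
    using R F_clock_measurable phase_measurable clock_measurable by auto
  have Fb: "0 < ?f w" "?f w \<le> F u R" if "w \<in> space M" for w
    using F_mono[OF clock_bounds[OF that R]] F_pos[of u "clock R w"] by simp_all
  have bnd: "norm (?f w * g) \<le> F u R" if "w \<in> space M" "\<bar>g\<bar> \<le> 1" for w g
    using mult_mono[OF Fb(2)[OF that(1)] that(2)] Fb[OF that(1)] F_pos[of u R] by (simp add: abs_mult)
  have ic: "integrable M (\<lambda>w. ?f w * cos (?p w))" and isn: "integrable M (\<lambda>w. ?f w * sin (?p w))"
    by (rule integrable_const_bound[where B="F u R"], use bnd in auto)+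
  let ?Z = "\<integral>w. ?f w * iexp (?p w) \<partial>M"
  have iz: "integrable M (\<lambda>w. ?f w * iexp (?p w))"
  proof (rule integrable_const_bound[where B="F u R"])
    show "AE w in M. norm (?f w * iexp (?p w)) \<le> F u R"
      using Fb by (auto intro!: AE_I2 simp: norm_mult less_imp_le)
    show "(\<lambda>w. ?f w * iexp (?p w)) \<in> borel_measurable M" by simp
  qed
  have Re: "Re ?Z = (\<integral>w. ?f w * cos (?p w) \<partial>M)" and Im: "Im ?Z = (\<integral>w. ?f w * sin (?p w) \<partial>M)"
    using iz by (simp_all flip: integral_Re integral_Im add: Re_exp Im_exp)
  have "(\<integral>w. ?f w * cos (?p w) \<partial>M) \<le> 1 + err u \<delta> R * R"
    using weighted_cos_le[OF \<delta> R, of u 0] by simp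
  moreover have "- (\<integral>w. ?f w * cos (?p w) \<partial>M) \<le> - 1 + err u \<delta> R * R"
    using weighted_cos_le[OF \<delta> R, of u pi] by simp
  moreover have "(\<integral>w. ?f w * sin (?p w) \<partial>M) \<le> err u \<delta> R * R"
    using weighted_cos_le[OF \<delta> R, of u "- (pi / 2)"] by (simp add: cos_diff)
  moreover have "- (\<integral>w. ?f w * sin (?p w) \<partial>M) \<le> err u \<delta> R * R"
    using weighted_cos_le[OF \<delta> R, of u "pi / 2"] by (simp add: cos_add)
  ultimately have "\<bar>Re (?Z - 1)\<bar> \<le> err u \<delta> R * R" "\<bar>Im (?Z - 1)\<bar> \<le> err u \<delta> R * R"
    using Re Im by auto
  then have Z1: "cmod (?Z - 1) \<le> 2 * (err u \<delta> R * R)"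
    using cmod_le[of "?Z - 1"] by linarith
  let ?I = "\<integral>w. iexp (?p w) \<partial>M"
  let ?E = "{w \<in> space M. clock R w < R}"
  have ii: "integrable M (\<lambda>w. F u R * iexp (?p w))" using integrable_iexp_phase[OF R, of u] by simp
  have iE: "integrable M (\<lambda>w. 2 * F u R * indicator ?E w)" by (intro integrable_mult_right integrable_real_indicator) (simp_all add: emeasure_eq_measure)
  have dif: "F u R * ?I - ?Z = (\<integral>w. F u R * iexp (?p w) - ?f w * iexp (?p w) \<partial>M)"
    using ii iz by simp
  have "cmod (F u R * ?I - ?Z) \<le> (\<integral>w. cmod (F u R * iexp (?p w) - ?f w * iexp (?p w)) \<partial>M)"
    unfolding dif by (rule integral_norm_bound)
  also have "\<dots> \<le> (\<integral>w. 2 * F u R * indicator ?E w \<partial>M)"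
  proof (rule integral_mono_AE)
    show "integrable M (\<lambda>w. cmod (F u R * iexp (?p w) - ?f w * iexp (?p w)))" using ii iz by simp
    show "integrable M (\<lambda>w. 2 * F u R * indicator ?E w)" by (rule iE)
    show "AE w in M. cmod (F u R * iexp (?p w) - ?f w * iexp (?p w)) \<le> 2 * F u R * indicator ?E w"
    proof (rule AE_I2)
      fix w assume w: "w \<in> space M"
      have eq: "cmod (F u R * iexp (?p w) - ?f w * iexp (?p w)) = \<bar>F u R - ?f w\<bar>"
        by (simp add: norm_mult flip: left_diff_distrib of_real_diff)
      show "cmod (F u R * iexp (?p w) - ?f w * iexp (?p w)) \<le> 2 * F u R * indicator ?E w"
      proof (cases "clock R w < R")
        case True
        then show ?thesis unfolding eq using w Fb[OF w] by simp
      next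
        case False
        then have "clock R w = R" using clock_bounds(2)[OF w R] by simp
        then show ?thesis unfolding eq using F_pos[of u R] by simp
      qed
    qed
  qed
  also have "\<dots> = 2 * F u R * measure M ?E" by simp
  finally have "cmod (F u R * ?I - 1) \<le> 2 * (err u \<delta> R * R) + 2 * F u R * measure M ?E"
    using Z1 norm_triangle_ineq[of "F u R * ?I - ?Z" "?Z - 1"] by simp
  moreover have "cmod (?I - exp (- (u\<^sup>2 / 2 * A R))) \<le> cmod (F u R * ?I - 1)"
  proof -
    have "complex_of_real (F u R) * exp (- (u\<^sup>2 / 2 * A R)) = 1"
      by (simp add: F_def exp_minus exp_of_real flip: of_real_mult of_real_exp)
    then have "F u R * ?I - 1 = F u R * (?I - exp (- (u\<^sup>2 / 2 * A R)))" by (simp add: right_diff_distrib)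
    then have "cmod (F u R * ?I - 1) = F u R * cmod (?I - exp (- (u\<^sup>2 / 2 * A R)))"
      using F_pos[of u R] by (simp add: norm_mult)
    then show ?thesis using mult_right_mono[OF F_ge_1[OF R, of u] norm_ge_zero[of "?I - exp (- (u\<^sup>2 / 2 * A R))"]] by simp
  qed
  ultimately show ?thesis by simp
qed

text \<open>
  After time \<open>R\<close> the phase changes by at most \<open>\<bar>u\<bar> *
  \<epsilon>\<close>, except with the probability given by the oscillation bound.
\<close>

theorem characteristic_bound:
  assumes \<delta>: "0 < \<delta>" and R: "0 \<le> R" and t: "R \<le> t" and \<epsilon>: "0 < \<epsilon>"
  shows "cmod ((\<integral>w. iexp (phase u t w) \<partial>M) - exp (- (u\<^sup>2 / 2 * A R)))
    \<le> 2 * (err u \<delta> R * R) + 2 * F u R * measure M {w \<in> space M. clock R w < R} + \<bar>u\<bar> * \<epsilon> + 2 * (n * C2 R / \<epsilon>\<^sup>2)"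
proof -
  have t0: "0 \<le> t" using R t by simp
  let ?d = "\<lambda>w. exp (- lam * clock t w) * state t w $ 2 - exp (- lam * clock R w) * state R w $ 2"
  let ?E = "{w \<in> space M. \<exists>g\<in>{t}. \<epsilon>\<^sup>2 / n \<le> (exp (- lam * clock g w) * state g w $ 2 - exp (- lam * clock R w) * state R w $ 2)\<^sup>2}"
  have [measurable]: "clock t \<in> borel_measurable M" "clock R \<in> borel_measurable M"
    "(\<lambda>w. state t w $ 2) \<in> borel_measurable M" "(\<lambda>w. state R w $ 2) \<in> borel_measurable M"
    using R t0 by (auto intro: clock_measurable intro!: measurable_compose[OF state_measurable vec_nth_borel])
  have E: "?E \<in> sets M" by simp
  have PE: "measure M ?E \<le> n * C2 R / \<epsilon>\<^sup>2"
    using unstable_coordinate_bound[OF R, of "{t}" "\<epsilon>\<^sup>2 / n"] t \<epsilon> n by (simp add: ac_simps)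
  note i = integrable_iexp_phase[OF t0, of u] integrable_iexp_phase[OF R, of u]
  have iE: "integrable M (\<lambda>w. \<bar>u\<bar> * \<epsilon> + 2 * indicator ?E w)"
    using E by (intro Bochner_Integration.integrable_add integrable_mult_right integrable_real_indicator) (simp_all add: emeasure_eq_measure)
  have int_E: "(\<integral>w. c + 2 * indicator B w \<partial>M) = c + 2 * measure M B" if "B \<in> sets M" for B and c :: real
  proof -
    have "integrable M (\<lambda>w. 2 * indicator B w :: real)"
      using that by (intro integrable_mult_right integrable_real_indicator) (simp_all add: emeasure_eq_measure)
    then show ?thesis using that by (simp add: prob_space)
  qed
  have dif: "(\<integral>w. iexp (phase u t w) \<partial>M) - (\<integral>w. iexp (phase u R w) \<partial>M) = (\<integral>w. iexp (phase u t w) - iexp (phase u R w) \<partial>M)"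
    using i by simp
  have "cmod ((\<integral>w. iexp (phase u t w) \<partial>M) - (\<integral>w. iexp (phase u R w) \<partial>M)) \<le> (\<integral>w. cmod (iexp (phase u t w) - iexp (phase u R w)) \<partial>M)"
    unfolding dif by (rule integral_norm_bound)
  also have "\<dots> \<le> (\<integral>w. \<bar>u\<bar> * \<epsilon> + 2 * indicator ?E w \<partial>M)"
  proof (rule integral_mono_AE[OF _ iE])
    show "integrable M (\<lambda>w. cmod (iexp (phase u t w) - iexp (phase u R w)))" using i by simp
    show "AE w in M. cmod (iexp (phase u t w) - iexp (phase u R w)) \<le> \<bar>u\<bar> * \<epsilon> + 2 * indicator ?E w"
    proof (rule AE_I2)
      fix w assume w: "w \<in> space M"
      show "cmod (iexp (phase u t w) - iexp (phase u R w)) \<le> \<bar>u\<bar> * \<epsilon> + 2 * indicator ?E w"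
      proof (cases "w \<in> ?E")
        case True
        have "cmod (iexp (phase u t w) - iexp (phase u R w)) \<le> cmod (iexp (phase u t w)) + cmod (iexp (phase u R w))"
          by (rule norm_triangle_ineq4)
        also have "\<dots> = 2" by simp
        also have "\<dots> \<le> \<bar>u\<bar> * \<epsilon> + 2 * indicator ?E w" using True \<epsilon> by simp
        finally show ?thesis .
      next
        case False
        then have "(?d w)\<^sup>2 < \<epsilon>\<^sup>2 / n" using w by (simp add: not_le)
        then have "(sqrt n * \<bar>?d w\<bar>)\<^sup>2 < \<epsilon>\<^sup>2" using n by (simp add: power_mult_distrib field_simps)
        then have "sqrt n * \<bar>?d w\<bar> < \<epsilon>" using \<epsilon> n by (intro power_less_imp_less_base[of _ 2 \<epsilon>]) auto
        then have "\<bar>u\<bar> * (sqrt n * \<bar>?d w\<bar>) \<le> \<bar>u\<bar> * \<epsilon>" by (intro mult_left_mono) auto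
        moreover have "\<bar>phase u t w - phase u R w\<bar> = \<bar>u\<bar> * (sqrt n * \<bar>?d w\<bar>)"
        proof -
          have "phase u t w - phase u R w = u * (sqrt n * ?d w)" by (simp add: phase_def algebra_simps)
          then show ?thesis using n by (simp add: abs_mult)
        qed
        moreover have "cmod (iexp (phase u t w) - iexp (phase u R w)) \<le> \<bar>phase u t w - phase u R w\<bar>"
        proof -
          have "iexp (phase u t w) - iexp (phase u R w) = iexp (phase u R w) * (iexp (phase u t w - phase u R w) - 1)"
            by (simp add: right_diff_distrib exp_add[symmetric])
          then have "cmod (iexp (phase u t w) - iexp (phase u R w)) = cmod (iexp (phase u t w - phase u R w) - 1)"
            by (simp add: norm_mult)
          also have "\<dots> \<le> \<bar>phase u t w - phase u R w\<bar>"
            using iexp_approx1[of "phase u t w - phase u R w" 0] by simp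
          finally show ?thesis .
        qed
        ultimately show ?thesis using False by simp
      qed
    qed
  qed
  also have "\<dots> = \<bar>u\<bar> * \<epsilon> + 2 * measure M ?E"
    by (rule int_E[OF E])
  finally have "cmod ((\<integral>w. iexp (phase u t w) \<partial>M) - (\<integral>w. iexp (phase u R w) \<partial>M)) \<le> \<bar>u\<bar> * \<epsilon> + 2 * (n * C2 R / \<epsilon>\<^sup>2)"
    using PE by linarith
  then show ?thesis
    using characteristic_bound_fixed[OF \<delta> R, of u]
      norm_triangle_ineq[of "(\<integral>w. iexp (phase u t w) \<partial>M) - (\<integral>w. iexp (phase u R w) \<partial>M)" "(\<integral>w. iexp (phase u R w) \<partial>M) - exp (- (u\<^sup>2 / 2 * A R))"]
    by simp
qed

end

section \<open>Suprema over uncountable sets of times\<close>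

text \<open>
  Right-continuity lets every value of \<open>f\<close> be approached through rationals in
  \<open>C\<close>, so the supremum is the same over \<open>C\<close>. A right end point cannot be
  approached in this way and has to belong to \<open>C\<close>.
\<close>

lemma SUP_ereal_dense:
  fixes f :: "real \<Rightarrow> real"
  assumes sub: "C \<subseteq> I"
    and right: "\<And>t. t \<in> I \<Longrightarrow> t \<notin> C \<Longrightarrow> (f \<longlongrightarrow> f t) (at_right t) \<and> (\<exists>b>t. \<forall>q\<in>\<rat>. t < q \<and> q < b \<longrightarrow> q \<in> C)"
  shows "(SUP t\<in>I. ereal (f t)) = (SUP t\<in>C. ereal (f t))"
proof (rule antisym)
  show "(SUP t\<in>C. ereal (f t)) \<le> (SUP t\<in>I. ereal (f t))" by (rule SUP_subset_mono[OF sub]) simp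
  show "(SUP t\<in>I. ereal (f t)) \<le> (SUP t\<in>C. ereal (f t))"
  proof (rule SUP_least)
    fix t assume t: "t \<in> I"
    show "ereal (f t) \<le> (SUP t\<in>C. ereal (f t))"
    proof (cases "t \<in> C")
      case True
      then show ?thesis by (rule SUP_upper)
    next
      case False
      then obtain b where lim: "(f \<longlongrightarrow> f t) (at_right t)" and b: "t < b" "\<And>q. q \<in> \<rat> \<Longrightarrow> t < q \<Longrightarrow> q < b \<Longrightarrow> q \<in> C"
        using right[OF t] by blast
      show ?thesis
      proof (rule ccontr)
        assume "\<not> ?thesis"
        then have lt: "(SUP t\<in>C. ereal (f t)) < ereal (f t)" by simp
        have "((\<lambda>s. ereal (f s)) \<longlongrightarrow> ereal (f t)) (at_right t)" using lim by simp
        from order_tendstoD(1)[OF this lt]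
        obtain d where d: "t < d" "\<And>s. t < s \<Longrightarrow> s < d \<Longrightarrow> (SUP t\<in>C. ereal (f t)) < ereal (f s)"
          unfolding eventually_at_right_field by blast
        obtain q where q: "q \<in> \<rat>" "t < q" "q < min b d"
          using Rats_dense_in_real[of t "min b d"] b(1) d(1) by auto
        have "ereal (f q) \<le> (SUP t\<in>C. ereal (f t))" by (rule SUP_upper) (use b(2) q in auto)
        then show False using d(2)[of q] q by simp
      qed
    qed
  qed
qed

lemma SUP_ereal_dense_Icc:
  fixes f :: "real \<Rightarrow> real"
  assumes "\<And>t. a \<le> t \<Longrightarrow> (f \<longlongrightarrow> f t) (at_right t)"
  shows "(SUP t\<in>{a..b}. ereal (f t)) = (SUP t\<in>{a..b} \<inter> insert b \<rat>. ereal (f t))"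
proof (rule SUP_ereal_dense)
  fix t assume "t \<in> {a..b}" "t \<notin> {a..b} \<inter> insert b \<rat>"
  then have "a \<le> t" "t < b" by auto
  then show "(f \<longlongrightarrow> f t) (at_right t) \<and> (\<exists>c>t. \<forall>q\<in>\<rat>. t < q \<and> q < c \<longrightarrow> q \<in> {a..b} \<inter> insert b \<rat>)"
    using assms by (intro conjI exI[of _ b]) auto
qed auto

lemma SUP_ereal_dense_atLeast:
  fixes f :: "real \<Rightarrow> real"
  assumes "\<And>t. a \<le> t \<Longrightarrow> (f \<longlongrightarrow> f t) (at_right t)"
  shows "(SUP t\<in>{a..}. ereal (f t)) = (SUP t\<in>{a..} \<inter> \<rat>. ereal (f t))"
proof (rule SUP_ereal_dense)
  fix t assume "t \<in> {a..}" "t \<notin> {a..} \<inter> \<rat>"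
  then have "a \<le> t" by auto
  then show "(f \<longlongrightarrow> f t) (at_right t) \<and> (\<exists>c>t. \<forall>q\<in>\<rat>. t < q \<and> q < c \<longrightarrow> q \<in> {a..} \<inter> \<rat>)"
    using assms by (intro conjI exI[of _ "t + 1"]) auto
qed auto

lemma countable_Rats_Int: "countable (A \<inter> \<rat>)" "countable (A \<inter> insert b (\<rat> :: real set))"
  using countable_rat by (auto intro: countable_Int2)

lemma (in jump_process) right_continuous_functional:
  assumes S: "S \<in> sets borel" and t: "0 \<le> t" and w: "w \<in> space M"
    and c: "\<And>c x. isCont (\<lambda>s. \<Phi> s c x) t" "\<And>x. isCont (\<lambda>s. \<Phi> s s x) t"
  shows "((\<lambda>s. \<Phi> s (stopped_clock S X s w) (stopped S X s w)) \<longlongrightarrow> \<Phi> t (stopped_clock S X t w) (stopped S X t w)) (at_right t)"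
proof -
  let ?c = "\<lambda>s. stopped_clock S X s w" and ?x = "\<lambda>s. stopped S X s w"
  obtain \<delta> where \<delta>: "0 < \<delta>" and x: "\<And>s. t \<le> s \<and> s < t + \<delta> \<Longrightarrow> ?x s = ?x t"
    and clk: "(\<forall>s. t \<le> s \<and> s < t + \<delta> \<longrightarrow> ?c s = ?c t) \<or> (\<forall>s. t \<le> s \<and> s < t + \<delta> \<longrightarrow> ?c s = s)"
    using stopped_right_constant[OF S t w] by blast
  have ev: "eventually (\<lambda>s. t < s \<and> s < t + \<delta>) (at_right t)"
    unfolding eventually_at_right_field using \<delta> by (intro exI[of _ "t + \<delta>"]) auto
  from clk show ?thesis
  proof
    assume A: "\<forall>s. t \<le> s \<and> s < t + \<delta> \<longrightarrow> ?c s = ?c t"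
    have "((\<lambda>s. \<Phi> s (?c t) (?x t)) \<longlongrightarrow> \<Phi> t (?c t) (?x t)) (at_right t)"
      using c(1)[of "?c t" "?x t"] unfolding isCont_def by (rule tendsto_within_subset) simp
    then show ?thesis
    proof (rule Lim_transform_eventually)
      show "\<forall>\<^sub>F s in at_right t. \<Phi> s (?c t) (?x t) = \<Phi> s (?c s) (?x s)"
        using ev
      proof eventually_elim
        case (elim s)
        then have "t \<le> s \<and> s < t + \<delta>" by simp
        then have "?c s = ?c t" "?x s = ?x t" using A x by blast+
        then show ?case by (simp only:)
      qed
    qed
  next
    assume B: "\<forall>s. t \<le> s \<and> s < t + \<delta> \<longrightarrow> ?c s = s"
    then have ct: "?c t = t" using \<delta> by simp
    have "((\<lambda>s. \<Phi> s s (?x t)) \<longlongrightarrow> \<Phi> t t (?x t)) (at_right t)"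
      using c(2)[of "?x t"] unfolding isCont_def by (rule tendsto_within_subset) simp
    then have "((\<lambda>s. \<Phi> s (?c s) (?x s)) \<longlongrightarrow> \<Phi> t t (?x t)) (at_right t)"
    proof (rule Lim_transform_eventually)
      show "\<forall>\<^sub>F s in at_right t. \<Phi> s s (?x t) = \<Phi> s (?c s) (?x s)"
        using ev
      proof eventually_elim
        case (elim s)
        then have "t \<le> s \<and> s < t + \<delta>" by simp
        then have "?c s = s" "?x s = ?x t" using B x by blast+
        then show ?case by (simp only:)
      qed
    qed
    then show ?thesis unfolding ct .
  qed
qed

text \<open>
  By scaling the standard normal law.
\<close>

lemma char_normal:
  assumes "0 < \<sigma>"
  shows "char (density lborel (normal_density 0 \<sigma>)) u = complex_of_real (exp (- (u\<^sup>2 / 2 * \<sigma>\<^sup>2)))"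
proof -
  interpret std: prob_space std_normal_distribution by (rule prob_space_normal_density) simp
  have "distributed std_normal_distribution lborel (\<lambda>x. x) std_normal_density"
    unfolding distributed_def by (auto simp: distr_id2)
  from std.normal_density_affine[OF this, of \<sigma> 0] assms
  have "distributed std_normal_distribution lborel (\<lambda>x. \<sigma> * x) (normal_density 0 \<sigma>)" by simp
  then have eq: "density lborel (normal_density 0 \<sigma>) = distr std_normal_distribution lborel (\<lambda>x. \<sigma> * x)"
    by (simp add: distributed_distr_eq_density)
  have "char (density lborel (normal_density 0 \<sigma>)) u = (\<integral>x. iexp (u * (\<sigma> * x)) \<partial>std_normal_distribution)"
    unfolding char_def eq by (subst integral_distr) auto
  also have "\<dots> = char std_normal_distribution (u * \<sigma>)"
    by (simp add: char_def mult.assoc)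
  also have "\<dots> = complex_of_real (exp (- (u\<^sup>2 / 2 * \<sigma>\<^sup>2)))"
    by (simp add: char_std_normal_distribution power_mult_distrib)
  finally show ?thesis .
qed

locale near_saddle =
  fixes M :: "nat \<Rightarrow> 'a measure"
    and X :: "nat \<Rightarrow> real \<Rightarrow> 'a \<Rightarrow> real^2"
    and I :: "nat \<Rightarrow> (real^2) set"
    and KN :: "nat \<Rightarrow> real^2 \<Rightarrow> (real^2) measure"
    and K :: "real^2 \<Rightarrow> (real^2) measure"
    and S :: "(real^2) set"
    and x0 :: "real^2"
    and \<eta>0 lam \<mu> :: real
  assumes process: "\<And>N. N \<ge> 1 \<Longrightarrow> pure_jump_markov (M N) (I N) (KN N) x0 (X N)"
    and S: "open S"
    and K: "levy_kernel_on S K"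
    and eta: "\<eta>0 > 0"
    and a_fin: "\<And>x \<theta>. x \<in> S \<Longrightarrow> norm \<theta> \<le> \<eta>0 \<Longrightarrow> laplace_finite (K x) \<theta>"
    and a_bdd: "\<exists>C. \<forall>x\<in>S. \<forall>\<theta>\<in>cball 0 \<eta>0. laplace (K x) \<theta> \<le> C"
    and b_fin: "\<forall>\<^sub>F N in sequentially. \<forall>x\<in>I N \<inter> S. \<forall>\<theta>\<in>cball 0 \<eta>0. laplace_finite (KN N x) (real N *\<^sub>R \<theta>)"
    and b_lim: "(\<lambda>N. SUP x\<in>I N \<inter> S. SUP \<theta>\<in>cball 0 \<eta>0.
                   ereal \<bar>laplace (KN N x) (real N *\<^sub>R \<theta>) / real N - laplace (K x) \<theta>\<bar>) \<longlonglongrightarrow> 0"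
    and c: "(\<lambda>N. SUP x\<in>I N \<inter> S. ereal (sqrt (real N) * norm (drift (KN N x) - drift (K x)))) \<longlonglongrightarrow> 0"
    and d: "\<exists>L. L-lipschitz_on S (\<lambda>x. diffusivity (K x))"
    and lam: "lam > 0" and \<mu>: "\<mu> > 0"
    and linear: "\<And>x. x \<in> S \<Longrightarrow> drift (K x) = saddle_matrix lam \<mu> *v x"
    and start: "x0 $ 2 = 0"
    and path: "\<exists>\<epsilon>>0. \<forall>t\<ge>0. ball (stable_path \<mu> x0 t) \<epsilon> \<subseteq> S"
begin

text \<open>
  The variance rate in the unstable direction.
\<close>

definition a :: "real^2 \<Rightarrow> real" where "a x = diffusivity (K x) $ 2 $ 2"

lemma K_moments: "x \<in> S \<Longrightarrow> exponential_moments (K x) \<eta>0"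
  unfolding exponential_moments_def exponential_moments_axioms_def
  using K eta a_fin unfolding levy_kernel_on_def by blast

lemma a_eq: "x \<in> S \<Longrightarrow> a x = (\<integral>y. (y $ 2)\<^sup>2 \<partial>K x)"
  unfolding a_def diffusivity_component[OF K_moments] by (simp add: power2_eq_square)

lemma path_in: "0 \<le> t \<Longrightarrow> stable_path \<mu> x0 t \<in> S"
  using path by (metis centre_in_ball subsetD)

lemma laplace_close:
  assumes "0 < e"
  shows "\<forall>\<^sub>F N in sequentially. \<forall>x\<in>I N \<inter> S. \<forall>\<theta>\<in>cball 0 \<eta>0. \<bar>laplace (KN N x) (real N *\<^sub>R \<theta>) / real N - laplace (K x) \<theta>\<bar> \<le> e"
proof -
  have "(0::ereal) < ereal e" using assms by simp
  from order_tendstoD(2)[OF b_lim this] show ?thesis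
  proof eventually_elim
    case (elim N)
    show ?case
    proof (intro ballI)
      fix x \<theta> :: "real^2" assume x: "x \<in> I N \<inter> S" and \<theta>: "\<theta> \<in> cball 0 \<eta>0"
      let ?f = "\<lambda>(x::real^2) (\<theta>::real^2). ereal \<bar>laplace (KN N x) (real N *\<^sub>R \<theta>) / real N - laplace (K x) \<theta>\<bar>"
      have "?f x \<theta> \<le> (SUP \<theta>\<in>cball 0 \<eta>0. ?f x \<theta>)" by (rule SUP_upper[OF \<theta>])
      also have "\<dots> \<le> (SUP x\<in>I N \<inter> S. SUP \<theta>\<in>cball 0 \<eta>0. ?f x \<theta>)" by (rule SUP_upper[OF x])
      also have "\<dots> < ereal e" by (rule elim)
      finally show "\<bar>laplace (KN N x) (real N *\<^sub>R \<theta>) / real N - laplace (K x) \<theta>\<bar> \<le> e" by simp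
    qed
  qed
qed

lemma drift_close:
  assumes "0 < e"
  shows "\<forall>\<^sub>F N in sequentially. \<forall>x\<in>I N \<inter> S. sqrt (real N) * norm (drift (KN N x) - drift (K x)) \<le> e"
proof -
  have "(0::ereal) < ereal e" using assms by simp
  from order_tendstoD(2)[OF c this] show ?thesis
  proof eventually_elim
    case (elim N)
    show ?case
    proof (intro ballI)
      fix x assume x: "x \<in> I N \<inter> S"
      have "ereal (sqrt (real N) * norm (drift (KN N x) - drift (K x))) \<le> (SUP x\<in>I N \<inter> S. ereal (sqrt (real N) * norm (drift (KN N x) - drift (K x))))"
        by (rule SUP_upper[OF x])
      also have "\<dots> < ereal e" by (rule elim)
      finally show "sqrt (real N) * norm (drift (KN N x) - drift (K x)) \<le> e" by simp
    qed
  qed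
qed

lemma laplace_bound: "\<exists>C>0. \<forall>x\<in>S. \<forall>\<theta>\<in>cball 0 \<eta>0. laplace (K x) \<theta> \<le> C"
proof -
  obtain C where C: "\<forall>x\<in>S. \<forall>\<theta>\<in>cball 0 \<eta>0. laplace (K x) \<theta> \<le> C" using a_bdd by blast
  have "\<forall>x\<in>S. \<forall>\<theta>\<in>cball 0 \<eta>0. laplace (K x) \<theta> \<le> max C 1" using C by fastforce
  then show ?thesis by (intro exI[of _ "max C 1"]) simp
qed

text \<open>
  A positive uniform bound for the limiting transforms, fixed so that the constants below depend
  on nothing else.
\<close>

definition Cl :: real where "Cl = (SOME C. C > 0 \<and> (\<forall>x\<in>S. \<forall>\<theta>\<in>cball 0 \<eta>0. laplace (K x) \<theta> \<le> C))"

lemma Cl: "0 < Cl" "x \<in> S \<Longrightarrow> norm \<theta> \<le> \<eta>0 \<Longrightarrow> laplace (K x) \<theta> \<le> Cl"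
proof -
  have "Cl > 0 \<and> (\<forall>x\<in>S. \<forall>\<theta>\<in>cball 0 \<eta>0. laplace (K x) \<theta> \<le> Cl)"
    unfolding Cl_def by (rule someI_ex) (use laplace_bound in blast)
  then show "0 < Cl" "x \<in> S \<Longrightarrow> norm \<theta> \<le> \<eta>0 \<Longrightarrow> laplace (K x) \<theta> \<le> Cl" by auto
qed

text \<open>
  \<open>c2 / N\<close> and \<open>c3 / N\<^sup>2\<close> will bound the second and third absolute
  moments of the \<open>N\<close>-th kernel, and \<open>h ^ 4 * c4\<close> the error of second
  differences with step \<open>h\<close>; the numerators are \<open>k! * 2 ^ k * 2\<close> for
  \<open>k = 2, 3, 4\<close>.
\<close>

definition c2 :: real where "c2 = 16 * (Cl + 1) / \<eta>0\<^sup>2"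
definition c3 :: real where "c3 = 96 * (Cl + 1) / \<eta>0 ^ 3"
definition c4 :: real where "c4 = 768 * (Cl + 1) / \<eta>0 ^ 4"

lemma c_pos: "0 < c2" "0 < c3" "0 < c4"
  using Cl(1) eta by (simp_all add: c2_def c3_def c4_def)

lemma moments_N:
  shows "\<forall>\<^sub>F N in sequentially. N \<ge> 1 \<and> (\<forall>x\<in>I N \<inter> S. exponential_moments (KN N x) (real N * \<eta>0) \<and>
     (\<forall>\<theta>. norm \<theta> \<le> \<eta>0 \<longrightarrow> laplace (KN N x) (real N *\<^sub>R \<theta>) \<le> real N * (Cl + 1)))"
  using b_fin laplace_close[OF zero_less_one] eventually_ge_at_top[of 1]
proof eventually_elim
  case (elim N)
  have N: "0 < real N" using elim(3) by simp
  show ?case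
  proof (intro conjI ballI allI impI)
    fix x assume x: "x \<in> I N \<inter> S"
    have "finite_measure (KN N x) \<and> sets (KN N x) = sets borel"
      using process[OF elim(3)] x unfolding pure_jump_markov_def levy_kernel_on_def by blast
    moreover have "laplace_finite (KN N x) \<theta>" if "norm \<theta> \<le> real N * \<eta>0" for \<theta>
    proof -
      have "\<theta> /\<^sub>R real N \<in> cball 0 \<eta>0" using that N by (simp add: field_simps)
      with elim(1) x have "laplace_finite (KN N x) (real N *\<^sub>R (\<theta> /\<^sub>R real N))" by blast
      then show ?thesis using N by simp
    qed
    ultimately show "exponential_moments (KN N x) (real N * \<eta>0)"
      unfolding exponential_moments_def exponential_moments_axioms_def using N eta by simp
    fix \<theta> :: "real^2" assume \<theta>: "norm \<theta> \<le> \<eta>0"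
    have "\<theta> \<in> cball 0 \<eta>0" using \<theta> by simp
    then have "\<bar>laplace (KN N x) (real N *\<^sub>R \<theta>) / real N - laplace (K x) \<theta>\<bar> \<le> 1" using elim(2) x by blast
    moreover have "laplace (K x) \<theta> \<le> Cl" using Cl(2) x \<theta> by blast
    ultimately have "laplace (KN N x) (real N *\<^sub>R \<theta>) / real N \<le> Cl + 1" by linarith
    then show "laplace (KN N x) (real N *\<^sub>R \<theta>) \<le> real N * (Cl + 1)" using N by (simp add: field_simps)
  qed (rule elim(3))
qed

lemma power_moment_N:
  assumes N: "N \<ge> 1" and em: "exponential_moments (KN N x) (real N * \<eta>0)"
    and lp: "\<And>\<theta>. norm \<theta> \<le> \<eta>0 \<Longrightarrow> laplace (KN N x) (real N *\<^sub>R \<theta>) \<le> real N * (Cl + 1)"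
  shows "integrable (KN N x) (\<lambda>y. \<bar>y $ i\<bar> ^ k)"
    and "(\<integral>y. \<bar>y $ i\<bar> ^ k \<partial>KN N x) \<le> fact k * (2 / (real N * \<eta>0)) ^ k * (2 * (real N * (Cl + 1)))"
proof -
  interpret exponential_moments "KN N x" "real N * \<eta>0" by (rule em)
  have b: "axis i 1 \<in> (Basis :: (real^2) set)" by (simp add: axis_in_Basis_iff)
  have yi: "y \<bullet> axis i 1 = y $ i" for y :: "real^2" by (simp add: inner_axis)
  note cm = coordinate_moment[OF b, of k, unfolded yi]
  show "integrable (KN N x) (\<lambda>y. \<bar>y $ i\<bar> ^ k)" by (rule cm(1))
  have "laplace (KN N x) ((real N * \<eta>0) *\<^sub>R axis i 1) \<le> real N * (Cl + 1)"
    using lp[of "\<eta>0 *\<^sub>R axis i 1"] eta by simp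
  moreover have "laplace (KN N x) (- (real N * \<eta>0) *\<^sub>R axis i 1) \<le> real N * (Cl + 1)"
    using lp[of "- \<eta>0 *\<^sub>R axis i 1"] eta by simp
  ultimately have "laplace (KN N x) ((real N * \<eta>0) *\<^sub>R axis i 1) + laplace (KN N x) (- (real N * \<eta>0) *\<^sub>R axis i 1) \<le> 2 * (real N * (Cl + 1))"
    by linarith
  then have "fact k * (2 / (real N * \<eta>0)) ^ k * (laplace (KN N x) ((real N * \<eta>0) *\<^sub>R axis i 1) + laplace (KN N x) (- (real N * \<eta>0) *\<^sub>R axis i 1))
     \<le> fact k * (2 / (real N * \<eta>0)) ^ k * (2 * (real N * (Cl + 1)))"
    using eta by (intro mult_left_mono) auto
  with cm(2) show "(\<integral>y. \<bar>y $ i\<bar> ^ k \<partial>KN N x) \<le> fact k * (2 / (real N * \<eta>0)) ^ k * (2 * (real N * (Cl + 1)))" by linarith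
qed

text \<open>
  Compare the second differences of both transforms with step \<open>h\<close>. Fourth-order
  accuracy bounds the error by a multiple of \<open>h\<^sup>2\<close> after division by
  \<open>h\<^sup>2\<close>, so \<open>h\<close> is fixed first, and then uniform convergence of
  the transforms is used at scale \<open>e * h\<^sup>2\<close>.
\<close>

lemma variance_close:
  assumes e: "0 < e"
  shows "\<forall>\<^sub>F N in sequentially. \<forall>x\<in>I N \<inter> S. \<bar>a x - real N * (\<integral>y. (y $ 2)\<^sup>2 \<partial>KN N x)\<bar> \<le> e"
proof -
  define h where "h = min (\<eta>0 / 2) (sqrt (e / (4 * c4)))"
  have h: "0 < h" "h \<le> \<eta>0 / 2" using eta e c_pos by (auto simp: h_def)
  have "h\<^sup>2 \<le> (sqrt (e / (4 * c4)))\<^sup>2" using h by (intro power_mono) (auto simp: h_def)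
  also have "\<dots> = e / (4 * c4)" using e c_pos by simp
  finally have h2: "2 * h\<^sup>2 * c4 \<le> e / 2" using c_pos by (simp add: field_simps)
  have e': "0 < e * h\<^sup>2 / 8" using e h by simp
  show ?thesis
    using moments_N laplace_close[OF e']
  proof eventually_elim
    case (elim N)
    show ?case
    proof (rule ballI)
      fix x assume x: "x \<in> I N \<inter> S"
      have N: "N \<ge> 1" "0 < real N" using elim by auto
      let ?b = "axis 2 1 :: real^2"
      have b: "?b \<in> Basis" by (simp add: axis_in_Basis_iff)
      have yi: "y \<bullet> ?b = y $ 2" for y :: "real^2" by (simp add: inner_axis)
      have nb: "norm (r *\<^sub>R ?b) = \<bar>r\<bar>" for r by simp
      interpret k: exponential_moments "K x" \<eta>0 using K_moments x by blast
      interpret kN: exponential_moments "KN N x" "real N * \<eta>0" using elim(1) x by blast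
      let ?m = "\<integral>y. (y $ 2)\<^sup>2 \<partial>KN N x"
      define D where "D = laplace (K x) (h *\<^sub>R ?b) + laplace (K x) (- h *\<^sub>R ?b) - 2 * laplace (K x) 0"
      define DN where "DN = laplace (KN N x) ((real N * h) *\<^sub>R ?b) + laplace (KN N x) (- (real N * h) *\<^sub>R ?b) - 2 * laplace (KN N x) 0"
      have "\<bar>D - h\<^sup>2 * a x\<bar> \<le> h ^ 4 * (24 * (2 / \<eta>0) ^ 4 * (laplace (K x) (\<eta>0 *\<^sub>R ?b) + laplace (K x) (- \<eta>0 *\<^sub>R ?b)))"
        using k.second_difference[OF b, of h] h x unfolding yi D_def by (simp add: a_eq)
      also have "\<dots> \<le> h ^ 4 * (24 * (2 / \<eta>0) ^ 4 * (2 * (Cl + 1)))"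
      proof (intro mult_left_mono)
        have l: "laplace (K x) (\<eta>0 *\<^sub>R ?b) \<le> Cl" "laplace (K x) (- \<eta>0 *\<^sub>R ?b) \<le> Cl"
          using x eta by (auto intro!: Cl(2))
        show "laplace (K x) (\<eta>0 *\<^sub>R ?b) + laplace (K x) (- \<eta>0 *\<^sub>R ?b) \<le> 2 * (Cl + 1)"
          by (rule order_trans[OF add_mono[OF l(1) l(2)]]) simp
      qed (use eta in auto)
      also have "\<dots> = h ^ 4 * c4" using eta by (simp add: c4_def power_divide)
      finally have 1: "\<bar>D - h\<^sup>2 * a x\<bar> \<le> h ^ 4 * c4" .
      have "\<bar>DN - (real N * h)\<^sup>2 * ?m\<bar> \<le> (real N * h) ^ 4 * (24 * (2 / (real N * \<eta>0)) ^ 4 * (laplace (KN N x) ((real N * \<eta>0) *\<^sub>R ?b) + laplace (KN N x) (- (real N * \<eta>0) *\<^sub>R ?b)))"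
        using kN.second_difference[OF b, of "real N * h"] h N unfolding yi DN_def by simp
      also have "\<dots> \<le> (real N * h) ^ 4 * (24 * (2 / (real N * \<eta>0)) ^ 4 * (2 * (real N * (Cl + 1))))"
      proof (intro mult_left_mono)
        have lp: "laplace (KN N x) (real N *\<^sub>R \<theta>) \<le> real N * (Cl + 1)" if "norm \<theta> \<le> \<eta>0" for \<theta> using elim(1) x that by blast
        show "laplace (KN N x) ((real N * \<eta>0) *\<^sub>R ?b) + laplace (KN N x) (- (real N * \<eta>0) *\<^sub>R ?b) \<le> 2 * (real N * (Cl + 1))"
          using lp[of "\<eta>0 *\<^sub>R ?b"] lp[of "- \<eta>0 *\<^sub>R ?b"] eta by simp
      qed (use eta in auto)
      also have "\<dots> = real N * (h ^ 4 * c4)" using eta N by (simp add: c4_def power_divide power_mult_distrib field_simps eval_nat_numeral)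
      finally have "\<bar>DN - (real N * h)\<^sup>2 * ?m\<bar> / real N \<le> h ^ 4 * c4" using N by (simp add: field_simps)
      moreover have "\<bar>DN - (real N * h)\<^sup>2 * ?m\<bar> / real N = \<bar>DN / real N - h\<^sup>2 * (real N * ?m)\<bar>"
      proof -
        have "(DN - (real N * h)\<^sup>2 * ?m) / real N = DN / real N - h\<^sup>2 * (real N * ?m)"
          using N by (simp add: field_simps power2_eq_square)
        moreover have "\<bar>(DN - (real N * h)\<^sup>2 * ?m) / real N\<bar> = \<bar>DN - (real N * h)\<^sup>2 * ?m\<bar> / real N"
          using N by simp
        ultimately show ?thesis by simp
      qed
      ultimately have 2: "\<bar>DN / real N - h\<^sup>2 * (real N * ?m)\<bar> \<le> h ^ 4 * c4" by simp
      have cl: "\<bar>laplace (KN N x) (real N *\<^sub>R \<theta>) / real N - laplace (K x) \<theta>\<bar> \<le> e * h\<^sup>2 / 8" if "norm \<theta> \<le> \<eta>0" for \<theta>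
      proof -
        have "\<theta> \<in> cball 0 \<eta>0" using that by simp
        then show ?thesis using elim(2) x by blast
      qed
      have 3: "\<bar>DN / real N - D\<bar> \<le> e * h\<^sup>2 / 2"
      proof -
        have "DN / real N = laplace (KN N x) (real N *\<^sub>R (h *\<^sub>R ?b)) / real N + laplace (KN N x) (real N *\<^sub>R (- h *\<^sub>R ?b)) / real N
            - 2 * (laplace (KN N x) (real N *\<^sub>R 0) / real N)"
          by (simp add: DN_def add_divide_distrib diff_divide_distrib)
        moreover have "norm (h *\<^sub>R ?b) \<le> \<eta>0" "norm (- h *\<^sub>R ?b) \<le> \<eta>0" "norm (0 :: real^2) \<le> \<eta>0" using h eta by auto
        note cl[OF this(1)] cl[OF this(2)] cl[OF this(3)]
        ultimately show ?thesis unfolding D_def by linarith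
      qed
      have "h\<^sup>2 * \<bar>a x - real N * ?m\<bar> = \<bar>h\<^sup>2 * a x - h\<^sup>2 * (real N * ?m)\<bar>"
        by (simp add: abs_mult flip: right_diff_distrib)
      also have "\<dots> \<le> 2 * (h ^ 4 * c4) + e * h\<^sup>2 / 2" using 1 2 3 by linarith
      also have "\<dots> = h\<^sup>2 * (2 * h\<^sup>2 * c4 + e / 2)" by (simp add: eval_nat_numeral algebra_simps)
      also have "\<dots> \<le> h\<^sup>2 * e" using h2 by (intro mult_left_mono) auto
      finally show "\<bar>a x - real N * ?m\<bar> \<le> e" using h by simp
    qed
  qed
qed

end

section \<open>Probability bounds for the suprema\<close>

context saddle_process
begin

lemma clock_eq_self:
  assumes w: "w \<in> space M" and s: "0 \<le> s" "s \<le> R" and nR: "\<not> clock R w < R"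
  shows "clock s w = s"
proof -
  have R: "0 \<le> R" using s by simp
  have "clock R w = R" using clock_bounds(2)[OF w R] nR by simp
  then show ?thesis using clock_min[OF w s] s by simp
qed

lemma clock_ge:
  assumes w: "w \<in> space M" and s: "0 \<le> s" "s \<le> t" and ns: "\<not> clock s w < s"
  shows "s \<le> clock t w"
  using clock_min[OF w s] clock_eq_self[OF w s(1) order_refl ns] by simp

lemma exited_event: "0 \<le> R \<Longrightarrow> {w \<in> space M. clock R w < R} \<in> sets M"
  using clock_measurable[of R] by measurable

lemma stable_event:
  assumes C: "countable C" "C \<subseteq> {0..}"
  shows "{w \<in> space M. \<exists>g\<in>C. c \<le> exp (- lam * clock g w) * (state g w $ 1 - exp (- \<mu> * clock g w) * x0 $ 1)\<^sup>2} \<in> sets M"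
proof (rule event_measurable[OF C(1)])
  fix g assume "g \<in> C"
  then have g: "0 \<le> g" using C(2) by auto
  note [measurable] = clock_measurable[OF g] state_measurable[OF g]
  show "{w \<in> space M. c \<le> exp (- lam * clock g w) * (state g w $ 1 - exp (- \<mu> * clock g w) * x0 $ 1)\<^sup>2} \<in> sets M"
    by measurable
qed

text \<open>
  As long as the process has not left \<open>S\<close>, the clock shows \<open>t\<close>, and
  \<open>exp (\<mu> * t)\<close> times the deviation from the path exceeds
  \<open>\<epsilon>\<close> only if \<open>exp (- lam * t) * d\<^sup>2\<close> exceeds \<open>exp
  (- (lam + 2 * \<mu>) * t) * \<epsilon>\<^sup>2\<close>; the worst case is \<open>t = T\<close>.
\<close>

lemma stable_sup:
  assumes T: "0 \<le> T"
  shows "(\<lambda>w. SUP t\<in>{0..T}. ereal \<bar>exp (\<mu> * t) * state t w $ 1 - x0 $ 1\<bar>) \<in> borel_measurable M"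
    and "0 < \<epsilon> \<Longrightarrow> measure M {w \<in> space M. (SUP t\<in>{0..T}. ereal \<bar>exp (\<mu> * t) * state t w $ 1 - x0 $ 1\<bar>) > ereal \<epsilon>}
      \<le> C1 / (lam * (exp (- (lam + 2 * \<mu>) * T) * \<epsilon>\<^sup>2)) + measure M {w \<in> space M. clock T w < T}"
proof -
  let ?f = "\<lambda>w t. \<bar>exp (\<mu> * t) * state t w $ 1 - x0 $ 1\<bar>"
  let ?C = "{0..T} \<inter> insert T \<rat>"
  have C: "countable ?C" "?C \<subseteq> {0..}" using countable_Rats_Int by auto
  have dense: "(SUP t\<in>{0..T}. ereal (?f w t)) = (SUP t\<in>?C. ereal (?f w t))" if w: "w \<in> space M" for w
  proof (rule SUP_ereal_dense_Icc)
    fix t :: real assume t: "0 \<le> t"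
    show "(?f w \<longlongrightarrow> ?f w t) (at_right t)"
      by (rule right_continuous_functional[OF S_borel t w, where \<Phi>="\<lambda>s c x. \<bar>exp (\<mu> * s) * x $ 1 - x0 $ 1\<bar>"])
        (intro continuous_intros)+
  qed
  have "(\<lambda>w. SUP t\<in>?C. ereal (?f w t)) \<in> borel_measurable M"
  proof (rule borel_measurable_SUP[OF C(1)])
    fix t assume "t \<in> ?C"
    then have t: "0 \<le> t" by simp
    note [measurable] = state_measurable[OF t]
    show "(\<lambda>w. ereal (?f w t)) \<in> borel_measurable M" by measurable
  qed
  then show "(\<lambda>w. SUP t\<in>{0..T}. ereal (?f w t)) \<in> borel_measurable M"
    using dense by (simp cong: measurable_cong)
  assume \<epsilon>: "0 < \<epsilon>"
  define c where "c = exp (- (lam + 2 * \<mu>) * T) * \<epsilon>\<^sup>2"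
  have c: "0 < c" using \<epsilon> by (simp add: c_def)
  let ?E1 = "{w \<in> space M. \<exists>g\<in>?C. c \<le> exp (- lam * clock g w) * (state g w $ 1 - exp (- \<mu> * clock g w) * x0 $ 1)\<^sup>2}"
  let ?E2 = "{w \<in> space M. clock T w < T}"
  have "{w \<in> space M. (SUP t\<in>{0..T}. ereal (?f w t)) > ereal \<epsilon>} \<subseteq> ?E1 \<union> ?E2"
  proof
    fix w assume "w \<in> {w \<in> space M. (SUP t\<in>{0..T}. ereal (?f w t)) > ereal \<epsilon>}"
    then have w: "w \<in> space M" and "ereal \<epsilon> < (SUP t\<in>?C. ereal (?f w t))" using dense by auto
    then obtain t where t: "t \<in> ?C" "ereal \<epsilon> < ereal (?f w t)" unfolding less_SUP_iff by blast
    from t(2) have t2: "\<epsilon> < ?f w t" by simp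
    show "w \<in> ?E1 \<union> ?E2"
    proof (cases "clock T w < T")
      case True
      then show ?thesis using w by simp
    next
      case False
      have t0: "0 \<le> t" "t \<le> T" using t(1) T by auto
      have ck: "clock t w = t" by (rule clock_eq_self[OF w t0 False])
      let ?d = "state t w $ 1 - exp (- \<mu> * t) * x0 $ 1"
      have "exp (\<mu> * t) * ?d = exp (\<mu> * t) * state t w $ 1 - x0 $ 1"
        by (simp add: right_diff_distrib exp_add[symmetric] mult.assoc[symmetric])
      then have "\<epsilon> < exp (\<mu> * t) * \<bar>?d\<bar>" using t2 by (metis abs_exp_cancel abs_mult)
      then have "\<epsilon>\<^sup>2 \<le> (exp (\<mu> * t) * \<bar>?d\<bar>)\<^sup>2" using \<epsilon> by (intro power_mono) auto
      then have le: "\<epsilon>\<^sup>2 \<le> exp (2 * \<mu> * t) * ?d\<^sup>2"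
        by (simp add: power_mult_distrib exp_double[symmetric] mult.assoc)
      have "(lam + 2 * \<mu>) * t \<le> (lam + 2 * \<mu>) * T" using t0 lam \<mu> by (intro mult_left_mono) auto
      then have "- (lam + 2 * \<mu>) * T \<le> - (lam + 2 * \<mu>) * t" by (simp only: mult_minus_left neg_le_iff_le)
      then have "c \<le> exp (- (lam + 2 * \<mu>) * t) * \<epsilon>\<^sup>2" unfolding c_def by (intro mult_right_mono) auto
      also have "\<dots> \<le> exp (- (lam + 2 * \<mu>) * t) * (exp (2 * \<mu> * t) * ?d\<^sup>2)" using le by (intro mult_left_mono) auto
      also have "\<dots> = exp (- (lam + 2 * \<mu>) * t + 2 * \<mu> * t) * ?d\<^sup>2" by (simp only: exp_add mult.assoc)
      also have "- (lam + 2 * \<mu>) * t + 2 * \<mu> * t = - lam * t" by (simp add: algebra_simps)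
      finally have "c \<le> exp (- lam * clock t w) * (state t w $ 1 - exp (- \<mu> * clock t w) * x0 $ 1)\<^sup>2" unfolding ck .
      then show ?thesis using w t(1) by blast
    qed
  qed
  then have "measure M {w \<in> space M. (SUP t\<in>{0..T}. ereal (?f w t)) > ereal \<epsilon>} \<le> measure M (?E1 \<union> ?E2)"
    by (rule finite_measure_mono[OF _ sets.Un[OF stable_event[OF C] exited_event[OF T]]])
  also have "\<dots> \<le> measure M ?E1 + measure M ?E2"
    by (rule measure_Un_le[OF stable_event[OF C] exited_event[OF T]])
  finally show "measure M {w \<in> space M. (SUP t\<in>{0..T}. ereal (?f w t)) > ereal \<epsilon>}
      \<le> C1 / (lam * (exp (- (lam + 2 * \<mu>) * T) * \<epsilon>\<^sup>2)) + measure M ?E2"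
    using stable_coordinate_bound[OF C c] unfolding c_def by linarith
qed

text \<open>
  Split the first coordinate into the deviation from the path and the path itself. If
  \<open>S\<close> has not been left by time \<open>s\<close>, the stopped clock is at least
  \<open>s\<close>, so the contribution of the path is covered by the smallness hypothesis at time
  \<open>s\<close>, and part of the factor \<open>exp (- 2 * lam * t)\<close> remains as a gain
  \<open>exp (- lam * s)\<close> in the deviation. The time \<open>s\<close> may be much smaller
  than \<open>T\<close>, which matters because leaving \<open>S\<close> before \<open>T\<close>
  can be likely.
\<close>

lemma late_stable_sup:
  assumes n: "0 < n" and s: "0 \<le> s" "s \<le> T"
  shows "(\<lambda>w. SUP t\<in>{T..}. ereal (sqrt n * exp (- lam * t) * \<bar>state t w $ 1\<bar>)) \<in> borel_measurable M"
    and "0 < \<epsilon> \<Longrightarrow> sqrt n * \<bar>x0 $ 1\<bar> * exp (- (lam + \<mu>) * s) \<le> \<epsilon> / 2 \<Longrightarrow>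
      measure M {w \<in> space M. (SUP t\<in>{T..}. ereal (sqrt n * exp (- lam * t) * \<bar>state t w $ 1\<bar>)) > ereal \<epsilon>}
      \<le> C1 / (lam * ((\<epsilon> / 2)\<^sup>2 * exp (lam * s) / n)) + measure M {w \<in> space M. clock s w < s}"
proof -
  let ?f = "\<lambda>w t. sqrt n * exp (- lam * t) * \<bar>state t w $ 1\<bar>"
  let ?C = "{T..} \<inter> \<rat>"
  have T: "0 \<le> T" using s by simp
  have C: "countable ?C" "?C \<subseteq> {0..}" using countable_Rats_Int T by auto
  have dense: "(SUP t\<in>{T..}. ereal (?f w t)) = (SUP t\<in>?C. ereal (?f w t))" if w: "w \<in> space M" for w
  proof (rule SUP_ereal_dense_atLeast)
    fix t :: real assume "T \<le> t"
    then have t: "0 \<le> t" using T by simp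
    show "(?f w \<longlongrightarrow> ?f w t) (at_right t)"
      by (rule right_continuous_functional[OF S_borel t w, where \<Phi>="\<lambda>s c x. sqrt n * exp (- lam * s) * \<bar>x $ 1\<bar>"])
        (intro continuous_intros)+
  qed
  have "(\<lambda>w. SUP t\<in>?C. ereal (?f w t)) \<in> borel_measurable M"
  proof (rule borel_measurable_SUP[OF C(1)])
    fix t assume "t \<in> ?C"
    then have t: "0 \<le> t" using T by simp
    note [measurable] = state_measurable[OF t]
    show "(\<lambda>w. ereal (?f w t)) \<in> borel_measurable M" by measurable
  qed
  then show "(\<lambda>w. SUP t\<in>{T..}. ereal (?f w t)) \<in> borel_measurable M"
    using dense by (simp cong: measurable_cong)
  assume \<epsilon>: "0 < \<epsilon>" and small: "sqrt n * \<bar>x0 $ 1\<bar> * exp (- (lam + \<mu>) * s) \<le> \<epsilon> / 2"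
  define c where "c = (\<epsilon> / 2)\<^sup>2 * exp (lam * s) / n"
  have c: "0 < c" using \<epsilon> n by (simp add: c_def)
  let ?E1 = "{w \<in> space M. \<exists>g\<in>?C. c \<le> exp (- lam * clock g w) * (state g w $ 1 - exp (- \<mu> * clock g w) * x0 $ 1)\<^sup>2}"
  let ?E2 = "{w \<in> space M. clock s w < s}"
  have "{w \<in> space M. (SUP t\<in>{T..}. ereal (?f w t)) > ereal \<epsilon>} \<subseteq> ?E1 \<union> ?E2"
  proof
    fix w assume "w \<in> {w \<in> space M. (SUP t\<in>{T..}. ereal (?f w t)) > ereal \<epsilon>}"
    then have w: "w \<in> space M" and "ereal \<epsilon> < (SUP t\<in>?C. ereal (?f w t))" using dense by auto
    then obtain t where t: "t \<in> ?C" "ereal \<epsilon> < ereal (?f w t)" unfolding less_SUP_iff by blast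
    from t(2) have t2: "\<epsilon> < ?f w t" by simp
    show "w \<in> ?E1 \<union> ?E2"
    proof (cases "clock s w < s")
      case True
      then show ?thesis using w by simp
    next
      case False
      have t0: "0 \<le> t" "s \<le> t" using t(1) T s by auto
      define k where "k = clock t w"
      have k: "s \<le> k" "k \<le> t"
        using clock_ge[OF w s(1) t0(2) False] clock_bounds(2)[OF w t0(1)] by (simp_all add: k_def)
      define d where "d = state t w $ 1 - exp (- \<mu> * k) * x0 $ 1"
      have "\<bar>state t w $ 1\<bar> \<le> \<bar>d\<bar> + exp (- \<mu> * k) * \<bar>x0 $ 1\<bar>"
        using abs_triangle_ineq[of d "exp (- \<mu> * k) * x0 $ 1"] by (simp add: d_def abs_mult)
      then have "?f w t \<le> sqrt n * exp (- lam * t) * (\<bar>d\<bar> + exp (- \<mu> * k) * \<bar>x0 $ 1\<bar>)"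
        using n by (intro mult_left_mono) auto
      also have "\<dots> = sqrt n * exp (- lam * t) * \<bar>d\<bar> + sqrt n * \<bar>x0 $ 1\<bar> * (exp (- lam * t) * exp (- \<mu> * k))"
        by (simp add: algebra_simps)
      also have "exp (- lam * t) * exp (- \<mu> * k) \<le> exp (- (lam + \<mu>) * s)"
      proof -
        have "lam * s \<le> lam * t" "\<mu> * s \<le> \<mu> * k" using t0 k lam \<mu> by auto
        then have "- lam * t + - \<mu> * k \<le> - (lam + \<mu>) * s" by (simp add: algebra_simps)
        then show ?thesis unfolding exp_add[symmetric] by simp
      qed
      finally have "?f w t \<le> sqrt n * exp (- lam * t) * \<bar>d\<bar> + \<epsilon> / 2"
        using small n by (simp add: mult_left_mono)
      then have "\<epsilon> / 2 \<le> sqrt n * exp (- lam * t) * \<bar>d\<bar>" using t2 by linarith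
      then have "(\<epsilon> / 2)\<^sup>2 \<le> (sqrt n * exp (- lam * t) * \<bar>d\<bar>)\<^sup>2" using \<epsilon> by (intro power_mono) auto
      also have "\<dots> = n * exp (- 2 * lam * t) * d\<^sup>2"
        using n by (simp add: power_mult_distrib exp_double[symmetric])
      also have "\<dots> \<le> n * exp (- lam * k - lam * s) * d\<^sup>2"
      proof -
        have "lam * k \<le> lam * t" "lam * s \<le> lam * t" using k t0 lam by auto
        then have "- 2 * lam * t \<le> - lam * k - lam * s" by linarith
        then show ?thesis using n by (intro mult_right_mono mult_left_mono) auto
      qed
      also have "\<dots> = n * exp (- lam * s) * (exp (- lam * k) * d\<^sup>2)"
        by (simp add: exp_diff exp_minus field_simps)
      finally have "(\<epsilon> / 2)\<^sup>2 * exp (lam * s) \<le> n * exp (- lam * s) * (exp (- lam * k) * d\<^sup>2) * exp (lam * s)"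
        by (intro mult_right_mono) auto
      also have "\<dots> = n * (exp (- lam * k) * d\<^sup>2)" by (simp add: exp_minus field_simps)
      finally have "c \<le> exp (- lam * k) * d\<^sup>2" using n by (simp add: c_def field_simps)
      then show ?thesis using w t(1) unfolding d_def k_def by blast
    qed
  qed
  then have "measure M {w \<in> space M. (SUP t\<in>{T..}. ereal (?f w t)) > ereal \<epsilon>} \<le> measure M (?E1 \<union> ?E2)"
    by (rule finite_measure_mono[OF _ sets.Un[OF stable_event[OF C] exited_event[OF s(1)]]])
  also have "\<dots> \<le> measure M ?E1 + measure M ?E2"
    by (rule measure_Un_le[OF stable_event[OF C] exited_event[OF s(1)]])
  finally show "measure M {w \<in> space M. (SUP t\<in>{T..}. ereal (?f w t)) > ereal \<epsilon>}
      \<le> C1 / (lam * ((\<epsilon> / 2)\<^sup>2 * exp (lam * s) / n)) + measure M ?E2"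
    using stable_coordinate_bound[OF C c] unfolding c_def by linarith
qed

text \<open>
  An oscillation above \<open>\<epsilon>\<close> forces a deviation of at least \<open>\<epsilon>
  / 2\<close> from the value at time \<open>T\<close>.
\<close>

lemma unstable_oscillation:
  assumes n: "0 < n" and T: "0 \<le> T"
  defines "p \<equiv> \<lambda>t w. exp (- lam * clock t w) * state t w $ 2"
  shows "(\<lambda>w. SUP t1\<in>{T..}. SUP t2\<in>{T..}. ereal (sqrt n * \<bar>p t1 w - p t2 w\<bar>)) \<in> borel_measurable M"
    and "0 < \<epsilon> \<Longrightarrow> measure M {w \<in> space M. (SUP t1\<in>{T..}. SUP t2\<in>{T..}. ereal (sqrt n * \<bar>p t1 w - p t2 w\<bar>)) > ereal \<epsilon>}
      \<le> 4 * n * C2 T / \<epsilon>\<^sup>2"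
proof -
  let ?f = "\<lambda>w t1 t2. sqrt n * \<bar>p t1 w - p t2 w\<bar>"
  let ?C = "{T..} \<inter> \<rat>"
  have C: "countable ?C" "?C \<subseteq> {T..}" using countable_Rats_Int by auto
  have dense1: "(SUP t2\<in>{T..}. ereal (?f w t1 t2)) = (SUP t2\<in>?C. ereal (?f w t1 t2))" if w: "w \<in> space M" for w t1
  proof (rule SUP_ereal_dense_atLeast)
    fix t :: real assume "T \<le> t"
    then have t: "0 \<le> t" using T by simp
    show "(?f w t1 \<longlongrightarrow> ?f w t1 t) (at_right t)"
      unfolding p_def
      by (rule right_continuous_functional[OF S_borel t w,
            where \<Phi>="\<lambda>s c x. sqrt n * \<bar>exp (- lam * clock t1 w) * state t1 w $ 2 - exp (- lam * c) * x $ 2\<bar>"])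
        (intro continuous_intros)+
  qed
  have sym: "?f w t1 t2 = ?f w t2 t1" for w t1 t2 by (simp add: abs_minus_commute)
  have dense: "(SUP t1\<in>{T..}. SUP t2\<in>{T..}. ereal (?f w t1 t2)) = (SUP t2\<in>?C. SUP t1\<in>?C. ereal (?f w t2 t1))"
    if w: "w \<in> space M" for w
  proof -
    have "(SUP t1\<in>{T..}. SUP t2\<in>{T..}. ereal (?f w t1 t2)) = (SUP t1\<in>{T..}. SUP t2\<in>?C. ereal (?f w t1 t2))"
      by (simp only: dense1[OF w])
    also have "\<dots> = (SUP t2\<in>?C. SUP t1\<in>{T..}. ereal (?f w t1 t2))" by (rule SUP_commute)
    also have "\<dots> = (SUP t2\<in>?C. SUP t1\<in>{T..}. ereal (?f w t2 t1))" by (intro SUP_cong refl arg_cong[where f=ereal] sym)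
    also have "\<dots> = (SUP t2\<in>?C. SUP t1\<in>?C. ereal (?f w t2 t1))" by (simp only: dense1[OF w])
    finally show ?thesis .
  qed
  have pm: "p t \<in> borel_measurable M" if "T \<le> t" for t
  proof -
    have t: "0 \<le> t" using that T by simp
    note [measurable] = state_measurable[OF t] clock_measurable[OF t]
    show ?thesis unfolding p_def by measurable
  qed
  have "(\<lambda>w. SUP t2\<in>?C. SUP t1\<in>?C. ereal (?f w t2 t1)) \<in> borel_measurable M"
  proof (rule borel_measurable_SUP[OF C(1)], rule borel_measurable_SUP[OF C(1)])
    fix t s assume "t \<in> ?C" "s \<in> ?C"
    then have [measurable]: "p t \<in> borel_measurable M" "p s \<in> borel_measurable M" using pm by auto
    show "(\<lambda>w. ereal (?f w t s)) \<in> borel_measurable M" by measurable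
  qed
  then show "(\<lambda>w. SUP t1\<in>{T..}. SUP t2\<in>{T..}. ereal (?f w t1 t2)) \<in> borel_measurable M"
    using dense by (simp cong: measurable_cong)
  assume \<epsilon>: "0 < \<epsilon>"
  define c where "c = \<epsilon>\<^sup>2 / (4 * n)"
  have c: "0 < c" using \<epsilon> n by (simp add: c_def)
  let ?E = "{w \<in> space M. \<exists>g\<in>?C. c \<le> (p g w - p T w)\<^sup>2}"
  have E: "?E \<in> sets M"
  proof (rule event_measurable[OF C(1)])
    fix g assume "g \<in> ?C"
    then have [measurable]: "p g \<in> borel_measurable M" "p T \<in> borel_measurable M" using pm by auto
    show "{w \<in> space M. c \<le> (p g w - p T w)\<^sup>2} \<in> sets M" by measurable
  qed
  have far: "c \<le> d\<^sup>2" if "\<epsilon> / 2 \<le> sqrt n * \<bar>d\<bar>" for d :: real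
  proof -
    have "(\<epsilon> / 2)\<^sup>2 \<le> (sqrt n * \<bar>d\<bar>)\<^sup>2" using that \<epsilon> by (intro power_mono) auto
    then have "\<epsilon>\<^sup>2 / 4 \<le> n * d\<^sup>2" using n by (simp add: power_mult_distrib power_divide)
    then show ?thesis using n by (simp add: c_def field_simps)
  qed
  have "{w \<in> space M. (SUP t1\<in>{T..}. SUP t2\<in>{T..}. ereal (?f w t1 t2)) > ereal \<epsilon>} \<subseteq> ?E"
  proof
    fix w assume "w \<in> {w \<in> space M. (SUP t1\<in>{T..}. SUP t2\<in>{T..}. ereal (?f w t1 t2)) > ereal \<epsilon>}"
    then have w: "w \<in> space M" and "ereal \<epsilon> < (SUP t2\<in>?C. SUP t1\<in>?C. ereal (?f w t2 t1))" using dense by auto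
    then obtain t s where ts: "t \<in> ?C" "s \<in> ?C" "ereal \<epsilon> < ereal (?f w t s)" unfolding less_SUP_iff by blast
    from ts(3) have ts3: "\<epsilon> < ?f w t s" by simp
    have "sqrt n * \<bar>p t w - p s w\<bar> \<le> sqrt n * (\<bar>p t w - p T w\<bar> + \<bar>p s w - p T w\<bar>)"
      using n by (intro mult_left_mono) auto
    then have "\<epsilon> / 2 \<le> sqrt n * \<bar>p t w - p T w\<bar> \<or> \<epsilon> / 2 \<le> sqrt n * \<bar>p s w - p T w\<bar>"
      using ts3 unfolding distrib_left by linarith
    then show "w \<in> ?E" using w ts far by blast
  qed
  then have "measure M {w \<in> space M. (SUP t1\<in>{T..}. SUP t2\<in>{T..}. ereal (?f w t1 t2)) > ereal \<epsilon>} \<le> measure M ?E"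
    by (rule finite_measure_mono[OF _ E])
  also have "\<dots> \<le> C2 T / c" unfolding p_def by (rule unstable_coordinate_bound[OF T C c])
  also have "\<dots> = 4 * n * C2 T / \<epsilon>\<^sup>2" by (simp add: c_def)
  finally show "measure M {w \<in> space M. (SUP t1\<in>{T..}. SUP t2\<in>{T..}. ereal (?f w t1 t2)) > ereal \<epsilon>} \<le> 4 * n * C2 T / \<epsilon>\<^sup>2" .
qed

end

text \<open>
  The bound with the scaling in \<open>n\<close> made explicit. The first group is small for small
  \<open>e\<close>, the second for small \<open>\<epsilon>\<close> and then large
  \<open>R\<close>, and the third for large \<open>n\<close> with everything else fixed.
\<close>

lemma (in saddle_clt) characteristic_estimate:
  fixes u :: real
  assumes tube: "0 < \<rho>" "\<And>t. 0 \<le> t \<Longrightarrow> ball (stable_path \<mu> x0 t) \<rho> \<subseteq> S"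
    and R: "0 \<le> R" "R \<le> t" and \<epsilon>: "0 < \<epsilon>" and e: "0 < e"
    and scale: "v = k2 / n" "\<beta> = e / sqrt n" "\<tau> = k3 / n\<^sup>2" "\<alpha> = e"
  defines "E \<equiv> exp (u\<^sup>2 / 2 * A R)"
  shows "cmod ((\<integral>w. iexp (phase u t w) \<partial>M) - exp (- (u\<^sup>2 / 2 * A R)))
    \<le> (2 * R * E * (\<bar>u\<bar> + u\<^sup>2 / 2 * (1 + L)) * e + 8 * e\<^sup>2 / (lam\<^sup>2 * \<epsilon>\<^sup>2)) + (\<bar>u\<bar> * \<epsilon> + 4 * k2 * exp (- lam * R) / (lam * \<epsilon>\<^sup>2))
      + (2 * R * E * \<bar>u\<bar> ^ 3 * k3 / sqrt n
        + (2 * R * (E * (u\<^sup>2 / 2) * L / e * exp ((2 * lam + 1) * R)) * (R + 1) * (2 * e\<^sup>2 + 2 * k2)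
          + 2 * E * (2 * (k2 + e\<^sup>2 / \<mu>) * exp (lam * R) / (lam * \<rho>\<^sup>2) + 2 * (4 * e\<^sup>2 / lam\<^sup>2 + 2 * k2 / lam) * exp (2 * lam * R) / \<rho>\<^sup>2)) / n)"
proof -
  have sn: "0 < sqrt n" "sqrt n * sqrt n = n" "(sqrt n)\<^sup>2 = n" using n by auto
  define K where "K = \<bar>u\<bar> + u\<^sup>2 / 2 * (1 + L)"
  define B where "B = E * (u\<^sup>2 / 2) * L / e * exp ((2 * lam + 1) * R)"
  define G where "G = 2 * (k2 + e\<^sup>2 / \<mu>) * exp (lam * R) / (lam * \<rho>\<^sup>2) + 2 * (4 * e\<^sup>2 / lam\<^sup>2 + 2 * k2 / lam) * exp (2 * lam * R) / \<rho>\<^sup>2"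
  let ?P = "measure M {w \<in> space M. clock R w < R}"
  have b2: "\<beta>\<^sup>2 = e\<^sup>2 / n" by (simp add: scale power_divide sn)
  have C1: "C1 = (k2 + e\<^sup>2 / \<mu>) / n"
    by (simp only: C1_def b2) (simp add: scale(1) add_divide_distrib)
  have C2: "C2 r = (4 * e\<^sup>2 / lam\<^sup>2 + 2 * k2 * exp (- lam * r) / lam) / n" for r
    by (simp only: C2_def b2) (simp add: scale(1) add_divide_distrib mult.commute)
  have C2_0: "C2 0 = (4 * e\<^sup>2 / lam\<^sup>2 + 2 * k2 / lam) / n" unfolding C2 by simp
  have FE: "F u R = E" by (simp add: F_def E_def)
  have E0: "0 < E" by (simp add: E_def)
  have cube: "\<bar>u * sqrt n\<bar> ^ 3 * \<tau> = \<bar>u\<bar> ^ 3 * k3 / sqrt n"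
  proof -
    have "\<bar>u * sqrt n\<bar> ^ 3 * \<tau> = \<bar>u\<bar> ^ 3 * k3 * ((sqrt n) ^ 3 / n\<^sup>2)" using sn by (simp add: scale abs_mult power_mult_distrib)
    also have "(sqrt n) ^ 3 / n\<^sup>2 = 1 / sqrt n"
    proof -
      have "(sqrt n) ^ 3 * sqrt n = n\<^sup>2" using sn(2) by (simp add: power2_eq_square power3_eq_cube)
      then show ?thesis using sn(1) n by (simp add: field_simps)
    qed
    finally show ?thesis by simp
  qed
  have err: "err u e R = E * (K * e) + E * (\<bar>u\<bar> ^ 3 * k3 / sqrt n) + B * (R + 1) * ((2 * e\<^sup>2 + 2 * k2) / n)"
  proof -
    have lin: "\<bar>u * sqrt n\<bar> * \<beta> = \<bar>u\<bar> * e" using sn by (simp add: scale abs_mult)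
    have quad: "2 * \<beta>\<^sup>2 + 2 * v = (2 * e\<^sup>2 + 2 * k2) / n" by (simp add: b2 scale(1) add_divide_distrib)
    have "E * (\<bar>u\<bar> * e + z + u\<^sup>2 / 2 * (\<alpha> + L * e)) = E * (K * e) + E * z" for z
      by (simp add: K_def scale(4) algebra_simps)
    then show ?thesis by (simp only: err_def B0_def FE lin cube quad B_def)
  qed
  have "2 * (c / n) * x / y + 2 * (c' / n) * x' / y' = (2 * c * x / y + 2 * c' * x' / y') / n" for c x y c' x' y'
    by (simp add: add_divide_distrib mult.commute)
  then have "?P \<le> G / n"
    using exit_bound[OF tube R(1)] by (simp only: C1 C2_0 G_def)
  then have "2 * F u R * ?P \<le> 2 * E * (G / n)"
    unfolding FE using E0 by (intro mult_left_mono) auto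
  moreover have "2 * (n * C2 R / \<epsilon>\<^sup>2) = 8 * e\<^sup>2 / (lam\<^sup>2 * \<epsilon>\<^sup>2) + 4 * k2 * exp (- lam * R) / (lam * \<epsilon>\<^sup>2)"
  proof -
    have "n * C2 R = 4 * e\<^sup>2 / lam\<^sup>2 + 2 * k2 * exp (- lam * R) / lam" unfolding C2 using n by simp
    then show ?thesis by (simp only:) (simp add: add_divide_distrib)
  qed
  moreover have "2 * (err u e R * R) = 2 * R * E * K * e + 2 * R * E * \<bar>u\<bar> ^ 3 * k3 / sqrt n
     + 2 * R * B * (R + 1) * (2 * e\<^sup>2 + 2 * k2) / n"
  proof -
    have "2 * ((E * (K * e) + E * (a' * k3 / c') + B * r * (q / n)) * R) = 2 * R * E * K * e + 2 * R * E * a' * k3 / c' + 2 * R * B * r * q / n"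
      for a' c' r q by (simp add: algebra_simps)
    then show ?thesis unfolding err .
  qed
  moreover have "(p + 2 * E * G) / n = p / n + 2 * E * (G / n)" for p by (simp add: add_divide_distrib)
  ultimately have "cmod ((\<integral>w. iexp (phase u t w) \<partial>M) - exp (- (u\<^sup>2 / 2 * A R)))
    \<le> (2 * R * E * K * e + 8 * e\<^sup>2 / (lam\<^sup>2 * \<epsilon>\<^sup>2)) + (\<bar>u\<bar> * \<epsilon> + 4 * k2 * exp (- lam * R) / (lam * \<epsilon>\<^sup>2))
      + (2 * R * E * \<bar>u\<bar> ^ 3 * k3 / sqrt n + (2 * R * B * (R + 1) * (2 * e\<^sup>2 + 2 * k2) + 2 * E * G) / n)"
    using characteristic_bound[OF e R(1) R(2) \<epsilon>, of u] by (simp only:)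
  then show ?thesis unfolding K_def B_def G_def .
qed

section \<open>Scaling of the kernels: variance and drift\<close>

context near_saddle
begin

lemma a_bounds:
  assumes x: "x \<in> S"
  shows "0 \<le> a x" "a x \<le> c2"
proof -
  show "0 \<le> a x" unfolding a_eq[OF x] by (rule Bochner_Integration.integral_nonneg) simp
  interpret k: exponential_moments "K x" \<eta>0 using K_moments[OF x] .
  let ?b = "axis 2 1 :: real^2"
  have b: "?b \<in> Basis" by (simp add: axis_in_Basis_iff)
  have yi: "y \<bullet> ?b = y $ 2" for y :: "real^2" by (simp add: inner_axis)
  have l: "laplace (K x) (\<eta>0 *\<^sub>R ?b) \<le> Cl" "laplace (K x) (- \<eta>0 *\<^sub>R ?b) \<le> Cl"
    using x eta by (auto intro!: Cl(2))
  have "a x \<le> fact 2 * (2 / \<eta>0)\<^sup>2 * (laplace (K x) (\<eta>0 *\<^sub>R ?b) + laplace (K x) (- \<eta>0 *\<^sub>R ?b))"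
    using k.coordinate_moment(2)[OF b, of 2] unfolding a_eq[OF x] yi power2_abs .
  also have "\<dots> \<le> fact 2 * (2 / \<eta>0)\<^sup>2 * (2 * (Cl + 1))"
    by (intro mult_left_mono order_trans[OF add_mono[OF l(1) l(2)]]) auto
  also have "\<dots> = c2" by (simp add: c2_def power_divide)
  finally show "a x \<le> c2" .
qed

text \<open>
  \<open>A\<close> is an antiderivative along the path, extended constantly to negative times
  inside \<open>a\<close> so that it is differentiable at 0 from both sides. Its limit is the
  integral over the half-line since \<open>a\<close> is bounded and the exponential is integrable.
\<close>

lemma limiting_variance:
  obtains L A where "0 \<le> L" "\<And>x x'. x \<in> S \<Longrightarrow> x' \<in> S \<Longrightarrow> \<bar>a x - a x'\<bar> \<le> L * norm (x - x')"
    "A 0 = 0" "\<And>t. 0 \<le> t \<Longrightarrow> (A has_real_derivative exp (- 2 * lam * t) * a (stable_path \<mu> x0 t)) (at t)"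
    "A \<in> borel_measurable borel" "(\<lambda>t. a (stable_path \<mu> x0 (max 0 t))) \<in> borel_measurable borel"
    "(A \<longlongrightarrow> sigma_inf_sq lam \<mu> x0 K) at_top"
proof -
  obtain L where L: "L-lipschitz_on S (\<lambda>x. diffusivity (K x))" using d by blast
  have L0: "0 \<le> L" using lipschitz_on_nonneg[OF L] .
  have lip: "\<bar>a x - a x'\<bar> \<le> L * norm (x - x')" if "x \<in> S" "x' \<in> S" for x x'
  proof -
    have "\<bar>a x - a x'\<bar> = \<bar>(diffusivity (K x) - diffusivity (K x')) $ 2 $ 2\<bar>" by (simp add: a_def)
    also have "\<dots> \<le> norm ((diffusivity (K x) - diffusivity (K x')) $ 2)" by (rule component_le_norm_cart)
    also have "\<dots> \<le> norm (diffusivity (K x) - diffusivity (K x'))" by (rule Finite_Cartesian_Product.norm_nth_le)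
    also have "\<dots> \<le> L * norm (x - x')" using lipschitz_onD[OF L that] by (simp add: dist_norm)
    finally show ?thesis .
  qed
  have "L-lipschitz_on S a" using lip L0 by (intro lipschitz_onI) (auto simp: dist_norm)
  then have "continuous_on S a" by (rule lipschitz_on_continuous_on)
  then have ca: "isCont a x" if "x \<in> S" for x using that continuous_on_eq_continuous_at[OF S] by blast
  let ?p = "\<lambda>t. stable_path \<mu> x0 (max 0 t)"
  have cp: "isCont (\<lambda>t. a (?p t)) t" for t
  proof (rule isCont_o2[where g=a and f="?p"])
    show "isCont ?p t" unfolding stable_path_def by (intro continuous_intros)
    show "isCont a (?p t)" by (rule ca[OF path_in]) simp
  qed
  define \<psi> where "\<psi> t = exp (- 2 * lam * t) * a (?p t)" for t
  have c\<psi>: "isCont \<psi> t" for t unfolding \<psi>_def using cp by (intro continuous_intros)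
  obtain F where F: "\<And>t. (F has_vector_derivative \<psi> t) (at t)"
    using einterval_antiderivative[of "-\<infinity>" \<infinity> \<psi>] c\<psi> by auto
  define A where "A t = F t - F 0" for t
  have A': "(A has_real_derivative \<psi> t) (at t)" for t
    unfolding A_def using F[of t] by (auto intro!: derivative_eq_intros simp: has_real_derivative_iff_has_vector_derivative[symmetric])
  have "isCont A t" for t using A' by (rule DERIV_isCont)
  then have A_meas: "A \<in> borel_measurable borel" by (intro borel_measurable_continuous_onI continuous_at_imp_continuous_on) auto
  have p_meas: "(\<lambda>t. a (?p t)) \<in> borel_measurable borel"
    using cp by (intro borel_measurable_continuous_onI continuous_at_imp_continuous_on) auto
  have \<psi>_bounds: "0 \<le> \<psi> t" "\<psi> t \<le> c2 * exp (- (t * (2 * lam)))" for t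
  proof -
    have "?p t \<in> S" by (rule path_in) simp
    note ab = a_bounds[OF this]
    show "0 \<le> \<psi> t" using ab by (simp add: \<psi>_def)
    have "exp (- 2 * lam * t) * a (?p t) \<le> exp (- 2 * lam * t) * c2" using ab(2) by (intro mult_left_mono) auto
    then show "\<psi> t \<le> c2 * exp (- (t * (2 * lam)))" by (simp add: \<psi>_def ac_simps)
  qed
  have \<psi>_meas: "\<psi> \<in> borel_measurable borel"
    using c\<psi> by (intro borel_measurable_continuous_onI continuous_at_imp_continuous_on) auto
  have int: "set_integrable lborel {0..} \<psi>"
  proof -
    have "set_integrable lborel {0 <..} (\<lambda>t. c2 * exp (- (t * (2 * lam))))"
      using lam by (intro set_integrable_mult_right integrable_I0i_exp_mscale) simp
    then have "set_integrable lborel {0 <..} \<psi>"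
      unfolding set_integrable_def
    proof (rule Bochner_Integration.integrable_bound)
      show "(\<lambda>t. indicator {0<..} t *\<^sub>R \<psi> t) \<in> borel_measurable lborel" using \<psi>_meas by simp
      show "AE t in lborel. norm (indicator {0<..} t *\<^sub>R \<psi> t) \<le> norm (indicator {0<..} t *\<^sub>R (c2 * exp (- (t * (2 * lam)))))"
        using \<psi>_bounds by (intro AE_I2) (auto split: split_indicator intro: order_trans[OF _ abs_ge_self])
    qed
    then show ?thesis
      unfolding set_integrable_def
    proof (subst integrable_cong_AE[where g="\<lambda>t. indicator {0<..} t *\<^sub>R \<psi> t"])
      show "AE t in lborel. indicator {0..} t *\<^sub>R \<psi> t = indicator {0<..} t *\<^sub>R \<psi> t"
        using AE_lborel_singleton[of 0] by eventually_elim (auto split: split_indicator)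
    qed (use \<psi>_meas in simp_all)
  qed
  have "(LINT t : {0..b} | lborel. \<psi> t) = A b" if "0 \<le> b" for b
  proof -
    have "(\<integral>t. \<psi> t * indicator {0..b} t \<partial>lborel) = A b - A 0"
      using A' c\<psi> that by (intro integral_FTC_Icc_real) auto
    then show ?thesis by (simp add: set_lebesgue_integral_def A_def mult.commute)
  qed
  then have ev: "eventually (\<lambda>b. (LINT t : {0..b} | lborel. \<psi> t) = A b) at_top"
    by (rule eventually_at_top_linorderI)
  have "((\<lambda>b. LINT t : {0..b} | lborel. \<psi> t) \<longlongrightarrow> (LINT t : {0..} | lborel. \<psi> t)) at_top"
    by (rule tendsto_set_lebesgue_integral_at_top[OF _ int]) simp
  then have "(A \<longlongrightarrow> (LINT t : {0..} | lborel. \<psi> t)) at_top"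
    by (rule Lim_transform_eventually[OF _ ev])
  also have "(LINT t : {0..} | lborel. \<psi> t) = sigma_inf_sq lam \<mu> x0 K"
    unfolding sigma_inf_sq_def by (rule set_lebesgue_integral_cong) (auto simp: \<psi>_def a_def)
  finally have lim: "(A \<longlongrightarrow> sigma_inf_sq lam \<mu> x0 K) at_top" .
  have A0: "A 0 = 0" by (simp add: A_def)
  have Ad: "(A has_real_derivative exp (- 2 * lam * t) * a (stable_path \<mu> x0 t)) (at t)" if "0 \<le> t" for t
  proof -
    have "max 0 t = t" using that by simp
    then show ?thesis using A'[of t] by (simp only: \<psi>_def)
  qed
  show thesis by (rule that[OF L0 lip A0 Ad A_meas p_meas lim])
qed

text \<open>
  All bounds on the kernels hold for the same large \<open>N\<close>, with the drift error and the
  variance error at an arbitrary fixed level \<open>e\<close>.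
\<close>

lemma eventually_saddle_clt:
  assumes e: "0 < e" and L: "0 \<le> L" "\<And>x x'. x \<in> S \<Longrightarrow> x' \<in> S \<Longrightarrow> \<bar>a x - a x'\<bar> \<le> L * norm (x - x')"
    and A: "A 0 = 0" "\<And>t. 0 \<le> t \<Longrightarrow> (A has_real_derivative exp (- 2 * lam * t) * a (stable_path \<mu> x0 t)) (at t)"
      "A \<in> borel_measurable borel" "(\<lambda>t. a (stable_path \<mu> x0 (max 0 t))) \<in> borel_measurable borel"
  shows "\<forall>\<^sub>F N in sequentially. N \<ge> 1 \<and> (\<exists>J Y. saddle_clt (M N) (I N) (KN N) x0 (X N) J Y S lam \<mu> (c2 / real N) (e / sqrt (real N)) a L (real N) e (c3 / (real N)\<^sup>2) A)"
  using moments_N drift_close[OF e] variance_close[OF e]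
proof eventually_elim
  case (elim N)
  have N: "N \<ge> 1" "0 < real N" using elim(1) by auto
  have em: "exponential_moments (KN N x) (real N * \<eta>0)" if "x \<in> I N \<inter> S" for x
    using elim(1) that by blast
  have lp: "laplace (KN N x) (real N *\<^sub>R \<theta>) \<le> real N * (Cl + 1)" if "x \<in> I N \<inter> S" "norm \<theta> \<le> \<eta>0" for x \<theta>
    using elim(1) that by blast
  obtain J Y where jp: "jump_process (M N) (I N) (KN N) x0 (X N) J Y"
    using pure_jump_markovD[OF process[OF N(1)]] .
  have dr: "\<bar>(\<integral>y. y $ i \<partial>KN N x) - drift (K x) $ i\<bar> \<le> e / sqrt (real N)" if x: "x \<in> I N \<inter> S" for x i
  proof -
    have "\<bar>(\<integral>y. y $ i \<partial>KN N x) - drift (K x) $ i\<bar> = \<bar>(drift (KN N x) - drift (K x)) $ i\<bar>"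
      by (simp add: drift_component(2)[OF em[OF x]])
    also have "\<dots> \<le> norm (drift (KN N x) - drift (K x))" by (rule component_le_norm_cart)
    also have "\<dots> \<le> e / sqrt (real N)"
    proof -
      have "sqrt (real N) * norm (drift (KN N x) - drift (K x)) \<le> e" using elim(2) x by blast
      then show ?thesis using N by (simp add: field_simps)
    qed
    finally show ?thesis .
  qed
  have dK: "drift (K x) $ 1 = - \<mu> * x $ 1" "drift (K x) $ 2 = lam * x $ 2" if "x \<in> S" for x
    using linear[OF that] by (simp_all add: saddle_matrix_def matrix_vector_mult_def sum_2)
  have second: "integrable (KN N x) (\<lambda>y. (y $ i)\<^sup>2)" "(\<integral>y. (y $ i)\<^sup>2 \<partial>KN N x) \<le> c2 / real N" if x: "x \<in> I N \<inter> S" for x i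
  proof -
    note pm = power_moment_N[OF N(1) em[OF x] lp[OF x], of i 2]
    show "integrable (KN N x) (\<lambda>y. (y $ i)\<^sup>2)" using pm(1) by simp
    have "fact 2 * (2 / (real N * \<eta>0))\<^sup>2 * (2 * (real N * (Cl + 1))) = c2 / real N"
      using N eta by (simp add: c2_def power2_eq_square field_simps)
    with pm(2) show "(\<integral>y. (y $ i)\<^sup>2 \<partial>KN N x) \<le> c2 / real N" by simp
  qed
  have third: "integrable (KN N x) (\<lambda>y. \<bar>y $ 2\<bar> ^ 3)" "(\<integral>y. \<bar>y $ 2\<bar> ^ 3 \<partial>KN N x) \<le> c3 / (real N)\<^sup>2" if x: "x \<in> I N \<inter> S" for x
  proof -
    note pm = power_moment_N[OF N(1) em[OF x] lp[OF x], of 2 3]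
    show "integrable (KN N x) (\<lambda>y. \<bar>y $ 2\<bar> ^ 3)" by (rule pm(1))
    have "fact 3 * (2 / (real N * \<eta>0)) ^ 3 * (2 * (real N * (Cl + 1))) = c3 / (real N)\<^sup>2"
      using N eta by (simp add: c3_def fact_numeral power2_eq_square power3_eq_cube field_simps)
    with pm(2) show "(\<integral>y. \<bar>y $ 2\<bar> ^ 3 \<partial>KN N x) \<le> c3 / (real N)\<^sup>2" by simp
  qed
  have "saddle_process (M N) (I N) (KN N) x0 (X N) J Y S lam \<mu> (c2 / real N) (e / sqrt (real N))"
  proof (rule saddle_process.intro[OF jp], unfold_locales)
    show "open S" by (rule S)
    show "0 < lam" by (rule lam)
    show "0 < \<mu>" by (rule \<mu>)
    show "x0 $ 2 = 0" by (rule start)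
    show "0 \<le> c2 / real N" using c_pos(1) by simp
    show "0 \<le> e / sqrt (real N)" using e by simp
    show "integrable (KN N x) (\<lambda>y. y $ i)" if "x \<in> I N \<inter> S" for x i by (rule drift_component(1)[OF em[OF that]])
    show "integrable (KN N x) (\<lambda>y. (y $ i)\<^sup>2)" if "x \<in> I N \<inter> S" for x i by (rule second(1)[OF that])
    show "(\<integral>y. (y $ i)\<^sup>2 \<partial>KN N x) \<le> c2 / real N" if "x \<in> I N \<inter> S" for x i by (rule second(2)[OF that])
    show "\<bar>(\<integral>y. y $ 1 \<partial>KN N x) + \<mu> * x $ 1\<bar> \<le> e / sqrt (real N)" if "x \<in> I N \<inter> S" for x
      using dr[OF that, of 1] dK(1)[of x] that by simp
    show "\<bar>(\<integral>y. y $ 2 \<partial>KN N x) - lam * x $ 2\<bar> \<le> e / sqrt (real N)" if "x \<in> I N \<inter> S" for x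
      using dr[OF that, of 2] dK(2)[of x] that by simp
  qed
  then have "saddle_clt (M N) (I N) (KN N) x0 (X N) J Y S lam \<mu> (c2 / real N) (e / sqrt (real N)) a L (real N) e (c3 / (real N)\<^sup>2) A"
  proof (rule saddle_clt.intro, unfold_locales)
    show "0 < real N" by (rule N)
    show "0 \<le> L" by (rule L)
    show "\<bar>a x - a x'\<bar> \<le> L * norm (x - x')" if "x \<in> S" "x' \<in> S" for x x' by (rule L(2)[OF that])
    show "stable_path \<mu> x0 t \<in> S" if "0 \<le> t" for t by (rule path_in[OF that])
    show "0 \<le> a x" if "x \<in> S" for x by (rule a_bounds(1)[OF that])
    show "\<bar>a x - real N * (\<integral>y. (y $ 2)\<^sup>2 \<partial>KN N x)\<bar> \<le> e" if "x \<in> I N \<inter> S" for x using elim(3) that by blast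
    show "integrable (KN N x) (\<lambda>y. \<bar>y $ 2\<bar> ^ 3)" if "x \<in> I N \<inter> S" for x by (rule third(1)[OF that])
    show "(\<integral>y. \<bar>y $ 2\<bar> ^ 3 \<partial>KN N x) \<le> c3 / (real N)\<^sup>2" if "x \<in> I N \<inter> S" for x by (rule third(2)[OF that])
    show "0 \<le> e" using e by simp
    show "0 \<le> c3 / (real N)\<^sup>2" using c_pos(2) by simp
    show "A 0 = 0" by (rule A(1))
    show "(A has_real_derivative exp (- 2 * lam * t) * a (stable_path \<mu> x0 t)) (at t)" if "0 \<le> t" for t by (rule A(2)[OF that])
    show "A \<in> borel_measurable borel" by (rule A(3))
    show "(\<lambda>t. a (stable_path \<mu> x0 (max 0 t))) \<in> borel_measurable borel" by (rule A(4))
  qed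
  then show ?case using N(1) by blast
qed

lemma eventually_saddle:
  assumes e: "0 < e"
  shows "\<forall>\<^sub>F N in sequentially. N \<ge> 1 \<and> (\<exists>J Y. saddle_process (M N) (I N) (KN N) x0 (X N) J Y S lam \<mu> (c2 / real N) (e / sqrt (real N)))"
proof (rule limiting_variance)
  fix L A
  assume LA: "0 \<le> L" "\<And>x x'. x \<in> S \<Longrightarrow> x' \<in> S \<Longrightarrow> \<bar>a x - a x'\<bar> \<le> L * norm (x - x')"
    "A 0 = 0" "\<And>t. 0 \<le> t \<Longrightarrow> (A has_real_derivative exp (- 2 * lam * t) * a (stable_path \<mu> x0 t)) (at t)"
    "A \<in> borel_measurable borel" "(\<lambda>t. a (stable_path \<mu> x0 (max 0 t))) \<in> borel_measurable borel"
  have "\<forall>\<^sub>F N in sequentially. N \<ge> 1 \<and> (\<exists>J Y. saddle_clt (M N) (I N) (KN N) x0 (X N) J Y S lam \<mu> (c2 / real N) (e / sqrt (real N)) a L (real N) e (c3 / (real N)\<^sup>2) A)"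
    by (rule eventually_saddle_clt[OF e LA(1) _ LA(3) _ LA(5) LA(6)], rule LA(2), assumption, assumption, rule LA(4), assumption)
  then show ?thesis
    by eventually_elim (use saddle_clt.axioms(1) in blast)
qed

end

section \<open>Convergence in probability\<close>

lemma tendsto_zero_in_probI:
  assumes meas: "\<forall>\<^sub>F N in sequentially. Z N \<in> borel_measurable (M N)"
    and small: "\<And>\<epsilon> \<delta>. 0 < \<epsilon> \<Longrightarrow> 0 < \<delta> \<Longrightarrow> \<forall>\<^sub>F N in sequentially. measure (M N) {w \<in> space (M N). Z N w > ereal \<epsilon>} < \<delta>"
  shows "tendsto_zero_in_prob M Z"
  unfolding tendsto_zero_in_prob_def
proof (intro conjI meas allI impI)
  fix \<epsilon> :: real assume \<epsilon>: "0 < \<epsilon>"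
  show "(\<lambda>N. measure (M N) {w \<in> space (M N). Z N w > ereal \<epsilon>}) \<longlonglongrightarrow> 0"
  proof (rule order_tendstoI)
    fix \<delta> :: real
    show "0 < \<delta> \<Longrightarrow> \<forall>\<^sub>F N in sequentially. measure (M N) {w \<in> space (M N). Z N w > ereal \<epsilon>} < \<delta>"
      by (rule small[OF \<epsilon>])
    show "\<delta> < 0 \<Longrightarrow> \<forall>\<^sub>F N in sequentially. \<delta> < measure (M N) {w \<in> space (M N). Z N w > ereal \<epsilon>}"
      by (intro always_eventually allI) (rule less_le_trans, assumption, rule measure_nonneg)
  qed
qed

text \<open>
  The square of the growth condition compares \<open>exp (2 * c * T N)\<close> with
  \<open>N\<close>, so every smaller exponential rate is negligible.
\<close>

lemma exp_over_N_tendsto_0: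
  fixes T :: "nat \<Rightarrow> real"
  assumes T: "filterlim T at_top sequentially" and O: "(\<lambda>N. exp (c * T N)) \<in> O(\<lambda>N. sqrt (real N))" and \<theta>: "\<theta> < 2 * c"
  shows "(\<lambda>N. exp (\<theta> * T N) / real N) \<longlonglongrightarrow> 0"
proof -
  obtain C where C: "0 < C" "\<forall>\<^sub>F N in sequentially. norm (exp (c * T N)) \<le> C * norm (sqrt (real N))"
    using landau_o.bigE[OF O] by blast
  have "((\<lambda>x. exp (- ((2 * c - \<theta>) * x))) \<longlongrightarrow> 0) at_top"
    using \<theta> by real_asymp
  then have "(\<lambda>N. exp (- ((2 * c - \<theta>) * T N))) \<longlonglongrightarrow> 0" by (rule filterlim_compose[OF _ T])
  then have lim: "(\<lambda>N. C\<^sup>2 * exp (- ((2 * c - \<theta>) * T N))) \<longlonglongrightarrow> 0" by (rule tendsto_mult_right_zero)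
  show ?thesis
  proof (rule Lim_null_comparison[OF _ lim])
    show "\<forall>\<^sub>F N in sequentially. norm (exp (\<theta> * T N) / real N) \<le> C\<^sup>2 * exp (- ((2 * c - \<theta>) * T N))"
      using C(2) eventually_gt_at_top[of 0]
    proof eventually_elim
      case (elim N)
      have N: "0 < real N" using elim(2) by simp
      have "(exp (c * T N))\<^sup>2 \<le> (C * sqrt (real N))\<^sup>2" using elim(1) by (intro power_mono) auto
      then have le: "(exp (c * T N))\<^sup>2 \<le> C\<^sup>2 * real N" by (simp add: power_mult_distrib)
      have "exp (\<theta> * T N) = exp (2 * (c * T N) + - ((2 * c - \<theta>) * T N))" by (simp add: algebra_simps)
      also have "\<dots> = (exp (c * T N))\<^sup>2 * exp (- ((2 * c - \<theta>) * T N))" by (simp only: exp_add exp_double)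
      also have "\<dots> \<le> C\<^sup>2 * real N * exp (- ((2 * c - \<theta>) * T N))" using le by (intro mult_right_mono) auto
      finally show ?case using N by (simp add: field_simps)
    qed
  qed
qed

context near_saddle
begin

lemma exit_unlikely:
  assumes s: "\<forall>\<^sub>F N in sequentially. 0 \<le> s N" and l1: "(\<lambda>N. exp (lam * s N) / real N) \<longlonglongrightarrow> 0" and l2: "(\<lambda>N. exp (2 * lam * s N) / real N) \<longlonglongrightarrow> 0"
  shows "(\<lambda>N. measure (M N) {w \<in> space (M N). stopped_clock S (X N) (s N) w < s N}) \<longlonglongrightarrow> 0"
proof -
  obtain \<rho> where \<rho>: "0 < \<rho>" "\<And>t. 0 \<le> t \<Longrightarrow> ball (stable_path \<mu> x0 t) \<rho> \<subseteq> S" using path by blast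
  define k1 where "k1 = 2 * (c2 + 1 / \<mu>) / (lam * \<rho>\<^sup>2)"
  define k2 where "k2 = 2 * (4 / lam\<^sup>2 + 2 * c2 / lam) / \<rho>\<^sup>2"
  have "(\<lambda>N. k1 * (exp (lam * s N) / real N) + k2 * (exp (2 * lam * s N) / real N)) \<longlonglongrightarrow> k1 * 0 + k2 * 0"
    by (intro tendsto_intros l1 l2)
  then have lim: "(\<lambda>N. k1 * (exp (lam * s N) / real N) + k2 * (exp (2 * lam * s N) / real N)) \<longlonglongrightarrow> 0" by simp
  show ?thesis
  proof (rule Lim_null_comparison[OF _ lim])
    show "\<forall>\<^sub>F N in sequentially. norm (measure (M N) {w \<in> space (M N). stopped_clock S (X N) (s N) w < s N})
        \<le> k1 * (exp (lam * s N) / real N) + k2 * (exp (2 * lam * s N) / real N)"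
      using eventually_saddle[OF zero_less_one] s
    proof eventually_elim
      case (elim N)
      then obtain J Y where "saddle_process (M N) (I N) (KN N) x0 (X N) J Y S lam \<mu> (c2 / real N) (1 / sqrt (real N))" by blast
      then interpret sp: saddle_process "M N" "I N" "KN N" x0 "X N" J Y S lam \<mu> "c2 / real N" "1 / sqrt (real N)" .
      have N: "0 < real N" using elim(1) by simp
      have C1: "sp.C1 = (c2 + 1 / \<mu>) / real N" using N by (simp add: sp.C1_def power_divide add_divide_distrib mult.commute)
      have C2: "sp.C2 0 = (4 / lam\<^sup>2 + 2 * c2 / lam) / real N" using N by (simp add: sp.C2_def power_divide add_divide_distrib mult.commute)
      have "2 * (c / n) * x / y + 2 * (c' / n) * x' / y' = 2 * c / y * (x / n) + 2 * c' / y' * (x' / n)" for c x y c' x' y' n :: real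
        by (simp add: mult.commute)
      then show ?case using sp.exit_bound[OF \<rho> elim(2)] by (simp add: C1 C2 k1_def k2_def ac_simps)
    qed
  qed
qed

text \<open>
  Both \<open>lam + 2 * \<mu>\<close> and the rate \<open>2 * lam\<close> of the exit bound are
  smaller than \<open>2 * (lam + \<mu>)\<close>.
\<close>

theorem stable_coordinate_limit:
  assumes T: "filterlim T at_top sequentially" and O: "(\<lambda>N. exp ((lam + \<mu>) * T N)) \<in> O(\<lambda>N. sqrt (real N))"
  shows "tendsto_zero_in_prob M (\<lambda>N w. SUP t\<in>{0..T N}. ereal \<bar>exp (\<mu> * t) * stopped S (X N) t w $ 1 - x0 $ 1\<bar>)"
proof (rule tendsto_zero_in_probI)
  have T0: "\<forall>\<^sub>F N in sequentially. 0 \<le> T N" using T unfolding filterlim_at_top by blast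
  show "\<forall>\<^sub>F N in sequentially. (\<lambda>w. SUP t\<in>{0..T N}. ereal \<bar>exp (\<mu> * t) * stopped S (X N) t w $ 1 - x0 $ 1\<bar>) \<in> borel_measurable (M N)"
    using eventually_saddle[OF zero_less_one] T0
    by eventually_elim (use saddle_process.stable_sup(1) in blast)
  fix \<epsilon> \<delta> :: real assume \<epsilon>: "0 < \<epsilon>" and \<delta>: "0 < \<delta>"
  have "(\<lambda>N. (c2 + 1 / \<mu>) / (lam * \<epsilon>\<^sup>2) * (exp ((lam + 2 * \<mu>) * T N) / real N) + measure (M N) {w \<in> space (M N). stopped_clock S (X N) (T N) w < T N})
      \<longlonglongrightarrow> (c2 + 1 / \<mu>) / (lam * \<epsilon>\<^sup>2) * 0 + 0"
    using lam \<mu> by (intro tendsto_intros exit_unlikely T0 exp_over_N_tendsto_0[OF T O]) auto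
  then have "\<forall>\<^sub>F N in sequentially. (c2 + 1 / \<mu>) / (lam * \<epsilon>\<^sup>2) * (exp ((lam + 2 * \<mu>) * T N) / real N) + measure (M N) {w \<in> space (M N). stopped_clock S (X N) (T N) w < T N} < \<delta>"
    using \<delta> by (intro order_tendstoD(2)) auto
  then show "\<forall>\<^sub>F N in sequentially. measure (M N) {w \<in> space (M N). (SUP t\<in>{0..T N}. ereal \<bar>exp (\<mu> * t) * stopped S (X N) t w $ 1 - x0 $ 1\<bar>) > ereal \<epsilon>} < \<delta>"
    using eventually_saddle[OF zero_less_one] T0
  proof eventually_elim
    case (elim N)
    then obtain J Y where "saddle_process (M N) (I N) (KN N) x0 (X N) J Y S lam \<mu> (c2 / real N) (1 / sqrt (real N))" by blast
    then interpret sp: saddle_process "M N" "I N" "KN N" x0 "X N" J Y S lam \<mu> "c2 / real N" "1 / sqrt (real N)" .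
    have N: "0 < real N" using elim(2) by simp
    have C1: "sp.C1 = (c2 + 1 / \<mu>) / real N" using N by (simp add: sp.C1_def power_divide add_divide_distrib mult.commute)
    have "exp (- (lam + 2 * \<mu>) * T N) = 1 / exp ((lam + 2 * \<mu>) * T N)" by (simp only: mult_minus_left exp_minus inverse_eq_divide)
    then have "sp.C1 / (lam * (exp (- (lam + 2 * \<mu>) * T N) * \<epsilon>\<^sup>2)) = (c2 + 1 / \<mu>) / (lam * \<epsilon>\<^sup>2) * (exp ((lam + 2 * \<mu>) * T N) / real N)"
      unfolding C1 by simp
    then show ?case using sp.stable_sup(2)[OF elim(3) \<epsilon>] elim(1) by linarith
  qed
qed

text \<open>
  The bound is used at an intermediate time \<open>s\<close> that is early enough for the process
  to be still in \<open>S\<close> and late enough for the path to be negligible.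
\<close>

theorem late_stable_coordinate_limit:
  assumes \<omega>: "(\<lambda>N. exp ((lam + \<mu>) * T N)) \<in> \<omega>(\<lambda>N. sqrt (real N))"
  shows "tendsto_zero_in_prob M (\<lambda>N w. SUP t\<in>{T N..}. ereal (sqrt (real N) * exp (- lam * t) * \<bar>stopped S (X N) t w $ 1\<bar>))"
proof (rule tendsto_zero_in_probI)
  \<comment> \<open>With exp ((2 * lam + \<mu>) * s) at most N, the rate 2 * lam of the exit bound is beaten, while sqrt N is of smaller order than exp ((lam + \<mu>) * s).\<close>
  define s where "s N = min (T N) (ln (real N) / (2 * lam + \<mu>))" for N
  have "(\<lambda>N. sqrt (real N)) \<in> o(\<lambda>N. exp ((lam + \<mu>) * T N))" using \<omega> by (simp only: smallomega_iff_smallo)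
  from smalloD_tendsto[OF this] have ratio: "(\<lambda>N. sqrt (real N) / exp ((lam + \<mu>) * T N)) \<longlonglongrightarrow> 0" .
  define q where "q N = ln (real N) / (2 * lam + \<mu>)" for N
  have q: "filterlim q at_top sequentially" unfolding q_def using lam \<mu> by real_asymp
  have Ttop: "filterlim T at_top sequentially"
    unfolding filterlim_at_top
  proof
    fix Z :: real
    have "filterlim (\<lambda>N. sqrt (real N)) at_top sequentially" by real_asymp
    then have "\<forall>\<^sub>F N in sequentially. exp ((lam + \<mu>) * Z) \<le> sqrt (real N)" unfolding filterlim_at_top by blast
    moreover have "\<forall>\<^sub>F N in sequentially. sqrt (real N) / exp ((lam + \<mu>) * T N) < 1" by (rule order_tendstoD(2)[OF ratio]) simp
    ultimately show "\<forall>\<^sub>F N in sequentially. Z \<le> T N"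
    proof eventually_elim
      case (elim N)
      then have "sqrt (real N) < exp ((lam + \<mu>) * T N)" by (simp add: field_simps)
      with elim(1) have "exp ((lam + \<mu>) * Z) < exp ((lam + \<mu>) * T N)" by linarith
      then have "(lam + \<mu>) * Z < (lam + \<mu>) * T N" by simp
      moreover have "0 < lam + \<mu>" using lam \<mu> by simp
      ultimately show ?case by (simp add: mult_less_cancel_left_pos)
    qed
  qed
  have s_eq: "s N = min (T N) (q N)" for N by (simp add: s_def q_def)
  have stop: "filterlim s at_top sequentially"
    unfolding filterlim_at_top
  proof
    fix Z :: real
    have "\<forall>\<^sub>F N in sequentially. Z \<le> T N" "\<forall>\<^sub>F N in sequentially. Z \<le> q N" using Ttop q unfolding filterlim_at_top by blast+
    then show "\<forall>\<^sub>F N in sequentially. Z \<le> s N" by eventually_elim (simp add: s_eq)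
  qed
  have s0: "\<forall>\<^sub>F N in sequentially. 0 \<le> s N" using stop unfolding filterlim_at_top by blast
  have small: "(\<lambda>N. exp (\<theta> * s N) / real N) \<longlonglongrightarrow> 0" if "0 \<le> \<theta>" "\<theta> \<le> 2 * lam" for \<theta>
  proof -
    have lim: "(\<lambda>N. exp (\<theta> * q N) / real N) \<longlonglongrightarrow> 0"
    proof -
      have "(\<lambda>N. exp (- (\<mu> * q N))) \<longlonglongrightarrow> 0"
      proof -
        have "((\<lambda>x. exp (- (\<mu> * x))) \<longlongrightarrow> 0) at_top" using \<mu> by real_asymp
        then show ?thesis by (rule filterlim_compose[OF _ q])
      qed
      then show ?thesis
      proof (rule Lim_null_comparison[rotated])
        show "\<forall>\<^sub>F N in sequentially. norm (exp (\<theta> * q N) / real N) \<le> exp (- (\<mu> * q N))"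
          using eventually_gt_at_top[of 0] filterlim_at_top[THEN iffD1, OF q, rule_format, of 0]
        proof eventually_elim
          case (elim N)
          have N: "0 < real N" using elim(1) by simp
          have "real N = exp ((2 * lam + \<mu>) * q N)" using N lam \<mu> by (simp add: q_def)
          then have "exp (\<theta> * q N) / real N = exp (\<theta> * q N - (2 * lam + \<mu>) * q N)" by (simp only: exp_diff)
          also have "\<dots> \<le> exp (- (\<mu> * q N))"
            using mult_right_mono[OF that(2) elim(2)] by (simp add: algebra_simps)
          finally show ?case by simp
        qed
      qed
    qed
    show ?thesis
    proof (rule Lim_null_comparison[OF _ lim])
      have "exp (\<theta> * s N) / real N \<le> exp (\<theta> * q N) / real N" for N
        using that by (intro divide_right_mono) (auto simp: s_eq intro!: mult_left_mono)
      then show "\<forall>\<^sub>F N in sequentially. norm (exp (\<theta> * s N) / real N) \<le> exp (\<theta> * q N) / real N" by simp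
    qed
  qed
  have path_small: "(\<lambda>N. sqrt (real N) * exp (- (lam + \<mu>) * s N)) \<longlonglongrightarrow> 0"
  proof -
    have "(\<lambda>N. exp (- (\<mu> / 2 * q N))) \<longlonglongrightarrow> 0"
    proof -
      have "((\<lambda>x. exp (- (\<mu> / 2 * x))) \<longlongrightarrow> 0) at_top" using \<mu> by real_asymp
      then show ?thesis by (rule filterlim_compose[OF _ q])
    qed
    with ratio have lim: "(\<lambda>N. sqrt (real N) / exp ((lam + \<mu>) * T N) + exp (- (\<mu> / 2 * q N))) \<longlonglongrightarrow> 0 + 0" by (rule tendsto_add)
    have "(\<lambda>N. sqrt (real N) / exp ((lam + \<mu>) * T N) + exp (- (\<mu> / 2 * q N))) \<longlonglongrightarrow> 0" using lim by simp
    then show ?thesis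
    proof (rule Lim_null_comparison[rotated])
      show "\<forall>\<^sub>F N in sequentially. norm (sqrt (real N) * exp (- (lam + \<mu>) * s N)) \<le> sqrt (real N) / exp ((lam + \<mu>) * T N) + exp (- (\<mu> / 2 * q N))"
        using eventually_gt_at_top[of 0]
      proof eventually_elim
        case (elim N)
        have N: "0 < real N" using elim by simp
        have "sqrt (real N) = exp ((lam + \<mu> / 2) * q N)"
        proof -
          have "real N = exp ((2 * lam + \<mu>) * q N)" using N lam \<mu> by (simp add: q_def)
          also have "(2 * lam + \<mu>) * q N = 2 * ((lam + \<mu> / 2) * q N)" by (simp add: algebra_simps)
          finally have "real N = (exp ((lam + \<mu> / 2) * q N))\<^sup>2" by (simp only: exp_double)
          then show ?thesis by simp
        qed
        then have q': "sqrt (real N) * exp (- (lam + \<mu>) * q N) = exp (- (\<mu> / 2 * q N))"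
          by (simp only: exp_add[symmetric]) (simp add: algebra_simps)
        have T': "sqrt (real N) * exp (- (lam + \<mu>) * T N) = sqrt (real N) / exp ((lam + \<mu>) * T N)"
          by (simp only: mult_minus_left exp_minus divide_inverse)
        have "0 \<le> sqrt (real N) / exp ((lam + \<mu>) * T N)" "0 \<le> exp (- (\<mu> / 2 * q N))" by auto
        then have "sqrt (real N) * exp (- (lam + \<mu>) * s N) \<le> sqrt (real N) / exp ((lam + \<mu>) * T N) + exp (- (\<mu> / 2 * q N))"
          using q' T' by (cases "T N \<le> q N") (auto simp: s_eq min_def)
        then show ?case by simp
      qed
    qed
  qed
  show "\<forall>\<^sub>F N in sequentially. (\<lambda>w. SUP t\<in>{T N..}. ereal (sqrt (real N) * exp (- lam * t) * \<bar>stopped S (X N) t w $ 1\<bar>)) \<in> borel_measurable (M N)"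
    using eventually_saddle[OF zero_less_one] s0
  proof eventually_elim
    case (elim N)
    then obtain J Y where sp: "saddle_process (M N) (I N) (KN N) x0 (X N) J Y S lam \<mu> (c2 / real N) (1 / sqrt (real N))" by blast
    show ?case by (rule saddle_process.late_stable_sup(1)[OF sp _ elim(2)]) (use elim in \<open>auto simp: s_eq\<close>)
  qed
  fix \<epsilon> \<delta> :: real assume \<epsilon>: "0 < \<epsilon>" and \<delta>: "0 < \<delta>"
  have "(\<lambda>N. \<bar>x0 $ 1\<bar> * (sqrt (real N) * exp (- (lam + \<mu>) * s N))) \<longlonglongrightarrow> 0" by (rule tendsto_mult_right_zero[OF path_small])
  then have ev1: "\<forall>\<^sub>F N in sequentially. \<bar>x0 $ 1\<bar> * (sqrt (real N) * exp (- (lam + \<mu>) * s N)) < \<epsilon> / 2"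
    using \<epsilon> by (intro order_tendstoD(2)) auto
  have decay: "(\<lambda>N. exp (- (lam * s N))) \<longlonglongrightarrow> 0"
  proof -
    have "((\<lambda>x. exp (- (lam * x))) \<longlongrightarrow> 0) at_top" using lam by real_asymp
    then show ?thesis by (rule filterlim_compose[OF _ stop])
  qed
  have "(\<lambda>N. (c2 + 1 / \<mu>) / (lam * (\<epsilon> / 2)\<^sup>2) * exp (- (lam * s N)) + measure (M N) {w \<in> space (M N). stopped_clock S (X N) (s N) w < s N})
      \<longlonglongrightarrow> (c2 + 1 / \<mu>) / (lam * (\<epsilon> / 2)\<^sup>2) * 0 + 0"
    using lam by (intro tendsto_add tendsto_mult tendsto_const exit_unlikely s0 small decay) auto
  then have "\<forall>\<^sub>F N in sequentially. (c2 + 1 / \<mu>) / (lam * (\<epsilon> / 2)\<^sup>2) * exp (- (lam * s N)) + measure (M N) {w \<in> space (M N). stopped_clock S (X N) (s N) w < s N} < \<delta>"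
    using \<delta> by (intro order_tendstoD(2)) auto
  then show "\<forall>\<^sub>F N in sequentially. measure (M N) {w \<in> space (M N). (SUP t\<in>{T N..}. ereal (sqrt (real N) * exp (- lam * t) * \<bar>stopped S (X N) t w $ 1\<bar>)) > ereal \<epsilon>} < \<delta>"
    using eventually_saddle[OF zero_less_one] s0 ev1
  proof eventually_elim
    case (elim N)
    then obtain J Y where "saddle_process (M N) (I N) (KN N) x0 (X N) J Y S lam \<mu> (c2 / real N) (1 / sqrt (real N))" by blast
    then interpret sp: saddle_process "M N" "I N" "KN N" x0 "X N" J Y S lam \<mu> "c2 / real N" "1 / sqrt (real N)" .
    have N: "0 < real N" using elim(2) by simp
    have C1: "sp.C1 = (c2 + 1 / \<mu>) / real N" using N by (simp add: sp.C1_def power_divide add_divide_distrib mult.commute)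
    have "s N \<le> T N" by (simp add: s_eq)
    moreover have "sqrt (real N) * \<bar>x0 $ 1\<bar> * exp (- (lam + \<mu>) * s N) \<le> \<epsilon> / 2" using elim(4) by (simp only: ac_simps)
    moreover have "sp.C1 / (lam * ((\<epsilon> / 2)\<^sup>2 * exp (lam * s N) / real N)) = (c2 + 1 / \<mu>) / (lam * (\<epsilon> / 2)\<^sup>2) * exp (- (lam * s N))"
    proof -
      have "k / n / (lam * (y * E / n)) = k / (lam * y) * inverse E" if "0 < n" "0 < y" "0 < E" for k n y E :: real
        using that lam by (simp add: field_simps)
      then show ?thesis unfolding C1 exp_minus using N \<epsilon> by simp
    qed
    ultimately show ?case using sp.late_stable_sup(2)[OF N elim(3) _ \<epsilon>, of "T N"] elim(1) by linarith
  qed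
qed

text \<open>
  The oscillation bound does not vanish for fixed drift error \<open>e\<close>, but
  \<open>e\<close> can be chosen in advance, depending on \<open>\<epsilon>\<close> and
  \<open>\<delta>\<close>.
\<close>

theorem unstable_coordinate_limit:
  assumes T: "filterlim T at_top sequentially"
  shows "tendsto_zero_in_prob M (\<lambda>N w. SUP t1\<in>{T N..}. SUP t2\<in>{T N..}.
          ereal (sqrt (real N) *
            \<bar>exp (- lam * stopped_clock S (X N) t1 w) * stopped S (X N) t1 w $ 2
             - exp (- lam * stopped_clock S (X N) t2 w) * stopped S (X N) t2 w $ 2\<bar>))"
proof (rule tendsto_zero_in_probI)
  have T0: "\<forall>\<^sub>F N in sequentially. 0 \<le> T N" using T unfolding filterlim_at_top by blast
  show "\<forall>\<^sub>F N in sequentially. (\<lambda>w. SUP t1\<in>{T N..}. SUP t2\<in>{T N..}.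
          ereal (sqrt (real N) *
            \<bar>exp (- lam * stopped_clock S (X N) t1 w) * stopped S (X N) t1 w $ 2
             - exp (- lam * stopped_clock S (X N) t2 w) * stopped S (X N) t2 w $ 2\<bar>)) \<in> borel_measurable (M N)"
    using eventually_saddle[OF zero_less_one] T0
  proof eventually_elim
    case (elim N)
    then obtain J Y where sp: "saddle_process (M N) (I N) (KN N) x0 (X N) J Y S lam \<mu> (c2 / real N) (1 / sqrt (real N))" by blast
    show ?case by (rule saddle_process.unstable_oscillation(1)[OF sp _ elim(2)]) (use elim in auto)
  qed
  fix \<epsilon> \<delta> :: real assume \<epsilon>: "0 < \<epsilon>" and \<delta>: "0 < \<delta>"
  \<comment> \<open>This makes the contribution of the drift error exactly half of the admissible probability.\<close>
  define e where "e = sqrt (\<delta> * \<epsilon>\<^sup>2 * lam\<^sup>2 / 32)"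
  have e: "0 < e" using \<delta> \<epsilon> lam by (simp add: e_def)
  have e2: "e\<^sup>2 = \<delta> * \<epsilon>\<^sup>2 * lam\<^sup>2 / 32" using \<delta> by (simp add: e_def)
  have "4 * (4 * e\<^sup>2 / lam\<^sup>2) / \<epsilon>\<^sup>2 = \<delta> / 2" unfolding e2 using \<epsilon> lam by (simp add: field_simps)
  have "((\<lambda>x. exp (- lam * x)) \<longlongrightarrow> 0) at_top" using lam by real_asymp
  then have "(\<lambda>N. exp (- lam * T N)) \<longlonglongrightarrow> 0" by (rule filterlim_compose[OF _ T])
  then have "(\<lambda>N. 8 * c2 / (lam * \<epsilon>\<^sup>2) * exp (- lam * T N)) \<longlonglongrightarrow> 0" by (rule tendsto_mult_right_zero)
  then have "\<forall>\<^sub>F N in sequentially. 8 * c2 / (lam * \<epsilon>\<^sup>2) * exp (- lam * T N) < \<delta> / 2"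
    using \<delta> by (intro order_tendstoD(2)) auto
  then show "\<forall>\<^sub>F N in sequentially. measure (M N) {w \<in> space (M N). (SUP t1\<in>{T N..}. SUP t2\<in>{T N..}.
          ereal (sqrt (real N) *
            \<bar>exp (- lam * stopped_clock S (X N) t1 w) * stopped S (X N) t1 w $ 2
             - exp (- lam * stopped_clock S (X N) t2 w) * stopped S (X N) t2 w $ 2\<bar>)) > ereal \<epsilon>} < \<delta>"
    using eventually_saddle[OF e] T0
  proof eventually_elim
    case (elim N)
    then obtain J Y where "saddle_process (M N) (I N) (KN N) x0 (X N) J Y S lam \<mu> (c2 / real N) (e / sqrt (real N))" by blast
    then interpret sp: saddle_process "M N" "I N" "KN N" x0 "X N" J Y S lam \<mu> "c2 / real N" "e / sqrt (real N)" .
    have N: "0 < real N" using elim(2) by simp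
    have "real N * sp.C2 (T N) = 4 * e\<^sup>2 / lam\<^sup>2 + 2 * c2 * exp (- lam * T N) / lam"
      using N by (simp add: sp.C2_def power_divide field_simps)
    then have "4 * real N * sp.C2 (T N) / \<epsilon>\<^sup>2 = 4 * (4 * e\<^sup>2 / lam\<^sup>2 + 2 * c2 * exp (- lam * T N) / lam) / \<epsilon>\<^sup>2"
      by (simp only: mult.assoc)
    also have "\<dots> = 4 * (4 * e\<^sup>2 / lam\<^sup>2) / \<epsilon>\<^sup>2 + 8 * c2 / (lam * \<epsilon>\<^sup>2) * exp (- lam * T N)"
      by (simp add: distrib_left add_divide_distrib)
    finally have "4 * real N * sp.C2 (T N) / \<epsilon>\<^sup>2 < \<delta>"
      using elim(1) \<open>4 * (4 * e\<^sup>2 / lam\<^sup>2) / \<epsilon>\<^sup>2 = \<delta> / 2\<close> by linarith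
    then show ?case using sp.unstable_oscillation(2)[OF N elim(3) \<epsilon>] by linarith
  qed
qed

end

section \<open>Asymptotic normality\<close>

lemma weak_conv_m_offset:
  assumes "weak_conv_m (\<lambda>k. D (k + m)) D'"
  shows "weak_conv_m D D'"
  using assms unfolding weak_conv_m_def weak_conv_def by (auto intro: LIMSEQ_offset[where k=m])

context near_saddle
begin

definition rescaled :: "nat \<Rightarrow> real \<Rightarrow> 'a \<Rightarrow> real" where
  "rescaled N t w = sqrt (real N) * exp (- lam * stopped_clock S (X N) t w) * stopped S (X N) t w $ 2"

lemma rescaled_measurable:
  assumes "N \<ge> 1" "0 \<le> t"
  shows "rescaled N t \<in> borel_measurable (M N)"
proof -
  obtain J Y where "jump_process (M N) (I N) (KN N) x0 (X N) J Y" using pure_jump_markovD[OF process[OF assms(1)]] .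
  then interpret jump_process "M N" "I N" "KN N" x0 "X N" J Y .
  have Sb: "S \<in> sets borel" using S by (rule borel_open)
  note [measurable] = stopped_measurable[OF Sb assms(2)] stopped_clock_measurable[OF Sb assms(2)]
  have [measurable]: "(\<lambda>x::real^2. x $ 2) \<in> borel_measurable borel"
    by (intro borel_measurable_continuous_onI continuous_intros)
  have [measurable]: "(\<lambda>w. stopped S (X N) t w $ 2) \<in> borel_measurable (M N)"
    by (rule measurable_compose[of "stopped S (X N) t" _ borel]) measurable
  show ?thesis unfolding rescaled_def by measurable
qed

text \<open>
  The parameters are chosen in the order \<open>\<epsilon>\<close>, \<open>R\<close>,
  \<open>e\<close>, and finally the index, each depending on the earlier ones.
\<close>

lemma characteristic_limit:
  assumes n: "filterlim n at_top sequentially" and t: "filterlim t at_top sequentially"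
  shows "(\<lambda>k. \<integral>w. iexp (u * rescaled (n k) (t k) w) \<partial>M (n k)) \<longlonglongrightarrow> complex_of_real (exp (- (u\<^sup>2 / 2 * sigma_inf_sq lam \<mu> x0 K)))"
proof (rule limiting_variance)
  let ?\<sigma> = "sigma_inf_sq lam \<mu> x0 K"
  fix L A
  assume LA: "0 \<le> L" "\<And>x x'. x \<in> S \<Longrightarrow> x' \<in> S \<Longrightarrow> \<bar>a x - a x'\<bar> \<le> L * norm (x - x')"
    "A 0 = 0" "\<And>t. 0 \<le> t \<Longrightarrow> (A has_real_derivative exp (- 2 * lam * t) * a (stable_path \<mu> x0 t)) (at t)"
    "A \<in> borel_measurable borel" "(\<lambda>t. a (stable_path \<mu> x0 (max 0 t))) \<in> borel_measurable borel"
    and A_lim: "(A \<longlongrightarrow> ?\<sigma>) at_top"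
  obtain \<rho> where \<rho>: "0 < \<rho>" "\<And>t. 0 \<le> t \<Longrightarrow> ball (stable_path \<mu> x0 t) \<rho> \<subseteq> S" using path by blast
  show ?thesis
    unfolding tendsto_iff
  proof (intro allI impI)
    fix \<delta> :: real assume \<delta>: "0 < \<delta>"
    define \<epsilon> where "\<epsilon> = \<delta> / (6 * (\<bar>u\<bar> + 1))"
    have \<epsilon>: "0 < \<epsilon>" "\<bar>u\<bar> * \<epsilon> \<le> \<delta> / 6" using \<delta> by (simp_all add: \<epsilon>_def field_simps)
    have "((\<lambda>R. exp (- (u\<^sup>2 / 2 * A R))) \<longlongrightarrow> exp (- (u\<^sup>2 / 2 * ?\<sigma>))) at_top"
      by (intro tendsto_intros A_lim)
    from tendstoD[OF this, of "\<delta> / 6"] \<delta>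
    have R1: "\<forall>\<^sub>F R in at_top. \<bar>exp (- (u\<^sup>2 / 2 * A R)) - exp (- (u\<^sup>2 / 2 * ?\<sigma>))\<bar> < \<delta> / 6"
      by (simp add: dist_real_def)
    have "((\<lambda>R. exp (- lam * R)) \<longlongrightarrow> 0) at_top" using lam by real_asymp
    then have "((\<lambda>R. 4 * c2 / (lam * \<epsilon>\<^sup>2) * exp (- lam * R)) \<longlongrightarrow> 0) at_top" by (rule tendsto_mult_right_zero)
    then have R2: "\<forall>\<^sub>F R in at_top. 4 * c2 / (lam * \<epsilon>\<^sup>2) * exp (- lam * R) < \<delta> / 6"
      using \<delta> by (intro order_tendstoD(2)) auto
    have "\<forall>\<^sub>F R in at_top. \<bar>exp (- (u\<^sup>2 / 2 * A R)) - exp (- (u\<^sup>2 / 2 * ?\<sigma>))\<bar> < \<delta> / 6 \<and> 4 * c2 / (lam * \<epsilon>\<^sup>2) * exp (- lam * R) < \<delta> / 6 \<and> 0 \<le> R"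
      using R1 R2 eventually_ge_at_top[of 0] by eventually_elim auto
    then obtain R where R: "\<bar>exp (- (u\<^sup>2 / 2 * A R)) - exp (- (u\<^sup>2 / 2 * ?\<sigma>))\<bar> < \<delta> / 6" "4 * c2 / (lam * \<epsilon>\<^sup>2) * exp (- lam * R) < \<delta> / 6" "0 \<le> R"
      using eventually_happens'[OF trivial_limit_at_top_linorder] by blast
    define E where "E = exp (u\<^sup>2 / 2 * A R)"
    define k where "k = 2 * R * E * (\<bar>u\<bar> + u\<^sup>2 / 2 * (1 + L))"
    have "((\<lambda>e. k * e + 8 * e\<^sup>2 / (lam\<^sup>2 * \<epsilon>\<^sup>2)) \<longlongrightarrow> k * 0 + 8 * 0\<^sup>2 / (lam\<^sup>2 * \<epsilon>\<^sup>2)) (at_right 0)"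
      using lam \<epsilon> by (intro tendsto_intros) auto
    then have "\<forall>\<^sub>F e in at_right 0. k * e + 8 * e\<^sup>2 / (lam\<^sup>2 * \<epsilon>\<^sup>2) < \<delta> / 6"
      using \<delta> by (intro order_tendstoD(2)) auto
    then obtain b where b: "0 < b" "\<And>e. 0 < e \<Longrightarrow> e < b \<Longrightarrow> k * e + 8 * e\<^sup>2 / (lam\<^sup>2 * \<epsilon>\<^sup>2) < \<delta> / 6"
      unfolding eventually_at_right_field by auto
    define e where "e = b / 2"
    have "0 < e" "e < b" using b(1) by (simp_all add: e_def)
    then have e: "0 < e" "k * e + 8 * e\<^sup>2 / (lam\<^sup>2 * \<epsilon>\<^sup>2) < \<delta> / 6" using b(2) by blast+
    define p where "p = 2 * R * E * \<bar>u\<bar> ^ 3 * c3"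
    define q where "q = 2 * R * (E * (u\<^sup>2 / 2) * L / e * exp ((2 * lam + 1) * R)) * (R + 1) * (2 * e\<^sup>2 + 2 * c2)
          + 2 * E * (2 * (c2 + e\<^sup>2 / \<mu>) * exp (lam * R) / (lam * \<rho>\<^sup>2) + 2 * (4 * e\<^sup>2 / lam\<^sup>2 + 2 * c2 / lam) * exp (2 * lam * R) / \<rho>\<^sup>2)"
    have "(\<lambda>N. p / sqrt (real N) + q / real N) \<longlonglongrightarrow> 0" by real_asymp
    then have N3: "\<forall>\<^sub>F N in sequentially. p / sqrt (real N) + q / real N < \<delta> / 6"
      using \<delta> by (intro order_tendstoD(2)) auto
    have clt: "\<forall>\<^sub>F N in sequentially. N \<ge> 1 \<and> (\<exists>J Y. saddle_clt (M N) (I N) (KN N) x0 (X N) J Y S lam \<mu> (c2 / real N) (e / sqrt (real N)) a L (real N) e (c3 / (real N)\<^sup>2) A)"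
      by (rule eventually_saddle_clt[OF e(1) LA(1) _ LA(3) _ LA(5) LA(6)], rule LA(2), assumption, assumption, rule LA(4), assumption)
    have tR: "\<forall>\<^sub>F k in sequentially. R \<le> t k" using t unfolding filterlim_at_top by blast
    show "\<forall>\<^sub>F k in sequentially. dist (\<integral>w. iexp (u * rescaled (n k) (t k) w) \<partial>M (n k)) (complex_of_real (exp (- (u\<^sup>2 / 2 * ?\<sigma>)))) < \<delta>"
      using eventually_compose_filterlim[OF clt n] eventually_compose_filterlim[OF N3 n] tR
    proof eventually_elim
      case (elim i)
      then obtain J Y where "saddle_clt (M (n i)) (I (n i)) (KN (n i)) x0 (X (n i)) J Y S lam \<mu> (c2 / real (n i)) (e / sqrt (real (n i))) a L (real (n i)) e (c3 / (real (n i))\<^sup>2) A" by blast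
      then interpret sc: saddle_clt "M (n i)" "I (n i)" "KN (n i)" x0 "X (n i)" J Y S lam \<mu> "c2 / real (n i)" "e / sqrt (real (n i))" a L "real (n i)" e "c3 / (real (n i))\<^sup>2" A .
      have phase: "sc.phase u (t i) = (\<lambda>w. u * rescaled (n i) (t i) w)"
        by (simp add: sc.phase_def rescaled_def fun_eq_iff mult.assoc)
      have "cmod ((\<integral>w. iexp (u * rescaled (n i) (t i) w) \<partial>M (n i)) - exp (- (u\<^sup>2 / 2 * A R)))
         \<le> (k * e + 8 * e\<^sup>2 / (lam\<^sup>2 * \<epsilon>\<^sup>2)) + (\<bar>u\<bar> * \<epsilon> + 4 * c2 * exp (- lam * R) / (lam * \<epsilon>\<^sup>2)) + (p / sqrt (real (n i)) + q / real (n i))"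
        using sc.characteristic_estimate[OF \<rho> R(3) elim(3) \<epsilon>(1) e(1) refl refl refl refl, of u]
        unfolding phase k_def p_def q_def E_def .
      also have "4 * c2 * exp (- lam * R) / (lam * \<epsilon>\<^sup>2) = 4 * c2 / (lam * \<epsilon>\<^sup>2) * exp (- lam * R)" by simp
      finally have "cmod ((\<integral>w. iexp (u * rescaled (n i) (t i) w) \<partial>M (n i)) - exp (- (u\<^sup>2 / 2 * A R))) < 4 * (\<delta> / 6)"
        using e(2) \<epsilon>(2) R(2) elim(2) by linarith
      moreover have "cmod (complex_of_real (exp (- (u\<^sup>2 / 2 * A R))) - complex_of_real (exp (- (u\<^sup>2 / 2 * ?\<sigma>)))) < \<delta> / 6"
        using R(1) by (simp only: of_real_diff[symmetric] norm_of_real)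
      ultimately show ?case
        using norm_triangle_ineq[of "(\<integral>w. iexp (u * rescaled (n i) (t i) w) \<partial>M (n i)) - exp (- (u\<^sup>2 / 2 * A R))" "complex_of_real (exp (- (u\<^sup>2 / 2 * A R))) - complex_of_real (exp (- (u\<^sup>2 / 2 * ?\<sigma>)))"] \<delta>
        by (simp add: dist_norm)
    qed
  qed
qed

text \<open>
  Finitely many members of the sequence may have index 0 or a negative time, where nothing is
  known about measurability; Levy's theorem is applied after discarding them.
\<close>

theorem asymptotic_normality:
  assumes \<sigma>: "sigma_inf_sq lam \<mu> x0 K \<noteq> 0"
    and n: "filterlim n at_top sequentially" and t: "filterlim t at_top sequentially"
  shows "weak_conv_m (\<lambda>k. distr (M (n k)) borel (rescaled (n k) (t k))) (density lborel (normal_density 0 (sqrt (sigma_inf_sq lam \<mu> x0 K))))"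
proof -
  let ?\<sigma> = "sigma_inf_sq lam \<mu> x0 K"
  have "0 \<le> ?\<sigma>"
    unfolding sigma_inf_sq_def set_lebesgue_integral_def
    by (intro Bochner_Integration.integral_nonneg) (use a_bounds(1)[OF path_in] in \<open>auto simp: a_def split: split_indicator\<close>)
  then have pos: "0 < sqrt ?\<sigma>" and sq: "(sqrt ?\<sigma>)\<^sup>2 = ?\<sigma>" using \<sigma> by auto
  have "\<forall>\<^sub>F k in sequentially. 1 \<le> n k" "\<forall>\<^sub>F k in sequentially. 0 \<le> t k" using n t unfolding filterlim_at_top by blast+
  then have "\<forall>\<^sub>F k in sequentially. 1 \<le> n k \<and> 0 \<le> t k" by eventually_elim simp
  then obtain m where m: "\<And>k. m \<le> k \<Longrightarrow> 1 \<le> n k \<and> 0 \<le> t k" unfolding eventually_sequentially by blast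
  have meas: "rescaled (n (k + m)) (t (k + m)) \<in> borel_measurable (M (n (k + m)))" for k
    using m[of "k + m"] by (intro rescaled_measurable) auto
  have prob: "prob_space (M (n (k + m)))" for k
    using process[of "n (k + m)"] m[of "k + m"] unfolding pure_jump_markov_def by simp
  show ?thesis
  proof (rule weak_conv_m_offset[where m=m], rule levy_continuity)
    show "real_distribution (distr (M (n (k + m))) borel (rescaled (n (k + m)) (t (k + m))))" for k
      by (rule prob_space.real_distribution_distr[OF prob meas])
    show "real_distribution (density lborel (normal_density 0 (sqrt ?\<sigma>)))"
      unfolding real_distribution_def real_distribution_axioms_def using prob_space_normal_density[OF pos] by simp
    fix u
    have "filterlim (\<lambda>k. n (k + m)) at_top sequentially" "filterlim (\<lambda>k. t (k + m)) at_top sequentially"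
      using filterlim_compose[OF n filterlim_add_const_nat_at_top] filterlim_compose[OF t filterlim_add_const_nat_at_top] by auto
    note lim = characteristic_limit[OF this, of u]
    have char: "char (distr (M (n (k + m))) borel (rescaled (n (k + m)) (t (k + m)))) u = (\<integral>w. iexp (u * rescaled (n (k + m)) (t (k + m)) w) \<partial>M (n (k + m)))" for k
      unfolding char_def using meas by (subst integral_distr) auto
    show "(\<lambda>k. char (distr (M (n (k + m))) borel (rescaled (n (k + m)) (t (k + m)))) u) \<longlonglongrightarrow> char (density lborel (normal_density 0 (sqrt ?\<sigma>))) u"
      unfolding char char_normal[OF pos] sq by (rule lim)
  qed
qed

end

theorem theorem2p3:
  fixes M :: "nat \<Rightarrow> 'a measure"
    and X :: "nat \<Rightarrow> real \<Rightarrow> 'a \<Rightarrow> real^2"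
    and I :: "nat \<Rightarrow> (real^2) set"
    and KN :: "nat \<Rightarrow> real^2 \<Rightarrow> (real^2) measure"
    and K :: "real^2 \<Rightarrow> (real^2) measure"
    and S :: "(real^2) set"
    and x0 :: "real^2"
    and \<eta>0 lam \<mu> :: real
  assumes process: "\<And>N. N \<ge> 1 \<Longrightarrow> pure_jump_markov (M N) (I N) (KN N) x0 (X N)"
    and stays: "\<And>N w t. N \<ge> 1 \<Longrightarrow> w \<in> space (M N) \<Longrightarrow> t \<ge> 0 \<Longrightarrow> stopped S (X N) t w \<in> closure S"
    and S: "open S" "x0 \<in> S"
    and K: "levy_kernel_on S K"
    and eta: "\<eta>0 > 0"
    and a_fin: "\<And>x \<theta>. x \<in> S \<Longrightarrow> norm \<theta> \<le> \<eta>0 \<Longrightarrow> laplace_finite (K x) \<theta>"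
    and a_bdd: "\<exists>C. \<forall>x\<in>S. \<forall>\<theta>\<in>cball 0 \<eta>0. laplace (K x) \<theta> \<le> C"
    and b_fin: "\<forall>\<^sub>F N in sequentially. \<forall>x\<in>I N \<inter> S. \<forall>\<theta>\<in>cball 0 \<eta>0. laplace_finite (KN N x) (real N *\<^sub>R \<theta>)"
    and b_lim: "(\<lambda>N. SUP x\<in>I N \<inter> S. SUP \<theta>\<in>cball 0 \<eta>0.
                   ereal \<bar>laplace (KN N x) (real N *\<^sub>R \<theta>) / real N - laplace (K x) \<theta>\<bar>) \<longlonglongrightarrow> 0"
    and c: "(\<lambda>N. SUP x\<in>I N \<inter> S. ereal (sqrt (real N) * norm (drift (KN N x) - drift (K x)))) \<longlonglongrightarrow> 0"
    and d: "\<exists>L. L-lipschitz_on S (\<lambda>x. diffusivity (K x))"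
    and linear: "lam > 0" "\<mu> > 0" "\<And>x. x \<in> S \<Longrightarrow> drift (K x) = saddle_matrix lam \<mu> *v x"
    and start: "x0 $ 1 \<noteq> 0" "x0 $ 2 = 0"
    and path: "\<exists>\<epsilon>>0. \<forall>t\<ge>0. ball (stable_path \<mu> x0 t) \<epsilon> \<subseteq> S"
  shows
    "(\<forall>tN :: nat \<Rightarrow> real.
        filterlim tN at_top sequentially \<and>
        (\<lambda>N. exp ((lam + \<mu>) * tN N)) \<in> O(\<lambda>N. sqrt (real N)) \<longrightarrow>
        tendsto_zero_in_prob M (\<lambda>N w. SUP t\<in>{0..tN N}.
          ereal \<bar>exp (\<mu> * t) * stopped S (X N) t w $ 1 - x0 $ 1\<bar>)) \<and>
     (\<forall>tN :: nat \<Rightarrow> real.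
        (\<lambda>N. exp ((lam + \<mu>) * tN N)) \<in> \<omega>(\<lambda>N. sqrt (real N)) \<longrightarrow>
        tendsto_zero_in_prob M (\<lambda>N w. SUP t\<in>{tN N..}.
          ereal (sqrt (real N) * exp (- lam * t) * \<bar>stopped S (X N) t w $ 1\<bar>))) \<and>
     (\<forall>tN :: nat \<Rightarrow> real.
        filterlim tN at_top sequentially \<longrightarrow>
        tendsto_zero_in_prob M (\<lambda>N w. SUP t1\<in>{tN N..}. SUP t2\<in>{tN N..}.
          ereal (sqrt (real N) *
            \<bar>exp (- lam * stopped_clock S (X N) t1 w) * stopped S (X N) t1 w $ 2
             - exp (- lam * stopped_clock S (X N) t2 w) * stopped S (X N) t2 w $ 2\<bar>))) \<and>
     (sigma_inf_sq lam \<mu> x0 K \<noteq> 0 \<longrightarrow>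
        (\<forall>(n :: nat \<Rightarrow> nat) (t :: nat \<Rightarrow> real).
           filterlim n at_top sequentially \<and> filterlim t at_top sequentially \<longrightarrow>
           weak_conv_m
             (\<lambda>k. distr (M (n k)) borel (\<lambda>w. sqrt (real (n k)) *
                exp (- lam * stopped_clock S (X (n k)) (t k) w) * stopped S (X (n k)) (t k) w $ 2))
             (density lborel (normal_density 0 (sqrt (sigma_inf_sq lam \<mu> x0 K))))))"
proof -
  interpret near_saddle M X I KN K S x0 \<eta>0 lam \<mu>
    using process S(1) K eta a_fin a_bdd b_fin b_lim c d linear start(2) path
    unfolding near_saddle_def by blast
  show ?thesis
    using stable_coordinate_limit late_stable_coordinate_limit unstable_coordinate_limit
      asymptotic_normality[unfolded rescaled_def[abs_def]] by blast
qed

end
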